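(* Let $n\ge m\ge1$ be integers. (i) The differential operators $\mathcal{T}_k[\lambda_1]\cdots\mathcal{T}_k[\lambda_m]$ ($k=1,\dots,m$) and $\mathrm{LCLM}(\mathcal{T}_1[\lambda_k],\ldots,\mathcal{T}_m[\lambda_k])$ ($k=1,\ldots,m$), which annihilate $\mathcal{R}_{n,m}(x,\lambda_1,\ldots,\lambda_m)$, generate a holonomic system of rank $2\,m!\cdot 3^{m-1}$. (ii) Let $\mathcal{S}$ denote the subspace of anti-symmetric solutions in a full solution space (of dimension $2\,m!\cdot3^{m-1}$) of the system in (i). Then $\dim\mathcal{S}=2\cdot3^{m-1}$. (iii) The subspace of non-logarithmic anti-symmetric solutions of the system in (i) has dimension $2^{m-1}$. (iv) There exists a holonomic system of rank $\le 3^m-1$ defined over $\mathbb{Q}(x,\lambda_1,\ldots,\lambda_m)$ and annihilating $\mathcal{R}_{n,m}(x,\lambda_1,\ldots,\lambda_m)$.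
   Context: For a positive integer $a$, ${}_0F_1(a;z)=\sum_{k=0}^\infty \frac{z^k}{(a)_k\,k!}$ with $(a)_k=a(a+1)\cdots(a+k-1)$. For integers $k\ge 0$, $a\ge1$, put $$H^k_a(x,y)=\int_0^x t^k e^{-t}\,{}_0F_1(a;ty)\,dt .$$ For integers $n\ge m\ge1$ define $$\mathcal{R}_{n,m}(x,\lambda_1,\ldots,\lambda_m)=\frac{\partial}{\partial x}\det\Big(H^{n-j}_{n-m+1}(x,\lambda_i)\Big)_{i,j=1}^m ,$$ where $i$ is the row index and $j$ the column index. Define differential operators in $\partial/\partial y$ (with $x$ regarded as a parameter) $$\mathcal{P}_M[y]=y\frac{\partial^2}{\partial y^2}+(M+1)\frac{\partial}{\partial y}-x,$$ $$\mathcal{Q}_{N,M}[y]=y\frac{\partial^3}{\partial y^3}+(M-y+2)\frac{\partial^2}{\partial y^2}-(x+N+1)\frac{\partial}{\partial y}+x,$$ and set $\mathcal{T}_1[y]=\mathcal{P}_{n-m}[y]$ and $\mathcal{T}_j[y]=\mathcal{Q}_{n-m+j,\,n-m}[y]$ for $2\le j\le m$. The notation $\mathcal{T}_j[\lambda_i]$ means that $y$ is replaced by $\lambda_i$ and $\partial/\partial y$ by $\partial/\partial\lambda_i$. A least common left multiple (LCLM) of differential operators $\mathcal{L}_1,\ldots,\mathcal{L}_k$ in $\mathbb{C}(x,y)\langle\partial/\partial y\rangle$ is a differential operator of minimal order that is a left multiple of every $\mathcal{L}_j$; it is unique up to left multiplication by a nonzero element of $\mathbb{C}(x,y)$. A holonomic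 system is understood as a left ideal in the algebra of differential operators with rational function coefficients whose quotient is finite-dimensional over the field of rational functions; this dimension is its rank, and it equals the dimension of a full (Picard–Vessiot) solution space. In (i)–(iii) only the differentiations $\partial/\partial\lambda_1,\ldots,\partial/\partial\lambda_m$ are used and $x$ is a (generic) parameter; the full solution space may be realized by analytic functions of $(\lambda_1,\dots,\lambda_m)\in U^m$ with $U\subset\mathbb{C}\setminus\{0\}$ a simply connected domain. In (iv) differential operators in $\partial/\partial x,\partial/\partial\lambda_1,\ldots,\partial/\partial\lambda_m$ are meant. A solution is anti-symmetric if it is multiplied by the sign of $\sigma$ under each permutation $\sigma$ of the variables $\lambda_1,\ldots,\lambda_m$. A solution is non-logarithmic if its local expansion at $\lambda_1=\cdots=\lambda_m=0$ involves no logarithms of the $\lambda_i$. *)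

theory Defs
  imports
    "HOL-Complex_Analysis.Complex_Analysis"
    "HOL-Library.Option_ord"
    "HOL-Library.Function_Algebras"
    "HOL-Computational_Algebra.Fraction_Field"
    "HOL-Library.Poly_Mapping"
begin

section \<open>Polynomials and rational functions in variables indexed by a finite linear order\<close>

abbreviation "lookup \<equiv> Poly_Mapping.lookup"
abbreviation "keys \<equiv> Poly_Mapping.keys"
abbreviation "single \<equiv> Poly_Mapping.single"

type_synonym ('v, 'a) mpol = "('v \<Rightarrow>\<^sub>0 nat) \<Rightarrow>\<^sub>0 'a"
type_synonym ('v, 'a) ratfun = "('v, 'a) mpol fract"

definition mpol_vars :: "('v, 'a::zero) mpol \<Rightarrow> 'v set" where
  "mpol_vars p = (\<Union>\<alpha>\<in>keys p. keys \<alpha>)"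

definition mpol_deriv :: "'v \<Rightarrow> ('v, 'a::comm_ring_1) mpol \<Rightarrow> ('v, 'a) mpol" where
  "mpol_deriv v p =
     (\<Sum>\<alpha>\<in>keys p. single (\<alpha> - single v 1) (of_nat (lookup \<alpha> v) * lookup p \<alpha>))"

text \<open>The argument \<open>h\<close> embeds the coefficients into the complex numbers.\<close>

definition mpol_eval :: "('a::comm_ring_1 \<Rightarrow> complex) \<Rightarrow> ('v::finite, 'a) mpol \<Rightarrow> complex^'v \<Rightarrow> complex" where
  "mpol_eval h p z = (\<Sum>\<alpha>\<in>keys p. h (lookup p \<alpha>) * (\<Prod>v\<in>UNIV. z $ v ^ lookup \<alpha> v))"

lemma mpol_deriv_superset:
  assumes "finite A" "keys p \<subseteq> A"
  shows "mpol_deriv v p =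
     (\<Sum>\<alpha>\<in>A. single (\<alpha> - single v 1) (of_nat (lookup \<alpha> v) * lookup p \<alpha>))"
  unfolding mpol_deriv_def
  by (rule sum.mono_neutral_left) (use assms in \<open>auto simp: in_keys_iff\<close>)

lemma mpol_deriv_add: "mpol_deriv v (p + q) = mpol_deriv v p + mpol_deriv v q"
proof -
  let ?A = "keys p \<union> keys q"
  have "keys (p + q) \<subseteq> ?A" by (rule Poly_Mapping.keys_add)
  then show ?thesis
    by (simp add: mpol_deriv_superset[of ?A] lookup_add distrib_left single_add sum.distrib)
qed

lemma mpol_deriv_0 [simp]: "mpol_deriv v 0 = 0"
  by (simp add: mpol_deriv_def)

lemma mpol_deriv_sum: "mpol_deriv v (\<Sum>i\<in>A. f i) = (\<Sum>i\<in>A. mpol_deriv v (f i))"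
  by (induction A rule: infinite_finite_induct) (auto simp: mpol_deriv_add)

lemma mpol_deriv_single:
  "mpol_deriv v (single \<alpha> c) =
     single (\<alpha> - single v 1) (of_nat (lookup \<alpha> v) * c)"
  by (subst mpol_deriv_superset[of "{\<alpha>}"]) auto

lemma mpol_deriv_mult_single:
  fixes a b :: "'a::comm_ring_1"
  shows "mpol_deriv v (single \<alpha> a * single \<beta> b) =
    mpol_deriv v (single \<alpha> a) * single \<beta> b +
    single \<alpha> a * mpol_deriv v (single \<beta> b)"
proof -
  let ?e = "single v (1::nat)"
  have sh: "\<alpha> + \<beta> - ?e = \<alpha> - ?e + \<beta>" if "lookup \<alpha> v \<noteq> 0" for \<alpha> \<beta> :: "'b \<Rightarrow>\<^sub>0 nat"
    by (rule poly_mapping_eqI) (use that in \<open>auto simp: lookup_minus lookup_add lookup_single when_def\<close>)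
  consider "lookup \<alpha> v = 0" "lookup \<beta> v = 0" | "lookup \<alpha> v \<noteq> 0" "lookup \<beta> v = 0"
    | "lookup \<alpha> v = 0" "lookup \<beta> v \<noteq> 0" | "lookup \<alpha> v \<noteq> 0" "lookup \<beta> v \<noteq> 0" by blast
  then show ?thesis
  proof cases
    case 4
    have "\<alpha> + \<beta> - ?e = \<alpha> - ?e + \<beta>" "\<alpha> + \<beta> - ?e = \<alpha> + (\<beta> - ?e)"
      using sh[OF 4(1), of \<beta>] sh[OF 4(2), of \<alpha>] by (simp_all add: add.commute)
    then show ?thesis
      by (simp add: mpol_deriv_single mult_single lookup_add algebra_simps flip: single_add)
  next
    case 2
    then show ?thesis using sh[OF 2(1), of \<beta>]
      by (simp add: mpol_deriv_single mult_single lookup_add algebra_simps)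
  next
    case 3
    then show ?thesis using sh[OF 3(2), of \<alpha>]
      by (simp add: mpol_deriv_single mult_single lookup_add algebra_simps)
  qed (simp add: mpol_deriv_single mult_single lookup_add)
qed

lemma mpol_sum_monomials: "p = (\<Sum>\<alpha>\<in>keys p. single \<alpha> (lookup p \<alpha>))"
proof (rule poly_mapping_eqI)
  fix k
  show "lookup p k = lookup (\<Sum>\<alpha>\<in>keys p. single \<alpha> (lookup p \<alpha>)) k"
    by (auto simp: lookup_sum lookup_single when_def in_keys_iff)
qed

lemma mpol_deriv_mult:
  fixes p q :: "('v, 'a::comm_ring_1) mpol"
  shows "mpol_deriv v (p * q) = mpol_deriv v p * q + p * mpol_deriv v q"
proof -
  let ?s = "\<lambda>(p::('v, 'a) mpol) \<alpha>. single \<alpha> (lookup p \<alpha>)"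
  have "mpol_deriv v ((\<Sum>\<alpha>\<in>keys p. ?s p \<alpha>) * (\<Sum>\<beta>\<in>keys q. ?s q \<beta>)) =
      mpol_deriv v (\<Sum>\<alpha>\<in>keys p. ?s p \<alpha>) * (\<Sum>\<beta>\<in>keys q. ?s q \<beta>) +
      (\<Sum>\<alpha>\<in>keys p. ?s p \<alpha>) * mpol_deriv v (\<Sum>\<beta>\<in>keys q. ?s q \<beta>)"
    by (simp only: sum_product mpol_deriv_sum mpol_deriv_mult_single sum.distrib)
  then show ?thesis
    by (simp only: mpol_sum_monomials[symmetric])
qed

lemma quotient_rule_well_defined:
  fixes a b c d :: "('v::linorder, 'a::idom) mpol"
  assumes nz: "b \<noteq> 0" "d \<noteq> 0" and eq: "a * d = c * b"
  shows "(mpol_deriv v a * b - a * mpol_deriv v b) * (d * d) =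
         (mpol_deriv v c * d - c * mpol_deriv v d) * (b * b)"
proof -
  let ?D = "mpol_deriv v :: ('v, 'a) mpol \<Rightarrow> _"
  have "?D (a * d) = ?D (c * b)" using eq by simp
  then have "?D a * d + a * ?D d = ?D c * b + c * ?D b"
    by (simp add: mpol_deriv_mult)
  then have D: "?D a * d - c * ?D b = ?D c * b - a * ?D d"
    by (simp add: algebra_simps)
  have "(?D a * b - a * ?D b) * (d * d) = b * d * (?D a * d) - (a * d) * (?D b * d)"
    by (simp add: algebra_simps)
  also have "\<dots> = b * d * (?D a * d - c * ?D b)"
    using eq by (simp add: right_diff_distrib mult_ac)
  also have "\<dots> = b * d * (?D c * b - a * ?D d)"
    by (simp add: D)
  also have "\<dots> = b * d * (?D c * b) - (a * d) * (?D d * b)"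
    by (simp add: algebra_simps)
  also have "\<dots> = (?D c * d - c * ?D d) * (b * b)"
    by (simp add: eq algebra_simps)
  finally show "(?D a * b - a * ?D b) * (d * d) = (?D c * d - c * ?D d) * (b * b)" .
qed

definition ratfun_deriv :: "'v::linorder \<Rightarrow> ('v, 'a::idom) ratfun \<Rightarrow> ('v, 'a) ratfun" where
  "ratfun_deriv v q = (THE r. \<exists>a b. b \<noteq> 0 \<and> q = Fract a b \<and>
     r = Fract (mpol_deriv v a * b - a * mpol_deriv v b) (b * b))"

lemma ratfun_deriv_Fract:
  fixes a b :: "('v::linorder, 'a::idom) mpol"
  assumes "b \<noteq> 0"
  shows "ratfun_deriv v (Fract a b) = Fract (mpol_deriv v a * b - a * mpol_deriv v b) (b * b)"
  unfolding ratfun_deriv_def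
proof (rule the_equality)
  fix r
  assume "\<exists>a' b'. b' \<noteq> 0 \<and> Fract a b = Fract a' b' \<and>
    r = Fract (mpol_deriv v a' * b' - a' * mpol_deriv v b') (b' * b')"
  then obtain a' b' where *: "b' \<noteq> 0" "Fract a b = Fract a' b'"
    "r = Fract (mpol_deriv v a' * b' - a' * mpol_deriv v b') (b' * b')" by blast
  have "a' * b = a * b'" using *(1,2) assms eq_fract(1) by metis
  from quotient_rule_well_defined[OF *(1) assms this] *(1) assms
  show "r = Fract (mpol_deriv v a * b - a * mpol_deriv v b) (b * b)"
    unfolding *(3) by (subst eq_fract(1)) (auto simp only: mult_eq_0_iff)
qed (use assms in blast)

definition ratfun_var :: "'v::linorder \<Rightarrow> ('v, 'a::idom) ratfun" where
  "ratfun_var v = Fract (single (single v 1) 1) 1"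

definition ratfuns :: "'v::linorder set \<Rightarrow> ('v, 'a::idom) ratfun set" where
  "ratfuns X = {Fract a b | a b. b \<noteq> 0 \<and> mpol_vars a \<subseteq> X \<and> mpol_vars b \<subseteq> X}"

section \<open>Differential operators with rational coefficients\<close>

text \<open>
  An operator is given by its normal form: \<open>P\<close> stands for
  \<open>\<Sum>\<alpha>. lookup P \<alpha> * \<partial>^\<alpha>\<close>, coefficients on the left, \<open>\<alpha>\<close> ranging over multi-indices.
\<close>

type_synonym ('v, 'a) diffop = "('v \<Rightarrow>\<^sub>0 nat) \<Rightarrow>\<^sub>0 ('v, 'a) ratfun"

text \<open>
  \<open>multi_iter F \<alpha>\<close> applies each \<open>F v\<close> exactly \<open>lookup \<alpha> v\<close> times. It is only used for families
  of commuting maps, so that the order of the variables is immaterial.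
\<close>

definition multi_iter :: "('v::{finite,linorder} \<Rightarrow> 'b \<Rightarrow> 'b) \<Rightarrow> ('v \<Rightarrow>\<^sub>0 nat) \<Rightarrow> 'b \<Rightarrow> 'b" where
  "multi_iter F \<alpha> = foldr (\<lambda>v. F v ^^ lookup \<alpha> v) (sorted_list_of_set UNIV)"

definition op_scale :: "('v::linorder, 'a::idom) ratfun \<Rightarrow> ('v, 'a) diffop \<Rightarrow> ('v, 'a) diffop" where
  "op_scale a P = Poly_Mapping.map (\<lambda>b. a * b) P"

definition op_one :: "('v::linorder, 'a::idom) diffop" where
  "op_one = single 0 1"

text \<open>Left multiplication by \<open>\<partial>\<^sub>v\<close>, from the commutation rule \<open>\<partial>\<^sub>v b = b \<partial>\<^sub>v + \<partial>b/\<partial>v\<close>.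
  The ring product is \<open>op_mult\<close>, not the commutative convolution product that
  \<open>poly_mapping\<close> also carries.\<close>

definition op_partial_mult :: "'v::linorder \<Rightarrow> ('v, 'a::idom) diffop \<Rightarrow> ('v, 'a) diffop" where
  "op_partial_mult v Q =
     (\<Sum>\<beta>\<in>keys Q. single (\<beta> + single v 1) (lookup Q \<beta>)
                  + single \<beta> (ratfun_deriv v (lookup Q \<beta>)))"

definition op_mult ::
  "('v::{finite,linorder}, 'a::idom) diffop \<Rightarrow> ('v, 'a) diffop \<Rightarrow> ('v, 'a) diffop" where
  "op_mult P Q = (\<Sum>\<alpha>\<in>keys P. op_scale (lookup P \<alpha>) (multi_iter op_partial_mult \<alpha> Q))"

text \<open>The operators involving only the variables \<open>X\<close> in the coefficients and only the
  derivations \<open>\<partial>\<^sub>v\<close> with \<open>v \<in> S\<close>.\<close>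

definition diffops :: "'v::linorder set \<Rightarrow> 'v set \<Rightarrow> ('v, 'a::idom) diffop set" where
  "diffops X S = {P. \<forall>\<alpha>\<in>keys P. keys \<alpha> \<subseteq> S \<and> lookup P \<alpha> \<in> ratfuns X}"

definition op_order :: "('v::{finite,linorder}, 'a::idom) diffop \<Rightarrow> nat" where
  "op_order P = Max (insert 0 ((\<lambda>\<alpha>. \<Sum>v\<in>UNIV. lookup \<alpha> v) ` keys P))"

definition is_lclm :: "('v::{finite,linorder}, 'a::idom) diffop set \<Rightarrow>
    ('v, 'a) diffop set \<Rightarrow> ('v, 'a) diffop \<Rightarrow> bool" where
  "is_lclm D T L \<longleftrightarrow>
     (let common = {M \<in> D. M \<noteq> 0 \<and> (\<forall>P\<in>T. \<exists>A\<in>D. M = op_mult A P)}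
      in L \<in> common \<and> (\<forall>M\<in>common. op_order L \<le> op_order M))"

definition left_ideal ::
  "('v::{finite,linorder}, 'a::idom) diffop set \<Rightarrow> ('v, 'a) diffop set \<Rightarrow> bool" where
  "left_ideal D I \<longleftrightarrow> I \<subseteq> D \<and> 0 \<in> I \<and> (\<forall>P\<in>I. \<forall>Q\<in>I. P + Q \<in> I) \<and>
     (\<forall>A\<in>D. \<forall>P\<in>I. op_mult A P \<in> I)"

text \<open>\<open>D/I\<close> has dimension \<open>r\<close> over the field of all rational functions:
  some \<open>b 0, \<dots>, b (r - 1)\<close> represent a basis of the quotient.\<close>

definition has_rank :: "('v::{finite,linorder}, 'a::idom) diffop set \<Rightarrow>
    ('v, 'a) diffop set \<Rightarrow> nat \<Rightarrow> bool" where
  "has_rank D I r \<longleftrightarrow>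
     (\<exists>b. (\<forall>i<r. b i \<in> D) \<and>
          (\<forall>P\<in>D. \<exists>!c. (\<forall>i\<ge>r. c i = 0) \<and> P - (\<Sum>i<r. op_scale (c i) (b i)) \<in> I))"

definition holonomic_of_rank :: "('v::{finite,linorder}, 'a::idom) diffop set \<Rightarrow>
    ('v, 'a) diffop set \<Rightarrow> nat \<Rightarrow> bool" where
  "holonomic_of_rank D I r \<longleftrightarrow> left_ideal D I \<and> has_rank D I r"

section \<open>Action on analytic functions\<close>

definition holomorphic_several :: "(complex^'v::finite) set \<Rightarrow> (complex^'v \<Rightarrow> complex) \<Rightarrow> bool" where
  "holomorphic_several S f \<longleftrightarrow>
     (\<forall>z\<in>S. \<exists>D. (f has_derivative D) (at z) \<and> (\<forall>c w. D (c *s w) = c * D w))"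

definition cpartial ::
  "'v::finite \<Rightarrow> (complex^'v \<Rightarrow> complex) \<Rightarrow> complex^'v \<Rightarrow> complex" where
  "cpartial v F z = deriv (\<lambda>t. F (\<chi> w. if w = v then t else z $ w)) (z $ v)"

text \<open>
  \<open>P F = 0\<close> on \<open>W\<close>, where \<open>P\<close> may have poles: every operator \<open>Q = d P\<close> with polynomial
  coefficients obtained by clearing denominators kills \<open>F\<close> at all points of \<open>W\<close>.
\<close>

definition annihilates :: "('a::idom \<Rightarrow> complex) \<Rightarrow> ('v::{finite,linorder}, 'a) diffop \<Rightarrow>
    (complex^('v::{finite,linorder}) \<Rightarrow> complex) \<Rightarrow> (complex^('v::{finite,linorder})) set \<Rightarrow> bool" where
  "annihilates h P F W \<longleftrightarrow>
     (\<forall>d (Q :: ('v \<Rightarrow>\<^sub>0 nat) \<Rightarrow>\<^sub>0 ('v, 'a) mpol).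
        d \<noteq> 0 \<and> (\<forall>\<alpha>. Fract d 1 * lookup P \<alpha> = Fract (lookup Q \<alpha>) 1) \<longrightarrow>
        (\<forall>z\<in>W. (\<Sum>\<alpha>\<in>keys Q. mpol_eval h (lookup Q \<alpha>) z * multi_iter cpartial \<alpha> F z) = 0))"

abbreviation complex_dim :: "('b \<Rightarrow> complex) set \<Rightarrow> nat" where
  "complex_dim \<equiv> vector_space.dim (\<lambda>(c::complex) f z. c * f z)"

section \<open>The function and the operators\<close>

text \<open>
  The variables are indexed by \<open>'m option\<close> where \<open>'m\<close> has \<open>m\<close> elements: \<open>None\<close> is the index of \<open>x\<close>
  and \<open>Some i\<close> that of \<open>\<lambda>\<^sub>i\<close>. The number \<open>position i\<close> identifies \<open>'m\<close> with \<open>{1..m}\<close> in increasing order.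
\<close>

definition position :: "'m::{finite,linorder} \<Rightarrow> nat" where
  "position i = card {j. j \<le> i}"

definition hyp0F1 :: "nat \<Rightarrow> complex \<Rightarrow> complex" where
  "hyp0F1 a z = suminf (\<lambda>k. z ^ k / (pochhammer (of_nat a) k * fact k))"

definition Hint :: "nat \<Rightarrow> nat \<Rightarrow> complex \<Rightarrow> complex \<Rightarrow> complex" where
  "Hint k a x y = contour_integral (linepath 0 x) (\<lambda>t. t ^ k * exp (- t) * hyp0F1 a (t * y))"

definition Rfun :: "nat \<Rightarrow> complex^('m::{finite,linorder} option) \<Rightarrow> complex" where
  "Rfun n z = deriv (\<lambda>x. det (\<chi> (i::'m) (j::'m).
      Hint (n - position j) (n - CARD('m) + 1) x (z $ Some i))) (z $ None)"

definition Pop :: "nat \<Rightarrow> 'm \<Rightarrow> ('m::{finite,linorder} option, complex) diffop" where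
  "Pop M i =
    (let x = ratfun_var None; y = ratfun_var (Some i); term = (\<lambda>a k. single (single (Some i) k) a)
     in term y 2 + term (of_nat (M + 1)) 1 - term x 0)"

definition Qop :: "nat \<Rightarrow> nat \<Rightarrow> 'm \<Rightarrow> ('m::{finite,linorder} option, complex) diffop" where
  "Qop N M i =
    (let x = ratfun_var None; y = ratfun_var (Some i); term = (\<lambda>a k. single (single (Some i) k) a)
     in term y 3 + term (of_nat M - y + 2) 2 - term (x + of_nat N + 1) 1 + term x 0)"

definition Top :: "nat \<Rightarrow> nat \<Rightarrow> 'm \<Rightarrow> ('m::{finite,linorder} option, complex) diffop" where
  "Top n j i = (if j = 1 then Pop (n - CARD('m)) i else Qop (n - CARD('m) + j) (n - CARD('m)) i)"

definition Tprod :: "nat \<Rightarrow> nat \<Rightarrow> ('m::{finite,linorder} option, complex) diffop" where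
  "Tprod n j = foldr op_mult (map (Top n j) (sorted_list_of_set (UNIV :: 'm set))) op_one"

definition is_Tlclm :: "nat \<Rightarrow> 'm \<Rightarrow> ('m::{finite,linorder} option, complex) diffop \<Rightarrow> bool" where
  "is_Tlclm n i L \<longleftrightarrow> is_lclm (diffops {None, Some i} {Some i}) ((\<lambda>j. Top n j i) ` {1..CARD('m)}) L"

text \<open>\<open>L i\<close> is a choice of the least common left multiple in the variable \<open>\<lambda>\<^sub>i\<close>.\<close>

definition generators :: "nat \<Rightarrow> ('m \<Rightarrow> ('m::{finite,linorder} option, complex) diffop) \<Rightarrow>
    ('m option, complex) diffop set" where
  "generators n L = Tprod n ` {1..CARD('m)} \<union> range L"

abbreviation lambda_diffops :: "('m::{finite,linorder} option, complex) diffop set" where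
  "lambda_diffops \<equiv> diffops UNIV (range Some)"

section \<open>Solution spaces\<close>

abbreviation cpower :: "complex set \<Rightarrow> (complex^'m) set" where
  "cpower U \<equiv> {z. \<forall>i. z $ i \<in> U}"

text \<open>
  Holomorphic solutions on \<open>U^m\<close> of a system in the derivations \<open>\<partial>/\<partial>\<lambda>\<^sub>i\<close>, the parameter \<open>x\<close> being
  specialised to the number \<open>x0\<close>. Functions on \<open>U^m\<close> are represented by their extension by zero.
\<close>

definition solutions :: "('m::{finite,linorder} option, complex) diffop set \<Rightarrow> complex \<Rightarrow> complex set \<Rightarrow>
    (complex^('m::{finite,linorder}) \<Rightarrow> complex) set" where
  "solutions G x0 U =
     {f. holomorphic_several (cpower U) f \<and> (\<forall>z. z \<notin> cpower U \<longrightarrow> f z = 0) \<and>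
         (\<forall>P\<in>G. annihilates id P (\<lambda>p. f (\<chi> i. p $ Some i))
                  {p. p $ None = x0 \<and> (\<forall>i. p $ Some i \<in> U)})}"

definition antisymmetric :: "(complex^'m::finite \<Rightarrow> complex) \<Rightarrow> bool" where
  "antisymmetric f \<longleftrightarrow>
     (\<forall>\<sigma>. \<sigma> permutes UNIV \<longrightarrow> (\<forall>z. f (\<chi> i. z $ \<sigma> i) = of_int (sign \<sigma>) * f z))"

text \<open>
  The local expansion at the origin (a normal crossing of the singular locus, with regular
  singularities) is a finite sum of terms \<open>\<lambda>^\<rho> (log \<lambda>)^\<beta> g(\<lambda>)\<close> with \<open>g\<close> analytic at the origin;
  it is non-logarithmic if no \<open>\<beta> \<noteq> 0\<close> occurs. The power \<open>\<lambda>^\<rho>\<close> is formed with a branch \<open>l\<close>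
  of the logarithm on \<open>U\<close>.
\<close>

definition non_logarithmic :: "complex set \<Rightarrow> (complex^'m::finite \<Rightarrow> complex) \<Rightarrow> bool" where
  "non_logarithmic U f \<longleftrightarrow>
     (\<exists>l r E g. l holomorphic_on U \<and> (\<forall>u\<in>U. exp (l u) = u) \<and> r > 0 \<and> finite (E :: (complex^'m) set) \<and>
        (\<forall>\<rho>\<in>E. holomorphic_several (cpower (ball 0 r)) (g \<rho>)) \<and>
        (\<forall>z \<in> cpower (U \<inter> ball 0 r).
           f z = (\<Sum>\<rho>\<in>E. exp (\<Sum>i\<in>UNIV. \<rho> $ i * l (z $ i)) * g \<rho> z)))"

end

theory Submission
 imports Defs
begin

text \<open>
  Put \<open>M = n - m\<close>. For a fixed \<open>x\<close> the equation \<open>\<T>\<^sub>j f = 0\<close> has at \<open>y = 0\<close> a regular singularity with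
  integral exponents, and exactly one element of a Frobenius basis of its solution space \<open>V\<^sub>j\<close> is
  logarithmic. As \<open>(\<partial> - 1) \<P>\<^sub>M f = J \<partial> f\<close> on \<open>V\<^sub>j\<close> with \<open>J = 0\<close> for \<open>j = 1\<close> and \<open>J = j\<close> otherwise, a relation \<open>\<Sum> f\<^sub>j = 0\<close> with
  \<open>f\<^sub>j \<in> V\<^sub>j\<close> forces all \<open>f\<^sub>j\<close> to be polynomials and then to vanish. Hence the solution space of the
  least common left multiple is the direct sum \<open>V\<close> of the \<open>V\<^sub>j\<close>, of dimension \<open>3 m - 1\<close>, and the solutions
  of the system are the elements of the \<open>m\<close>-th tensor power of \<open>V\<close> in the sum of the spaces
  \<open>V\<^sub>\<sigma>\<^sub>(\<^sub>1\<^sub>) \<otimes> \<dots> \<otimes> V\<^sub>\<sigma>\<^sub>(\<^sub>m\<^sub>)\<close>. An anti-symmetric solution is determined by its component for \<open>\<sigma> = id\<close>; it is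
  non-logarithmic if no logarithmic basis element occurs. Algebraically, operators that are 1 modulo \<open>\<T>\<^sub>j\<close>
  and 0 modulo the other \<open>\<T>\<^sub>k\<close> split the quotient by the ideal in the same way.

  A column operation with constant coefficients, for a fixed value of \<open>x\<close>, replaces the functions \<open>H\<close> by
  \<open>\<integral>\<^sub>0\<^sup>x (t - x)\<^sup>k t\<^sup>M e\<^sup>-\<^sup>t \<^sub>0F\<^sub>1(M + 1; t y) dt\<close>. For \<open>k > 0\<close> this integral is annihilated by \<open>\<T>\<^sub>k\<^sub>+\<^sub>1\<close> and has no
  \<open>x\<close>-derivative from its upper limit; for \<open>k = 0\<close> only the integrand at \<open>t = x\<close> is left, which \<open>\<T>\<^sub>1\<close> annihilates.
  Thus \<open>\<R>\<close> is a sum of products of solutions. For (iv), \<open>\<R>\<close> is a combination over \<open>\<rat>(x, \<lambda>)\<close> of products of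
  \<open>H\<^sup>M\<close>, \<open>e\<^sup>-\<^sup>x \<^sub>0F\<^sub>1(M + 1; x \<lambda>\<^sub>i)\<close> and \<open>e\<^sup>-\<^sup>x \<^sub>0F\<^sub>1'(M + 1; x \<lambda>\<^sub>i)\<close>, one for each \<open>i\<close>. The product of the \<open>H\<^sup>M\<close> alone
  does not occur, and the span of the other \<open>3\<^sup>m - 1\<close> products is closed under derivatives.
\<close>

text \<open>The obstacle is the specialisation of x. Operators have coefficients that are rational
  in x and the \<lambda> variables, solutions live over a number x0, and \<open>annihilates\<close>
  tests every way of clearing denominators. So one clearing per operator is fixed that serves all x0
  and all domains at once (\<open>Kill\<close>, \<open>Fam\<close>). Besides 0, the exceptional x0
  are those at which one of finitely many nonzero polynomials vanishes identically; density of the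
  good points leads back to \<open>annihilates\<close>.

  Algebra and analysis support each other. The order 3 m - 1 of the LCLM is bounded below by
  independent solutions for a generic x0 and above by counting coefficients, and the lower bound
  makes the Chinese remainder systems solvable. Independence over the rational functions in (i) is
  read off from the action on products of solutions with prescribed jets.

  Algebraic statements are tested on the disc of radius 1 about 2, where \<open>Ln\<close> is a
  branch of the logarithm. In the coordinate s with y = exp s the solutions are entire, and s -> s +
  2 pi i separates the logarithmic basis element from the others.\<close>

no_notation fps_nth (infixl \<open>$\<close> 75)

section \<open>Evaluation of polynomials\<close>

definition upd :: "complex^'v => 'v => complex => complex^'v" where
 "upd z v t = (\<chi> w. if w = v then t else z $ w)"

lemma upd_nth [simp]: "upd z v t $ w = (if w = v then t else z $ w)"
 by (simp add: upd_def)

lemma upd_same [simp]: "upd z v (z $ v) = z"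
 by (simp add: vec_eq_iff)

lemma upd_upd [simp]: "upd (upd z v s) v t = upd z v t"
 by (simp add: vec_eq_iff)

lemma cpartial_upd: "cpartial v F z = deriv (%t. F (upd z v t)) (z $ v)"
 by (simp add: cpartial_def upd_def)

text \<open>Formulated for arbitrary finitely supported functions, so that the same rule serves
  polynomials and differential operators.\<close>

lemma mpol_induct [case_names single add]:
 assumes "!!al c. P (single al c)" and "!!p q. P p ==> P q ==> P (p + q)"
 shows "P (p :: 'k \<Rightarrow>\<^sub>0 'b::comm_monoid_add)"
proof -
 have *: "p = (SUM al:keys p. single al (lookup p al))" for p :: "'k \<Rightarrow>\<^sub>0 'b"
  by (rule poly_mapping_eqI) (auto simp: lookup_sum lookup_single when_def in_keys_iff)
 have "P (SUM al:A. single al (lookup p al))" if "finite A" for A using that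
 proof (induction A rule: finite_induct)
  case empty
  show ?case using assms(1)[of undefined 0] by simp
 qed (simp add: assms)
 thus ?thesis by (subst *) simp
qed

text \<open>Matches the step \<open>al + single v 1\<close> in which facts on iterated derivatives
  are proved, independently of the order of the variables inside \<open>multi_iter\<close>.\<close>

lemma multiindex_induct [case_names zero step]:
 assumes "P 0" and "!!al v. P al ==> P (al + single v 1)"
 shows "P (al :: 'v \<Rightarrow>\<^sub>0 nat)"
proof -
 have add: "P (be + single v k)" if "P be" for be v k
 proof (induction k)
  case (Suc k)
  have "be + single v (Suc k) = (be + single v k) + single v 1" by (simp add: add.assoc flip: single_add)
  thus ?case using assms(2)[OF Suc] by simp
 qed (simp add: that)
 \<comment> \<open>The starting index \<open>be\<close> is general because the sum case of
   \<open>mpol_induct\<close> adds two multi-indices one after the other.\<close>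
 have gen: "ALL be. P be --> P (be + al)"
 proof (induction al rule: mpol_induct)
  case (add p q)
  thus ?case by (metis add.assoc)
 qed (use add in blast)
 show ?thesis using gen assms(1) by (metis add_0)
qed

text \<open>Instantiated twice: with the identity on the complex numbers for (i) to (iii) and with
  \<open>of_rat\<close> for the system over the rationals in (iv).\<close>

locale coeff_embedding =
 fixes h :: "'a::idom => complex"
 assumes h_add: "h (a + b) = h a + h b" and h_mult: "h (a * b) = h a * h b"
  and h_one [simp]: "h 1 = 1" and h_inj: "h a = 0 ==> a = 0"
begin

lemma h_zero [simp]: "h 0 = 0"
 using h_add[of 0 0] by simp

lemma h_of_nat: "h (of_nat k) = of_nat k"
 by (induction k) (simp_all add: h_add)

lemma mpol_eval_superset:
 assumes "finite A" "keys p \<subseteq> A"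
 shows "mpol_eval h p z = (SUM al:A. h (lookup p al) * (PROD v:UNIV. z $ v ^ lookup al v))"
 unfolding mpol_eval_def by (rule sum.mono_neutral_left) (use assms in \<open>auto simp: in_keys_iff\<close>)

lemma mpol_eval_0 [simp]: "mpol_eval h 0 z = 0"
 by (simp add: mpol_eval_def)

lemma mpol_eval_add: "mpol_eval h (p + q) z = mpol_eval h p z + mpol_eval h q z"
proof -
 have "keys (p + q) \<subseteq> keys p \<union> keys q" by (rule Poly_Mapping.keys_add)
 thus ?thesis
  by (simp add: mpol_eval_superset[of "keys p \<union> keys q"] lookup_add h_add distrib_right sum.distrib)
qed

lemma mpol_eval_uminus: "mpol_eval h (- p) z = - mpol_eval h p z"
 using mpol_eval_add[of p "- p" z] by (simp add: add_eq_0_iff)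

lemma mpol_eval_diff: "mpol_eval h (p - q) z = mpol_eval h p z - mpol_eval h q z"
 using mpol_eval_add[of p "- q" z] by (simp add: mpol_eval_uminus)

lemma mpol_eval_sum: "mpol_eval h (SUM i:A. f i) z = (SUM i:A. mpol_eval h (f i) z)"
 by (induction A rule: infinite_finite_induct) (auto simp: mpol_eval_add)

lemma mpol_eval_single: "mpol_eval h (single al c) z = h c * (PROD v:UNIV. z $ v ^ lookup al v)"
 by (subst mpol_eval_superset[of "{al}"]) auto

lemma mpol_eval_mult: "mpol_eval h (p * q) z = mpol_eval h p z * mpol_eval h q z"
proof (induction p rule: mpol_induct)
 case (single al c)
 show ?case
 proof (induction q rule: mpol_induct)
  case (single be d)
  thus ?case by (simp add: mult_single mpol_eval_single h_mult lookup_add power_add prod.distrib)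
 qed (simp add: distrib_left mpol_eval_add)
qed (simp add: distrib_right mpol_eval_add)

lemma mpol_eval_1 [simp]: "mpol_eval h 1 z = 1"
 using mpol_eval_single[of 0 1 z] by simp

lemma mpol_eval_var: "mpol_eval h (single (single v 1) 1) z = z $ v"
proof -
 have "(PROD w:UNIV. z $ w ^ lookup (single v 1) w) = (PROD w:UNIV. if w = v then z $ v else 1)"
  by (rule prod.cong) (auto simp: lookup_single when_def)
 thus ?thesis by (simp add: mpol_eval_single)
qed

lemma mpol_eval_prod: "mpol_eval h (PROD i:A. f i) z = (PROD i:A. mpol_eval h (f i) z)"
 by (induction A rule: infinite_finite_induct) (auto simp: mpol_eval_mult)

lemma mpol_eval_of_nat: "mpol_eval h (of_nat k) z = of_nat k"
 by (induction k) (auto simp: mpol_eval_add)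

lemma mpol_eval_numeral: "mpol_eval h (numeral k) z = numeral k"
 using mpol_eval_of_nat[of "numeral k" z] by simp

lemma mpol_eval_power: "mpol_eval h (p ^ k) z = mpol_eval h p z ^ k"
 by (induction k) (auto simp: mpol_eval_mult)

text \<open>Restriction to a line in a coordinate direction; it bounds the number of zeros there and
  makes coefficients holomorphic along slices.\<close>

lemma mpol_eval_slice_poly: "EX q. ALL t. mpol_eval h p (upd z v t) = poly q t"
proof (induction p rule: mpol_induct)
 case (single al c)
 have "mpol_eval h (single al c) (upd z v t) =
   poly (monom (h c * (PROD w:UNIV-{v}. z $ w ^ lookup al w)) (lookup al v)) t" for t proof -
  have "(PROD w:UNIV. upd z v t $ w ^ lookup al w) =
   t ^ lookup al v * (PROD w:UNIV-{v}. z $ w ^ lookup al w)" by (subst prod.remove[of _ v]) auto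
  thus ?thesis by (simp add: mpol_eval_single poly_monom mult_ac)
 qed
 thus ?case by blast
next
 case (add p q)
 then obtain a b where "ALL t. mpol_eval h p (upd z v t) = poly a t"
  "ALL t. mpol_eval h q (upd z v t) = poly b t" by blast
 hence "ALL t. mpol_eval h (p + q) (upd z v t) = poly (a + b) t" by (simp add: mpol_eval_add)
 thus ?case by blast
qed

lemma mpol_eval_has_partial:
 "((%t. mpol_eval h p (upd z v t)) has_field_derivative mpol_eval h (mpol_deriv v p) (upd z v t)) (at t)"
proof (induction p rule: mpol_induct)
 case (single al c)
 let ?r = "h c * (PROD w:UNIV-{v}. z $ w ^ lookup al w)"
 have 1: "(%t. mpol_eval h (single al c) (upd z v t)) = (%t. ?r * t ^ lookup al v)"
 proof
  fix t
  have "(PROD w:UNIV. upd z v t $ w ^ lookup al w) =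
   t ^ lookup al v * (PROD w:UNIV-{v}. z $ w ^ lookup al w)" by (subst prod.remove[of _ v]) auto
  thus "mpol_eval h (single al c) (upd z v t) = ?r * t ^ lookup al v"
   by (simp add: mpol_eval_single mult_ac)
 qed
 have 2: "mpol_eval h (mpol_deriv v (single al c)) (upd z v t) =
   ?r * (of_nat (lookup al v) * t ^ (lookup al v - 1))" proof -
  have "(PROD w:UNIV. upd z v t $ w ^ lookup (al - single v 1) w) =
   t ^ (lookup al v - 1) * (PROD w:UNIV-{v}. z $ w ^ lookup (al - single v 1) w)"
   by (subst prod.remove[of _ v]) (auto simp: lookup_minus)
  also have "(PROD w:UNIV-{v}. z $ w ^ lookup (al - single v 1) w) = (PROD w:UNIV-{v}. z $ w ^ lookup al w)"
   by (rule prod.cong) (auto simp: lookup_minus lookup_single when_def)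
  finally show ?thesis by (simp add: mpol_deriv_single mpol_eval_single h_mult h_of_nat mult_ac)
 qed
 show ?case unfolding 1 2 by (auto intro!: derivative_eq_intros)
next
 case (add p q)
 thus ?case by (auto simp: mpol_eval_add mpol_deriv_add intro: DERIV_add)
qed

lemma continuous_on_mpol_eval [continuous_intros]: "continuous_on A (mpol_eval h p)"
 unfolding mpol_eval_def by (intro continuous_intros)

lemma mpol_eval_eq_0_everywhere:
 fixes p :: "('v::{finite,linorder}, 'a) mpol"
 assumes "!!z. mpol_eval h p z = 0"
 shows "p = 0"
proof -
 \<comment> \<open>For the induction on the set S of variables the exponents in A only have to be
   separated by their values on S. The step fixes the exponent k of v and compares the coefficients
   of \<open>t ^ k\<close>.\<close>
 have gen: "ALL al:A. c al = 0"
  if "finite S" "finite A" "!!al be. al : A ==> be : A ==> (ALL v:S. lookup al v = lookup be v) ==> al = be"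
   "!!z. (SUM al:A. c al * (PROD v:S. z $ v ^ lookup al v)) = 0"
  for S :: "'v set" and A and c :: "('v \<Rightarrow>\<^sub>0 nat) => complex" using that
 proof (induction S arbitrary: A rule: finite_induct)
  case empty
  show ?case
  proof
   fix al assume "al : A"
   hence "A = {al}" using empty(2) by auto
   thus "c al = 0" using empty(3) by simp
  qed
 next
  case (insert v S)
  show ?case
  proof
   fix al0 assume al0: "al0 : A"
   define k where "k = lookup al0 v"
   let ?B = "{al:A. lookup al v = k}"
   have "ALL al:?B. c al = 0"
   proof (rule insert.IH)
    show "finite ?B" using insert.prems by simp
   next
    fix al be assume "al : ?B" "be : ?B" "ALL v:S. lookup al v = lookup be v"
    thus "al = be" using insert.prems(2)[of al be] by auto
   next
    fix z :: "complex^('v::{finite,linorder})"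
    define q where "q = (SUM al:A. monom (c al * (PROD w:S. z $ w ^ lookup al w)) (lookup al v))"
    have "poly q t = 0" for t
    proof -
     have "0 = (SUM al:A. c al * (PROD w:insert v S. upd z v t $ w ^ lookup al w))"
      using insert.prems(3)[of "upd z v t"] by simp
     also have "... = poly q t" unfolding q_def poly_sum
     proof (rule sum.cong)
      fix al assume "al : A"
      have "(PROD w:S. upd z v t $ w ^ lookup al w) = (PROD w:S. z $ w ^ lookup al w)"
       by (rule prod.cong) (use insert.hyps in auto)
      thus "c al * (PROD w:insert v S. upd z v t $ w ^ lookup al w) =
       poly (monom (c al * (PROD w:S. z $ w ^ lookup al w)) (lookup al v)) t"
       using insert.hyps by (simp add: poly_monom mult_ac)
     qed simp
     finally show ?thesis by simp
    qed
    hence "q = 0" by (metis poly_all_0_iff_0)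
    hence "coeff q k = 0" by simp
    also have "coeff q k = (SUM al:A. if lookup al v = k then c al * (PROD w:S. z $ w ^ lookup al w) else 0)"
     unfolding q_def coeff_sum by (rule sum.cong) auto
    also have "... = (SUM al:?B. c al * (PROD w:S. z $ w ^ lookup al w))"
     using insert.prems(1) by (simp add: sum.inter_filter)
    finally show "(SUM al:?B. c al * (PROD w:S. z $ w ^ lookup al w)) = 0" .
   qed
   thus "c al0 = 0" using al0 k_def by blast
  qed
 qed
 have "ALL al:keys p. h (lookup p al) = 0"
  by (rule gen[of UNIV]) (use assms in \<open>auto simp: mpol_eval_def intro: poly_mapping_eqI\<close>)
 thus ?thesis by (metis h_inj in_keys_iff keys_eq_empty equals0I)
qed

text \<open>Variables outside S stay frozen at c. Those in S are released one by one from
  \<open>X v\<close> to all complex numbers, since a polynomial in one variable with infinitely many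
  zeros is zero.\<close>

lemma mpol_eval_zero_extend:
 fixes p :: "('v::{finite,linorder}, 'a) mpol"
 assumes "finite S" "!!v. v : S ==> infinite (X v)"
  and "!!z. (ALL v:S. z $ v : X v) ==> (ALL v. v ~: S --> z $ v = c v) ==> mpol_eval h p z = 0"
  and "!!v. v ~: S ==> z $ v = c v"
 shows "mpol_eval h p z = 0"
proof -
 have "ALL z. (ALL v:S-T. z $ v : X v) & (ALL v. v ~: S --> z $ v = c v) --> mpol_eval h p z = 0"
  if "finite T" "T \<subseteq> S" for T using that
 proof (induction T rule: finite_induct)
  case (insert v T)
  show ?case
  proof (intro allI impI)
   fix z assume z: "(ALL v:S - insert v T. z $ v : X v) & (ALL v. v ~: S --> z $ v = c v)"
   obtain q where q: "!!t. mpol_eval h p (upd z v t) = poly q t" using mpol_eval_slice_poly by blast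
   have "poly q t = 0" if "t : X v" for t unfolding q[symmetric] using insert z that by auto
   hence "X v \<subseteq> {t. poly q t = 0}" by auto
   hence "q = 0" using assms(2)[of v] insert.prems using finite_subset[OF _ poly_roots_finite[of q]] by blast
   thus "mpol_eval h p z = 0" using q[of "z $ v"] by simp
  qed
 qed (use assms(3) in auto)
 from this[OF assms(1) order_refl] show ?thesis using assms(4) by auto
qed

lemma mpol_eval_zero_slice:
 fixes p :: "('v::{finite,linorder}, 'a) mpol"
 assumes "!!v. infinite (X v)" and "!!z. (!!v. z $ v : X v) ==> mpol_eval h p z = 0"
 shows "p = 0" by (rule mpol_eval_eq_0_everywhere, rule mpol_eval_zero_extend[of UNIV X]) (use assms in auto)

lemma mpol_eval_cong_vars:
 assumes "!!v. v : mpol_vars p ==> z $ v = w $ v"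
 shows "mpol_eval h p z = mpol_eval h p w" unfolding mpol_eval_def
proof (rule sum.cong)
 fix al assume al: "al : keys p"
 have "z $ v ^ lookup al v = w $ v ^ lookup al v" for v
 proof (cases "v : keys al")
  case True
  hence "v : mpol_vars p" using al by (auto simp: mpol_vars_def)
  thus ?thesis using assms by simp
 qed (simp add: in_keys_iff)
 thus "h (lookup p al) * (PROD v:UNIV. z $ v ^ lookup al v) =
  h (lookup p al) * (PROD v:UNIV. w $ v ^ lookup al v)" by simp qed simp

end

lemma coeff_embedding_id: "coeff_embedding (id :: complex => complex)"
 by unfold_locales auto

lemma coeff_embedding_of_rat: "coeff_embedding (of_rat :: rat => complex)"
 by unfold_locales (auto simp: of_rat_add of_rat_mult)

section \<open>The field of rational functions\<close>

lemma mpol_deriv_1 [simp]: "mpol_deriv v 1 = 0"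
 using mpol_deriv_single[of v 0 1] by simp

lemma mpol_deriv_commute: "mpol_deriv v (mpol_deriv w p) = mpol_deriv w (mpol_deriv v p)"
proof (induction p rule: mpol_induct)
 case (single al c)
 have "al - single v 1 - single w 1 = al - single w (1::nat) - single v 1"
  by (rule poly_mapping_eqI) (simp add: lookup_minus)
 moreover have "of_nat (lookup (al - single v 1) w) * (of_nat (lookup al v) * c) =
   of_nat (lookup (al - single w 1) v) * (of_nat (lookup al w) * c)"
  by (cases "v = w") (auto simp: lookup_minus lookup_single when_def mult_ac)
 ultimately show ?case by (simp add: mpol_deriv_single)
qed (simp add: mpol_deriv_add)

lemma ratfun_deriv_of_mpol: "ratfun_deriv v (Fract a 1) = Fract (mpol_deriv v a) 1"
 by (simp add: ratfun_deriv_Fract)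

lemma ratfun_deriv_add: "ratfun_deriv v (p + q) = ratfun_deriv v p + ratfun_deriv v q"
proof (cases p, cases q)
 fix a b c d assume p: "p = Fract a b" "b ~= 0" and q: "q = Fract c d" "d ~= 0"
 show ?thesis by (simp add: p q ratfun_deriv_Fract eq_fract mpol_deriv_add mpol_deriv_mult algebra_simps)
qed

lemma ratfun_deriv_mult: "ratfun_deriv v (p * q) = ratfun_deriv v p * q + p * ratfun_deriv v q"
proof (cases p, cases q)
 fix a b c d assume p: "p = Fract a b" "b ~= 0" and q: "q = Fract c d" "d ~= 0"
 show ?thesis by (simp add: p q ratfun_deriv_Fract eq_fract mpol_deriv_add mpol_deriv_mult algebra_simps)
qed

lemma ratfun_deriv_0 [simp]: "ratfun_deriv v 0 = 0"
 using ratfun_deriv_add[of v 0 0] by (metis add_0 add_cancel_right_right)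

text \<open>The commutator \<open>?C\<close> of two derivations is again a derivation and vanishes
  on polynomials; applied to b q = a it shows that b times \<open>?C q\<close> is 0.\<close>

lemma ratfun_deriv_commute:
 fixes q :: "('v::linorder, 'a::idom) ratfun"
 shows "ratfun_deriv v (ratfun_deriv w q) = ratfun_deriv w (ratfun_deriv v q)"
proof (cases q)
 fix a b assume q: "q = Fract a b" and b: "b ~= 0"
 let ?C = "%q. ratfun_deriv v (ratfun_deriv w q) - ratfun_deriv w (ratfun_deriv v q)"
 have bq: "Fract b 1 * q = Fract a 1" using q b by (simp add: eq_fract)
 have "?C (Fract b 1 * q) = ?C (Fract b 1) * q + Fract b 1 * ?C q"
  by (simp add: ratfun_deriv_mult ratfun_deriv_add algebra_simps)
 moreover have "?C (Fract c 1) = 0" for c by (simp only: ratfun_deriv_of_mpol mpol_deriv_commute[of v w c]) simp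
 ultimately have "Fract b 1 * ?C q = 0" by (metis bq mult_zero_left add_0)
 moreover have "Fract b 1 ~= 0" using b by (simp add: Zero_fract_def eq_fract)
 ultimately show ?thesis by simp
qed

section \<open>Occurring variables and the subfields they define\<close>

lemma mpol_vars_add: "mpol_vars (p + q) \<subseteq> mpol_vars p \<union> mpol_vars q"
 using Poly_Mapping.keys_add[of p q] by (fastforce simp: mpol_vars_def)

lemma mpol_vars_uminus [simp]: "mpol_vars (- p) = mpol_vars (p :: ('v, 'a::ring) mpol)"
 by (simp add: mpol_vars_def in_keys_iff set_eq_iff Bex_def)

lemma mpol_vars_diff: "mpol_vars (p - q) \<subseteq> mpol_vars p \<union> mpol_vars (q :: ('v, 'a::ring) mpol)"
 using mpol_vars_add[of p "- q"] by simp

lemma mpol_vars_mult: "mpol_vars (p * q) \<subseteq> mpol_vars p \<union> mpol_vars q"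
proof
 fix v assume "v : mpol_vars (p * q)"
 then obtain al where al: "al : keys (p * q)" "v : keys al" by (auto simp: mpol_vars_def)
 then obtain a b where "al = a + b" "a : keys p" "b : keys q" using keys_mult[of p q] by blast
 thus "v : mpol_vars p \<union> mpol_vars q" using al(2) by (auto simp: mpol_vars_def in_keys_iff lookup_add)
qed

lemma mpol_vars_deriv: "mpol_vars (mpol_deriv v p) \<subseteq> mpol_vars p"
proof
 fix w assume "w : mpol_vars (mpol_deriv v p)"
 then obtain ga where ga: "ga : keys (mpol_deriv v p)" "w : keys ga" by (auto simp: mpol_vars_def)
 have "keys (mpol_deriv v p) \<subseteq> (UN al:keys p. {al - single v 1})"
  unfolding mpol_deriv_def by (rule order_trans[OF Poly_Mapping.keys_sum]) auto
 then obtain al where "al : keys p" "ga = al - single v 1" using ga by auto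
 moreover have "w : keys al" using ga(2) \<open>ga = _\<close> by (auto simp: in_keys_iff lookup_minus)
 ultimately show "w : mpol_vars p" by (auto simp: mpol_vars_def)
qed

lemma mpol_deriv_not_var: "v ~: mpol_vars p ==> mpol_deriv v p = 0"
 unfolding mpol_deriv_def by (rule sum.neutral) (auto simp: mpol_vars_def in_keys_iff)

lemma mpol_vars_1 [simp]: "mpol_vars 1 = {}"
 by (auto simp: mpol_vars_def)

lemma mpol_vars_0 [simp]: "mpol_vars 0 = {}"
 by (auto simp: mpol_vars_def)

lemma ratfunsI: "b ~= 0 ==> mpol_vars a \<subseteq> X ==> mpol_vars b \<subseteq> X ==> Fract a b : ratfuns X"
 by (auto simp: ratfuns_def)

lemma ratfunsE:
 assumes "q : ratfuns X"
 obtains a b where "q = Fract a b" "b ~= 0" "mpol_vars a \<subseteq> X" "mpol_vars b \<subseteq> X"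
 using assms by (auto simp: ratfuns_def)

lemma ratfuns_UNIV [simp]: "q : ratfuns UNIV"
 by (cases q) (auto simp: ratfuns_def)

lemma ratfuns_0 [simp]: "0 : ratfuns X"
 unfolding Zero_fract_def by (rule ratfunsI) auto

lemma ratfuns_1 [simp]: "1 : ratfuns X"
 unfolding One_fract_def by (rule ratfunsI) auto

lemma ratfuns_mult: "p : ratfuns X ==> q : ratfuns X ==> p * q : ratfuns X"
proof (elim ratfunsE)
 fix a b c d assume "p = Fract a b" "q = Fract c d" "b ~= 0" "d ~= 0"
  "mpol_vars a \<subseteq> X" "mpol_vars b \<subseteq> X" "mpol_vars c \<subseteq> X" "mpol_vars d \<subseteq> X"
 thus "p * q : ratfuns X" using mpol_vars_mult[of a c] mpol_vars_mult[of b d] by (auto intro!: ratfunsI)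
qed

lemma ratfuns_add: "p : ratfuns X ==> q : ratfuns X ==> p + q : ratfuns X"
proof (elim ratfunsE)
 fix a b c d assume "p = Fract a b" "q = Fract c d" "b ~= 0" "d ~= 0"
  "mpol_vars a \<subseteq> X" "mpol_vars b \<subseteq> X" "mpol_vars c \<subseteq> X" "mpol_vars d \<subseteq> X"
 thus "p + q : ratfuns X" using mpol_vars_mult[of a d] mpol_vars_mult[of c b] mpol_vars_mult[of b d]
   mpol_vars_add[of "a * d" "c * b"] by (simp, intro ratfunsI) (simp_all, blast+)
qed

lemma ratfuns_uminus: "p : ratfuns X ==> - p : ratfuns X"
 by (elim ratfunsE) (auto intro!: ratfunsI)

lemma ratfuns_diff: "p : ratfuns X ==> q : ratfuns X ==> p - q : ratfuns X"
 using ratfuns_add[OF _ ratfuns_uminus, of p X q] by simp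

lemma ratfuns_inverse: "p : ratfuns X ==> inverse p : ratfuns X"
proof (elim ratfunsE)
 fix a b assume "p = Fract a b" "b ~= 0" "mpol_vars a \<subseteq> X" "mpol_vars b \<subseteq> X"
 thus "inverse p : ratfuns X" by (cases "a = 0") (auto intro!: ratfunsI simp: rat_number_collapse eq_fract)
qed

lemma ratfuns_divide: "p : ratfuns X ==> q : ratfuns X ==> p / q : ratfuns X"
 by (simp add: divide_inverse ratfuns_mult ratfuns_inverse)

lemma ratfuns_deriv: "p : ratfuns X ==> ratfun_deriv v p : ratfuns X"
proof (elim ratfunsE)
 fix a b assume *: "p = Fract a b" "b ~= 0" "mpol_vars a \<subseteq> X" "mpol_vars b \<subseteq> X"
 have "mpol_vars (mpol_deriv v a * b - a * mpol_deriv v b) \<subseteq> X"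
  using mpol_vars_diff[of "mpol_deriv v a * b" "a * mpol_deriv v b"]
   mpol_vars_mult[of "mpol_deriv v a" b] mpol_vars_mult[of a "mpol_deriv v b"]
   mpol_vars_deriv[of v a] mpol_vars_deriv[of v b] * by blast
 thus ?thesis using * mpol_vars_mult[of b b] by (auto simp: ratfun_deriv_Fract intro!: ratfunsI)
qed

lemma ratfun_deriv_not_var:
 assumes "p : ratfuns X" "v ~: X"
 shows "ratfun_deriv v p = 0"
proof -
 obtain a b where "p = Fract a b" "b ~= 0" "mpol_vars a \<subseteq> X" "mpol_vars b \<subseteq> X"
  using assms by (elim ratfunsE)
 moreover hence "mpol_deriv v a = 0" "mpol_deriv v b = 0" using assms(2) by (auto intro: mpol_deriv_not_var)
 ultimately show ?thesis by (simp add: ratfun_deriv_Fract Zero_fract_def eq_fract)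
qed

lemma ratfun_var_in: "v : X ==> ratfun_var v : ratfuns X"
 unfolding ratfun_var_def by (rule ratfunsI) (auto simp: mpol_vars_def)

lemma Fract_of_nat: "of_nat k = Fract (of_nat k) 1"
 by (induction k) (auto simp: Zero_fract_def One_fract_def)

lemma ratfuns_of_nat [simp]: "of_nat k : ratfuns X"
 by (induction k) (auto intro: ratfuns_add)

section \<open>The ring of differential operators\<close>

lemma lookup_op_scale [simp]: "lookup (op_scale a P) al = a * lookup P al"
 unfolding op_scale_def by transfer (auto simp: when_def)

lemma op_scale_simps [simp]:
 "op_scale 0 P = 0" "op_scale a 0 = 0" "op_scale 1 P = P"
 "op_scale a (op_scale b P) = op_scale (a * b) P"
 "op_scale a (single al b) = single al (a * b)"
 by (rule poly_mapping_eqI; simp add: mult.assoc lookup_single when_def)+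

lemma op_scale_add: "op_scale a (P + Q) = op_scale a P + op_scale a Q"
 by (rule poly_mapping_eqI) (simp add: lookup_add distrib_left)

lemma op_scale_add_left: "op_scale (a + b) P = op_scale a P + op_scale b P"
 by (rule poly_mapping_eqI) (simp add: lookup_add distrib_right)

lemma op_scale_diff: "op_scale a (P - Q) = op_scale a P - op_scale a Q"
 by (rule poly_mapping_eqI) (simp add: lookup_minus right_diff_distrib)

lemma op_scale_diff_left: "op_scale (a - b) P = op_scale a P - op_scale b P"
 by (rule poly_mapping_eqI) (simp add: lookup_minus left_diff_distrib)

lemma op_scale_minus: "op_scale (- a) P = - op_scale a P"
 by (rule poly_mapping_eqI) simp

lemma op_scale_sum: "op_scale a (SUM i:A. f i) = (SUM i:A. op_scale a (f i))"
 by (induction A rule: infinite_finite_induct) (auto simp: op_scale_add)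

lemma op_scale_sum_left: "op_scale (SUM i:A. f i) P = (SUM i:A. op_scale (f i) P)"
 by (induction A rule: infinite_finite_induct) (auto simp: op_scale_add_left)

lemma op_decompose: "(P :: ('v::{finite,linorder}, 'a::idom) diffop) = (SUM al:keys P. op_scale (lookup P al) (single al 1))"
 by (rule poly_mapping_eqI) (auto simp: lookup_sum lookup_single when_def in_keys_iff)

lemma op_partial_superset:
 assumes "finite A" "keys Q \<subseteq> A"
 shows "op_partial_mult v Q = (SUM be:A. single (be + single v 1) (lookup Q be)
         + single be (ratfun_deriv v (lookup Q be)))" unfolding op_partial_mult_def
 by (rule sum.mono_neutral_left) (use assms in \<open>auto simp: in_keys_iff\<close>)

lemma op_partial_add: "op_partial_mult v (P + Q) = op_partial_mult v P + op_partial_mult v Q"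
proof -
 have "keys (P + Q) \<subseteq> keys P \<union> keys Q" by (rule Poly_Mapping.keys_add)
 thus ?thesis by (simp add: op_partial_superset[of "keys P \<union> keys Q"] lookup_add single_add
    ratfun_deriv_add sum.distrib algebra_simps)
qed

lemma op_partial_0 [simp]: "op_partial_mult v 0 = 0"
 by (simp add: op_partial_mult_def)

lemma op_partial_single:
 "op_partial_mult v (single be a) = single (be + single v 1) a + single be (ratfun_deriv v a)"
 by (subst op_partial_superset[of "{be}"]) auto

lemma op_partial_scale:
 "op_partial_mult v (op_scale a P) = op_scale a (op_partial_mult v P) + op_scale (ratfun_deriv v a) P"
proof (induction P rule: mpol_induct)
 case (single al c)
 thus ?case by (simp add: op_partial_single op_scale_add ratfun_deriv_mult single_add algebra_simps)
qed (simp add: op_partial_add op_scale_add algebra_simps)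

lemma op_partial_commute:
 "op_partial_mult v (op_partial_mult w P) = op_partial_mult w (op_partial_mult v P)"
proof (induction P rule: mpol_induct)
 case (single al c)
 have "al + single w 1 + single v 1 = al + single v 1 + single w (1::nat)" by (simp add: algebra_simps)
 thus ?case by (simp add: op_partial_single op_partial_add ratfun_deriv_commute[of v w c])
qed (simp add: op_partial_add)

text \<open>The relation \<open>R\<close> accounts for functions that agree on an open set only.\<close>

lemma multi_iter_step:
 assumes closed: "!!v x. x : S ==> F v x : S"
  and refl: "!!x. x : S ==> R x x" and trans: "!!x y z. R x y ==> R y z ==> R x z"
  and cong: "!!v x y. x : S ==> y : S ==> R x y ==> R (F v x) (F v y)"
  and comm: "!!v w x. x : S ==> R (F v (F w x)) (F w (F v x))"
  and x: "x : S"
 shows "R (multi_iter F (al + single v 1) x) (F v (multi_iter F al x)) & multi_iter F al x : S"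
proof -
 have pw: "(F w ^^ k) y : S" if "y : S" for w k y by (induction k) (auto simp: that closed)
 have pwc: "R ((F w ^^ k) y) ((F w ^^ k) y')" if "y : S" "y' : S" "R y y'" for w k y y'
  by (induction k) (auto simp: that cong pw)
 have fs: "foldr (%v. F v ^^ a v) L y : S" if "y : S" for L y a by (induction L) (auto simp: that pw)
 have fsc: "R (foldr (%v. F v ^^ a v) L y) (foldr (%v. F v ^^ a v) L y')"
  if "y : S" "y' : S" "R y y'" for L y y' a by (induction L) (auto simp: that pwc fs)
 have pm: "R ((F w ^^ k) (F v y)) (F v ((F w ^^ k) y))" if "y : S" for w k y
 proof (induction k)
  case (Suc k)
  have "R (F w ((F w ^^ k) (F v y))) (F w (F v ((F w ^^ k) y)))"
   using Suc by (intro cong) (auto simp: pw that closed)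
  also have "R ... (F v (F w ((F w ^^ k) y)))" by (rule comm) (simp add: pw that)
  finally (trans) show ?case by simp
 qed (simp add: refl that closed)
 have fm: "R (foldr (%v. F v ^^ a v) L (F v y)) (F v (foldr (%v. F v ^^ a v) L y))" if "y : S" for L y a
 proof (induction L)
  case (Cons w L)
  have "R ((F w ^^ a w) (foldr (%v. F v ^^ a v) L (F v y)))
   ((F w ^^ a w) (F v (foldr (%v. F v ^^ a v) L y)))" using Cons by (intro pwc) (auto simp: fs that closed)
  also have "R ... (F v ((F w ^^ a w) (foldr (%v. F v ^^ a v) L y)))" by (rule pm) (simp add: fs that)
  finally (trans) show ?case by simp
 qed (simp add: refl that closed)
 obtain L1 L2 where L: "sorted_list_of_set UNIV = L1 @ v # L2"
  by (metis UNIV_I finite set_sorted_list_of_set split_list)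
 have "distinct (L1 @ v # L2)" using L by (metis distinct_sorted_list_of_set)
 hence nv: "v ~: set L1" "v ~: set L2" by auto
 let ?a = "lookup al" and ?b = "lookup (al + single v 1)"
 have e: "foldr (%w. F w ^^ ?b w) L' y = foldr (%w. F w ^^ ?a w) L' y" if "v ~: set L'" for L' y
  using that by (induction L') (auto simp: lookup_add lookup_single when_def)
 \<comment> \<open>The additional application of \<open>F v\<close> takes place between the
   variables before and after v; \<open>fm\<close> moves it to the front through those in
   \<open>L1\<close>.\<close>
 define y where "y = (F v ^^ ?a v) (foldr (%w. F w ^^ ?a w) L2 x)"
 have y: "y : S" by (simp add: y_def pw fs x)
 have "multi_iter F al x = foldr (%w. F w ^^ ?a w) L1 y" by (simp add: multi_iter_def L y_def)
 moreover have "multi_iter F (al + single v 1) x = foldr (%w. F w ^^ ?a w) L1 (F v y)"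
  unfolding multi_iter_def L y_def foldr_append foldr.simps comp_def
  by (simp only: e[OF nv(1)] e[OF nv(2)]) (simp add: lookup_add)
 ultimately show ?thesis using fm[OF y] fs[OF y] by simp
qed

lemma multi_iter_0 [simp]: "multi_iter F 0 x = x"
proof -
 have "foldr (%v. F v ^^ lookup 0 v) L x = x" for L by (induction L) auto
 thus ?thesis by (simp add: multi_iter_def)
qed

lemma multi_iter_single: "multi_iter F (single v k) x = (F v ^^ k) x"
proof -
 obtain L1 L2 where L: "sorted_list_of_set UNIV = L1 @ v # L2"
  by (metis UNIV_I finite set_sorted_list_of_set split_list)
 have "distinct (L1 @ v # L2)" using L by (metis distinct_sorted_list_of_set)
 hence nv: "v ~: set L1" "v ~: set L2" by auto
 have e: "foldr (%w. F w ^^ lookup (single v k) w) L' y = y" if "v ~: set L'" for L' y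
  using that by (induction L') (auto simp: lookup_single when_def)
 show ?thesis unfolding multi_iter_def L by (simp add: e nv)
qed

abbreviation opi :: "('v::{finite,linorder} \<Rightarrow>\<^sub>0 nat) => ('v, 'a::idom) diffop => ('v, 'a) diffop" where
 "opi \<equiv> multi_iter op_partial_mult"

lemma opi_step: "opi (al + single v 1) P = op_partial_mult v (opi al P)"
 using multi_iter_step[of UNIV op_partial_mult "(=)"] op_partial_commute by fastforce

lemma opi_add: "opi al (P + Q) = opi al P + opi al Q"
 by (induction al rule: multiindex_induct) (auto simp only: multi_iter_0 opi_step op_partial_add)

lemma opi_zero [simp]: "opi al 0 = 0"
 by (induction al rule: multiindex_induct) (auto simp only: multi_iter_0 opi_step op_partial_0)

lemma op_mult_superset:
 assumes "finite A" "keys P \<subseteq> A"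
 shows "op_mult P Q = (SUM al:A. op_scale (lookup P al) (opi al Q))" unfolding op_mult_def
 by (rule sum.mono_neutral_left) (use assms in \<open>auto simp: in_keys_iff\<close>)

lemma op_mult_add_left: "op_mult (P + P') Q = op_mult P Q + op_mult P' Q"
proof -
 have "keys (P + P') \<subseteq> keys P \<union> keys P'" by (rule Poly_Mapping.keys_add)
 thus ?thesis by (simp add: op_mult_superset[of "keys P \<union> keys P'"] lookup_add op_scale_add_left sum.distrib)
qed

lemma op_mult_add_right: "op_mult P (Q + Q') = op_mult P Q + op_mult P Q'"
 by (simp add: op_mult_def opi_add op_scale_add sum.distrib)

lemma op_mult_0 [simp]: "op_mult 0 Q = 0" "op_mult P 0 = 0"
 by (simp_all add: op_mult_def)

lemma op_mult_minus_left: "op_mult (- P) Q = - op_mult P Q"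
 using op_mult_add_left[of P "- P" Q] by (simp add: add_eq_0_iff)

lemma op_mult_minus_right: "op_mult P (- Q) = - op_mult P Q"
 using op_mult_add_right[of P Q "- Q"] by (simp add: add_eq_0_iff)

lemma op_mult_diff_left: "op_mult (P - P') Q = op_mult P Q - op_mult P' Q"
 using op_mult_add_left[of P "- P'" Q] by (simp add: op_mult_minus_left)

lemma op_mult_diff_right: "op_mult P (Q - Q') = op_mult P Q - op_mult P Q'"
 using op_mult_add_right[of P Q "- Q'"] by (simp add: op_mult_minus_right)

lemma op_mult_sum_left: "op_mult (SUM i:A. f i) Q = (SUM i:A. op_mult (f i) Q)"
 by (induction A rule: infinite_finite_induct) (auto simp: op_mult_add_left)

lemma op_mult_sum_right: "op_mult P (SUM i:A. f i) = (SUM i:A. op_mult P (f i))"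
 by (induction A rule: infinite_finite_induct) (auto simp: op_mult_add_right)

lemma op_mult_single: "op_mult (single al a) Q = op_scale a (opi al Q)"
 by (subst op_mult_superset[of "{al}"]) auto

lemma op_mult_scale: "op_mult (op_scale a P) Q = op_scale a (op_mult P Q)"
proof (induction P rule: mpol_induct)
 case (single al c)
 thus ?case by (simp add: op_mult_single)
qed (simp add: op_mult_add_left op_scale_add)

text \<open>The case of associativity in which the left factor is a single derivation; iterated in
  \<open>op_mult_opi\<close> and combined with \<open>op_mult_scale\<close> it gives
  \<open>op_mult_assoc\<close>.\<close>

lemma op_mult_partial: "op_mult (op_partial_mult v P) Q = op_partial_mult v (op_mult P Q)"
proof (induction P rule: mpol_induct)
 case (single al c)
 show ?case by (simp add: op_partial_single op_mult_single op_mult_add_left op_partial_scale flip: opi_step)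
qed (simp add: op_mult_add_left op_partial_add)

lemma op_mult_opi: "op_mult (opi al P) Q = opi al (op_mult P Q)"
 by (induction al rule: multiindex_induct) (simp only: multi_iter_0, simp only: opi_step op_mult_partial)

lemma op_mult_assoc: "op_mult (op_mult P Q) S = op_mult P (op_mult Q S)"
proof (induction P rule: mpol_induct)
 case (single al c)
 show ?case by (simp add: op_mult_single op_mult_scale op_mult_opi)
qed (simp add: op_mult_add_left)

lemma opi_single_indep:
 assumes "b : ratfuns X" "keys al \<inter> X = {}"
 shows "opi al (single be b) = single (al + be) b" using assms(2)
proof (induction al rule: multiindex_induct)
 case (step al v)
 have "keys al \<subseteq> keys (al + single v 1)" "v : keys (al + single v 1)"
  by (auto simp: in_keys_iff lookup_add)
 hence "opi al (single be b) = single (al + be) b" "v ~: X" using step by auto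
 moreover hence "ratfun_deriv v b = 0" by (simp add: ratfun_deriv_not_var[OF assms(1)])
 ultimately show ?case by (simp only: opi_step op_partial_single) (simp add: add_ac)
qed simp

lemma opi_single_const: "opi al (single be 1) = single (al + be) 1"
 by (rule opi_single_indep[of _ "{}"]) auto

lemma opi_1: "opi al 1 = single al 1"
 using opi_single_const[of al 0] by (metis add.right_neutral single_one)

lemma op_mult_one_right [simp]: "op_mult P op_one = P"
proof (induction P rule: mpol_induct)
 case (single al c)
 show ?case by (simp add: op_one_def op_mult_single opi_1)
qed (simp add: op_mult_add_left)

lemma op_mult_one_left [simp]: "op_mult op_one P = P"
 using op_mult_single[of 0 1 P] by (simp add: op_one_def)

lemma op_scale_eq_mult: "op_scale a P = op_mult (single 0 a) P"
 by (simp add: op_mult_single)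

section \<open>Operators with restricted coefficients and derivations\<close>

lemma diffopsI: "(!!al. al : keys P ==> keys al \<subseteq> S & lookup P al : ratfuns X) ==> P : diffops X S"
 by (auto simp: diffops_def)

lemma diffops_lookup: "P : diffops X S ==> lookup P al : ratfuns X"
 by (cases "al : keys P") (auto simp: diffops_def in_keys_iff)

lemma diffops_0 [simp]: "0 : diffops X S"
 by (simp add: diffops_def)

lemma diffops_add: "P : diffops X S ==> Q : diffops X S ==> P + Q : diffops X S"
 using Poly_Mapping.keys_add[of P Q]
 by (auto intro!: diffopsI simp: lookup_add diffops_lookup ratfuns_add) (auto simp: diffops_def)

lemma diffops_uminus: "P : diffops X S ==> - P : diffops X S"
 by (auto intro!: diffopsI simp: diffops_lookup ratfuns_uminus) (auto simp: diffops_def)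

lemma diffops_diff: "P : diffops X S ==> Q : diffops X S ==> P - Q : diffops X S"
 using diffops_add[OF _ diffops_uminus, of P X S Q] by simp

lemma diffops_sum: "(!!i. i : A ==> f i : diffops X S) ==> sum f A : diffops X S"
 by (induction A rule: infinite_finite_induct) (auto intro: diffops_add)

lemma diffops_single: "a : ratfuns X ==> keys al \<subseteq> S ==> single al a : diffops X S"
 by (rule diffopsI) (auto split: if_splits)

lemma diffops_scale: "a : ratfuns X ==> P : diffops X S ==> op_scale a P : diffops X S"
 by (rule diffopsI) (auto simp: diffops_def in_keys_iff ratfuns_mult)

lemma diffops_partial: "P : diffops X S ==> v : S ==> op_partial_mult v P : diffops X S"
proof -
 assume P: "P : diffops X S" and v: "v : S"
 have "keys (be + single v 1) \<subseteq> S" if "be : keys P" for be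
  using Poly_Mapping.keys_add[of be "single v 1"] P that v by (fastforce simp: diffops_def)
 thus ?thesis unfolding op_partial_mult_def by (intro diffops_sum diffops_add diffops_single ratfuns_deriv)
   (use P in \<open>auto simp: diffops_def\<close>)
qed

lemma diffops_opi: "P : diffops X S ==> keys al \<subseteq> S ==> opi al P : diffops X S"
proof (induction al rule: multiindex_induct)
 case (step al v)
 have "keys al \<subseteq> keys (al + single v 1)" "v : keys (al + single v 1)"
  by (auto simp: in_keys_iff lookup_add)
 thus ?case using step by (auto simp only: opi_step intro!: diffops_partial)
qed simp

lemma diffops_mult: "P : diffops X S ==> Q : diffops X S ==> op_mult P Q : diffops X S"
 unfolding op_mult_def by (intro diffops_sum diffops_scale diffops_opi) (auto simp: diffops_def)

lemma diffops_one [simp]: "op_one : diffops X S"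
 unfolding op_one_def by (rule diffops_single) auto

lemma diffops_mono: "P : diffops X S ==> X \<subseteq> X' ==> S \<subseteq> S' ==> P : diffops X' S'"
 by (fastforce simp: diffops_def ratfuns_def)

text \<open>Neither operator differentiates a variable in the coefficients of the other, so on
  monomials both products are \<open>single (al + be)\<close> with the product of the
  coefficients.\<close>

lemma op_mult_commute:
 assumes P: "P : diffops X S" and Q: "Q : diffops X' S'" and disj: "S \<inter> X' = {}" "S' \<inter> X = {}"
 shows "op_mult P Q = op_mult Q P"
proof -
 have m: "op_mult (single al (lookup P al)) (single be (lookup Q be)) =
   single (al + be) (lookup P al * lookup Q be)" if "al : keys P" for al be
  using opi_single_indep[OF diffops_lookup[OF Q], of al] P that disj(1)
  by (fastforce simp: op_mult_single diffops_def)
 have m': "op_mult (single be (lookup Q be)) (single al (lookup P al)) =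
   single (al + be) (lookup P al * lookup Q be)" if "be : keys Q" for al be
  using opi_single_indep[OF diffops_lookup[OF P], of be] Q that disj(2)
  by (fastforce simp: op_mult_single diffops_def add.commute mult.commute)
 have "op_mult P Q = op_mult (SUM al:keys P. single al (lookup P al)) (SUM be:keys Q. single be (lookup Q be))"
  by (simp only: mpol_sum_monomials[symmetric])
 also have "... = op_mult (SUM be:keys Q. single be (lookup Q be)) (SUM al:keys P. single al (lookup P al))"
  unfolding op_mult_sum_left op_mult_sum_right by (subst sum.swap) (intro sum.cong refl, simp add: m m')
 also have "... = op_mult Q P" by (simp only: mpol_sum_monomials[symmetric])
 finally show ?thesis .
qed

section \<open>Functions with commuting partial derivatives\<close>

lemma continuous_on_upd: "continuous_on A (%t. upd z v t)"
proof -
 have "continuous_on A (%t. if w = v then t else z $ w)" for w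
  by (cases "w = v") (auto intro: continuous_intros)
 thus ?thesis unfolding upd_def by (rule continuous_on_vec_lambda)
qed

lemma eventually_upd:
 assumes "open Om" "z : Om"
 shows "\<forall>\<^sub>F t in nhds (z $ v). upd z v t : Om"
proof -
 have "open ((%t. upd z v t) -` Om)" using continuous_on_upd assms(1) by (rule open_vimage[rotated])
 from eventually_nhds_in_open[OF this, of "z $ v"] show ?thesis using assms(2) by simp
qed

lemma cpartial_cong:
 assumes "open Om" "z : Om" "!!w. w : Om ==> F w = G w"
 shows "cpartial v F z = cpartial v G z" unfolding cpartial_upd
 by (rule deriv_cong_ev) (use eventually_mono[OF eventually_upd[OF assms(1,2)]] assms(3) in auto)

definition pdiff :: "'v => (complex^'v => complex) => complex^'v => bool" where
 "pdiff v F z \<longleftrightarrow> (%t. F (upd z v t)) field_differentiable at (z $ v)"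

lemma pdiff_has_deriv:
 assumes "pdiff v F z"
 shows "((%t. F (upd z v t)) has_field_derivative cpartial v F z) (at (z $ v))"
 using assms unfolding pdiff_def cpartial_upd by (simp add: field_differentiable_derivI)

lemma pdiffI:
 assumes "((%t. F (upd z v t)) has_field_derivative D) (at (z $ v))"
 shows "pdiff v F z" "cpartial v F z = D" using assms unfolding pdiff_def cpartial_upd
 by (auto simp: field_differentiable_def DERIV_imp_deriv)

lemma pdiff_cong:
 assumes "open Om" "z : Om" "!!w. w : Om ==> F w = G w" "pdiff v F z"
 shows "pdiff v G z"
proof (rule pdiffI)
 have "\<forall>\<^sub>F t in nhds (z $ v). G (upd z v t) = F (upd z v t)"
  using eventually_mono[OF eventually_upd[OF assms(1,2)]] assms(3) by auto
 thus "((%t. G (upd z v t)) has_field_derivative cpartial v F z) (at (z $ v))"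
  using pdiff_has_deriv[OF assms(4)] by (subst DERIV_cong_ev[OF refl _ refl])
qed

lemma pdiff_add:
 assumes "pdiff v F z" "pdiff v G z"
 shows "pdiff v (%z. F z + G z) z" "cpartial v (%z. F z + G z) z = cpartial v F z + cpartial v G z"
 by (rule pdiffI, rule DERIV_add[OF assms[THEN pdiff_has_deriv]])+

lemma pdiff_mult:
 assumes "pdiff v F z" "pdiff v G z"
 shows "pdiff v (%z. F z * G z) z"
  "cpartial v (%z. F z * G z) z = cpartial v F z * G z + F z * cpartial v G z"
 using pdiffI[OF DERIV_mult[OF assms[THEN pdiff_has_deriv]]] by (simp_all add: algebra_simps)

lemma pdiff_const [simp]: "pdiff v (%z. c) z" "cpartial v (%z. c) z = 0"
 by (rule pdiffI, rule DERIV_const)+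

text \<open>Conditions on \<open>F\<close> that make sense up to equality on \<open>Om\<close>; derivatives are to lie in \<open>S\<close>.\<close>

definition diff_into :: "(complex^'v::finite) set => (complex^'v => complex) set =>
  (complex^'v => complex) => bool" where
 "diff_into Om S F \<longleftrightarrow> continuous_on Om F & (ALL v. ALL z:Om. pdiff v F z) &
  (ALL v. EX G:S. ALL z:Om. cpartial v F z = G z) &
  (ALL v w. ALL z:Om. cpartial v (cpartial w F) z = cpartial w (cpartial v F) z)"

text \<open>A coinductive definition: the family S witnesses that all iterated partial derivatives
  exist, are continuous and commute. It is verified by exhibiting a family that is closed under
  differentiation.\<close>

definition smooth :: "(complex^'v::finite) set => (complex^'v => complex) => bool" where
 "smooth Om F \<longleftrightarrow> (EX S. F : S & (ALL G:S. diff_into Om S G))"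

lemma diff_into_mono: "diff_into Om S F ==> S \<subseteq> S' ==> diff_into Om S' F"
 unfolding diff_into_def by fast

lemma smooth_diff_into: "smooth Om F ==> diff_into Om {F. smooth Om F} F"
 unfolding smooth_def by (erule exE, erule conjE) (rule diff_into_mono, blast+)

lemma smooth_coinduct: "F : S ==> (!!G. G : S ==> diff_into Om S G) ==> smooth Om F"
 unfolding smooth_def by (rule exI[of _ S]) simp

lemma diff_into_cong:
 assumes Om: "open Om" and F: "diff_into Om S F" and eq: "!!w. w : Om ==> F w = G w"
 shows "diff_into Om S G"
proof -
 have c: "cpartial v F z = cpartial v G z" if "z : Om" for v z by (rule cpartial_cong[OF Om that eq])
 have cc: "cpartial v (cpartial w F) z = cpartial v (cpartial w G) z" if "z : Om" for v w z
  by (rule cpartial_cong[OF Om that c])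
 show ?thesis using F pdiff_cong[OF Om _ eq] unfolding diff_into_def
  by (auto simp flip: c cc) (metis continuous_on_cong eq)
qed

lemma smooth_cong:
 assumes "open Om" "smooth Om F" "!!w. w : Om ==> F w = G w"
 shows "smooth Om G"
proof -
 obtain S where S: "F : S" "!!G. G : S ==> diff_into Om S G"
  using assms(2) by (auto simp: smooth_def)
 show ?thesis
 proof (rule smooth_coinduct[of _ "insert G S"])
  fix H assume "H : insert G S"
  hence "diff_into Om S H"
  proof
   assume "H = G"
   thus ?thesis using diff_into_cong[OF assms(1) S(2)[OF S(1)] assms(3)] by simp
  qed (rule S(2))
  thus "diff_into Om (insert G S) H" by (rule diff_into_mono) auto
 qed simp
qed

lemma smooth_continuous: "smooth Om F ==> continuous_on Om F"
 using smooth_diff_into by (auto simp: diff_into_def)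

lemma smooth_pdiff: "smooth Om F ==> z : Om ==> pdiff v F z"
 using smooth_diff_into[of Om F] by (auto simp: diff_into_def)

lemma smooth_commute:
 "smooth Om F ==> z : Om ==> cpartial v (cpartial w F) z = cpartial w (cpartial v F) z"
 using smooth_diff_into[of Om F] by (auto simp: diff_into_def)

lemma smooth_cpartial:
 assumes "open Om" "smooth Om F"
 shows "smooth Om (cpartial v F)"
proof -
 obtain G where "smooth Om G" "ALL z:Om. cpartial v F z = G z"
  using smooth_diff_into[OF assms(2)] unfolding diff_into_def by blast
 thus ?thesis using smooth_cong[OF assms(1)] by metis
qed

inductive_set alg_gen :: "(complex^'v => complex) set => (complex^'v => complex) set"
 for \<G> where
 const: "(%z. c) : alg_gen \<G>"
| gen: "F : \<G> ==> F : alg_gen \<G>"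
| add: "F : alg_gen \<G> ==> G : alg_gen \<G> ==> (%z. F z + G z) : alg_gen \<G>"
| mult: "F : alg_gen \<G> ==> G : alg_gen \<G> ==> (%z. F z * G z) : alg_gen \<G>"

text \<open>By the sum and product rules the derivatives of an element of the algebra stay in it
  once those of the generators do; the symmetry of second derivatives passes to sums and products in
  the same way.\<close>

lemma smooth_alg_gen:
 assumes Om: "open Om" and gen: "!!F. F : \<G> ==> diff_into Om (alg_gen \<G>) F"
  and F: "F : alg_gen \<G>"
 shows "smooth Om F"
proof -
 have 1: "continuous_on Om F & (ALL v. ALL z:Om. pdiff v F z) &
  (ALL v. EX G:alg_gen \<G>. ALL z:Om. cpartial v F z = G z)" if "F : alg_gen \<G>" for F
  using that
 proof induction
  case (const c)
  thus ?case by (auto intro!: bexI[OF _ alg_gen.const[of 0]])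
 next
  case (gen F)
  thus ?case using assms(2) by (auto simp: diff_into_def)
 next
  case (add F G)
  have "EX H:alg_gen \<G>. ALL z:Om. cpartial v (%z. F z + G z) z = H z" for v
  proof -
   obtain F' G' where "F' : alg_gen \<G>" "ALL z:Om. cpartial v F z = F' z"
    "G' : alg_gen \<G>" "ALL z:Om. cpartial v G z = G' z" using add.IH by metis
   thus ?thesis using add.IH
    by (intro bexI[of _ "%z. F' z + G' z"]) (auto simp: pdiff_add intro: alg_gen.add)
  qed
  thus ?case using add.IH by (auto intro: continuous_intros pdiff_add)
 next
  case (mult F G)
  have "EX H:alg_gen \<G>. ALL z:Om. cpartial v (%z. F z * G z) z = H z" for v
  proof -
   obtain F' G' where "F' : alg_gen \<G>" "ALL z:Om. cpartial v F z = F' z"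
    "G' : alg_gen \<G>" "ALL z:Om. cpartial v G z = G' z" using mult.IH by metis
   thus ?thesis using mult.IH mult.hyps by (intro bexI[of _ "%z. F' z * G z + F z * G' z"])
     (auto simp: pdiff_mult intro!: alg_gen.add alg_gen.mult)
  qed
  thus ?case using mult.IH by (auto intro: continuous_intros pdiff_mult)
 qed
 have pd: "pdiff v F z" if "F : alg_gen \<G>" "z : Om" for v F z using 1 that by blast
 have pd2: "pdiff v (cpartial w F) z" if F: "F : alg_gen \<G>" and z: "z : Om" for v w F z
 proof -
  obtain G where G: "G : alg_gen \<G>" "!!z. z : Om ==> cpartial w F z = G z" using 1[OF F] by metis
  show ?thesis by (rule pdiff_cong[OF Om z _ pd[OF G(1) z, of v]]) (simp add: G(2))
 qed
 have 2: "ALL v w. ALL z:Om. cpartial v (cpartial w F) z = cpartial w (cpartial v F) z" if "F : alg_gen \<G>" for F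
  using that
 proof induction
  case (const c)
  have "cpartial v (%z. c) = (%z. 0)" for v :: 'a by (rule ext) simp
  thus ?case by simp
 next
  case (gen F)
  thus ?case using assms(2) by (auto simp: diff_into_def)
 next
  case (add F G)
  have "cpartial v (cpartial w (%z. F z + G z)) z = cpartial v (cpartial w F) z + cpartial v (cpartial w G) z"
   if z: "z : Om" for v w z
  proof -
   have "cpartial v (cpartial w (%z. F z + G z)) z = cpartial v (%z. cpartial w F z + cpartial w G z) z"
    by (rule cpartial_cong[OF Om z]) (simp add: pdiff_add pd add.hyps)
   thus ?thesis by (simp add: pdiff_add pd2 add.hyps z)
  qed
  thus ?case using add.IH by simp
 next
  case (mult F G)
  have "cpartial v (cpartial w (%z. F z * G z)) z =
    cpartial v (cpartial w F) z * G z + cpartial w F z * cpartial v G z +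
    (cpartial v F z * cpartial w G z + F z * cpartial v (cpartial w G) z)" if z: "z : Om" for v w z
  proof -
   have "cpartial v (cpartial w (%z. F z * G z)) z =
     cpartial v (%z. cpartial w F z * G z + F z * cpartial w G z) z"
    by (rule cpartial_cong[OF Om z]) (simp add: pdiff_mult pd mult.hyps)
   thus ?thesis by (simp add: pdiff_add pdiff_mult pd pd2 mult.hyps z)
  qed
  thus ?case using mult.IH by (simp add: algebra_simps)
 qed
 show ?thesis by (rule smooth_coinduct[OF F]) (use 1 2 in \<open>simp add: diff_into_def\<close>)
qed

lemma smooth_alg: "open Om ==> F : alg_gen {F. smooth Om F} ==> smooth Om F"
 by (rule smooth_alg_gen[of Om "{F. smooth Om F}"])
  (auto intro!: diff_into_mono[OF smooth_diff_into] alg_gen.gen)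

lemma smooth_const [simp]: "open Om ==> smooth Om (%z. c)"
 by (rule smooth_alg) (auto intro: alg_gen.intros)

lemma smooth_add: "open Om ==> smooth Om F ==> smooth Om G ==> smooth Om (%z. F z + G z)"
 by (rule smooth_alg) (auto intro: alg_gen.intros)

lemma smooth_mult: "open Om ==> smooth Om F ==> smooth Om G ==> smooth Om (%z. F z * G z)"
 by (rule smooth_alg) (auto intro: alg_gen.intros)

lemma smooth_sum: "open Om ==> (!!i. i : A ==> smooth Om (F i)) ==> smooth Om (%z. SUM i:A. F i z)"
 by (induction A rule: infinite_finite_induct) (auto intro!: smooth_add)

lemma smooth_prod: "open Om ==> (!!i. i : A ==> smooth Om (F i)) ==> smooth Om (%z. PROD i:A. F i z)"
 by (induction A rule: infinite_finite_induct) (auto intro!: smooth_mult)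

lemma smooth_of_component:
 assumes Om: "open Om" and U: "open U" "!!z. z : Om ==> z $ v : U" and g: "g holomorphic_on U"
 shows "smooth Om (%z. g (z $ v))"
proof (rule smooth_coinduct[of _ "{%z. g (z $ v) |g. g holomorphic_on U}"])
 fix G :: "complex^'a => complex" assume "G : {%z. g (z $ v) |g. g holomorphic_on U}"
 then obtain g where G: "G = (%z. g (z $ v))" and g: "g holomorphic_on U" by auto
 have p: "pdiff w (%z. g (z $ v)) z"
  "cpartial w (%z. g (z $ v)) z = (if w = v then deriv g (z $ v) else 0)"
  if "g holomorphic_on U" "z : Om" for g w z
 proof -
  have "((%t. g (upd z w t $ v)) has_field_derivative (if w = v then deriv g (z $ v) else 0)) (at (z $ w))"
   using holomorphic_derivI[OF that(1) U(1) U(2)[OF that(2)]] by auto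
  thus "pdiff w (%z. g (z $ v)) z"
   "cpartial w (%z. g (z $ v)) z = (if w = v then deriv g (z $ v) else 0)" by (rule pdiffI)+
 qed
 have pp: "cpartial w (cpartial w' (%z. g (z $ v))) z = (if w = v & w' = v then deriv (deriv g) (z $ v) else 0)"
  if z: "z : Om" for w w' z
 proof -
  have "cpartial w (cpartial w' (%z. g (z $ v))) z = cpartial w (%z. if w' = v then deriv g (z $ v) else 0) z"
   by (rule cpartial_cong[OF Om z]) (simp add: p g)
  thus ?thesis using p[OF holomorphic_deriv[OF g U(1)] z, of w] by (cases "w' = v") auto
 qed
 have "continuous_on Om (%z. g (z $ v))"
  by (rule continuous_on_compose2[OF holomorphic_on_imp_continuous_on[OF g]])
   (use U(2) in \<open>auto intro: continuous_intros\<close>)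
 moreover have "EX H:{%z. g (z $ v) |g. g holomorphic_on U}. ALL z:Om. cpartial w (%z. g (z $ v)) z = H z" for w
  using p(2)[OF g, of _ w] holomorphic_deriv[OF g U(1)]
  by (intro bexI[of _ "%z. (if w = v then deriv g else (%_. 0)) (z $ v)"]) auto
 ultimately show "diff_into Om {%z. g (z $ v) |g. g holomorphic_on U} G"
  unfolding diff_into_def G using p(1)[OF g] pp by simp
qed (use g in auto)

lemma smooth_multi_iter:
 assumes Om: "open Om" and F: "smooth Om F"
 shows "smooth Om (multi_iter cpartial al F)"
  "z : Om ==> multi_iter cpartial (al + single v 1) F z = cpartial v (multi_iter cpartial al F) z"
proof -
 \<comment> \<open>Equality on Om serves as the relation of \<open>multi_iter_step\<close>, because
   second derivatives are known to commute on Om only.\<close>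
 have *: "(ALL z:Om. multi_iter cpartial (al + single v 1) F z = cpartial v (multi_iter cpartial al F) z) &
   multi_iter cpartial al F : Collect (smooth Om)" for v
 proof (rule multi_iter_step[where R = "%F G. ALL z:Om. F z = G z"])
  show "ALL z:Om. cpartial v (cpartial w G) z = cpartial w (cpartial v G) z"
   if "G : Collect (smooth Om)" for v w G using that smooth_commute by blast
  show "ALL z:Om. cpartial v G z = cpartial v H z" if "ALL z:Om. G z = H z" for v G H
   by (intro ballI cpartial_cong[OF Om]) (use that in auto)
 qed (use F in \<open>auto intro: smooth_cpartial[OF Om]\<close>)
 thus "smooth Om (multi_iter cpartial al F)"
  "z : Om ==> multi_iter cpartial (al + single v 1) F z = cpartial v (multi_iter cpartial al F) z"
  by auto
qed

lemma multi_iter_cpartial_cong: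
 assumes Om: "open Om" "smooth Om F" "!!z. z : Om ==> F z = G z" "z : Om"
 shows "multi_iter cpartial al F z = multi_iter cpartial al G z"
proof -
 have G: "smooth Om G" by (rule smooth_cong[OF assms(1-3)])
 have "ALL z:Om. multi_iter cpartial al F z = multi_iter cpartial al G z"
 proof (induction al rule: multiindex_induct)
  case (step al v)
  thus ?case by (auto simp only: smooth_multi_iter[OF Om(1,2)] smooth_multi_iter[OF Om(1) G]
     intro!: cpartial_cong[OF Om(1)])
 qed (use assms(3) in simp)
 thus ?thesis using assms(4) by blast
qed

lemma multi_iter_cpartial_sum:
 assumes Om: "open Om" and F: "!!i. i : A ==> smooth Om (F i)" and "z : Om"
 shows "multi_iter cpartial al (%z. SUM i:A. c i * F i z) z = (SUM i:A. c i * multi_iter cpartial al (F i) z)"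
proof -
 have s: "smooth Om (%z. SUM i:A. c i * G i z)" if "!!i. i : A ==> smooth Om (G i)" for G
  using that by (intro smooth_sum smooth_mult smooth_const Om)
 have c: "cpartial v (%z. SUM i:A. c i * G i z) z = (SUM i:A. c i * cpartial v (G i) z)"
  if "!!i. i : A ==> smooth Om (G i)" "z : Om" for G v z
  by (rule pdiffI, rule DERIV_sum, rule DERIV_cmult)
   (use that in \<open>auto intro!: pdiff_has_deriv smooth_pdiff\<close>)
 have "ALL z:Om. multi_iter cpartial al (%z. SUM i:A. c i * F i z) z = (SUM i:A. c i * multi_iter cpartial al (F i) z)"
 proof (induction al rule: multiindex_induct)
  case (step al v)
  show ?case
  proof
   fix z assume z: "z : Om"
   have "multi_iter cpartial (al + single v 1) (%z. SUM i:A. c i * F i z) z =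
     cpartial v (%z. SUM i:A. c i * multi_iter cpartial al (F i) z) z"
    by (subst smooth_multi_iter(2)[OF Om s z, OF F], assumption, rule cpartial_cong[OF Om z])
     (use step in auto)
   also have "... = (SUM i:A. c i * cpartial v (multi_iter cpartial al (F i)) z)"
    by (rule c) (use z F smooth_multi_iter[OF Om] in auto)
   finally show "multi_iter cpartial (al + single v 1) (%z. SUM i:A. c i * F i z) z =
     (SUM i:A. c i * multi_iter cpartial (al + single v 1) (F i) z)"
    using smooth_multi_iter(2)[OF Om F z] by simp
  qed
 qed simp
 thus ?thesis using assms(3) by blast
qed

section \<open>Operators with polynomial coefficients\<close>

type_synonym ('v, 'a) polyop = "('v \<Rightarrow>\<^sub>0 nat) \<Rightarrow>\<^sub>0 ('v, 'a) mpol"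

definition emb :: "('v::linorder, 'a::idom) polyop => ('v, 'a) diffop" where
 "emb Q = Poly_Mapping.map (%a. Fract a 1) Q"

definition psc :: "('v, 'a::idom) mpol => ('v, 'a) polyop => ('v, 'a) polyop" where
 "psc a Q = Poly_Mapping.map (%b. a * b) Q"

definition ppart :: "'v::linorder => ('v, 'a::idom) polyop => ('v, 'a) polyop" where
 "ppart v Q = (SUM be:keys Q. single (be + single v 1) (lookup Q be) + single be (mpol_deriv v (lookup Q be)))"

lemma Fract_0_1 [simp]: "Fract 0 (1 :: 'a::idom) = 0"
 by (rule Zero_fract_def[symmetric])

lemma Fract_1_eq_0 [simp]: "Fract a (1 :: 'a::idom) = 0 \<longleftrightarrow> a = 0"
 unfolding Zero_fract_def by (subst eq_fract(1)) simp_all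

lemma Fract_1_eq [simp]: "Fract a (1 :: 'a::idom) = Fract b 1 \<longleftrightarrow> a = b"
 by (subst eq_fract(1)) simp_all

lemma lookup_map_zero: "f 0 = 0 ==> lookup (Poly_Mapping.map f p) k = f (lookup p k)"
 by transfer (auto simp: when_def)

lemma lookup_emb [simp]: "lookup (emb Q) al = Fract (lookup Q al) 1"
 unfolding emb_def by (rule lookup_map_zero) (rule Fract_0_1)

lemma lookup_psc [simp]: "lookup (psc a Q) al = a * lookup Q al"
 unfolding psc_def by (rule lookup_map_zero) simp

lemma emb_add: "emb (P + Q) = emb P + emb Q"
 by (rule poly_mapping_eqI) (simp add: lookup_add)

lemma emb_diff: "emb (P - Q) = emb P - emb Q"
 by (rule poly_mapping_eqI) (simp add: lookup_minus)

lemma emb_0 [simp]: "emb 0 = 0"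
 by (rule poly_mapping_eqI) simp

lemma emb_single [simp]: "emb (single al a) = single al (Fract a 1)"
 by (rule poly_mapping_eqI) (simp add: lookup_single when_def)

lemma emb_psc: "emb (psc a Q) = op_scale (Fract a 1) (emb Q)"
 by (rule poly_mapping_eqI) simp

lemma emb_inj: "emb P = emb Q ==> P = Q"
 by (rule poly_mapping_eqI) (metis lookup_emb Fract_1_eq)

lemma ppart_add: "ppart v (P + Q) = ppart v P + ppart v Q"
proof -
 have s: "ppart v Q = (SUM be:A. single (be + single v 1) (lookup Q be) + single be (mpol_deriv v (lookup Q be)))"
  if "finite A" "keys Q \<subseteq> A" for A Q unfolding ppart_def
  by (rule sum.mono_neutral_left) (use that in \<open>auto simp: in_keys_iff\<close>)
 have "keys (P + Q) \<subseteq> keys P \<union> keys Q" by (rule Poly_Mapping.keys_add)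
 thus ?thesis
  by (simp add: s[of "keys P \<union> keys Q"] lookup_add single_add mpol_deriv_add sum.distrib algebra_simps)
qed

lemma ppart_single: "ppart v (single be a) = single (be + single v 1) a + single be (mpol_deriv v a)"
 by (cases "a = 0") (simp_all add: ppart_def)

lemma emb_ppart: "emb (ppart v Q) = op_partial_mult v (emb Q)"
 by (induction Q rule: mpol_induct)
  (simp_all add: ppart_single ppart_add emb_add op_partial_single ratfun_deriv_of_mpol op_partial_add)

text \<open>One way of clearing the denominators of P; by \<open>clears_iff\<close> it is the
  premise under which \<open>annihilates\<close> demands vanishing.\<close>

definition clears :: "('v::{finite,linorder}, 'a::idom) mpol => ('v, 'a) diffop => ('v, 'a) polyop => bool" where
 "clears d P Q \<longleftrightarrow> d ~= 0 & op_scale (Fract d 1) P = emb Q"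

lemma clears_iff: "clears d P Q \<longleftrightarrow> d ~= 0 & (ALL al. Fract d 1 * lookup P al = Fract (lookup Q al) 1)"
 by (simp add: clears_def poly_mapping_eq_iff fun_eq_iff)

lemma clears_emb: "clears 1 (emb Q) Q"
 by (simp add: clears_def flip: One_fract_def)

text \<open>The denominators of the finitely many coefficients are multiplied. The variables are
  tracked so that the leading coefficient of an LCLM in one \<lambda> is seen to be free of the
  others.\<close>

lemma clears_exists:
 assumes "P : diffops X S"
 obtains d Q where "clears d P Q" "mpol_vars d \<subseteq> X" "!!al. mpol_vars (lookup Q al) \<subseteq> X"
proof -
 have "ALL al. EX a b. lookup P al = Fract a b & b ~= 0 & mpol_vars a \<subseteq> X & mpol_vars b \<subseteq> X"
  using diffops_lookup[OF assms] by (auto simp: ratfuns_def)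
 then obtain a b where ab: "!!al. lookup P al = Fract (a al) (b al)" "!!al. b al ~= 0"
  "!!al. mpol_vars (a al) \<subseteq> X" "!!al. mpol_vars (b al) \<subseteq> X" by metis
 have vp: "mpol_vars (PROD be:A. b be) \<subseteq> X" for A
 proof (induction A rule: infinite_finite_induct)
  case (insert be A)
  thus ?case using mpol_vars_mult[of "b be" "PROD be:A. b be"] ab(4)[of be] by auto
 qed auto
 define d where "d = (PROD be:keys P. b be)"
 define q where "q al = a al * (PROD be:keys P - {al}. b be)" for al
 define Q where "Q = (SUM al:keys P. single al (q al))"
 have l: "lookup Q al = (if al : keys P then q al else 0)" for al
  by (simp add: Q_def lookup_sum lookup_single when_def)
 show ?thesis
 proof (rule that)
  show "mpol_vars d \<subseteq> X" by (simp add: d_def vp)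
  show "mpol_vars (lookup Q al) \<subseteq> X" for al
   using mpol_vars_mult[of "a al" "PROD be:keys P - {al}. b be"] ab(3)[of al] vp[of "keys P - {al}"]
   by (auto simp: l q_def)
  have "Fract d 1 * lookup P al = Fract (lookup Q al) 1" for al
  proof (cases "al : keys P")
   case True
   hence "d = b al * (PROD be:keys P - {al}. b be)"
    unfolding d_def by (simp add: prod.remove)
   thus ?thesis using True ab(1,2) by (simp add: l q_def eq_fract)
  qed (auto simp: l in_keys_iff)
  moreover have "d ~= 0" using ab(2) by (simp add: d_def)
  ultimately show "clears d P Q" by (simp add: clears_iff)
 qed
qed

lemma clears_add:
 assumes "clears d P Q" "clears d' P' Q'"
 shows "clears (d * d') (P + P') (psc d' Q + psc d Q')"
proof -
 have "op_scale (Fract (d * d') 1) P = op_scale (Fract d' 1) (op_scale (Fract d 1) P)"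
  "op_scale (Fract (d * d') 1) P' = op_scale (Fract d 1) (op_scale (Fract d' 1) P')" by (simp_all add: mult.commute)
 thus ?thesis using assms by (simp add: clears_def op_scale_add emb_add emb_psc del: op_scale_simps(4))
qed

lemma clears_scale:
 assumes "clears d P Q" "b ~= 0"
 shows "clears (d * b) (op_scale (Fract a b) P) (psc a Q)"
proof -
 have "Fract (d * b) 1 * Fract a b = Fract a 1 * Fract d 1" using assms(2) by (simp add: eq_fract)
 hence "op_scale (Fract (d * b) 1) (op_scale (Fract a b) P) = op_scale (Fract a 1) (op_scale (Fract d 1) P)"
  by (simp only: op_scale_simps(4))
 thus ?thesis using assms by (simp add: clears_def emb_psc del: op_scale_simps(4))
qed

text \<open>This is the identity
  \<open>d^2 \<partial> P = d \<partial> (d P) - (\<partial> d) (d P)\<close>.\<close>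

lemma clears_partial:
 assumes "clears d P Q"
 shows "clears (d * d) (op_partial_mult v P) (psc d (ppart v Q) - psc (mpol_deriv v d) Q)"
proof -
 have Q: "op_scale (Fract d 1) P = emb Q" and d: "d ~= 0" using assms by (auto simp: clears_def)
 have "emb (psc d (ppart v Q) - psc (mpol_deriv v d) Q) = op_scale (Fract (d * d) 1) (op_partial_mult v P)"
  by (simp add: emb_diff emb_psc emb_ppart flip: Q)
   (simp add: op_partial_scale op_scale_add ratfun_deriv_of_mpol mult.commute)
 thus ?thesis using d by (simp add: clears_def)
qed

section \<open>The action on functions and annihilators\<close>

context coeff_embedding
begin

definition pact :: "('v::{finite,linorder}, 'a) polyop => (complex^('v::{finite,linorder}) => complex) => complex^('v::{finite,linorder}) => complex" where
 "pact Q F z = (SUM al:keys Q. mpol_eval h (lookup Q al) z * multi_iter cpartial al F z)"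

lemma annihilates_iff: "annihilates h P F W \<longleftrightarrow> (ALL d Q. clears d P Q --> (ALL z:W. pact Q F z = 0))"
 by (simp add: annihilates_def clears_iff pact_def)

lemma pact_superset:
 assumes "finite A" "keys Q \<subseteq> A"
 shows "pact Q F z = (SUM al:A. mpol_eval h (lookup Q al) z * multi_iter cpartial al F z)"
 unfolding pact_def by (rule sum.mono_neutral_left) (use assms in \<open>auto simp: in_keys_iff\<close>)

lemma pact_add: "pact (P + Q) F z = pact P F z + pact Q F z"
proof -
 have "keys (P + Q) \<subseteq> keys P \<union> keys Q" by (rule Poly_Mapping.keys_add)
 thus ?thesis
  by (simp add: pact_superset[of "keys P \<union> keys Q"] lookup_add mpol_eval_add distrib_right sum.distrib)
qed

lemma pact_single: "pact (single al a) F z = mpol_eval h a z * multi_iter cpartial al F z"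
 by (subst pact_superset[of "{al}"]) auto

lemma pact_0 [simp]: "pact 0 F z = 0"
 by (simp add: pact_def)

lemma pact_uminus: "pact (- Q) F z = - pact Q F z"
 using pact_add[of Q "- Q" F z] by (simp add: add_eq_0_iff)

lemma pact_diff: "pact (P - Q) F z = pact P F z - pact Q F z"
 using pact_add[of P "- Q" F z] by (simp add: pact_uminus)

lemma pact_psc: "pact (psc a Q) F z = mpol_eval h a z * pact Q F z"
proof -
 have "keys (psc a Q) \<subseteq> keys Q" by (auto simp: in_keys_iff)
 thus ?thesis by (simp add: pact_superset[of "keys Q"] mpol_eval_mult sum_distrib_left mult.assoc)
qed

lemma smooth_mpol_eval:
 fixes p :: "('v::{finite,linorder}, 'a) mpol"
 assumes "open Om"
 shows "smooth Om (mpol_eval h p)"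
proof (rule smooth_coinduct[of _ "range (mpol_eval h)"])
 fix G :: "complex^('v::{finite,linorder}) => complex" assume "G : range (mpol_eval h)"
 then obtain p where G: "G = mpol_eval h p" by auto
 have p: "pdiff v (mpol_eval h p) z" "cpartial v (mpol_eval h p) z = mpol_eval h (mpol_deriv v p) z"
  for v z and p :: "('v, 'a) mpol"
  using pdiffI[of "mpol_eval h p" z v] mpol_eval_has_partial[of p z v "z $ v"] by auto
 have c: "cpartial v (mpol_eval h p) = mpol_eval h (mpol_deriv v p)" for v and p :: "('v, 'a) mpol"
  by (rule ext) (rule p)
 show "diff_into Om (range (mpol_eval h)) G" unfolding diff_into_def G
  by (auto simp: p c mpol_deriv_commute intro: continuous_on_mpol_eval)
qed auto

lemma pdiff_mpol_eval:
 "pdiff v (mpol_eval h p) z" "cpartial v (mpol_eval h p) z = mpol_eval h (mpol_deriv v p) z"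
 using pdiffI[of "mpol_eval h p" z v] mpol_eval_has_partial[of p z v "z $ v"] by auto

lemma smooth_pact:
 assumes "open Om" "smooth Om F"
 shows "smooth Om (pact Q F)"
proof -
 have "smooth Om (%z. pact Q F z)" unfolding pact_def
  by (intro smooth_sum smooth_mult smooth_mpol_eval smooth_multi_iter assms)
 thus ?thesis by simp
qed

lemma pact_ppart:
 assumes Om: "open Om" "smooth Om F" and z: "z : Om"
 shows "pact (ppart v Q) F z = cpartial v (pact Q F) z"
proof (induction Q rule: mpol_induct)
 case (single al c)
 have e: "pact (single al c) F = (%z. mpol_eval h c z * multi_iter cpartial al F z)"
  by (rule ext) (rule pact_single)
 show ?case unfolding e ppart_single pact_add pact_single using smooth_multi_iter[OF Om] z
  by (simp add: pdiff_mult(2)[OF pdiff_mpol_eval(1) smooth_pdiff[of Om]] pdiff_mpol_eval)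
next
 case (add p q)
 have e: "pact (p + q) F = (%z. pact p F z + pact q F z)" by (rule ext) (rule pact_add)
 show ?case unfolding e ppart_add pact_add add
  using smooth_pdiff[OF smooth_pact[OF Om] z] by (simp add: pdiff_add)
qed

lemma pact_cong:
 assumes "open Om" "smooth Om F" "!!z. z : Om ==> F z = G z" "z : Om"
 shows "pact Q F z = pact Q G z" unfolding pact_def by (simp add: multi_iter_cpartial_cong[OF assms])

lemma pact_sum:
 assumes "open Om" "!!i. i : A ==> smooth Om (F i)" "z : Om"
 shows "pact Q (%z. SUM i:A. c i * F i z) z = (SUM i:A. c i * pact Q (F i) z)"
 unfolding pact_def sum_distrib_left
 by (subst sum.swap) (simp add: multi_iter_cpartial_sum[OF assms] sum_distrib_left mult_ac)

definition acts :: "(complex^('v::{finite,linorder})) set => ('v::{finite,linorder}, 'a) diffop =>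
  (complex^('v::{finite,linorder}) => complex) => (complex^('v::{finite,linorder}) => complex) => bool" where
 "acts Om P F G \<longleftrightarrow> (EX Q. P = emb Q & (ALL z:Om. pact Q F z = G z))"

text \<open>Both factors have polynomial coefficients and so has the product; hence no pole
  interferes with reading the product as a composition. The induction follows the recursion by which
  \<open>op_mult\<close> is built.\<close>

lemma acts_mult:
 assumes Om: "open Om" and F: "smooth Om F" and B: "acts Om B F G" and A: "acts Om A G H"
 shows "acts Om (op_mult A B) F H"
proof -
 obtain Q where Q: "B = emb Q" "!!z. z : Om ==> pact Q F z = G z" using B by (auto simp: acts_def)
 obtain P where P: "A = emb P" "!!z. z : Om ==> pact P G z = H z" using A by (auto simp: acts_def)
 have 1: "EX C. opi al (emb Q) = emb C & (ALL z:Om. pact C F z = multi_iter cpartial al (pact Q F) z)" for al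
 proof (induction al rule: multiindex_induct)
  case (step al v)
  then obtain C where C: "opi al (emb Q) = emb C"
   "!!z. z : Om ==> pact C F z = multi_iter cpartial al (pact Q F) z" by blast
  have "pact (ppart v C) F z = multi_iter cpartial (al + single v 1) (pact Q F) z" if z: "z : Om" for z
   unfolding pact_ppart[OF Om F z] smooth_multi_iter(2)[OF Om smooth_pact[OF Om F] z]
   by (rule cpartial_cong[OF Om z C(2)])
  thus ?case by (auto simp only: opi_step C emb_ppart[symmetric])
 qed auto
 have 2: "EX C. op_mult (emb P) (emb Q) = emb C & (ALL z:Om. pact C F z = pact P (pact Q F) z)"
 proof (induction P rule: mpol_induct)
  case (single al c)
  obtain C where C: "opi al (emb Q) = emb C" "!!z. z : Om ==> pact C F z = multi_iter cpartial al (pact Q F) z"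
   using 1 by blast
  show ?case by (rule exI[of _ "psc c C"]) (simp add: op_mult_single C emb_psc pact_psc pact_single)
 next
  case (add p q)
  then obtain C D where "op_mult (emb p) (emb Q) = emb C" "ALL z:Om. pact C F z = pact p (pact Q F) z"
   "op_mult (emb q) (emb Q) = emb D" "ALL z:Om. pact D F z = pact q (pact Q F) z" by blast
  thus ?case by (intro exI[of _ "C + D"]) (simp add: emb_add op_mult_add_left pact_add)
 qed
 then obtain C where C: "op_mult A B = emb C" "!!z. z : Om ==> pact C F z = pact P (pact Q F) z"
  unfolding P Q by blast
 have "pact P (pact Q F) z = H z" if "z : Om" for z
  using pact_cong[OF Om smooth_pact[OF Om F] Q(2) that] P(2)[OF that] by simp
 thus ?thesis unfolding acts_def using C by auto
qed

text \<open>\<open>Kill \<F>\<close> consists of the operators a fixed nonzero polynomial multiple of which annihilates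
  all \<open>F\<close> on \<open>W\<close>, for \<open>(F, W) \<in> \<F>\<close>. In contrast to \<open>annihilates\<close> one choice of the multiple is enough.\<close>

definition Kill :: "((complex^('v::{finite,linorder}) => complex) \<times> (complex^('v::{finite,linorder})) set) set =>
  ('v::{finite,linorder}, 'a) diffop set" where
 "Kill \<F> = {P. EX d Q. clears d P Q & (ALL (F, W):\<F>. ALL z:W. pact Q F z = 0)}"

text \<open>S lists the directions in which W is open around each of its points, so that a relation
  on W may be differentiated in them. For a set x = x0 these are the \<lambda> directions.\<close>

definition admissible :: "'v set => ((complex^'v::finite => complex) \<times> (complex^'v) set) set => bool" where
 "admissible S \<F> \<longleftrightarrow> (ALL (F, W):\<F>. EX Om. open Om & W \<subseteq> Om & smooth Om F &
   (ALL z:W. ALL v:S. \<forall>\<^sub>F t in nhds (z $ v). upd z v t : W))"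

lemma KillI: "clears d P Q ==> (!!F W z. (F, W) : \<F> ==> z : W ==> pact Q F z = 0) ==> P : Kill \<F>"
 unfolding Kill_def by fast

lemma KillE:
 assumes "P : Kill \<F>"
 obtains d Q where "clears d P Q" "!!F W z. (F, W) : \<F> ==> z : W ==> pact Q F z = 0"
 using assms unfolding Kill_def by fast

lemma Kill_add: "P : Kill \<F> ==> P' : Kill \<F> ==> P + P' : Kill \<F>"
 by (elim KillE, rule KillI[OF clears_add]) (auto simp: pact_add pact_psc)

lemma Kill_0 [simp]: "0 : Kill \<F>"
 by (rule KillI[of 1 0 0]) (auto simp: clears_def)

lemma Kill_sum: "(!!i. i : A ==> f i : Kill \<F>) ==> sum f A : Kill \<F>"
 by (induction A rule: infinite_finite_induct) (auto intro: Kill_add)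

lemma Kill_scale:
 assumes "P : Kill \<F>"
 shows "op_scale c P : Kill \<F>"
proof (cases c)
 case (Fract a b)
 thus ?thesis using assms by (auto elim!: KillE intro!: KillI[OF clears_scale] simp: pact_psc)
qed

lemma Kill_uminus: "P : Kill \<F> ==> - P : Kill \<F>"
 using Kill_scale[of P \<F> "- 1"] by (simp add: op_scale_minus)

lemma Kill_diff: "P : Kill \<F> ==> P' : Kill \<F> ==> P - P' : Kill \<F>"
 using Kill_add[OF _ Kill_uminus, of P \<F> P'] by simp

text \<open>Near each point W contains the line in direction v, so a relation on W may be
  differentiated along v. The polynomial of \<open>clears_partial\<close> depends on that of P only
  and thus serves the whole family.\<close>

lemma Kill_partial:
 assumes adm: "admissible S \<F>" and v: "v : S" and P: "P : Kill \<F>"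
 shows "op_partial_mult v P : Kill \<F>"
proof -
 obtain d Q where d: "clears d P Q" and Q: "!!F W z. (F, W) : \<F> ==> z : W ==> pact Q F z = 0"
  by (rule KillE[OF P]) (rule that)
 show ?thesis
 proof (rule KillI[OF clears_partial[OF d]])
  fix F W z assume FW: "(F, W) : \<F>" and z: "z : W"
  then obtain Om where Om: "open Om" "W \<subseteq> Om" "smooth Om F" and
   ev: "\<forall>\<^sub>F t in nhds (z $ v). upd z v t : W"
  proof -
   from adm FW have "EX Om. open Om & W \<subseteq> Om & smooth Om F &
     (ALL z:W. ALL v:S. \<forall>\<^sub>F t in nhds (z $ v). upd z v t : W)"
    unfolding admissible_def by (auto simp only: split: prod.splits)
   thus thesis using that z v by metis
  qed
  have "cpartial v (pact Q F) z = deriv (%t. 0) (z $ v)" unfolding cpartial_upd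
   by (rule deriv_cong_ev) (use eventually_mono[OF ev] Q[OF FW] in auto)
  thus "pact (psc d (ppart v Q) - psc (mpol_deriv v d) Q) F z = 0"
   using z Om by (simp add: pact_diff pact_psc Q[OF FW z] pact_ppart[of Om] subsetD)
 qed
qed

lemma Kill_mult:
 assumes adm: "admissible S \<F>" and A: "A : diffops X S" and P: "P : Kill \<F>"
 shows "op_mult A P : Kill \<F>"
proof -
 have "opi al P : Kill \<F>" if "keys al \<subseteq> S" for al using that
 proof (induction al rule: multiindex_induct)
  case (step al v)
  have "keys al \<subseteq> keys (al + single v 1)" "v : keys (al + single v 1)"
   by (auto simp: in_keys_iff lookup_add)
  thus ?case using step Kill_partial[OF adm] by (auto simp only: opi_step)
 qed (use P in simp)
 thus ?thesis using A unfolding op_mult_def by (intro Kill_sum Kill_scale) (auto simp: diffops_def)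
qed

text \<open>Two clearings satisfy \<open>psc d Q' = psc d' Q\<close>; hence \<open>Q'\<close> kills
  F where d is nonzero, and by continuity also at limits of such points.\<close>

lemma annihilates_of_clears:
 assumes d: "clears d P Q" and Q: "!!z. z : W ==> pact Q F z = 0"
  and Om: "open Om" "smooth Om F" "W \<subseteq> Om"
  and dense: "!!z e. z : W ==> e > 0 ==> EX w:W. dist w z < e & mpol_eval h d w ~= 0"
 shows "annihilates h P F W" unfolding annihilates_iff
proof (intro allI impI ballI, rule ccontr)
 fix d' Q' z assume d': "clears d' P Q'" and z: "z : W" and nz: "pact Q' F z ~= 0"
 have "emb (psc d Q') = emb (psc d' Q)"
 proof -
  have "op_scale (Fract d 1) (op_scale (Fract d' 1) P) = op_scale (Fract d' 1) (op_scale (Fract d 1) P)"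
   by (simp add: mult.commute)
  thus ?thesis using d d' by (simp add: emb_psc clears_def del: op_scale_simps(4))
 qed
 hence eq: "psc d Q' = psc d' Q" by (rule emb_inj)
 have "continuous_on W (pact Q' F)"
  using smooth_continuous[OF smooth_pact[OF Om(1,2)]] Om(3) by (rule continuous_on_subset)
 then obtain e where e: "e > 0" "!!w. w : W ==> dist w z < e ==> dist (pact Q' F w) (pact Q' F z) < norm (pact Q' F z)"
  using z nz unfolding continuous_on_iff by (metis zero_less_norm_iff)
 obtain w where w: "w : W" "dist w z < e" "mpol_eval h d w ~= 0" using dense[OF z e(1)] by blast
 have "mpol_eval h d w * pact Q' F w = mpol_eval h d' w * pact Q F w" using eq pact_psc by metis
 hence "pact Q' F w = 0" using Q w by simp
 thus False using e(2)[OF w(1,2)] by simp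
qed

text \<open>If d vanished near z on the affine subspace that frees the variables in S, it would
  vanish there on a product of discs and hence at y.\<close>

lemma mpol_eval_dense:
 fixes d :: "('v::{finite,linorder}, 'a) mpol"
 assumes nz: "mpol_eval h d y ~= 0" and y: "!!v. v ~: S ==> y $ v = z $ v" and e: "e > 0"
 shows "EX w. (ALL v. v ~: S --> w $ v = z $ v) & dist w z < e & mpol_eval h d w ~= 0"
proof (rule ccontr)
 assume neg: "\<not> ?thesis"
 \<comment> \<open>With this radius the coordinate distances add up to less than e.\<close>
 let ?X = "%v. ball (z $ v) (e / real CARD('v))"
 have "mpol_eval h d y = 0"
 proof (rule mpol_eval_zero_extend[of S ?X "%v. z $ v"])
  show "infinite (?X v)" for v using e uncountable_ball[of "e / real CARD('v)" "z $ v"] countable_finite by auto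
 next
  fix w assume w: "ALL v:S. w $ v : ?X v" "ALL v. v ~: S --> w $ v = z $ v"
  have "dist w z <= (SUM v:UNIV. dist (w $ v) (z $ v))" unfolding dist_vec_def by (rule L2_set_le_sum) auto
  also have "... < (SUM v:(UNIV::'v set). e / real CARD('v))"
  proof (rule sum_strict_mono)
   fix v
   show "dist (w $ v) (z $ v) < e / real CARD('v)" using w e by (cases "v : S") (auto simp: dist_commute)
  qed auto
  finally have "dist w z < e" by simp
  thus "mpol_eval h d w = 0" using neg w(2) by blast
 qed (use y in auto)
 thus False using nz by simp
qed

lemma annihilates_UNIV_of_Kill:
 assumes P: "P : Kill \<F>" and F: "(F, UNIV) : \<F>" "smooth UNIV F"
 shows "annihilates h P F UNIV"
proof -
 obtain d Q where d: "clears d P Q" and Q: "!!F W z. (F, W) : \<F> ==> z : W ==> pact Q F z = 0"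
  by (rule KillE[OF P]) (rule that)
 have "d ~= 0" using d by (simp add: clears_def)
 then obtain y where y: "mpol_eval h d y ~= 0" using mpol_eval_eq_0_everywhere by blast
 show ?thesis by (rule annihilates_of_clears[OF d Q[OF F(1)] open_UNIV F(2)])
   (use mpol_eval_dense[OF y, of UNIV] in auto)
qed

text \<open>On the line through a point with nonzero value, the polynomial in the coordinate v has
  finitely many roots. This is the source of the finite exceptional sets of x0.\<close>

lemma finite_bad_parameters:
 fixes d :: "('v::{finite,linorder}, 'a) mpol"
 assumes "d ~= 0"
 shows "finite {t. ALL z. z $ v = t --> mpol_eval h d z = 0}"
proof -
 obtain y where y: "mpol_eval h d y ~= 0" using mpol_eval_eq_0_everywhere assms by blast
 obtain q where q: "!!t. mpol_eval h d (upd y v t) = poly q t" using mpol_eval_slice_poly by blast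
 have "q ~= 0" using q[of "y $ v"] y by auto
 moreover have "{t. ALL z. z $ v = t --> mpol_eval h d z = 0} \<subseteq> {t. poly q t = 0}"
  by (auto simp flip: q)
 ultimately show ?thesis using poly_roots_finite finite_subset by blast
qed

end

section \<open>Linear algebra over a subfield\<close>

definition is_subfield :: "'k::field set => bool" where
 "is_subfield S \<longleftrightarrow> 0 : S & 1 : S & (ALL a:S. ALL b:S. a + b : S & a * b : S) &
  (ALL a:S. - a : S & inverse a : S)"

lemma is_subfield_UNIV [simp]: "is_subfield UNIV"
 by (simp add: is_subfield_def)

lemma is_subfield_ratfuns: "is_subfield (ratfuns X)"
 by (auto simp: is_subfield_def intro: ratfuns_add ratfuns_mult ratfuns_uminus ratfuns_inverse)

lemma is_subfield_sum: "is_subfield S ==> (!!i. i : A ==> f i : S) ==> sum f A : S"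
 by (induction A rule: infinite_finite_induct) (auto simp: is_subfield_def)

text \<open>Elimination of the unknown \<open>i0\<close> by means of the equation e. Tracking the
  subfield S keeps operators in one \<lambda> free of the other variables.\<close>

lemma more_unknowns_than_equations:
 fixes A :: "'i => 'e => 'k::field"
 assumes S: "is_subfield S" and "finite E" "finite I" "card E < card I"
  and "!!i e. i : I ==> e : E ==> A i e : S"
 shows "EX c. (ALL i:I. c i : S) & (EX i:I. c i ~= 0) & (ALL e:E. (SUM i:I. c i * A i e) = 0)"
 using assms(2-)
proof (induction E arbitrary: I A rule: finite_induct)
 case empty
 hence "I ~= {}" by auto
 thus ?case using S by (intro exI[of _ "%_. 1"]) (auto simp: is_subfield_def)
next
 case (insert e E)
 show ?case
 proof (cases "ALL i:I. A i e = 0")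
  case True
  have "card E < card I" using insert.prems(2) insert.hyps by simp
  then obtain c where "ALL i:I. c i : S" "EX i:I. c i ~= 0" "ALL e:E. (SUM i:I. c i * A i e) = 0"
   using insert.IH[OF insert.prems(1), of A] insert.prems(3) by auto
  thus ?thesis using True by (intro exI[of _ c]) auto
 next
  case False
  then obtain i0 where i0: "i0 : I" "A i0 e ~= 0" by blast
  let ?I = "I - {i0}"
  define r where "r i = A i e * inverse (A i0 e)" for i
  define B where "B i e' = A i e' - r i * A i0 e'" for i e'
  have rS: "r i : S" if "i : I" for i
   unfolding r_def using S insert.prems(3) i0 that by (auto simp: is_subfield_def)
  have "EX c. (ALL i:?I. c i : S) & (EX i:?I. c i ~= 0) & (ALL e:E. (SUM i:?I. c i * B i e) = 0)"
  proof (rule insert.IH)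
   show "card E < card ?I" using insert.prems insert.hyps i0 by (simp add: card_Diff_singleton)
   show "B i e' : S" if "i : ?I" "e' : E" for i e'
   proof -
    have "A i e' + - (r i * A i0 e') : S" using S insert.prems(3) i0 that rS unfolding is_subfield_def by blast
    thus ?thesis by (simp add: B_def)
   qed
  qed (use insert.prems in auto)
  then obtain c where c: "ALL i:?I. c i : S" "EX i:?I. c i ~= 0" "!!e. e : E ==> (SUM i:?I. c i * B i e) = 0"
   by blast
  \<comment> \<open>Back substitution: this value of the eliminated unknown restores the equation
    e.\<close>
  define c0 where "c0 = - (SUM i:?I. c i * r i)"
  have "(SUM i:?I. c i * r i) : S"
   by (rule is_subfield_sum[OF S]) (use c(1) rS S in \<open>auto simp: is_subfield_def\<close>)
  hence c0: "c0 : S" using S by (simp add: c0_def is_subfield_def)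
  have eq: "(SUM i:I. (if i = i0 then c0 else c i) * A i e') = 0" if "e' : insert e E" for e'
  proof -
   have "(SUM i:I. (if i = i0 then c0 else c i) * A i e') = c0 * A i0 e' + (SUM i:?I. c i * A i e')"
    using i0(1) insert.prems(1) by (subst sum.remove[of _ i0]) auto
   also have "... = (SUM i:?I. c i * B i e')"
    by (simp add: c0_def B_def sum_distrib_right right_diff_distrib sum_subtractf mult.assoc)
   also have "... = 0"
   proof (cases "e' = e")
    case True
    have "B i e = 0" for i using i0(2) by (simp add: B_def r_def)
    thus ?thesis using True by simp
   qed (use c(3) that in auto)
   finally show ?thesis .
  qed
  show ?thesis by (rule exI[of _ "%i. if i = i0 then c0 else c i"]) (use c c0 eq in auto)
 qed
qed

text \<open>The right-hand side joins as one more unknown \<open>None\<close>. A nontrivial solution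
  with coefficient 0 there would contradict injectivity, so that coefficient can be
  normalised.\<close>

lemma square_system_solvable:
 fixes A :: "'i => 'e => 'k::field"
 assumes S: "is_subfield S" and fin: "finite E" "finite I" "card E = card I"
  and A: "!!i e. i : I ==> e : E ==> A i e : S" and b: "!!e. e : E ==> b e : S"
  and inj: "!!c. (!!i. i : I ==> c i : S) ==> (!!e. e : E ==> (SUM i:I. c i * A i e) = 0) ==> (ALL i:I. c i = 0)"
 shows "EX c. (ALL i:I. c i : S) & (ALL e:E. (SUM i:I. c i * A i e) = b e)"
proof -
 let ?A = "%i. case i of None => b | Some i => A i"
 let ?I = "insert None (Some ` I)"
 have "card ?I = Suc (card I)" using fin by (simp add: card_image)
 hence "card E < card ?I" "finite ?I" "!!i e. i : ?I ==> e : E ==> ?A i e : S"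
  using fin A b by auto
 then obtain c where c: "ALL i:?I. c i : S" "EX i:?I. c i ~= 0" "ALL e:E. (SUM i:?I. c i * ?A i e) = 0"
  using more_unknowns_than_equations[OF S fin(1), of ?I ?A] by blast
 have sum: "c None * b e + (SUM i:I. c (Some i) * A i e) = 0" if "e : E" for e
  using c(3) that fin by (simp add: sum.reindex)
 have t: "c None ~= 0"
 proof
  assume "c None = 0"
  hence "ALL i:I. c (Some i) = 0" using inj[of "%i. c (Some i)"] c(1) sum by simp
  thus False using c(2) \<open>c None = 0\<close> by auto
 qed
 have "(SUM i:I. (- inverse (c None) * c (Some i)) * A i e) = b e" if "e : E" for e
 proof -
  have "(SUM i:I. (- inverse (c None) * c (Some i)) * A i e) = - inverse (c None) * (SUM i:I. c (Some i) * A i e)"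
   by (simp add: sum_distrib_left mult.assoc sum_negf)
  also have "(SUM i:I. c (Some i) * A i e) = - (c None * b e)" using sum[OF that] by (simp add: add_eq_0_iff)
  finally show ?thesis using t by simp
 qed
 moreover have "- inverse (c None) * c (Some i) : S" if "i : I" for i
  using S c(1) that unfolding is_subfield_def by auto
 ultimately show ?thesis by (intro exI[of _ "%i. - inverse (c None) * c (Some i)"]) auto
qed

section \<open>Entire power series\<close>

definition pser :: "(nat => complex) => complex => complex" where
 "pser c z = suminf (%n. c n * z ^ n)"

text \<open>A growth bound that forces convergence everywhere and survives sums, shifts and
  multiplication of the n-th coefficient by n, hence the Euler operator.\<close>

definition entire_coeffs :: "(nat => complex) => bool" where
 "entire_coeffs c \<longleftrightarrow> (EX A C. 0 <= A & 1 <= C & (ALL n. norm (c n) <= A * C ^ n / fact n))"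

definition shift_up :: "(nat => complex) => nat => complex" where
 "shift_up c i = (case i of 0 => 0 | Suc j => c j)"

lemma shift_up_simps [simp]: "shift_up c 0 = 0" "shift_up c (Suc i) = c i"
 by (simp_all add: shift_up_def)

lemma entire_summable:
 assumes "entire_coeffs c"
 shows "summable (%n. c n * z ^ n)"
proof -
 obtain A C where C: "!!n. norm (c n) <= A * C ^ n / fact n" using assms by (auto simp: entire_coeffs_def)
 have "summable (%n. A * (inverse (fact n) * (C * norm z) ^ n))" by (intro summable_mult summable_exp)
 thus ?thesis
 proof (rule summable_comparison_test'[of _ 0])
  fix n
  have "norm (c n * z ^ n) <= (A * C ^ n / fact n) * norm z ^ n"
   unfolding norm_mult norm_power by (intro mult_right_mono C) auto
  thus "norm (c n * z ^ n) <= A * (inverse (fact n) * (C * norm z) ^ n)"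
   by (simp add: power_mult_distrib field_simps)
 qed
qed

lemma entire_coeffs_0 [simp]: "entire_coeffs (%_. 0)"
 by (auto simp: entire_coeffs_def intro!: exI[of _ 0] exI[of _ 1])

lemma entire_coeffs_add:
 assumes "entire_coeffs a" "entire_coeffs b"
 shows "entire_coeffs (%i. a i + b i)"
proof -
 obtain A C where 1: "0 <= A" "1 <= C" "!!n. norm (a n) <= A * C ^ n / fact n"
  using assms(1) by (auto simp: entire_coeffs_def)
 obtain A' C' where 2: "0 <= A'" "1 <= C'" "!!n. norm (b n) <= A' * C' ^ n / fact n"
  using assms(2) by (auto simp: entire_coeffs_def)
 have "norm (a n + b n) <= (A + A') * (max C C') ^ n / fact n" for n
 proof -
  have "A * C ^ n <= A * (max C C') ^ n" "A' * C' ^ n <= A' * (max C C') ^ n"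
   using 1 2 by (auto intro!: mult_left_mono power_mono)
  hence "A * C ^ n + A' * C' ^ n <= (A + A') * (max C C') ^ n" by (simp add: distrib_right)
  hence "A * C ^ n / fact n + A' * C' ^ n / fact n <= (A + A') * (max C C') ^ n / fact n"
   by (simp add: divide_right_mono flip: add_divide_distrib)
  thus ?thesis using norm_triangle_ineq[of "a n" "b n"] 1(3)[of n] 2(3)[of n] by linarith
 qed
 thus ?thesis unfolding entire_coeffs_def using 1 2 by (intro exI[of _ "A + A'"] exI[of _ "max C C'"]) auto
qed

lemma entire_coeffs_cmult:
 assumes "entire_coeffs a"
 shows "entire_coeffs (%i. r * a i)"
proof -
 obtain A C where 1: "0 <= A" "1 <= C" "!!n. norm (a n) <= A * C ^ n / fact n"
  using assms(1) by (auto simp: entire_coeffs_def)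
 have "norm (r * a n) <= (norm r * A) * C ^ n / fact n" for n
  using mult_left_mono[OF 1(3)[of n], of "norm r"] by (simp add: norm_mult mult.assoc)
 thus ?thesis unfolding entire_coeffs_def using 1 by (intro exI[of _ "norm r * A"] exI[of _ C]) auto
qed

lemma entire_coeffs_index:
 assumes "entire_coeffs a"
 shows "entire_coeffs (%i. of_nat i * a i)"
proof -
 obtain A C where 1: "0 <= A" "1 <= C" "!!n. norm (a n) <= A * C ^ n / fact n"
  using assms(1) by (auto simp: entire_coeffs_def)
 have "norm (of_nat n * a n) <= A * (2 * C) ^ n / fact n" for n
 proof -
  have "real n <= 2 ^ n" using less_exp[of n] by (metis less_imp_le of_nat_le_iff of_nat_numeral of_nat_power)
  hence "real n * norm (a n) <= 2 ^ n * (A * C ^ n / fact n)" using 1 by (intro mult_mono) auto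
  thus ?thesis by (simp add: norm_mult power_mult_distrib field_simps)
 qed
 thus ?thesis unfolding entire_coeffs_def using 1 by (intro exI[of _ A] exI[of _ "2 * C"]) auto
qed

lemma pser_add: "entire_coeffs a ==> entire_coeffs b ==> pser (%i. a i + b i) z = pser a z + pser b z"
 unfolding pser_def by (simp add: distrib_right suminf_add entire_summable)

lemma pser_cmult: "entire_coeffs a ==> pser (%i. r * a i) z = r * pser a z"
 unfolding pser_def using suminf_mult[OF entire_summable, of a r z] by (simp add: mult.assoc)

lemma pser_0 [simp]: "pser (%_. 0) z = 0"
 by (simp add: pser_def)

lemma pser_shift_up:
 assumes "entire_coeffs a"
 shows "pser (shift_up a) z = z * pser a z"
proof -
 have "(%n. z * (a n * z ^ n)) sums (z * pser a z)"
  unfolding pser_def by (intro sums_mult summable_sums entire_summable assms)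
 hence "(%n. shift_up a (Suc n) * z ^ Suc n) sums (z * pser a z)" by (simp add: mult_ac)
 hence "(%n. shift_up a n * z ^ n) sums (z * pser a z + shift_up a 0 * z ^ 0)" by (rule sums_Suc)
 thus ?thesis by (simp add: pser_def sums_iff)
qed

lemma pser_has_deriv:
 assumes a: "entire_coeffs a"
 shows "(pser a has_field_derivative (suminf (%n. diffs a n * z ^ n))) (at z)"
 unfolding pser_def[abs_def] by (rule termdiffs_strong_converges_everywhere) (rule entire_summable[OF a])

lemma pser_deriv:
 assumes a: "entire_coeffs a" and z: "z ~= 0"
 shows "(pser a has_field_derivative pser (%i. of_nat i * a i) z / z) (at z)"
proof -
 have "summable (%n. diffs a n * z ^ n)" by (rule termdiff_converges_all) (rule entire_summable[OF a])
 hence "(%n. z * (diffs a n * z ^ n)) sums (z * (suminf (%n. diffs a n * z ^ n)))"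
  by (intro sums_mult summable_sums)
 hence "(%n. of_nat (Suc n) * a (Suc n) * z ^ Suc n) sums (z * (suminf (%n. diffs a n * z ^ n)))"
  by (simp add: diffs_def mult_ac)
 hence "(%n. of_nat n * a n * z ^ n) sums (z * (suminf (%n. diffs a n * z ^ n)) + of_nat 0 * a 0 * z ^ 0)"
  by (rule sums_Suc)
 hence "pser (%i. of_nat i * a i) z = z * (suminf (%n. diffs a n * z ^ n))"
  by (simp add: pser_def sums_iff)
 thus ?thesis using pser_has_deriv[OF a, of z] z by simp
qed

lemma pser_holomorphic: "entire_coeffs a ==> pser a holomorphic_on S"
 using pser_has_deriv by (meson holomorphic_onI field_differentiable_at_within field_differentiable_def)

text \<open>Only nonzero z are tested because z will be an exponential; continuity supplies z = 0,
  and then the zeros of a nonzero power series are isolated.\<close>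

lemma pser_eq_0:
 assumes a: "entire_coeffs a" and zero: "!!z. z ~= 0 ==> pser a z = 0"
 shows "a n = 0"
proof -
 have "isCont (pser a) 0" using pser_has_deriv[OF a] by (rule DERIV_isCont)
 moreover have "(pser a \<longlongrightarrow> 0) (at 0)"
  by (rule tendsto_eventually) (use zero in \<open>auto simp: eventually_at_filter\<close>)
 ultimately have p0: "pser a 0 = 0" using LIM_unique unfolding isCont_def by blast
 have "a 0 = 0" using p0 by (simp add: pser_def powser_zero)
 moreover have "a n = 0" if "n > 0"
 proof (rule ccontr)
  assume "a n ~= 0"
  have sm: "(%k. a k * (x - 0) ^ k) sums pser a x" for x
   using entire_summable[OF a, of x] by (simp add: pser_def summable_sums)
  obtain s where s: "0 < s" "!!z. z : cball 0 s - {0} ==> pser a z ~= 0"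
   by (rule powser_0_nonzero[of 1 0 a "pser a" n])
    (use sm p0 \<open>a n ~= 0\<close> \<open>n > 0\<close> in auto)
  from s(2)[of "of_real s"] s(1) zero[of "of_real s"] show False by auto
 qed
 ultimately show ?thesis by (cases n) auto
qed

section \<open>The ordinary differential equations\<close>

text \<open>With \<open>P = y \<partial>\<^sup>2 + (M + 1) \<partial> - x\<close> one has \<open>\<T>\<^sub>1 = P\<close> and \<open>\<T>\<^sub>j = (\<partial> - 1) P - j \<partial>\<close> for \<open>j \<ge> 2\<close>.\<close>

definition Pode :: "nat => complex => (complex => complex) => complex => complex" where
 "Pode M x f y = y * deriv (deriv f) y + (of_nat M + 1) * deriv f y - x * f y"

definition Qode :: "nat => complex => complex => (complex => complex) => complex => complex" where
 "Qode M x J f y = deriv (Pode M x f) y - Pode M x f y - J * deriv f y"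

definition Tode :: "nat => complex => nat => (complex => complex) => complex => complex" where
 "Tode M x j = (if j = 1 then Pode M x else Qode M x (of_nat j))"

definition Jpar :: "nat => complex" where
 "Jpar j = (if j = 1 then 0 else of_nat j)"

definition dord :: "nat => nat" where
 "dord j = (if j = 1 then 2 else 3)"

definition Vsol :: "nat => complex => complex set => nat => (complex => complex) set" where
 "Vsol M x U j = {f. f holomorphic_on U & (ALL y:U. Tode M x j f y = 0)}"

text \<open>For a branch \<open>l\<close> of the logarithm the coefficient sequences \<open>a\<close>, \<open>b\<close> encode the function
  \<open>y\<^sup>-\<^sup>M (\<Sum>\<^sub>i a\<^sub>i y\<^sup>i + log y \<Sum>\<^sub>i b\<^sub>i y\<^sup>i)\<close>; the Euler operator acts on them by \<open>euler_a\<close>, \<open>euler_b\<close>.\<close>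

definition logser :: "nat => (complex => complex) => (nat => complex) => (nat => complex) => complex => complex" where
 "logser M l a b y = (pser a y + l y * pser b y) / y ^ M"

definition euler_a :: "nat => (nat => complex) => (nat => complex) => nat => complex" where
 "euler_a M a b i = (of_nat i - of_nat M) * a i + b i"

definition euler_b :: "nat => (nat => complex) => nat => complex" where
 "euler_b M b i = (of_nat i - of_nat M) * b i"

lemma entire_coeffs_euler:
 assumes "entire_coeffs a" "entire_coeffs b"
 shows "entire_coeffs (euler_a M a b)" "entire_coeffs (euler_b M b)"
proof -
 have "entire_coeffs (%i. of_nat i * c i + (- of_nat M) * c i)" if "entire_coeffs c" for c
  by (intro entire_coeffs_add entire_coeffs_index entire_coeffs_cmult that)
 hence *: "entire_coeffs (%i. (of_nat i - of_nat M) * c i)" if "entire_coeffs c" for c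
  using that by (simp add: left_diff_distrib)
 show "entire_coeffs (euler_b M b)" unfolding euler_b_def[abs_def] by (rule *[OF assms(2)])
 show "entire_coeffs (euler_a M a b)" unfolding euler_a_def[abs_def] by (intro entire_coeffs_add * assms)
qed

lemma pser_euler:
 assumes "entire_coeffs a" "entire_coeffs b"
 shows "pser (euler_a M a b) y = pser (%i. of_nat i * a i) y - of_nat M * pser a y + pser b y"
  "pser (euler_b M b) y = pser (%i. of_nat i * b i) y - of_nat M * pser b y"
proof -
 have *: "pser (%i. (of_nat i - of_nat M) * c i) y = pser (%i. of_nat i * c i) y - of_nat M * pser c y"
  "entire_coeffs (%i. (of_nat i - of_nat M) * c i)" if c: "entire_coeffs c" for c
 proof -
  have "pser (%i. of_nat i * c i + (- of_nat M) * c i) y = pser (%i. of_nat i * c i) y + (- of_nat M) * pser c y"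
   by (subst pser_add) (intro entire_coeffs_index entire_coeffs_cmult c, intro entire_coeffs_cmult c,
    simp only: pser_cmult[OF c])
  thus "pser (%i. (of_nat i - of_nat M) * c i) y = pser (%i. of_nat i * c i) y - of_nat M * pser c y"
   by (simp add: left_diff_distrib)
  show "entire_coeffs (%i. (of_nat i - of_nat M) * c i)"
   using entire_coeffs_euler(2)[OF c c, of M] by (simp add: euler_b_def[abs_def])
 qed
 show "pser (euler_b M b) y = pser (%i. of_nat i * b i) y - of_nat M * pser b y"
  unfolding euler_b_def[abs_def] by (rule *(1)[OF assms(2)])
 show "pser (euler_a M a b) y = pser (%i. of_nat i * a i) y - of_nat M * pser a y + pser b y"
  unfolding euler_a_def[abs_def] by (simp add: pser_add[OF *(2)[OF assms(1)] assms(2)] *(1)[OF assms(1)])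
qed

lemma log_branch_deriv:
 assumes "open U" "l holomorphic_on U" "!!y. y : U ==> exp (l y) = y" "y : U"
 shows "(l has_field_derivative 1 / y) (at y)"
proof -
 have d: "(l has_field_derivative deriv l y) (at y)" by (rule holomorphic_derivI[OF assms(2,1,4)])
 have "((%y. exp (l y)) has_field_derivative exp (l y) * deriv l y) (at y)"
  by (rule DERIV_chain2[OF DERIV_exp d])
 moreover have "((%y. exp (l y)) has_field_derivative 1) (at y)"
  using DERIV_ident by (rule has_field_derivative_transform_within_open[OF _ assms(1,4)]) (simp add: assms(3))
 ultimately have "exp (l y) * deriv l y = 1" by (rule DERIV_unique)
 hence "y * deriv l y = 1" using assms(3,4) by simp
 hence "deriv l y = 1 / y" by (metis mult_not_zero nonzero_mult_div_cancel_left zero_neq_one)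
 thus ?thesis using d by simp
qed

lemma logser_deriv:
 assumes U: "open U" "l holomorphic_on U" "!!y. y : U ==> exp (l y) = y" "y : U"
  and ab: "entire_coeffs a" "entire_coeffs b"
 shows "(logser M l a b has_field_derivative logser M l (euler_a M a b) (euler_b M b) y / y) (at y)"
proof -
 have y: "y ~= 0" using U(3,4) by (metis exp_not_eq_zero)
 have yM: "((%y. 1 / y ^ M) has_field_derivative - of_nat M / (y ^ M * y)) (at y)"
 proof (cases M)
  case (Suc k)
  have "((%y. 1 / y ^ Suc k) has_field_derivative
    (0 * y ^ Suc k - 1 * (of_nat (Suc k) * y ^ k)) / (y ^ Suc k * y ^ Suc k)) (at y)"
   using y DERIV_power_Suc[OF DERIV_ident, of k y UNIV]
   by (intro DERIV_divide DERIV_const) (simp_all add: add.commute)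
  moreover have "(0 * y ^ Suc k - 1 * (of_nat (Suc k) * y ^ k)) / (y ^ Suc k * y ^ Suc k) =
    - of_nat (Suc k) / (y ^ Suc k * y)" using y by (simp add: field_simps del: of_nat_Suc)
  ultimately show ?thesis unfolding Suc by (simp only:)
 qed simp
 have "((%y. (pser a y + l y * pser b y) * (1 / y ^ M)) has_field_derivative
  (pser (%i. of_nat i * a i) y / y + (1 / y * pser b y + pser (%i. of_nat i * b i) y / y * l y)) * (1 / y ^ M)
   + (- of_nat M / (y ^ M * y)) * (pser a y + l y * pser b y)) (at y)"
  by (intro DERIV_mult DERIV_add pser_deriv ab y log_branch_deriv[OF U] yM)
 moreover have "(pser (%i. of_nat i * a i) y / y + (1 / y * pser b y + pser (%i. of_nat i * b i) y / y * l y)) * (1 / y ^ M)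
   + (- of_nat M / (y ^ M * y)) * (pser a y + l y * pser b y) = logser M l (euler_a M a b) (euler_b M b) y / y"
  unfolding logser_def pser_euler[OF ab] using y by (simp add: field_simps)
 ultimately show ?thesis by (simp add: logser_def[abs_def])
qed

text \<open>For f and q given by \<open>logser\<close> these are the coefficient equations of the
  system y P f = y (q + J f), y q' = y (q + J f), which implies (\<partial> - 1) P f = J \<partial>
  f. The first two equations belong to log y, the last two to the rest; 2 i - M is the derivative of
  i (i - M) and stems from differentiating the logarithm.\<close>

definition frobenius :: "nat => complex => complex => (nat => complex) => (nat => complex) =>
  (nat => complex) => (nat => complex) => bool" where
 "frobenius M x J qa fa qb fb \<longleftrightarrow> (ALL i.
  (of_nat i - of_nat M) * qb i = shift_up (%i. qb i + J * fb i) i &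
  (of_nat i - of_nat M) * of_nat i * fb i = shift_up (%i. qb i + (x + J) * fb i) i &
  (of_nat i - of_nat M) * qa i + qb i = shift_up (%i. qa i + J * fa i) i &
  (of_nat i - of_nat M) * of_nat i * fa i + (2 * of_nat i - of_nat M) * fb i =
   shift_up (%i. qa i + (x + J) * fa i) i)"

text \<open>The equations for the logarithmic part are those of a solution without logarithm, so the
  factor of log y is itself a solution.\<close>

lemma frobenius_partner: "frobenius M x J qa fa qb fb ==> frobenius M x J qb fb (%_. 0) (%_. 0)"
 by (auto simp: frobenius_def shift_up_def split: nat.splits)

text \<open>From index M on each step divides by i + 1 - M, which is comparable with i + 1; this
  produces the factorial in the bound.\<close>

lemma frobenius_entire:
 assumes "frobenius M x J qa fa qb fb"
 shows "entire_coeffs qa" "entire_coeffs fa" "entire_coeffs qb" "entire_coeffs fb"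
proof -
 define u where "u i = norm (qa i) + norm (fa i) + norm (qb i) + norm (fb i)" for i
 define K where "K = 1 + norm J + norm x"
 \<comment> \<open>7 + M collects the bounds 1 and 1 for \<open>qb\<close> and \<open>fb\<close>, 2
   for \<open>qa\<close> and 3 + M for \<open>fa\<close>; the factor M + 1 comes from
   \<open>?n <= (real M + 1) * k\<close>.\<close>
 define C where "C = K * (7 + real M) * (real M + 1)"
 have K: "K >= 1" by (simp add: K_def)
 have C: "C >= 1" unfolding C_def using mult_mono[of 1 K 1 "7 + real M"] mult_mono[of 1 "K * (7 + real M)" 1 "real M + 1"] K
  by simp
 have u0: "u i >= 0" for i by (simp add: u_def)
 have step: "u (Suc i) <= C / real (Suc i) * u i" if i: "i >= M" for i
 proof -
  define k where "k = real (Suc i) - real M"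
  have k1: "k >= 1" using i by (simp add: k_def)
  have kc: "of_nat (Suc i) - of_nat M = (of_real k :: complex)" by (simp add: k_def)
  have nk: "norm (of_nat (Suc i) - of_nat M :: complex) = k" unfolding kc using k1 by simp
  have R: "(of_nat (Suc i) - of_nat M) * qb (Suc i) = qb i + J * fb i"
   "(of_nat (Suc i) - of_nat M) * of_nat (Suc i) * fb (Suc i) = qb i + (x + J) * fb i"
   "(of_nat (Suc i) - of_nat M) * qa (Suc i) + qb (Suc i) = qa i + J * fa i"
   "(of_nat (Suc i) - of_nat M) * of_nat (Suc i) * fa (Suc i) + (2 * of_nat (Suc i) - of_nat M) * fb (Suc i) =
    qa i + (x + J) * fa i"
   using assms[unfolded frobenius_def, rule_format, of "Suc i"] unfolding shift_up_simps by blast+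
  have bd: "norm (q + J * f) <= K * u i" "norm (q + (x + J) * f) <= K * u i"
   if "norm q + norm f <= u i" for q f
  proof -
   have e: "0 <= (norm J + norm x) * norm q" "0 <= norm f" "0 <= norm x * norm f" by auto
   have 1: "K * (norm q + norm f) <= K * u i" using that K by (intro mult_left_mono) auto
   have 2: "norm (q + J * f) <= norm q + norm J * norm f" by (metis norm_mult norm_triangle_ineq)
   have 3: "norm (q + (x + J) * f) <= norm q + norm (x + J) * norm f" by (metis norm_mult norm_triangle_ineq)
   have "norm (x + J) * norm f <= (norm x + norm J) * norm f" by (intro mult_right_mono norm_triangle_ineq) auto
   hence 4: "norm (x + J) * norm f <= norm x * norm f + norm J * norm f" by (simp only: distrib_right)
   have 5: "K * (norm q + norm f) = norm q + norm f + (norm J + norm x) * norm q + (norm J * norm f + norm x * norm f)"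
    by (simp add: K_def algebra_simps)
   show "norm (q + J * f) <= K * u i" using e 1 2 5 by linarith
   show "norm (q + (x + J) * f) <= K * u i" using e 1 3 4 5 by linarith
  qed
  have "norm (qb i) + norm (fb i) <= u i" "norm (qa i) + norm (fa i) <= u i" by (simp_all add: u_def)
  note bds = bd[OF this(1)] bd[OF this(2)]
  let ?n = "real (Suc i)"
  have n1: "?n >= 1" by simp
  have Ku: "0 <= K * u i" using K u0[of i] by simp
  have 1: "k * norm (qb (Suc i)) <= K * u i" using bds(1) arg_cong[OF R(1), of norm] by (simp only: norm_mult nk)
  hence qb1: "norm (qb (Suc i)) <= K * u i" using k1
   by (metis (no_types, opaque_lifting) mult_le_cancel_right1 norm_ge_zero order_trans not_le)
  have 2: "k * ?n * norm (fb (Suc i)) <= K * u i"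
   using bds(2) arg_cong[OF R(2), of norm] by (simp only: norm_mult nk norm_of_nat)
  have "1 * (?n * norm (fb (Suc i))) <= k * (?n * norm (fb (Suc i)))" using k1 by (intro mult_right_mono) auto
  hence fb1: "?n * norm (fb (Suc i)) <= K * u i" using 2 by (simp only: mult.assoc mult_1)
  have fb2: "k * norm (fb (Suc i)) <= K * u i"
  proof -
   have "1 * (k * norm (fb (Suc i))) <= ?n * (k * norm (fb (Suc i)))" using k1 n1 by (intro mult_right_mono) auto
   thus ?thesis using 2 by (simp add: mult_ac)
  qed
  have 3: "k * norm (qa (Suc i)) <= 2 * (K * u i)"
  proof -
   have "k * norm (qa (Suc i)) = norm ((qa i + J * fa i) - qb (Suc i))"
    unfolding R(3)[symmetric] by (simp only: add_diff_cancel_right' norm_mult nk)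
   also have "... <= K * u i + K * u i" using norm_triangle_ineq4[of "qa i + J * fa i" "qb (Suc i)"] bds(3) qb1 by linarith
   finally show ?thesis by simp
  qed
  have 4: "k * norm (fa (Suc i)) <= (3 + real M) * (K * u i)"
  proof -
   have "k * ?n * norm (fa (Suc i)) = norm ((qa i + (x + J) * fa i) - (2 * of_nat (Suc i) - of_nat M) * fb (Suc i))"
    unfolding R(4)[symmetric] by (simp only: add_diff_cancel_right' norm_mult nk norm_of_nat)
   also have "... <= K * u i + norm ((2 * of_nat (Suc i) - of_nat M) * fb (Suc i))"
    using norm_triangle_ineq4[of "qa i + (x + J) * fa i" "(2 * of_nat (Suc i) - of_nat M) * fb (Suc i)"] bds(4) by linarith
   also have "norm ((2 * of_nat (Suc i) - of_nat M) * fb (Suc i)) <= (2 * ?n + real M) * norm (fb (Suc i))"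
   proof -
    have "norm (2 * of_nat (Suc i) - of_nat M :: complex) <= norm (2 * of_nat (Suc i) :: complex) + norm (of_nat M :: complex)"
     by (rule norm_triangle_ineq4)
    also have "... = 2 * ?n + real M" by (simp only: norm_mult norm_of_nat norm_numeral)
    finally show ?thesis unfolding norm_mult by (rule mult_right_mono) simp
   qed
   also have "... <= (2 + real M) * (?n * norm (fb (Suc i)))"
   proof -
    have "real M <= real M * ?n" using n1 by (simp add: mult_le_cancel_left1)
    hence "(2 * ?n + real M) * norm (fb (Suc i)) <= ((2 + real M) * ?n) * norm (fb (Suc i))"
     by (intro mult_right_mono) (auto simp: distrib_right)
    thus ?thesis by (simp only: mult.assoc)
   qed
   also have "... <= (2 + real M) * (K * u i)" using fb1 by (intro mult_left_mono) auto
   finally have "k * ?n * norm (fa (Suc i)) <= (3 + real M) * (K * u i)" by (simp add: algebra_simps)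
   moreover have "1 * (k * norm (fa (Suc i))) <= ?n * (k * norm (fa (Suc i)))"
    using k1 n1 by (intro mult_right_mono) auto
   ultimately show ?thesis by (simp add: mult_ac)
  qed
  have "k * u (Suc i) <= (7 + real M) * (K * u i)"
   using 1 fb2 3 4 unfolding u_def[of "Suc i"] by (simp add: algebra_simps)
  moreover have "?n <= (real M + 1) * k"
  proof -
   have "0 <= real M * (k - 1)" using k1 by simp
   thus ?thesis by (simp add: k_def algebra_simps)
  qed
  ultimately have "?n * u (Suc i) <= (real M + 1) * ((7 + real M) * (K * u i))"
   by (intro order_trans[OF mult_right_mono[OF \<open>?n <= (real M + 1) * k\<close> u0[of "Suc i"]]])
    (simp only: mult.assoc, intro mult_left_mono, auto)
  thus ?thesis by (simp add: C_def field_simps)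
 qed
 \<comment> \<open>A dominates the coefficients up to index M, for which the recursion gives no
   estimate.\<close>
 define A where "A = (SUM i<=M. u i * fact i)"
 have A: "A >= 0" unfolding A_def by (intro sum_nonneg mult_nonneg_nonneg u0) auto
 have bound: "u n <= A * C ^ n / fact n" for n
 proof (induction n)
  case 0
  have "u 0 * fact 0 <= A" unfolding A_def by (rule member_le_sum) (auto simp: u0)
  thus ?case by simp
 next
  case (Suc n)
  show ?case
  proof (cases "Suc n <= M")
   case True
   have "u (Suc n) * fact (Suc n) <= A" unfolding A_def by (rule member_le_sum) (use True in \<open>auto simp: u0\<close>)
   also have "A <= A * C ^ Suc n" using A C by (simp add: mult_le_cancel_left1 one_le_power del: power_Suc)
   finally show ?thesis by (simp only: pos_le_divide_eq fact_gt_zero)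
  next
   case False
   have "u (Suc n) <= C / real (Suc n) * u n" using step False by simp
   also have "... <= C / real (Suc n) * (A * C ^ n / fact n)" using Suc C by (intro mult_left_mono) auto
   also have "... = A * C ^ Suc n / fact (Suc n)" by (simp add: field_simps)
   finally show ?thesis .
  qed
 qed
 have "entire_coeffs c" if "!!n. norm (c n) <= u n" for c
  unfolding entire_coeffs_def using A C bound order_trans[OF that bound] by blast
 thus "entire_coeffs qa" "entire_coeffs fa" "entire_coeffs qb" "entire_coeffs fb" by (auto simp: u_def)
qed

text \<open>With the Euler operator theta, y P equals theta^2 + M theta - x y, so P f can be read
  off from \<open>euler_a\<close> and \<open>euler_b\<close>. Differentiating P f = q + J f and
  inserting the equation for q gives the third-order equation.\<close>

lemma frobenius_solves:
 assumes U: "open U" "l holomorphic_on U" "!!y. y : U ==> exp (l y) = y"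
  and fr: "frobenius M x J qa fa qb fb"
 shows "logser M l fa fb holomorphic_on U"
  "y : U ==> Pode M x (logser M l fa fb) y = logser M l qa qb y + J * logser M l fa fb y"
  "y : U ==> Qode M x J (logser M l fa fb) y = 0"
proof -
 note ent = frobenius_entire[OF fr]
 let ?f = "logser M l fa fb" and ?q = "logser M l qa qb"
 let ?f1 = "logser M l (euler_a M fa fb) (euler_b M fb)"
 let ?f2 = "logser M l (euler_a M (euler_a M fa fb) (euler_b M fb)) (euler_b M (euler_b M fb))"
 have e1: "entire_coeffs (euler_a M fa fb)" "entire_coeffs (euler_b M fb)"
  by (rule entire_coeffs_euler[OF ent(2,4)])+
 have e2: "entire_coeffs (euler_a M (euler_a M fa fb) (euler_b M fb))" "entire_coeffs (euler_b M (euler_b M fb))"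
  by (rule entire_coeffs_euler[OF e1])+
 have y0: "y ~= 0" if "y : U" for y using U(3)[OF that] by (metis exp_not_eq_zero)
 have d: "(?f has_field_derivative ?f1 y / y) (at y)" if "y : U" for y by (rule logser_deriv[OF U that ent(2,4)])
 show hol: "?f holomorphic_on U" using d U(1)
  by (meson holomorphic_onI field_differentiable_at_within field_differentiable_def)
 have d1: "deriv ?f y = ?f1 y / y" if "y : U" for y using d[OF that] by (rule DERIV_imp_deriv)
 have d2: "deriv (deriv ?f) y = (?f2 y - ?f1 y) / (y * y)" if y: "y : U" for y
 proof -
  have "((%y. ?f1 y / y) has_field_derivative ((?f2 y / y) * y - ?f1 y * 1) / (y * y)) (at y)"
   by (intro DERIV_divide logser_deriv[OF U y e1] DERIV_ident y0 y)
  hence "(deriv ?f has_field_derivative ((?f2 y / y) * y - ?f1 y * 1) / (y * y)) (at y)"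
   by (rule has_field_derivative_transform_within_open[OF _ U(1) y]) (simp add: d1)
  thus ?thesis using y0[OF y] by (simp add: DERIV_imp_deriv)
 qed
 have dq: "(?q has_field_derivative logser M l (euler_a M qa qb) (euler_b M qb) y / y) (at y)" if "y : U" for y
  by (rule logser_deriv[OF U that ent(1,3)])
 have c: "euler_a M qa qb = shift_up (%i. qa i + J * fa i)" "euler_b M qb = shift_up (%i. qb i + J * fb i)"
  using fr by (auto simp: fun_eq_iff euler_a_def euler_b_def frobenius_def)
 have eJ: "entire_coeffs (%i. qa i + r * fa i)" "entire_coeffs (%i. qb i + r * fb i)" for r
  by (intro entire_coeffs_add entire_coeffs_cmult ent)+
 have pJ: "pser (%i. qa i + r * fa i) y = pser qa y + r * pser fa y"
  "pser (%i. qb i + r * fb i) y = pser qb y + r * pser fb y" for r y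
  by (simp_all add: pser_add entire_coeffs_cmult ent pser_cmult)
 have q1: "logser M l (euler_a M qa qb) (euler_b M qb) y = y * (?q y + J * ?f y)" for y
  unfolding logser_def c pser_shift_up[OF eJ(1)] pser_shift_up[OF eJ(2)] pJ
  by (simp add: add_divide_distrib algebra_simps)
 have ca: "(%i. euler_a M (euler_a M fa fb) (euler_b M fb) i + of_nat M * euler_a M fa fb i) =
   shift_up (%i. qa i + (x + J) * fa i)" proof fix i
  have "euler_a M (euler_a M fa fb) (euler_b M fb) i + of_nat M * euler_a M fa fb i =
   (of_nat i - of_nat M) * of_nat i * fa i + (2 * of_nat i - of_nat M) * fb i"
   by (simp add: euler_a_def euler_b_def algebra_simps)
  thus "euler_a M (euler_a M fa fb) (euler_b M fb) i + of_nat M * euler_a M fa fb i =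
   shift_up (%i. qa i + (x + J) * fa i) i" using fr by (simp add: frobenius_def) qed
 have cb: "(%i. euler_b M (euler_b M fb) i + of_nat M * euler_b M fb i) = shift_up (%i. qb i + (x + J) * fb i)"
 proof
  fix i
  have "euler_b M (euler_b M fb) i + of_nat M * euler_b M fb i = (of_nat i - of_nat M) * of_nat i * fb i"
   by (simp add: euler_b_def algebra_simps)
  thus "euler_b M (euler_b M fb) i + of_nat M * euler_b M fb i = shift_up (%i. qb i + (x + J) * fb i) i"
   using fr by (simp add: frobenius_def)
 qed
 have f2: "?f2 y + of_nat M * ?f1 y = y * (?q y + (x + J) * ?f y)" for y
 proof -
  have "pser (euler_a M (euler_a M fa fb) (euler_b M fb)) y + of_nat M * pser (euler_a M fa fb) y =
    y * (pser qa y + (x + J) * pser fa y)" using arg_cong[OF ca, of "%c. pser c y"]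
   by (simp add: pser_add pser_cmult entire_coeffs_cmult e1 e2 pser_shift_up eJ(1) pJ)
  moreover have "pser (euler_b M (euler_b M fb)) y + of_nat M * pser (euler_b M fb) y =
    y * (pser qb y + (x + J) * pser fb y)" using arg_cong[OF cb, of "%c. pser c y"]
   by (simp add: pser_add pser_cmult entire_coeffs_cmult e1 e2 pser_shift_up eJ(2) pJ)
  moreover have "?f2 y + of_nat M * ?f1 y =
   ((pser (euler_a M (euler_a M fa fb) (euler_b M fb)) y + of_nat M * pser (euler_a M fa fb) y) +
   l y * (pser (euler_b M (euler_b M fb)) y + of_nat M * pser (euler_b M fb) y)) / y ^ M"
   by (simp add: logser_def add_divide_distrib algebra_simps)
  ultimately show ?thesis by (simp add: logser_def add_divide_distrib algebra_simps)
 qed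
 show P: "Pode M x ?f y = ?q y + J * ?f y" if "y : U" for y
 proof -
  have "y * Pode M x ?f y = (?f2 y + of_nat M * ?f1 y) - x * y * ?f y"
   unfolding Pode_def d1[OF that] d2[OF that] using y0[OF that] by (simp add: field_simps)
  also have "... = y * (?q y + J * ?f y)" unfolding f2 by (simp add: algebra_simps)
  finally show ?thesis using y0[OF that] by simp
 qed
 show "Qode M x J ?f y = 0" if y: "y : U" for y
 proof -
  have "((%y. ?q y + J * ?f y) has_field_derivative (?q y + J * ?f y) + J * (?f1 y / y)) (at y)"
   using DERIV_add[OF dq[OF y] DERIV_cmult[OF d[OF y], of J]] y0[OF y] by (simp add: q1)
  hence "(Pode M x ?f has_field_derivative (?q y + J * ?f y) + J * (?f1 y / y)) (at y)"
   by (rule has_field_derivative_transform_within_open[OF _ U(1) y]) (simp add: P)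
  thus ?thesis by (simp add: Qode_def DERIV_imp_deriv P[OF y] d1[OF y])
 qed
qed

section \<open>A basis of solutions\<close>

text \<open>The recursion of \<open>frobenius\<close> is solvable at the index \<open>i = M\<close> thanks to the logarithmic part;
  \<open>c\<close>, \<open>q0\<close>, \<open>f0\<close> are the free parameters.\<close>

primrec frob :: "nat => complex => complex => complex => complex => complex => nat =>
  complex \<times> complex \<times> complex \<times> complex" where
 "frob M x J c q0 f0 0 = (if M = 0 then (q0, f0, 0, c) else (0, c, 0, 0))"
| "frob M x J c q0 f0 (Suc i) = (case frob M x J c q0 f0 i of (qa, fa, qb, fb) =>
   if Suc i = M then (q0, f0, qa + J * fa, (qa + (x + J) * fa) / of_nat M)
   else let k = of_nat (Suc i) - of_nat M; n = of_nat (Suc i);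
       qb' = (qb + J * fb) / k; fb' = (qb + (x + J) * fb) / (k * n)
     in ((qa + J * fa - qb') / k, (qa + (x + J) * fa - (2 * n - of_nat M) * fb') / (k * n), qb', fb'))"

lemma frob_low:
 assumes "i < M"
 shows "snd (snd (frob M x J c q0 f0 i)) = (0, 0)"
 using assms by (induction i) (auto simp: Let_def split: prod.splits)

lemma frob_frobenius:
 "frobenius M x J (%i. fst (frob M x J c q0 f0 i)) (%i. fst (snd (frob M x J c q0 f0 i)))
  (%i. fst (snd (snd (frob M x J c q0 f0 i)))) (%i. snd (snd (snd (frob M x J c q0 f0 i))))"
 unfolding frobenius_def
proof (intro allI)
 fix i
 let ?s = "frob M x J c q0 f0"
 show "(of_nat i - of_nat M) * fst (snd (snd (?s i))) = shift_up (%i. fst (snd (snd (?s i))) + J * snd (snd (snd (?s i)))) i &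
  (of_nat i - of_nat M) * of_nat i * snd (snd (snd (?s i))) = shift_up (%i. fst (snd (snd (?s i))) + (x + J) * snd (snd (snd (?s i)))) i &
  (of_nat i - of_nat M) * fst (?s i) + fst (snd (snd (?s i))) = shift_up (%i. fst (?s i) + J * fst (snd (?s i))) i &
  (of_nat i - of_nat M) * of_nat i * fst (snd (?s i)) + (2 * of_nat i - of_nat M) * snd (snd (snd (?s i))) =
   shift_up (%i. fst (?s i) + (x + J) * fst (snd (?s i))) i" proof (cases i) case 0 thus ?thesis by simp
 next
  case (Suc j)
  obtain qa fa qb fb where s: "?s j = (qa, fa, qb, fb)" by (cases "?s j") auto
  show ?thesis
  proof (cases "Suc j = M")
   case True
   have "qb = 0" "fb = 0" using frob_low[of j M x J c q0 f0] True s by auto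
   thus ?thesis using True s by (auto simp: Suc simp del: of_nat_Suc)
  next
   case False
   have k: "(of_nat (Suc j) - of_nat M :: complex) ~= 0" using False by (metis eq_iff_diff_eq_0 of_nat_eq_iff)
   have n: "(of_nat (Suc j) :: complex) ~= 0" by (simp del: of_nat_Suc)
   show ?thesis unfolding Suc shift_up_simps using False s k n by (simp add: Let_def del: of_nat_Suc)
  qed
 qed
qed

text \<open>Started with 0, the recursion stays 0 below index M; there the factor i - M vanishes and
  the equations become void, which leaves q and f at M free.\<close>

lemma frobenius_analytic:
 "EX qa fa. frobenius M x J qa fa (%_. 0) (%_. 0) & qa M = q0 & fa M = f0 & (ALL i<M. fa i = 0)"
proof -
 let ?s = "frob M x J 0 q0 f0"
 have low: "?s i = (0, 0, 0, 0)" if "i < M" for i using that by (induction i) auto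
 have z: "snd (snd (?s i)) = (0, 0)" for i
 proof (induction i)
  case (Suc i)
  thus ?case using low[of i] by (cases "?s i") (auto simp: Let_def)
 qed simp
 have at: "fst (?s M) = q0" "fst (snd (?s M)) = f0" by (cases M; simp add: low split: prod.splits)+
 show ?thesis using frob_frobenius[of M x J 0 q0 f0] z at low
  by (intro exI[of _ "%i. fst (?s i)"] exI[of _ "%i. fst (snd (?s i))"]) simp
qed

text \<open>Started with 1, the pair (q, f) never vanishes below M, because x ~= 0 makes the two
  right-hand sides independent linear forms; at M they have to be absorbed by the logarithmic part.
  For J = 0 all q vanish, so that P f = 0 holds and not merely the equation derived from it.\<close>

lemma frobenius_log:
 assumes "x ~= 0"
 shows "EX qa fa qb fb. frobenius M x J qa fa qb fb & (qb M ~= 0 \<or> fb M ~= 0) &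
  (ALL i<M. fb i = 0) & (J = 0 --> (ALL i. qa i = 0 & qb i = 0))" proof -
 let ?s = "frob M x J 1 0 0"
 have nz: "fst (?s i) ~= 0 \<or> fst (snd (?s i)) ~= 0" if "i < M" for i using that
 proof (induction i)
  case (Suc i)
  obtain qa fa qb fb where s: "?s i = (qa, fa, qb, fb)" by (cases "?s i") auto
  have b: "qb = 0" "fb = 0" using frob_low[of i M x J 1 0 0] Suc.prems s by auto
  have k: "(of_nat (Suc i) - of_nat M :: complex) ~= 0" "(of_nat (Suc i) :: complex) ~= 0"
   using Suc.prems by (metis eq_iff_diff_eq_0 nat_neq_iff of_nat_eq_iff, simp del: of_nat_Suc)
  have "qa + J * fa ~= 0 \<or> qa + (x + J) * fa ~= 0"
  proof (rule ccontr)
   assume "\<not> ?thesis"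
   hence *: "qa + J * fa = 0" "qa + (x + J) * fa = 0" by auto
   moreover have "x * fa = (qa + (x + J) * fa) - (qa + J * fa)" by (simp add: algebra_simps)
   ultimately have "x * fa = 0" by simp
   hence "fa = 0" "qa = 0" using assms * by auto
   thus False using Suc s by simp
  qed
  thus ?case using Suc.prems s b k by (auto simp: Let_def simp del: of_nat_Suc)
 qed auto
 have M: "fst (snd (snd (?s M))) ~= 0 \<or> snd (snd (snd (?s M))) ~= 0"
 proof (cases M)
  case (Suc j)
  obtain qa fa qb fb where s: "?s j = (qa, fa, qb, fb)" by (cases "?s j") auto
  have "qa ~= 0 \<or> fa ~= 0" using nz[of j] s Suc by auto
  have "qa + J * fa ~= 0 \<or> qa + (x + J) * fa ~= 0"
  proof (rule ccontr)
   assume "\<not> ?thesis"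
   hence *: "qa + J * fa = 0" "qa + (x + J) * fa = 0" by auto
   moreover have "x * fa = (qa + (x + J) * fa) - (qa + J * fa)" by (simp add: algebra_simps)
   ultimately have "x * fa = 0" by simp
   hence "fa = 0" "qa = 0" using assms * by auto
   thus False using \<open>qa ~= 0 \<or> fa ~= 0\<close> by simp
  qed
  thus ?thesis using s Suc by (auto simp del: of_nat_Suc)
 qed simp
 have J0: "fst (?s i) = 0 & fst (snd (snd (?s i))) = 0" if "J = 0" for i using that
 proof (induction i)
  case (Suc i)
  thus ?case by (cases "?s i") (auto simp: Let_def)
 qed auto
 show ?thesis using frob_frobenius[of M x J 1 0 0] M J0 frob_low[of _ M x J 1 0 0]
  by (intro exI[of _ "%i. fst (?s i)"] exI[of _ "%i. fst (snd (?s i))"]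
    exI[of _ "%i. fst (snd (snd (?s i)))"] exI[of _ "%i. snd (snd (snd (?s i)))"]) simp
qed

definition log_branch :: "complex set => (complex => complex) => bool" where
 "log_branch U l \<longleftrightarrow> l holomorphic_on U & (ALL y:U. exp (l y) = y)"

text \<open>The solution with index \<open>dord j - 1\<close> is the logarithmic one, and the solution with index 0 is
  the coefficient of its logarithm.\<close>

definition vbasis :: "nat => complex => nat => (nat => nat => complex) => (nat => nat => complex) => bool" where
 "vbasis M x j a b \<longleftrightarrow> (ALL r<dord j. entire_coeffs (a r) & entire_coeffs (b r) &
    (ALL U l. open U --> log_branch U l --> logser M l (a r) (b r) : Vsol M x U j)) &
  (ALL r<dord j - 1. b r = (%_. 0) & (ALL i<M. a r i = 0)) & b (dord j - 1) = a 0 &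
  (ALL c. (ALL i. (SUM r<dord j - 1. c r * a r i) = 0) --> (ALL r<dord j - 1. c r = 0))"

lemma vbasis_exists:
 assumes x: "x ~= 0"
 shows "EX a b. vbasis M x j a b"
proof -
 obtain qa fa qb fb where fr: "frobenius M x (Jpar j) qa fa qb fb" and
  nz: "qb M ~= 0 \<or> fb M ~= 0" and low: "ALL i<M. fb i = 0" and
  J0: "Jpar j = 0 ==> (ALL i. qa i = 0 & qb i = 0)"
  using frobenius_log[OF x, of M "Jpar j"] by blast
 note fp = frobenius_partner[OF fr]
 have V: "logser M l g h : Vsol M x U j"
  if "frobenius M x (Jpar j) p g p' h" "j = 1 ==> p = (%_. 0) & p' = (%_. 0)" "open U" "log_branch U l"
  for l g h p p' U
 proof -
  have b: "l holomorphic_on U" "!!y. y : U ==> exp (l y) = y"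
   using that(4) by (auto simp: log_branch_def)
  show ?thesis using frobenius_solves[OF that(3) b that(1)] that(2)
   by (auto simp: Vsol_def Tode_def Jpar_def logser_def)
 qed
 note ent = frobenius_entire[OF fr]
 show ?thesis
 proof (cases "j = 1")
  case True
  let ?a = "%r::nat. if r = 0 then fb else fa" and ?b = "%r::nat. if r = 0 then (%_. 0) else fb"
  have q0: "qa = (%_. 0)" "qb = (%_. 0)" using J0 True by (auto simp: Jpar_def)
  have "EX i. fb i ~= 0" using nz q0 by auto
  then obtain i0 where i0: "fb i0 ~= 0" by blast
  have V1: "logser M l fb (%_. 0) : Vsol M x U j" "logser M l fa fb : Vsol M x U j"
   if "open U" "log_branch U l" for U l using V[OF fp _ that] V[OF fr _ that] q0 by auto
  have "vbasis M x j ?a ?b" unfolding vbasis_def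
  proof (intro conjI allI impI)
   fix c :: "nat => complex" and r assume "ALL i. (SUM r<dord j - 1. c r * ?a r i) = 0" "r < dord j - 1"
   thus "c r = 0" using i0 True by (auto simp: dord_def dest: spec[of _ i0])
  qed (use V1 ent low True in \<open>auto simp: dord_def\<close>)
  thus ?thesis by blast
 next
  case False
  \<comment> \<open>The data at M are chosen not proportional to \<open>(qb M, fb M)\<close>, which
    makes the second solution without logarithm independent of \<open>fb\<close>.\<close>
  obtain q1 f1 where 1: "frobenius M x (Jpar j) q1 f1 (%_. 0) (%_. 0)"
   "q1 M = (if qb M ~= 0 then 0 else 1)" "f1 M = (if qb M ~= 0 then 1 else 0)" "ALL i<M. f1 i = 0"
   using frobenius_analytic[of M x "Jpar j" "if qb M ~= 0 then 0 else 1" "if qb M ~= 0 then 1 else 0"] by blast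
  let ?a = "%r::nat. if r = 0 then fb else if r = 1 then f1 else fa"
  let ?b = "%r::nat. if r < 2 then (%_. 0) else fb"
  \<comment> \<open>The coefficient after M recovers q at M, so a relation between the sequences f
    yields one between the pairs (q, f) at M.\<close>
  have next_coeff: "(of_nat M + 1) * f (Suc M) = q M + (x + Jpar j) * f M"
   if "frobenius M x (Jpar j) q f (%_. 0) (%_. 0)" for q f
  proof -
   have "(of_nat (Suc M) - of_nat M) * of_nat (Suc M) * f (Suc M) + (2 * of_nat (Suc M) - of_nat M) * 0 =
     shift_up (%i. q i + (x + Jpar j) * f i) (Suc M)" using that unfolding frobenius_def by blast
   thus ?thesis by (simp add: add.commute)
  qed
  have indep: "c 0 = 0 & c 1 = 0" if c: "!!i. c 0 * fb i + c 1 * f1 i = 0" for c :: "nat => complex"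
  proof -
   have "c 0 * ((of_nat M + 1) * fb (Suc M)) + c 1 * ((of_nat M + 1) * f1 (Suc M)) = 0"
    using c[of "Suc M"] by (metis (no_types, opaque_lifting) distrib_left mult.left_commute mult_zero_right)
   hence "(c 0 * qb M + c 1 * q1 M) + (x + Jpar j) * (c 0 * fb M + c 1 * f1 M) = 0"
    unfolding next_coeff[OF fp] next_coeff[OF 1(1)] by (simp add: algebra_simps)
   hence 2: "c 0 * qb M + c 1 * q1 M = 0" using c[of M] by simp
   show ?thesis
   proof (cases "qb M ~= 0")
    case True
    thus ?thesis using 2 c[of M] 1(2,3) by auto
   next
    case False
    thus ?thesis using 2 c[of M] 1(2,3) nz by auto
   qed
  qed
  have V1: "logser M l fb (%_. 0) : Vsol M x U j" "logser M l f1 (%_. 0) : Vsol M x U j"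
   "logser M l fa fb : Vsol M x U j"
   if "open U" "log_branch U l" for U l using V[OF fp _ that] V[OF 1(1) _ that] V[OF fr _ that] False by auto
  note ent1 = frobenius_entire[OF 1(1)]
  have "vbasis M x j ?a ?b" unfolding vbasis_def
  proof (intro conjI allI impI)
   fix c :: "nat => complex" and r assume *: "ALL i. (SUM r<dord j - 1. c r * ?a r i) = 0" "r < dord j - 1"
   have "{..<2::nat} = {0, 1}" by auto
   hence "c 0 = 0 & c 1 = 0" using *(1) False by (intro indep) (simp add: dord_def)
   moreover have "r = 0 \<or> r = 1" using *(2) False by (auto simp: dord_def)
   ultimately show "c r = 0" by auto
  qed (use V1 ent ent1 low 1(4) False in \<open>auto simp: dord_def\<close>)
  thus ?thesis by blast
 qed
qed

section \<open>Linear independence\<close>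

text \<open>\<open>logser\<close> in the coordinate s with y = exp s, where it is entire; a turn
  around y = 0 becomes the translation by 2 pi i in \<open>sser_shift\<close>.\<close>

definition sser :: "nat => (nat => complex) => (nat => complex) => complex => complex" where
 "sser M a b s = (pser a (exp s) + s * pser b (exp s)) * exp (- of_nat M * s)"

lemma sser_holomorphic:
 assumes "entire_coeffs a" "entire_coeffs b"
 shows "sser M a b holomorphic_on S"
proof -
 have "(%s. pser c (exp s)) holomorphic_on S" if "entire_coeffs c" for c
  using holomorphic_on_compose[OF holomorphic_on_exp pser_holomorphic[OF that]] by (simp add: comp_def)
 thus ?thesis unfolding sser_def[abs_def] using assms by (intro holomorphic_intros) auto
qed

lemma logser_sser:
 assumes "log_branch U l" "y : U"
 shows "logser M l a b y = sser M a b (l y)"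
proof -
 have y: "exp (l y) = y" using assms by (auto simp: log_branch_def)
 have "exp (- of_nat M * l y) = inverse (exp (l y) ^ M)" by (simp add: exp_minus exp_of_nat_mult)
 thus ?thesis by (simp add: logser_def sser_def y divide_inverse)
qed

lemma sser_shift:
 "sser M a b (s + 2 * of_real pi * \<i> * of_nat N) =
  sser M a b s + of_nat N * (2 * of_real pi * \<i>) * sser M b (%_. 0) s" proof -
 have p: "exp (2 * of_real pi * \<i> * of_nat k) = 1" for k
  using exp_integer_2pi[of "of_nat k"] by (simp add: mult_ac)
 have e: "exp (s + 2 * of_real pi * \<i> * of_nat N) = exp s" unfolding exp_add p by simp
 have "exp (- of_nat M * (s + 2 * of_real pi * \<i> * of_nat N)) =
   exp (- of_nat M * s) * inverse (exp (2 * of_real pi * \<i> * of_nat (M * N)))"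
  by (simp add: algebra_simps flip: exp_minus exp_add)
 hence e2: "exp (- of_nat M * (s + 2 * of_real pi * \<i> * of_nat N)) = exp (- of_nat M * s)" unfolding p by simp
 show ?thesis unfolding sser_def e e2 by (simp add: algebra_simps)
qed

lemma log_branch_open_image:
 assumes "open U" "log_branch U l"
 shows "open (l ` U)"
proof -
 have "inj_on l U" by (rule inj_onI) (metis assms(2) log_branch_def)
 thus ?thesis using open_mapping_thm3 assms by (auto simp: log_branch_def)
qed

text \<open>The relation continues to all s, and its difference under s + 2 pi i retains only the
  logarithmic element, whose factor is the solution with index 0. Once that coefficient vanishes,
  independence of the power series settles the rest.\<close>

lemma vbasis_indep:
 assumes vb: "vbasis M x j a b" and U: "open U" "U ~= {}" "log_branch U l"
  and zero: "!!y. y : U ==> (SUM r<dord j. c r * logser M l (a r) (b r) y) = 0" and r: "r < dord j"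
 shows "c r = 0"
proof -
 obtain d where d: "dord j = Suc d" "d > 0" by (cases "j = 1") (auto simp: dord_def)
 have ent: "entire_coeffs (a r)" "entire_coeffs (b r)" if "r < dord j" for r
  using vb that d(1) by (auto simp: vbasis_def)
 have b0: "b r = (%_. 0)" if "r < d" for r using vb that d(1) by (auto simp: vbasis_def)
 have bd: "b d = a 0" using vb d(1) by (auto simp: vbasis_def)
 define G where "G s = (SUM r<dord j. c r * sser M (a r) (b r) s)" for s
 have "G s = 0" for s
 proof (rule analytic_continuation_open[of "l ` U" UNIV G "%_. 0"])
  show "open (l ` U)" by (rule log_branch_open_image[OF U(1,3)])
  show "G holomorphic_on UNIV" unfolding G_def[abs_def]
   by (intro holomorphic_intros sser_holomorphic) (auto simp: ent)
  show "G z = 0" if "z : l ` U" for z using that zero by (auto simp: G_def logser_sser[OF U(3)])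
 qed (use U in auto)
 hence "G (s + 2 * of_real pi * \<i> * of_nat 1) - G s = 0" for s by simp
 moreover have "G (s + 2 * of_real pi * \<i> * of_nat 1) - G s = c d * (2 * of_real pi * \<i>) * sser M (a 0) (%_. 0) s" for s
 proof -
  have "G (s + 2 * of_real pi * \<i> * of_nat 1) - G s =
    (SUM r<dord j. c r * (2 * of_real pi * \<i>) * sser M (b r) (%_. 0) s)"
   unfolding G_def sser_shift by (simp add: algebra_simps sum.distrib)
  also have "... = c d * (2 * of_real pi * \<i>) * sser M (b d) (%_. 0) s"
   unfolding d(1) by (simp add: b0 sser_def)
  finally show ?thesis by (simp add: bd)
 qed
 ultimately have "c d * (2 * of_real pi * \<i>) * sser M (a 0) (%_. 0) s = 0" for s by metis
 hence cd: "c d * sser M (a 0) (%_. 0) s = 0" for s by simp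
 have pz: "pser (%i. SUM r<d. e r * a r i) y = (SUM r<d. e r * pser (a r) y) & entire_coeffs (%i. SUM r<d. e r * a r i)" for e y
 proof -
  have "pser (%i. SUM r<k. e r * a r i) y = (SUM r<k. e r * pser (a r) y) & entire_coeffs (%i. SUM r<k. e r * a r i)"
   if "k <= d" for k using that
  proof (induction k)
   case (Suc k)
   hence "entire_coeffs (a k)" using ent[of k] d(1) by simp
   thus ?case using Suc by (auto simp: pser_add pser_cmult entire_coeffs_cmult intro!: entire_coeffs_add)
  qed simp
  thus ?thesis by simp
 qed
 have ind: "ALL r<d. e r = 0" if "!!s. (SUM r<d. e r * sser M (a r) (%_. 0) s) = 0" for e
 proof -
  have "(SUM r<d. e r * pser (a r) y) = 0" if y: "y ~= 0" for y
  proof -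
   have "(SUM r<d. e r * sser M (a r) (%_. 0) (Ln y)) = (SUM r<d. e r * pser (a r) y) * exp (- of_nat M * Ln y)"
    using y by (simp add: sser_def sum_distrib_right mult.assoc)
   thus ?thesis using \<open>!!s. (SUM r<d. e r * sser M (a r) (%_. 0) s) = 0\<close>[of "Ln y"] by simp
  qed
  hence "(SUM r<d. e r * a r i) = 0" for i using pser_eq_0[of "%i. SUM r<d. e r * a r i" i] pz by auto
  thus ?thesis using vb d(1) by (auto simp: vbasis_def)
 qed
 have cd0: "c d = 0"
 proof (rule ccontr)
  assume "c d ~= 0"
  hence "(SUM r<d. (if r = 0 then 1 else 0) * sser M (a r) (%_. 0) s) = 0" for s
   using cd[of s] d(2) by (simp add: if_distrib[of "%x. x * _"] cong: if_cong)
  from ind[OF this] d(2) show False by auto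
 qed
 have "(SUM r<d. c r * sser M (a r) (%_. 0) s) = 0" for s
  using \<open>G s = 0\<close> unfolding G_def d(1) by (simp add: cd0 b0)
 from ind[OF this] show ?thesis using r cd0 d(1) by (cases "r = d") auto
qed

section \<open>Linearity of the operators and absence of polynomial solutions\<close>

lemma higher_deriv_lincomb:
 assumes U: "open U" and f: "!!i. i : A ==> f i holomorphic_on U"
 shows "y : U ==> (deriv ^^ k) (%y. SUM i:A. c i * f i y) y = (SUM i:A. c i * (deriv ^^ k) (f i) y)"
proof (induction k arbitrary: y)
 case (Suc k)
 have "deriv ((deriv ^^ k) (%y. SUM i:A. c i * f i y)) y = deriv (%y. SUM i:A. c i * (deriv ^^ k) (f i) y) y"
  by (rule deriv_cong_ev) (use eventually_nhds_in_open[OF U Suc.prems] in \<open>auto elim!: eventually_mono simp: Suc.IH\<close>)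
 also have "... = (SUM i:A. c i * deriv ((deriv ^^ k) (f i)) y)"
  by (intro DERIV_imp_deriv DERIV_sum DERIV_cmult holomorphic_derivI[OF _ U Suc.prems]
    holomorphic_higher_deriv f U)
 finally show ?case by simp
qed simp

lemma deriv_lincomb:
 fixes c :: "'i => complex"
 assumes "open U" "!!i. i : A ==> f i holomorphic_on U" "y : U"
 shows "deriv (%y. SUM i:A. c i * f i y) y = (SUM i:A. c i * deriv (f i) y)"
  "deriv (deriv (%y. SUM i:A. c i * f i y)) y = (SUM i:A. c i * deriv (deriv (f i)) y)"
 using higher_deriv_lincomb[OF assms, where k = 1 and c = c]
  higher_deriv_lincomb[OF assms, where k = 2 and c = c] by (simp_all add: numeral_2_eq_2)

lemma Pode_holomorphic: "open U ==> f holomorphic_on U ==> Pode M x f holomorphic_on U"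
 unfolding Pode_def[abs_def] by (intro holomorphic_intros holomorphic_deriv) auto

lemma Pode_lincomb:
 assumes "open U" "!!i. i : A ==> f i holomorphic_on U" "y : U"
 shows "Pode M x (%y. SUM i:A. c i * f i y) y = (SUM i:A. c i * Pode M x (f i) y)"
proof -
 have "Pode M x (%y. SUM i:A. c i * f i y) y =
  y * (SUM i:A. c i * deriv (deriv (f i)) y) + (of_nat M + 1) * (SUM i:A. c i * deriv (f i) y) - x * (SUM i:A. c i * f i y)"
  by (simp only: Pode_def deriv_lincomb[OF assms])
 also have "... = (SUM i:A. c i * Pode M x (f i) y)"
  by (simp add: Pode_def sum_distrib_left algebra_simps sum.distrib sum_subtractf)
 finally show ?thesis .
qed

lemma deriv_Pode_lincomb:
 assumes "open U" "!!i. i : A ==> f i holomorphic_on U" "y : U"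
 shows "deriv (Pode M x (%y. SUM i:A. c i * f i y)) y = (SUM i:A. c i * deriv (Pode M x (f i)) y)"
proof -
 have "deriv (Pode M x (%y. SUM i:A. c i * f i y)) y = deriv (%y. SUM i:A. c i * Pode M x (f i) y) y"
  by (rule deriv_cong_ev)
   (use eventually_nhds_in_open[OF assms(1,3)] in \<open>auto elim!: eventually_mono simp: Pode_lincomb[OF assms(1,2)]\<close>)
 also have "... = (SUM i:A. c i * deriv (Pode M x (f i)) y)"
  by (rule deriv_lincomb(1)[OF assms(1) _ assms(3)]) (intro Pode_holomorphic assms)
 finally show ?thesis .
qed

lemma Tode_lincomb:
 assumes "open U" "!!i. i : A ==> f i holomorphic_on U" "y : U"
 shows "Tode M x j (%y. SUM i:A. c i * f i y) y = (SUM i:A. c i * Tode M x j (f i) y)"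
 unfolding Tode_def Qode_def
 by (simp add: Pode_lincomb[OF assms] deriv_Pode_lincomb[OF assms] deriv_lincomb[OF assms]
   sum_distrib_left algebra_simps sum.distrib sum_subtractf)

lemma Vsol_lincomb:
 assumes "open U" "!!i. i : A ==> f i : Vsol M x U j"
 shows "(%y. SUM i:A. c i * f i y) : Vsol M x U j"
 using assms by (auto simp: Vsol_def Tode_lincomb[OF assms(1)] intro!: holomorphic_intros)

lemma poly_antiderivative: "EX p :: complex poly. pderiv p = q"
proof -
 let ?p = "SUM i<=degree q. monom (coeff q i / of_nat (Suc i)) (Suc i)"
 have "pderiv ?p = (SUM i<=degree q. monom (coeff q i) i)" unfolding higher_pderiv_sum[of 1, simplified]
  by (intro sum.cong refl) (simp add: pderiv_monom del: of_nat_Suc)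
 thus ?thesis by (metis poly_as_sum_of_monoms)
qed

lemma deriv_poly: "deriv (poly p) y = poly (pderiv p) (y :: complex)"
 by (rule DERIV_imp_deriv) (rule poly_DERIV)

definition Ppoly :: "nat => complex => complex poly => complex poly" where
 "Ppoly M x p = [:0, 1:] * pderiv (pderiv p) + smult (of_nat M + 1) (pderiv p) - smult x p"

lemma Pode_poly: "Pode M x (poly p) = poly (Ppoly M x p)"
proof -
 have "deriv (poly p) = poly (pderiv p)" for p :: "complex poly" by (rule ext) (rule deriv_poly)
 thus ?thesis by (intro ext) (simp add: Pode_def Ppoly_def)
qed

lemma Pode_cong:
 assumes "open U" "!!y. y : U ==> f y = g y" "y : U"
 shows "deriv f y = deriv g y" "Pode M x f y = Pode M x g y" "deriv (Pode M x f) y = deriv (Pode M x g) y"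
proof -
 have d: "deriv f y = deriv g y" if "!!y. y : U ==> f y = g y" "y : U" for f g y
  by (rule deriv_cong_ev) (use eventually_nhds_in_open[OF assms(1) that(2)] that(1) in \<open>auto elim!: eventually_mono\<close>)
 have P: "Pode M x f y = Pode M x g y" if "y : U" for y
  unfolding Pode_def using d[OF d[OF assms(2)] that] d[OF assms(2) that] assms(2)[OF that] by simp
 show "deriv f y = deriv g y" "Pode M x f y = Pode M x g y" "deriv (Pode M x f) y = deriv (Pode M x g) y"
  using d[OF assms(2,3)] P[OF assms(3)] d[OF P assms(3)] by auto
qed

lemma coeff_Ppoly:
 "coeff (Ppoly M x p) i = of_nat (Suc i) * (of_nat i + of_nat M + 1) * coeff p (Suc i) - x * coeff p i"
 by (cases i) (simp_all add: Ppoly_def coeff_pCons coeff_pderiv algebra_simps)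

text \<open>All terms of the operator except x p have degree below that of p, so the leading
  coefficient is multiplied by x.\<close>

lemma Qode_poly_eq_0:
 assumes "x ~= 0" and U: "open U" "U ~= {}" and f: "!!y. y : U ==> f y = poly p y"
  and Q: "!!y. y : U ==> Qode M x J f y = 0"
 shows "p = 0"
proof -
 define q where "q = pderiv (Ppoly M x p) - Ppoly M x p - smult J (pderiv p)"
 have "poly q y = 0" if y: "y : U" for y
 proof -
  have "deriv f y = deriv (poly p) y" "Pode M x f y = Pode M x (poly p) y"
   "deriv (Pode M x f) y = deriv (Pode M x (poly p)) y" by (rule Pode_cong[OF U(1) _ y], rule f, assumption)+
  hence "Qode M x J f y = poly q y" unfolding Qode_def q_def by (simp add: Pode_poly deriv_poly)
  thus ?thesis using Q y by simp
 qed
 moreover obtain y e where "e > 0" "ball y e \<subseteq> U" using U open_contains_ball by (metis ex_in_conv)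
 ultimately have "ball y e \<subseteq> {y. poly q y = 0}" by auto
 hence "q = 0" using poly_roots_finite finite_subset uncountable_ball[OF \<open>e > 0\<close>] countable_finite by metis
 hence "coeff q (degree p) = 0" by simp
 moreover have hi: "coeff p (Suc (degree p)) = 0" "coeff p (Suc (Suc (degree p))) = 0" by (simp_all add: coeff_eq_0)
 have c1: "coeff (Ppoly M x p) (degree p) = - x * coeff p (degree p)" using hi by (simp add: coeff_Ppoly)
 have c2: "coeff (pderiv (Ppoly M x p)) (degree p) = 0" unfolding coeff_pderiv coeff_Ppoly hi by simp
 have "coeff q (degree p) = x * coeff p (degree p)"
  by (simp only: q_def coeff_diff coeff_smult c1 c2 coeff_pderiv[of p] hi) simp
 ultimately show ?thesis using assms(1) by simp
qed

lemma Vsol_Qode: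
 assumes "open U" "f : Vsol M x U j" "y : U"
 shows "Qode M x (Jpar j) f y = 0"
proof (cases "j = 1")
 case True
 have P: "Pode M x f y = 0" if "y : U" for y using assms(2) that True by (auto simp: Vsol_def Tode_def)
 have "deriv (Pode M x f) y = deriv (%_. 0) y"
  by (rule deriv_cong_ev) (use eventually_nhds_in_open[OF assms(1,3)] P in \<open>auto elim!: eventually_mono\<close>)
 thus ?thesis using P[OF assms(3)] True by (simp add: Qode_def Jpar_def)
qed (use assms in \<open>auto simp: Vsol_def Tode_def Jpar_def\<close>)

text \<open>If \<open>\<Sum>\<^sub>j f\<^sub>j = 0\<close>, then by \<open>(\<partial> - 1) P f\<^sub>j = J\<^sub>j \<partial> f\<^sub>j\<close> every moment \<open>\<Sum>\<^sub>j J\<^sub>j\<^sup>r f\<^sub>j\<close> is a polynomial.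
  Hence so is every \<open>f\<^sub>j\<close>, but the equations have no polynomial solutions.\<close>

lemma Vsol_direct:
 assumes x: "x ~= 0" and U: "open U" "connected U" "U ~= {}"
  and f: "!!j. j : {1..m} ==> f j : Vsol M x U j"
  and zero: "!!y. y : U ==> (SUM j:{1..m}. f j y) = 0"
  and j: "j : {1..m}" and y: "y : U"
 shows "f j y = 0"
proof -
 have hol: "f j holomorphic_on U" if "j : {1..m}" for j using f[OF that] by (simp add: Vsol_def)
 have Q: "deriv (Pode M x (f j)) y - Pode M x (f j) y = Jpar j * deriv (f j) y" if "j : {1..m}" "y : U" for j y
  using Vsol_Qode[OF U(1) f[OF that(1)] that(2)] by (simp add: Qode_def)
 \<comment> \<open>The moments with weights \<open>Jpar j ^ r\<close>: the derivative of the next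
   moment is (\<partial> - 1) P applied to the present one.\<close>
 define S where "S r y = (SUM j:{1..m}. Jpar j ^ r * f j y)" for r y
 have Shol: "S r holomorphic_on U" for r unfolding S_def[abs_def] by (intro holomorphic_intros hol)
 have "EX p. ALL y:U. S r y = poly p y" for r
 proof (induction r)
  case 0
  show ?case by (rule exI[of _ 0]) (use zero in \<open>simp add: S_def\<close>)
 next
  case (Suc r)
  then obtain p where p: "!!y. y : U ==> S r y = poly p y" by blast
  obtain q where q: "pderiv q = pderiv (Ppoly M x p) - Ppoly M x p" using poly_antiderivative by blast
  have d: "deriv (S (Suc r)) y = poly (pderiv q) y" if y: "y : U" for y
  proof -
   have "deriv (S (Suc r)) y = (SUM j:{1..m}. Jpar j ^ Suc r * deriv (f j) y)"
    unfolding S_def[abs_def] by (rule deriv_lincomb(1)[OF U(1) hol y])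
   also have "... = (SUM j:{1..m}. Jpar j ^ r * (deriv (Pode M x (f j)) y - Pode M x (f j) y))"
    by (intro sum.cong refl) (simp add: Q y)
   also have "... = deriv (Pode M x (S r)) y - Pode M x (S r) y"
   proof -
    have "deriv (Pode M x (S r)) y = (SUM j:{1..m}. Jpar j ^ r * deriv (Pode M x (f j)) y)"
     unfolding S_def[abs_def] by (rule deriv_Pode_lincomb[OF U(1) _ y]) (rule hol)
    moreover have "Pode M x (S r) y = (SUM j:{1..m}. Jpar j ^ r * Pode M x (f j) y)"
     unfolding S_def[abs_def] by (rule Pode_lincomb[OF U(1) _ y]) (rule hol)
    ultimately show ?thesis by (simp only: right_diff_distrib sum_subtractf)
   qed
   also have "... = poly (pderiv q) y"
   proof -
    have "Pode M x (S r) y = Pode M x (poly p) y" "deriv (Pode M x (S r)) y = deriv (Pode M x (poly p)) y"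
     by (rule Pode_cong[OF U(1) _ y], rule p, assumption)+
    thus ?thesis by (simp add: Pode_poly deriv_poly q)
   qed
   finally show ?thesis .
  qed
  have "EX c. ALL y:U. S (Suc r) y - poly q y = c"
  proof -
   have "((%y. S (Suc r) y - poly q y) has_field_derivative 0) (at y)" if "y : U" for y
    using DERIV_diff[OF holomorphic_derivI[OF Shol U(1) that] poly_DERIV[of q y], of "Suc r"] d[OF that] by simp
   moreover from this have "continuous_on U (%y. S (Suc r) y - poly q y)"
    by (meson DERIV_isCont continuous_at_imp_continuous_on)
   ultimately show ?thesis
    using DERIV_zero_connected_constant[OF U(2,1) finite.emptyI, of "%y. S (Suc r) y - poly q y"]
    by (metis Diff_empty)
  qed
  then obtain c where "!!y. y : U ==> S (Suc r) y = poly (q + [:c:]) y" by (auto simp: algebra_simps)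
  thus ?case by blast
 qed
 then obtain p where p: "!!r y. y : U ==> S r y = poly (p r) y" by metis
 \<comment> \<open>Lagrange interpolation: the values \<open>Jpar i\<close> are distinct, so the
   combination of moments with the coefficients of L isolates \<open>f j\<close>.\<close>
 define L where "L = (PROD i:{1..m}-{j}. [:- Jpar i, 1:])"
 have "inj_on Jpar {1..m}" by (auto simp: inj_on_def Jpar_def)
 hence "Jpar j - Jpar i ~= 0" if "i : {1..m} - {j}" for i
  using that j by (metis DiffD1 DiffD2 eq_iff_diff_eq_0 inj_on_eq_iff insertI1)
 hence Lj: "poly L (Jpar j) ~= 0" unfolding L_def poly_prod by (subst prod_zero_iff) auto
 have Li: "poly L (Jpar i) = 0" if "i : {1..m}" "i ~= j" for i
  using that unfolding L_def poly_prod by (intro prod_zero) auto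
 define g where "g = smult (1 / poly L (Jpar j)) (SUM r<=degree L. smult (coeff L r) (p r))"
 have fg: "f j y = poly g y" if y: "y : U" for y
 proof -
  have "(SUM r<=degree L. coeff L r * S r y) = (SUM i:{1..m}. poly L (Jpar i) * f i y)"
   unfolding S_def poly_altdef sum_distrib_left sum_distrib_right by (subst sum.swap) (simp add: mult.assoc)
  also have "... = poly L (Jpar j) * f j y" using j Li by (subst sum.remove[OF _ j]) auto
  finally have "poly L (Jpar j) * f j y = poly (SUM r<=degree L. smult (coeff L r) (p r)) y"
   using p[OF y] by (simp add: poly_sum)
  thus ?thesis using Lj by (simp add: g_def field_simps)
 qed
 have "g = 0" by (rule Qode_poly_eq_0[OF x U(1,3), of "f j"]) (use fg Vsol_Qode[OF U(1) f[OF j]] in auto)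
 thus ?thesis using fg[OF y] by simp
qed

section \<open>Linear ordinary differential equations\<close>

definition Osol :: "nat => (nat => complex => complex) => complex set => (complex => complex) set" where
 "Osol N p U = {g. g holomorphic_on U & (ALL y:U. (SUM k<=N. p k y * (deriv ^^ k) g y) = 0)}"

text \<open>Differentiating the equation r times at y0 and dividing by the leading coefficient
  expresses the derivative of order N + r through lower ones, so all Taylor coefficients
  vanish.\<close>

lemma Osol_unique:
 assumes U: "open U" "connected U" "y0 : U" and p: "!!k. k <= N ==> p k holomorphic_on U"
  and lead: "p N y0 ~= 0" and g: "g : Osol N p U"
  and init: "!!k. k < N ==> (deriv ^^ k) g y0 = 0" and y: "y : U"
 shows "g y = 0"
proof -
 have hol: "g holomorphic_on U" and ode: "!!y. y : U ==> (SUM k<=N. p k y * (deriv ^^ k) g y) = 0"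
  using g by (auto simp: Osol_def)
 have hk: "(deriv ^^ k) g holomorphic_on U" for k by (rule holomorphic_higher_deriv[OF hol U(1)])
 have "(deriv ^^ n) g y0 = 0" for n
 proof (induction n rule: less_induct)
  case (less n)
  show ?case
  proof (cases "n < N")
   case False
   define r where "r = n - N"
   have n: "n = N + r" using False by (simp add: r_def)
   have "0 = (deriv ^^ r) (%_. 0) y0" by (induction r) (simp_all add: funpow_swap1)
   also have "... = (deriv ^^ r) (%y. SUM k:{..N}. 1 * (p k y * (deriv ^^ k) g y)) y0"
   proof (rule higher_deriv_transform_within_open[OF _ _ U(1) U(3)])
    show "(%y. SUM k:{..N}. 1 * (p k y * (deriv ^^ k) g y)) holomorphic_on U"
     by (intro holomorphic_on_sum holomorphic_on_mult holomorphic_on_const p hk) auto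
    show "0 = (SUM k:{..N}. 1 * (p k y * (deriv ^^ k) g y))" if "y : U" for y using ode[OF that] by simp
   qed simp
   also have "... = (SUM k:{..N}. 1 * (deriv ^^ r) (%y. p k y * (deriv ^^ k) g y) y0)"
    by (rule higher_deriv_lincomb[OF U(1) _ U(3)]) (use p hk hol U(1) in \<open>auto intro!: holomorphic_intros\<close>)
   also have "... = (SUM k:{..N}. if k = N then p N y0 * (deriv ^^ n) g y0 else 0)"
   proof (rule sum.cong)
    fix k assume k: "k : {..N}"
    have "(deriv ^^ r) (%y. p k y * (deriv ^^ k) g y) y0 =
      (SUM i = 0..r. of_nat (r choose i) * (deriv ^^ i) (p k) y0 * (deriv ^^ (r - i)) ((deriv ^^ k) g) y0)"
     by (rule higher_deriv_mult[OF _ hk U(1,3)]) (use p k in auto)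
    also have "... = (SUM i = 0..r. if i = 0 then p k y0 * (deriv ^^ (r + k)) g y0 else 0)"
    proof (rule sum.cong)
     fix i assume i: "i : {0..r}"
     have e: "(deriv ^^ (r - i)) ((deriv ^^ k) g) = (deriv ^^ (r - i + k)) g" by (simp add: funpow_add)
     show "of_nat (r choose i) * (deriv ^^ i) (p k) y0 * (deriv ^^ (r - i)) ((deriv ^^ k) g) y0 =
      (if i = 0 then p k y0 * (deriv ^^ (r + k)) g y0 else 0)" proof (cases "i = 0") case False
      hence "(deriv ^^ (r - i + k)) g y0 = 0" using i k n by (intro less) auto
      thus ?thesis unfolding e using False by simp
     qed (simp add: funpow_add)
    qed simp
    also have "... = p k y0 * (deriv ^^ (r + k)) g y0" by simp
    also have "... = (if k = N then p N y0 * (deriv ^^ n) g y0 else 0)"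
     using less[of "r + k"] k n by (auto simp: add.commute)
    finally show "1 * (deriv ^^ r) (%y. p k y * (deriv ^^ k) g y) y0 =
      (if k = N then p N y0 * (deriv ^^ n) g y0 else 0)" by simp qed simp
   finally show ?thesis using lead by simp
  qed (use init in simp)
 qed
 thus ?thesis by (rule holomorphic_fun_eq_0_on_connected[OF hol U(1,2) _ U(3) y])
qed

lemma Osol_lincomb:
 assumes U: "open U" and g: "!!i. i : I ==> g i : Osol N p U"
 shows "(%y. SUM i:I. c i * g i y) : Osol N p U"
proof -
 have hol: "g i holomorphic_on U" if "i : I" for i using g[OF that] by (simp add: Osol_def)
 have "(SUM k<=N. p k y * (deriv ^^ k) (%y. SUM i:I. c i * g i y) y) = 0" if y: "y : U" for y
 proof -
  have "(SUM k<=N. p k y * (deriv ^^ k) (%y. SUM i:I. c i * g i y) y) =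
    (SUM k<=N. p k y * (SUM i:I. c i * (deriv ^^ k) (g i) y))"
   by (intro sum.cong refl arg_cong[of _ _ "%t. _ * t"] higher_deriv_lincomb[OF U _ y]) (rule hol)
  also have "... = (SUM i:I. c i * (SUM k<=N. p k y * (deriv ^^ k) (g i) y))"
   unfolding sum_distrib_left by (subst sum.swap) (simp add: mult_ac)
  also have "... = 0" using g y by (auto simp: Osol_def intro!: sum.neutral)
  finally show ?thesis .
 qed
 thus ?thesis using hol by (auto simp: Osol_def intro!: holomorphic_intros)
qed

text \<open>The initial values at y0 impose N linear conditions on more than N coefficients.\<close>

lemma Osol_dependent:
 assumes U: "open U" "connected U" "y0 : U" and p: "!!k. k <= N ==> p k holomorphic_on U"
  and lead: "p N y0 ~= 0" and g: "!!i. i : I ==> g i : Osol N p U"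
  and I: "finite I" "N < card I"
 shows "EX c. (EX i:I. c i ~= 0) & (ALL y:U. (SUM i:I. c i * g i y) = 0)"
proof -
 have "EX c. (ALL i:I. c i : UNIV) & (EX i:I. c i ~= 0) & (ALL k:{..<N}. (SUM i:I. c i * (deriv ^^ k) (g i) y0) = 0)"
  by (rule more_unknowns_than_equations) (use I in auto)
 then obtain c where c: "EX i:I. c i ~= 0" "!!k. k < N ==> (SUM i:I. c i * (deriv ^^ k) (g i) y0) = 0"
  by auto
 have hol: "g i holomorphic_on U" if "i : I" for i using g[OF that] by (simp add: Osol_def)
 have "(SUM i:I. c i * g i y) = 0" if y: "y : U" for y
 proof (rule Osol_unique[OF U _ _ _ _ y])
  show "(%y. SUM i:I. c i * g i y) : Osol N p U" by (rule Osol_lincomb[OF U(1) g])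
  fix k assume "k < N"
  thus "(deriv ^^ k) (%y. SUM i:I. c i * g i y) y0 = 0"
   using higher_deriv_lincomb[OF U(1) _ U(3), where A = I and f = g and k = k and c = c] hol c(2) by simp
 qed (use p lead in auto)
 thus ?thesis using c(1) by blast
qed

text \<open>N independent solutions together with g are N + 1 functions, hence dependent, and g must
  occur in the relation.\<close>

lemma Osol_span:
 assumes U: "open U" "connected U" "y0 : U" and p: "!!k. k <= N ==> p k holomorphic_on U"
  and lead: "p N y0 ~= 0" and u: "!!b. b : B ==> u b : Osol N p U"
  and B: "finite B" "card B = N"
  and indep: "!!c. (!!y. y : U ==> (SUM b:B. c b * u b y) = 0) ==> ALL b:B. c b = 0"
  and g: "g : Osol N p U"
 shows "EX c. ALL y:U. g y = (SUM b:B. c b * u b y)"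
proof -
 let ?g = "%i. case i of None => g | Some b => u b" and ?I = "insert None (Some ` B)"
 have "card ?I = Suc N" using B by (simp add: card_image)
 hence card: "N < card ?I" "finite ?I" using B by auto
 have gI: "?g i : Osol N p U" if "i : ?I" for i using that u g by auto
 have "EX c. (EX i:?I. c i ~= 0) & (ALL y:U. (SUM i:?I. c i * ?g i y) = 0)"
  by (rule Osol_dependent[where N = N and p = p, OF U _ lead _ card(2,1)]) (rule p gI, assumption)+
 then obtain c where c: "EX i:?I. c i ~= 0" "!!y. y : U ==> (SUM i:?I. c i * ?g i y) = 0" by blast
 have s: "c None * g y + (SUM b:B. c (Some b) * u b y) = 0" if "y : U" for y
  using c(2)[OF that] B(1) by (simp add: sum.reindex)
 have nz: "c None ~= 0"
 proof
  assume 0: "c None = 0"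
  hence "ALL b:B. c (Some b) = 0" using indep[of "%b. c (Some b)"] s by simp
  thus False using 0 c(1) by auto
 qed
 have "g y = (SUM b:B. (- c (Some b) / c None) * u b y)" if "y : U" for y
 proof -
  have "(SUM b:B. (- c (Some b) / c None) * u b y) = - (SUM b:B. c (Some b) * u b y) / c None"
   by (simp add: sum_divide_distrib sum_negf)
  also have "(SUM b:B. c (Some b) * u b y) = - (c None * g y)" using s[OF that] by (simp add: add_eq_0_iff)
  finally show ?thesis using nz by simp
 qed
 note * = this
 show ?thesis by (rule exI, rule ballI, rule *)
qed

definition tcoef :: "nat => complex => nat => nat => complex => complex" where
 "tcoef M x j k y = (if j = 1 then [- x, of_nat M + 1, y] ! k
  else [x, - (x + of_nat M + 1 + of_nat j), of_nat M + 2 - y, y] ! k)"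

lemma Tode_expand:
 assumes "open U" "f holomorphic_on U" "y : U"
 shows "Tode M x j f y = (SUM k<=dord j. tcoef M x j k y * (deriv ^^ k) f y)"
proof (cases "j = 1")
 case True
 thus ?thesis by (simp add: Tode_def dord_def Pode_def tcoef_def numeral_2_eq_2 algebra_simps)
next
 case False
 note d = holomorphic_derivI[OF _ assms(1,3)]
 note h = assms(2) holomorphic_deriv[OF assms(2,1)] holomorphic_deriv[OF holomorphic_deriv[OF assms(2,1)] assms(1)]
 have "(Pode M x f has_field_derivative
   (1 * deriv (deriv f) y + deriv (deriv (deriv f)) y * y + (of_nat M + 1) * deriv (deriv f) y - x * deriv f y)) (at y)"
  unfolding Pode_def[abs_def] by (intro DERIV_diff DERIV_add DERIV_mult DERIV_cmult DERIV_ident d h)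
 hence "deriv (Pode M x f) y = deriv (deriv f) y + y * deriv (deriv (deriv f)) y + (of_nat M + 1) * deriv (deriv f) y - x * deriv f y"
  by (simp add: DERIV_imp_deriv mult.commute)
 moreover have "{..3::nat} = {0, 1, 2, 3}" by auto
 ultimately show ?thesis using False
  by (simp add: Tode_def Qode_def dord_def tcoef_def Pode_def numeral_2_eq_2 numeral_3_eq_3 algebra_simps)
qed

lemma Vsol_Osol: "open U ==> Vsol M x U j = Osol (dord j) (tcoef M x j) U"
 using Tode_expand[of U] by (auto simp: Vsol_def Osol_def)

lemma tcoef_lead: "tcoef M x j (dord j) y = y"
 by (simp add: tcoef_def dord_def)

lemma tcoef_holomorphic:
 assumes "k <= dord j"
 shows "tcoef M x j k holomorphic_on U"
proof -
 have "k = 0 \<or> k = 1 \<or> k = 2 \<or> (k = 3 & j ~= 1)" using assms by (auto simp: dord_def split: if_splits)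
 thus ?thesis unfolding tcoef_def[abs_def] by (elim disjE; cases "j = 1") (auto intro!: holomorphic_intros)
qed

text \<open>By uniqueness and independence the matrix of jets of the basis at y0 is invertible.
  Products of such solutions later test operators coefficient by coefficient.\<close>

lemma Vsol_jets:
 assumes x: "x ~= 0" and U: "open U" "connected U" "y0 : U" "log_branch U l"
 shows "EX u:Vsol M x U j. ALL k<dord j. (deriv ^^ k) u y0 = e k"
proof -
 obtain a b where vb: "vbasis M x j a b" using vbasis_exists[OF x] by blast
 have uV: "logser M l (a r) (b r) : Vsol M x U j" if "r : {..<dord j}" for r
  using vb U that by (auto simp: vbasis_def)
 have y0: "y0 ~= 0" using U(3,4) by (metis exp_not_eq_zero log_branch_def)
 have hol: "logser M l (a r) (b r) holomorphic_on U" if "r : {..<dord j}" for r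
  using uV[OF that] by (simp add: Vsol_def)
 have "EX c. (ALL i:{..<dord j}. c i : UNIV) &
   (ALL k:{..<dord j}. (SUM r:{..<dord j}. c r * (deriv ^^ k) (logser M l (a r) (b r)) y0) = e k)"
 proof (rule square_system_solvable)
  fix c assume c: "!!k. k : {..<dord j} ==> (SUM r<dord j. c r * (deriv ^^ k) (logser M l (a r) (b r)) y0) = 0"
  have "(SUM r:{..<dord j}. c r * logser M l (a r) (b r) y) = 0" if y: "y : U" for y
  proof (rule Osol_unique[OF U(1-3) _ _ _ _ y])
   show "(%y. SUM r:{..<dord j}. c r * logser M l (a r) (b r) y) : Osol (dord j) (tcoef M x j) U"
    unfolding Vsol_Osol[OF U(1), symmetric] by (rule Vsol_lincomb[OF U(1)]) (rule uV)
   show "(deriv ^^ k) (%y. SUM r:{..<dord j}. c r * logser M l (a r) (b r) y) y0 = 0" if "k < dord j" for k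
    using higher_deriv_lincomb[OF U(1) _ U(3), where A = "{..<dord j}" and f = "%r. logser M l (a r) (b r)" and k = k and c = c]
     hol c[of k] that by simp
  qed (use y0 in \<open>auto simp: tcoef_lead intro: tcoef_holomorphic\<close>)
  thus "ALL r:{..<dord j}. c r = 0" using vbasis_indep[OF vb U(1) _ U(4)] U(3) by blast
 qed auto
 then obtain c where c: "!!k. k < dord j ==> (SUM r:{..<dord j}. c r * (deriv ^^ k) (logser M l (a r) (b r)) y0) = e k"
  by auto
 show ?thesis
 proof (intro bexI allI impI)
  show "(%y. SUM r:{..<dord j}. c r * logser M l (a r) (b r) y) : Vsol M x U j"
   by (rule Vsol_lincomb[OF U(1)]) (rule uV)
  show "(deriv ^^ k) (%y. SUM r:{..<dord j}. c r * logser M l (a r) (b r) y) y0 = e k" if "k < dord j" for k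
   using higher_deriv_lincomb[OF U(1) _ U(3), where A = "{..<dord j}" and f = "%r. logser M l (a r) (b r)" and k = k and c = c]
    hol c[OF that] by simp
 qed
qed

section \<open>The basis of all solution spaces together\<close>

definition Bidx :: "nat => (nat \<times> nat) set" where
 "Bidx m = Sigma {1..m} (%j. {..<dord j})"

lemma finite_Bidx [simp]: "finite (Bidx m)"
 by (simp add: Bidx_def)

lemma card_Bidx: "m >= 1 ==> card (Bidx m) = 3 * m - 1"
proof (induction m rule: dec_induct)
 case base
 show ?case by (simp add: Bidx_def dord_def)
next
 case (step m)
 have "card (Bidx (Suc m)) = (SUM j:{1..Suc m}. dord j)" by (simp add: Bidx_def)
 also have "... = card (Bidx m) + dord (Suc m)" by (simp add: Bidx_def)
 finally show ?case using step by (simp add: dord_def)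
qed

definition ubas :: "nat => (complex => complex) => (nat => nat => nat => complex) =>
  (nat => nat => nat => complex) => nat \<times> nat => complex => complex" where
 "ubas M l a b i = logser M l (a (fst i) (snd i)) (b (fst i) (snd i))"

lemma ubas_Vsol:
 assumes "vbasis M x (fst i) (a (fst i)) (b (fst i))" "i : Bidx m" "open U" "log_branch U l"
 shows "ubas M l a b i : Vsol M x U (fst i)" using assms by (auto simp: ubas_def Bidx_def vbasis_def)

lemma ubas_indep:
 assumes x: "x ~= 0" and vb: "!!j. vbasis M x j (a j) (b j)"
  and U: "open U" "connected U" "U ~= {}" "log_branch U l"
  and zero: "!!y. y : U ==> (SUM i:Bidx m. c i * ubas M l a b i y) = 0"
 shows "ALL i:Bidx m. c i = 0"
proof
 fix i assume i: "i : Bidx m"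
 obtain j r where jr: "i = (j, r)" "j : {1..m}" "r < dord j" using i by (auto simp: Bidx_def)
 define f where "f j y = (SUM r:{..<dord j}. c (j, r) * logser M l (a j r) (b j r) y)" for j y
 have fV: "f j : Vsol M x U j" for j
  unfolding f_def[abs_def] by (rule Vsol_lincomb[OF U(1)]) (use vb U in \<open>auto simp: vbasis_def\<close>)
 have "(SUM j:{1..m}. f j y) = 0" if "y : U" for y
 proof -
  have "(SUM i:Bidx m. c i * ubas M l a b i y) = (SUM j:{1..m}. f j y)"
   unfolding Bidx_def f_def by (subst sum.Sigma) (auto simp: ubas_def split_beta)
  thus ?thesis using zero[OF that] by simp
 qed
 hence "f j y = 0" if "y : U" for y
  using Vsol_direct[OF x U(1-3), where f = f and m = m and j = j and y = y and M = M] fV jr that by simp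
 thus "c i = 0"
  using vbasis_indep[OF vb[of j] U(1,3,4), where c = "%r. c (j, r)" and r = r] jr by (simp add: f_def)
qed

section \<open>Tensor products of function spaces\<close>

text \<open>Independent functions are separated by as many points: a new point is taken where the
  new function differs from the combination that interpolates it at the old ones. \<open>ka\<close>
  is the two-sided inverse of the matrix of values.\<close>

lemma dual_points:
 fixes u :: "'b => complex => complex"
 assumes "finite B"
  and "!!c. (!!y. y : Y ==> (SUM b:B. c b * u b y) = 0) ==> ALL b:B. c b = 0"
 obtains p ka where "!!e. e : B ==> p e : Y"
  "ALL c. (ALL e:B. (SUM b:B. c b * u b (p e)) = 0) --> (ALL b:B. c b = 0)"
  "!!e e'. e : B ==> e' : B ==> (SUM b:B. ka b e * u b (p e')) = (if e = e' then 1 else 0)"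
  "!!b b'. b : B ==> b' : B ==> (SUM e:B. ka b e * u b' (p e)) = (if b = b' then 1 else 0)"
proof -
 have "EX p. (ALL e:B. p e : Y) & (ALL c. (ALL e:B. (SUM b:B. c b * u b (p e)) = 0) --> (ALL b:B. c b = 0))"
  using assms
 proof (induction B rule: finite_induct)
  case (insert b0 B)
  have ind: "ALL b:B. c b = 0" if "!!y. y : Y ==> (SUM b:B. c b * u b y) = 0" for c
  proof -
   have "(SUM b:insert b0 B. (if b = b0 then 0 else c b) * u b y) = 0" if "y : Y" for y
   proof -
    have "(SUM b:B. (if b = b0 then 0 else c b) * u b y) = (SUM b:B. c b * u b y)"
     using insert.hyps by (intro sum.cong) auto
    thus ?thesis using insert.hyps \<open>y : Y\<close> \<open>!!y. y : Y ==> (SUM b:B. c b * u b y) = 0\<close> by simp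
   qed
   from insert.prems[OF this] show ?thesis using insert.hyps by (metis insertCI)
  qed
  from insert.IH[OF ind] obtain p where p: "!!e. e : B ==> p e : Y"
   and inj: "!!c. (!!e. e : B ==> (SUM b:B. c b * u b (p e)) = 0) ==> ALL b:B. c b = 0" by metis
  have "EX c. (ALL b:B. c b : UNIV) & (ALL e:B. (SUM b:B. c b * u b (p e)) = u b0 (p e))"
   by (rule square_system_solvable) (use insert.hyps inj in auto)
  then obtain c where c: "!!e. e : B ==> (SUM b:B. c b * u b (p e)) = u b0 (p e)" by auto
  have split: "(SUM b:insert b0 B. (if b = b0 then t else d b) * u b y) = t * u b0 y + (SUM b:B. d b * u b y)" for t d y
  proof -
   have "(SUM b:B. (if b = b0 then t else d b) * u b y) = (SUM b:B. d b * u b y)"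
    using insert.hyps by (intro sum.cong) auto
   thus ?thesis using insert.hyps by simp
  qed
  have "EX y:Y. u b0 y - (SUM b:B. c b * u b y) ~= 0"
  proof (rule ccontr)
   assume "\<not> ?thesis"
   hence "(SUM b:insert b0 B. (if b = b0 then 1 else - c b) * u b y) = 0" if "y : Y" for y
    using that unfolding split by (simp add: sum_negf)
   from insert.prems[OF this] show False by auto
  qed
  then obtain y where y: "y : Y" "u b0 y - (SUM b:B. c b * u b y) ~= 0" by blast
  show ?case
  proof (intro exI[of _ "p(b0 := y)"] conjI allI impI)
   fix d assume d: "ALL e:insert b0 B. (SUM b:insert b0 B. d b * u b ((p(b0 := y)) e)) = 0"
   have d': "d b0 * u b0 w + (SUM b:B. d b * u b w) = 0" if "w = y \<or> (EX e:B. w = p e)" for w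
   proof -
    have "EX e:insert b0 B. w = (p(b0 := y)) e" using that
    proof
     assume "EX e:B. w = p e"
     then obtain e where "e : B" "w = p e" by blast
     thus ?thesis using insert.hyps(2) by (intro bexI[of _ e]) auto
    qed auto
    then obtain e where "e : insert b0 B" "w = (p(b0 := y)) e" by blast
    hence "(SUM b:insert b0 B. d b * u b w) = 0" using d by blast
    thus ?thesis using insert.hyps by simp
   qed
   have "ALL b:B. d b + d b0 * c b = 0"
   proof (rule inj)
    fix e assume "e : B"
    thus "(SUM b:B. (d b + d b0 * c b) * u b (p e)) = 0" using d'[of "p e"] c[of e]
     by (simp add: distrib_right sum.distrib mult.assoc flip: sum_distrib_left) (auto simp: add.commute)
   qed
   hence db: "d b = - d b0 * c b" if "b : B" for b using that by (simp add: add_eq_0_iff)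
   have "d b0 * (u b0 y - (SUM b:B. c b * u b y)) = d b0 * u b0 y + (SUM b:B. d b * u b y)"
    by (simp add: db sum_distrib_left right_diff_distrib mult.assoc sum_negf)
   hence "d b0 = 0" using d'[of y] y(2) by simp
   thus "ALL b:insert b0 B. d b = 0" using db by auto
  qed (use p y in auto)
 qed auto
 then obtain p where p: "!!e. e : B ==> p e : Y"
  and inj: "!!c. (!!e. e : B ==> (SUM b:B. c b * u b (p e)) = 0) ==> ALL b:B. c b = 0" by metis
 have "EX c. (ALL b:B. c b : UNIV) & (ALL e':B. (SUM b:B. c b * u b (p e')) = (if e = e' then 1 else 0))" for e
  by (rule square_system_solvable) (use assms(1) inj in auto)
 then obtain ka' where ka': "!!e e'. e' : B ==> (SUM b:B. ka' e b * u b (p e')) = (if e = e' then 1 else 0)"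
  by metis
 \<comment> \<open>The other side of the inverse: d gives the coefficients of a combination that
   vanishes at all the points.\<close>
 have d2: "(SUM e:B. ka' e b * u b' (p e)) = (if b = b' then 1 else 0)" if b: "b : B" "b' : B" for b b'
 proof -
  define d where "d b'' = (SUM e:B. ka' e b'' * u b' (p e)) - (if b'' = b' then 1 else 0)" for b''
  have "ALL b:B. d b = 0"
  proof (rule inj)
   fix e' assume e': "e' : B"
   have "(SUM b'':B. d b'' * u b'' (p e')) =
     (SUM b'':B. (SUM e:B. ka' e b'' * u b' (p e)) * u b'' (p e')) - (SUM b'':B. (if b'' = b' then 1 else 0) * u b'' (p e'))"
    by (simp add: d_def left_diff_distrib sum_subtractf)
   also have "(SUM b'':B. (SUM e:B. ka' e b'' * u b' (p e)) * u b'' (p e')) =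
     (SUM e:B. u b' (p e) * (SUM b'':B. ka' e b'' * u b'' (p e')))"
    unfolding sum_distrib_left sum_distrib_right by (subst sum.swap) (simp add: mult_ac)
   also have "... = (SUM e:B. u b' (p e) * (if e = e' then 1 else 0))"
    by (intro sum.cong refl) (simp add: ka' e')
   also have "... = u b' (p e')" using e' assms(1) by (simp add: if_distrib[of "%x. _ * x"] cong: if_cong)
   also have "(SUM b'':B. (if b'' = b' then 1 else 0) * u b'' (p e')) = u b' (p e')"
    using b assms(1) by (simp add: if_distrib[of "%x. x * _"] cong: if_cong)
   finally show "(SUM b'':B. d b'' * u b'' (p e')) = 0" by simp
  qed
  thus ?thesis using b by (simp add: d_def)
 qed
 show ?thesis by (rule that[of p "%b e. ka' e b"]) (use p inj ka' d2 in auto)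
qed

abbreviation ms :: "'b set => ('m => 'b) set" where
 "ms B \<equiv> PiE UNIV (%_. B)"

text \<open>Evaluation on the grid of dual points and contraction with \<open>ka\<close> in each
  variable isolates a single coefficient.\<close>

lemma tensor_indep:
 fixes u :: "'b => complex => complex"
 assumes B: "finite B"
  and ind: "!!c. (!!y. y : U ==> (SUM b:B. c b * u b y) = 0) ==> ALL b:B. c b = 0"
  and zero: "!!z :: complex^('m::finite). z : cpower U ==> (SUM io:ms B. C io * (PROD i:UNIV. u (io i) (z $ i))) = 0"
  and io: "io0 : ms B"
 shows "C io0 = 0"
proof -
 obtain p ka where p: "!!e. e : B ==> p e : U"
  and d: "!!b b'. b : B ==> b' : B ==> (SUM e:B. ka b e * u b' (p e)) = (if b = b' then 1 else 0)"
  by (rule dual_points[OF B, of U u], erule ind) (rule that)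
 let ?g = "%ga::'m => 'b. (\<chi> i. p (ga i)) :: complex^'m"
 have fin: "finite (ms B :: ('m => 'b) set)" using B by (auto intro: finite_PiE)
 have "0 = (SUM ga:ms B. (PROD i:UNIV. ka (io0 i) (ga i)) * (SUM io:ms B. C io * (PROD i:UNIV. u (io i) (?g ga $ i))))"
  by (intro sum.neutral[symmetric] ballI) (subst zero, auto simp: PiE_def Pi_def intro!: p)
 also have "... = (SUM io:ms B. C io * (SUM ga:ms B. (PROD i:UNIV. ka (io0 i) (ga i) * u (io i) (p (ga i)))))"
  unfolding sum_distrib_left by (subst sum.swap) (simp add: prod.distrib mult_ac)
 also have "... = (SUM io:ms B. C io * (PROD i:UNIV. SUM e:B. ka (io0 i) e * u (io i) (p e)))"
  by (subst prod_sum_PiE) (use B in auto)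
 also have "... = (SUM io:ms B. C io * (if io = io0 then 1 else 0))"
 proof (intro sum.cong refl)
  fix io :: "'m => 'b" assume i: "io : ms B"
  have "(PROD i:UNIV. SUM e:B. ka (io0 i) e * u (io i) (p e)) = (PROD i:UNIV. if io0 i = io i then 1 else 0)"
   by (intro prod.cong refl d) (use i io in auto)
  also have "... = (if io = io0 then 1 else 0)"
   by (cases "io = io0") (auto intro!: prod_zero simp: fun_eq_iff, metis)
  finally show "C io * (PROD i:UNIV. SUM e:B. ka (io0 i) e * u (io i) (p e)) = C io * (if io = io0 then 1 else 0)"
   by simp
 qed
 also have "... = C io0" using io fin by (simp add: if_distrib[of "%x. _ * x"] cong: if_cong)
 finally show ?thesis by simp
qed

text \<open>A function all of whose one-variable slices lie in the span is determined by its values on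
  a grid of interpolation points.\<close>

lemma tensor_span:
 fixes f :: "complex^('m::finite) => complex" and u :: "'b => complex => complex"
 assumes B: "finite B"
  and ind: "!!c. (!!y. y : U ==> (SUM b:B. c b * u b y) = 0) ==> ALL b:B. c b = 0"
  and slice: "!!z i. z : cpower U ==> EX c. ALL t:U. f (upd z i t) = (SUM b:B. c b * u b t)"
 shows "EX C. ALL z:cpower U. f z = (SUM io:ms B. C io * (PROD i:UNIV. u (io i) (z $ i)))"
proof -
 obtain p ka where p: "!!e. e : B ==> p e : U"
  and inj0: "ALL c. (ALL e:B. (SUM b:B. c b * u b (p e)) = 0) --> (ALL b:B. c b = 0)"
  and d: "!!e e'. e : B ==> e' : B ==> (SUM b:B. ka b e * u b (p e')) = (if e = e' then 1 else 0)"
  by (rule dual_points[OF B, of U u], erule ind) (rule that)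
 have inj: "ALL b:B. c b = 0" if "!!e. e : B ==> (SUM b:B. c b * u b (p e)) = 0" for c
  using inj0 that by blast
 let ?g = "%ga::'m => 'b. (\<chi> i. p (ga i)) :: complex^'m"
 have fin: "finite (ms B :: ('m => 'b) set)" using B by (auto intro: finite_PiE)
 define C where "C io = (SUM ga:ms B. (PROD i:UNIV. ka (io i) (ga i)) * f (?g ga))" for io :: "'m => 'b"
 \<comment> \<open>The interpolation error. It vanishes on the grid and its slices lie in the span
   as well, which allows one variable after another to leave the grid.\<close>
 define h where "h z = f z - (SUM io:ms B. C io * (PROD i:UNIV. u (io i) (z $ i)))" for z
 have grid: "h (?g de) = 0" if de: "de : ms B" for de
 proof -
  have "(SUM io:ms B. C io * (PROD i:UNIV. u (io i) (?g de $ i))) =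
    (SUM ga:ms B. f (?g ga) * (SUM io:ms B. PROD i:UNIV. ka (io i) (ga i) * u (io i) (p (de i))))"
   unfolding C_def sum_distrib_left sum_distrib_right by (subst sum.swap) (simp add: prod.distrib mult_ac)
  also have "... = (SUM ga:ms B. f (?g ga) * (PROD i:UNIV. SUM b:B. ka b (ga i) * u b (p (de i))))"
   by (subst prod_sum_PiE) (use B in auto)
  also have "... = (SUM ga:ms B. f (?g ga) * (if ga = de then 1 else 0))"
  proof (intro sum.cong refl)
   fix ga :: "'m => 'b" assume g: "ga : ms B"
   have "(PROD i:UNIV. SUM b:B. ka b (ga i) * u b (p (de i))) = (PROD i:UNIV. if ga i = de i then 1 else 0)"
    by (intro prod.cong refl d) (use g de in auto)
   also have "... = (if ga = de then 1 else 0)"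
    by (cases "ga = de") (auto intro!: prod_zero simp: fun_eq_iff)
   finally show "f (?g ga) * (PROD i:UNIV. SUM b:B. ka b (ga i) * u b (p (de i))) = f (?g ga) * (if ga = de then 1 else 0)"
    by simp
  qed
  also have "... = f (?g de)" using de fin by (simp add: if_distrib[of "%x. _ * x"] cong: if_cong)
  finally show ?thesis by (simp add: h_def)
 qed
 have hslice: "EX c. ALL t:U. h (upd z i t) = (SUM b:B. c b * u b t)" if z: "z : cpower U" for z i
 proof -
  obtain c where c: "!!t. t : U ==> f (upd z i t) = (SUM b:B. c b * u b t)" using slice[OF z] by metis
  define r where "r io = C io * (PROD k:UNIV-{i}. u (io k) (z $ k))" for io :: "'m => 'b"
  have "h (upd z i t) = (SUM b:B. (c b - (SUM io:{io:ms B. io i = b}. r io)) * u b t)" if t: "t : U" for t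
  proof -
   have "(SUM io:ms B. C io * (PROD k:UNIV. u (io k) (upd z i t $ k))) = (SUM io:ms B. r io * u (io i) t)"
   proof (intro sum.cong refl)
    fix io :: "'m => 'b"
    have "(PROD k:UNIV. u (io k) (upd z i t $ k)) = u (io i) t * (PROD k:UNIV-{i}. u (io k) (z $ k))"
     by (subst prod.remove[of _ i]) (auto intro!: prod.cong)
    thus "C io * (PROD k:UNIV. u (io k) (upd z i t $ k)) = r io * u (io i) t"
     by (simp add: r_def mult_ac)
   qed
   also have "... = (SUM b:B. SUM io:{io:ms B. io i = b}. r io * u (io i) t)"
    by (rule sum.group[symmetric]) (use fin B in auto)
   also have "... = (SUM b:B. (SUM io:{io:ms B. io i = b}. r io) * u b t)"
    by (simp add: sum_distrib_right)
   finally show ?thesis by (simp add: h_def c[OF t] left_diff_distrib sum_subtractf)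
  qed
  note * = this
  show ?thesis by (rule exI, rule ballI, rule *)
 qed
 have "ALL z:cpower U. (ALL i. i ~: S --> z $ i : p ` B) --> h z = 0" for S :: "'m set"
  using finite[of S]
 proof (induction S rule: finite_induct)
  case empty
  show ?case
  proof (intro ballI impI)
   fix z :: "complex^'m" assume "ALL i. i ~: {} --> z $ i : p ` B"
   hence "ALL i. EX e. e : B & z $ i = p e" by blast
   then obtain ga :: "'m => 'b" where ga: "!!i. ga i : B & z $ i = p (ga i)" by metis
   hence "z = ?g ga" "ga : ms B" by (auto simp: vec_eq_iff)
   thus "h z = 0" using grid by simp
  qed
 next
  case (insert i S)
  show ?case
  proof (intro ballI impI)
   fix z assume z: "z : cpower U" and zS: "ALL k. k ~: insert i S --> z $ k : p ` B"
   obtain c where c: "!!t. t : U ==> h (upd z i t) = (SUM b:B. c b * u b t)" using hslice[OF z] by metis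
   have "ALL b:B. c b = 0"
   proof (rule inj)
    fix e assume e: "e : B"
    have "h (upd z i (p e)) = 0" using insert.IH z zS p[OF e] e by auto
    thus "(SUM b:B. c b * u b (p e)) = 0" using c[OF p[OF e]] by simp
   qed
   thus "h z = 0" using c[of "z $ i"] z by simp
  qed
 qed
 from this[of UNIV] have "h z = 0" if "z : cpower U" for z using that by simp
 hence "ALL z:cpower U. f z = (SUM io:ms B. C io * (PROD i:UNIV. u (io i) (z $ i)))"
  by (simp add: h_def)
 thus ?thesis by (intro exI[of _ C])
qed

section \<open>Operators in one derivation\<close>

lemma lookup_op_partial:
 "lookup (op_partial_mult v Q) (ga + single v 1) = lookup Q ga + ratfun_deriv v (lookup Q (ga + single v 1))"
proof (induction Q rule: mpol_induct)
 case (single be a)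
 have "be + single v 1 = ga + single v 1 \<longleftrightarrow> be = ga" by simp
 thus ?case by (auto simp: op_partial_single lookup_add lookup_single when_def)
qed (simp add: op_partial_add lookup_add ratfun_deriv_add)

lemma keys_subset_single: "keys al \<subseteq> {v} ==> al = single v (lookup al v)"
 by (rule poly_mapping_eqI) (auto simp: lookup_single when_def in_keys_iff subset_iff)

lemma sum_lookup_single: "(SUM w:UNIV. lookup (single (v::'v::finite) (k::nat)) w) = k"
proof -
 have "(SUM w:UNIV. lookup (single v k) w) = (SUM w:UNIV. if w = v then k else 0)"
  by (rule sum.cong) (auto simp: lookup_single when_def)
 thus ?thesis by simp
qed

lemma op_order_le_iff:
 assumes "P : diffops X {v}"
 shows "op_order P <= r \<longleftrightarrow> (ALL k>r. lookup P (single v k) = 0)"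
proof
 assume le: "op_order P <= r"
 show "ALL k>r. lookup P (single v k) = 0"
 proof (intro allI impI, rule ccontr)
  fix k assume k: "k > r" "lookup P (single v k) ~= 0"
  hence "k : (%al. SUM w:UNIV. lookup al w) ` keys P"
   by (intro image_eqI[of _ _ "single v k"]) (auto simp: sum_lookup_single in_keys_iff)
  hence "k <= op_order P" unfolding op_order_def by (intro Max_ge) auto
  thus False using le k by simp
 qed
next
 assume *: "ALL k>r. lookup P (single v k) = 0"
 have "(SUM w:UNIV. lookup al w) <= r" if "al : keys P" for al
 proof -
  have "al = single v (lookup al v)" using assms that by (intro keys_subset_single) (auto simp: diffops_def)
  then obtain k where k: "al = single v k" by blast
  hence "k <= r" using * that by (metis in_keys_iff not_le)
  thus ?thesis by (simp add: k sum_lookup_single)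
 qed
 thus "op_order P <= r" by (auto simp: op_order_def)
qed

lemma op_order_lead:
 assumes "P : diffops X {v}" "P ~= 0"
 shows "lookup P (single v (op_order P)) ~= 0"
proof
 assume z: "lookup P (single v (op_order P)) = 0"
 have hi: "lookup P (single v k) = 0" if "k >= op_order P" for k
  using op_order_le_iff[OF assms(1), of "op_order P"] z that by (cases "k = op_order P") auto
 show False
 proof (cases "op_order P")
  case 0
  have "lookup P al = 0" for al
  proof (cases "keys al \<subseteq> {v}")
   case True
   thus ?thesis using hi[of "lookup al v"] 0 keys_subset_single by (metis le0)
  qed (use assms(1) in \<open>auto simp: diffops_def in_keys_iff\<close>)
  hence "P = 0" by (intro poly_mapping_eqI) simp
  thus False using assms(2) by simp
 next
  case (Suc r)
  have "op_order P <= r" unfolding op_order_le_iff[OF assms(1)] using hi Suc by auto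
  thus False using Suc by simp
 qed
qed

text \<open>The shape of a remainder after division by an operator of order r in the derivation of
  v.\<close>

definition low_op :: "'v::linorder => nat => (nat => ('v, 'a::idom) ratfun) => ('v, 'a) diffop" where
 "low_op v r c = (SUM a<r. single (single v a) (c a))"

lemma lookup_low_op: "lookup (low_op v r c) (single v k) = (if k < r then c k else 0)"
proof -
 have "lookup (low_op v r c) (single v k) = (SUM a<r. if a = k then c k else 0)" unfolding low_op_def lookup_sum
  by (intro sum.cong refl) (auto simp: lookup_single when_def dest!: arg_cong[of _ _ "%al. lookup al v"])
 thus ?thesis by simp
qed

lemma low_op_in: "(!!a. a < r ==> c a : ratfuns X) ==> low_op v r c : diffops X {v}"
 unfolding low_op_def by (intro diffops_sum diffops_single) auto

lemma low_op_order:
 assumes "!!a. a < r ==> c a : ratfuns X" "r > 0"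
 shows "op_order (low_op v r c) < r"
proof -
 have "low_op v r c : diffops X {v}" by (rule low_op_in[OF assms(1)])
 hence "op_order (low_op v r c) <= r - 1" using assms(2) by (subst op_order_le_iff) (auto simp: lookup_low_op)
 thus ?thesis using assms(2) by simp
qed

lemma low_op_eq_0: "low_op v r c = 0 ==> a < r ==> c a = 0"
 using lookup_low_op[of v r c a] by simp

lemma low_op_eta:
 assumes "P : diffops X {v}" "!!k. k >= r ==> lookup P (single v k) = 0"
 shows "P = low_op v r (%k. lookup P (single v k))"
proof (rule poly_mapping_eqI)
 fix al
 show "lookup P al = lookup (low_op v r (%k. lookup P (single v k))) al"
 proof (cases "keys al \<subseteq> {v}")
  case True
  hence "al = single v (lookup al v)" by (rule keys_subset_single)
  then obtain k where "al = single v k" by blast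
  thus ?thesis using assms(2)[of k] by (simp add: lookup_low_op)
 next
  case False
  have "low_op v r (%k. lookup P (single v k)) : diffops X {v}"
   by (rule low_op_in) (rule diffops_lookup[OF assms(1)])
  hence "al ~: keys P" "al ~: keys (low_op v r (%k. lookup P (single v k)))"
   using False assms(1) by (auto simp: diffops_def)
  thus ?thesis by (simp add: in_keys_iff)
 qed
qed

text \<open>Commuting a derivation past the coefficients only adds terms of lower order.\<close>

lemma lookup_opi_lead:
 assumes "!!k. k > r ==> lookup L (single v k) = 0"
 shows "lookup (opi (single v s) L) (single v (s + r)) = lookup L (single v r)"
  "k > s + r ==> lookup (opi (single v s) L) (single v k) = 0"
proof -
 have "lookup ((op_partial_mult v ^^ s) L) (single v (s + r)) = lookup L (single v r) &
  (ALL k>s + r. lookup ((op_partial_mult v ^^ s) L) (single v k) = 0)" proof (induction s) case (Suc s)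
  have e: "single v (Suc k) = single v k + single v 1" for k :: nat by (simp flip: single_add)
  have "lookup ((op_partial_mult v ^^ s) L) (single v (Suc (s + r))) = 0" using Suc by blast
  moreover have "lookup ((op_partial_mult v ^^ Suc s) L) (single v k) = 0" if "k > Suc s + r" for k
  proof -
   have "k > 0" using that by simp
   then obtain k' where k': "k = Suc k'" using gr0_implies_Suc by blast
   hence "lookup ((op_partial_mult v ^^ s) L) (single v k') = 0"
    "lookup ((op_partial_mult v ^^ s) L) (single v (Suc k')) = 0" using Suc that by auto
   thus ?thesis unfolding k' funpow.simps comp_def e lookup_op_partial by simp
  qed
  ultimately show ?case using Suc unfolding funpow.simps comp_def add_Suc e lookup_op_partial by simp
 qed (use assms in simp)
 thus "lookup (opi (single v s) L) (single v (s + r)) = lookup L (single v r)"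
  "k > s + r ==> lookup (opi (single v s) L) (single v k) = 0" by (auto simp: multi_iter_single)
qed

text \<open>Right division: subtracting a left multiple of L with the same leading term lowers the
  order and does not leave \<open>ratfuns X\<close>.\<close>

lemma op_division:
 assumes L: "L : diffops X {v}" "L ~= 0" and P: "P : diffops X {v}"
 shows "EX A:diffops X {v}. EX c. (ALL a. c a : ratfuns X) & P = op_mult A L + low_op v (op_order L) c"
proof -
 let ?r = "op_order L" and ?l = "lookup L (single v (op_order L))"
 have l: "?l ~= 0" by (rule op_order_lead[OF L])
 have hiL: "lookup L (single v k) = 0" if "k > ?r" for k using op_order_le_iff[OF L(1), of ?r] that by auto
 have div: "EX A:diffops X {v}. EX c. (ALL a. c a : ratfuns X) & P = op_mult A L + low_op v ?r c"
  if "P : diffops X {v}" "!!k. k >= N ==> lookup P (single v k) = 0" for N P using that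
 proof (induction N arbitrary: P)
  case 0
  show ?case
   by (rule bexI[of _ 0], rule exI[of _ "%_. 0"]) (use low_op_eta[OF 0(1), of 0] 0(2) in \<open>auto simp: low_op_def\<close>)
 next
  case (Suc N)
  show ?case
  proof (cases "N < ?r")
   case True
   thus ?thesis using low_op_eta[OF Suc.prems(1), of ?r] Suc.prems(2) diffops_lookup[OF Suc.prems(1)]
    by (intro bexI[of _ 0] exI[of _ "%k. lookup P (single v k)"]) auto
  next
   case False
   define s where "s = N - ?r"
   have N: "N = s + ?r" using False by (simp add: s_def)
   define q where "q = lookup P (single v N) / ?l"
   define B where "B = single (single v s) q"
   have q: "q : ratfuns X" unfolding q_def
    by (intro ratfuns_divide diffops_lookup[OF Suc.prems(1)] diffops_lookup[OF L(1)])
   have B: "B : diffops X {v}" unfolding B_def by (rule diffops_single) (use q in auto)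
   have "EX A:diffops X {v}. EX c. (ALL a. c a : ratfuns X) & P - op_mult B L = op_mult A L + low_op v ?r c"
   proof (rule Suc.IH)
    show "P - op_mult B L : diffops X {v}" by (intro diffops_diff diffops_mult Suc.prems B L)
    fix k assume "k >= N"
    thus "lookup (P - op_mult B L) (single v k) = 0"
     using lookup_opi_lead(1)[of ?r L v s, OF hiL] lookup_opi_lead(2)[of ?r L v s k, OF hiL] Suc.prems(2)[of k] l
     by (cases "k = N") (auto simp: lookup_minus B_def op_mult_single N q_def)
   qed
   then obtain A c where A: "A : diffops X {v}" "ALL a. c a : ratfuns X" "P - op_mult B L = op_mult A L + low_op v ?r c"
    by blast
   have "P = op_mult (A + B) L + low_op v ?r c" using A(3) by (simp add: op_mult_add_left algebra_simps)
   moreover have "A + B : diffops X {v}" by (rule diffops_add[OF A(1) B])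
   ultimately show ?thesis using A(2) by (intro bexI[of _ "A + B"] exI[of _ c]) auto
  qed
 qed
 have "lookup P (single v k) = 0" if "k >= Suc (op_order P)" for k
  using op_order_le_iff[OF P, of "op_order P"] that by auto
 thus ?thesis by (rule div[OF P])
qed

section \<open>The operators of the system\<close>

global_interpretation cid: coeff_embedding "id :: complex => complex" by (rule coeff_embedding_id)

lemma funpow_cpartial: "(cpartial v ^^ k) F z = (deriv ^^ k) (%t. F (upd z v t)) (z $ v)"
proof (induction k arbitrary: z)
 case (Suc k)
 have e: "(cpartial v ^^ k) F (upd z v t) = (deriv ^^ k) (%t. F (upd z v t)) t" for t unfolding Suc by simp
 have "(cpartial v ^^ Suc k) F z = deriv (%t. (cpartial v ^^ k) F (upd z v t)) (z $ v)"
  unfolding funpow.simps comp_def by (rule cpartial_upd)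
 thus ?case by (simp add: e)
qed simp

text \<open>The operator \<open>Top\<close> with its coefficients read as polynomials, so that the
  factor 1 clears it.\<close>

definition Tpoly :: "nat => nat => 'm => ('m::{finite,linorder} option, complex) polyop" where
 "Tpoly n j i = (let M = n - CARD('m); x = single (single None 1) 1; y = single (single (Some i) 1) 1;
   t = (%a k. single (single (Some i) k) a) in
   if j = 1 then t y 2 + t (of_nat (M + 1)) 1 - t x 0
   else t y 3 + t (of_nat M - y + 2) 2 - t (x + of_nat (M + j) + 1) 1 + t x 0)"

lemma Fract_add_1: "Fract (a + b) (1 :: 'a::idom) = Fract a 1 + Fract b 1"
 by simp

lemma Fract_diff_1: "Fract (a - b) (1 :: 'a::idom) = Fract a 1 - Fract b 1"
 by simp

lemma Fract_2: "(2 :: ('a::idom) fract) = Fract 2 1"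
 using Fract_of_nat[of 2] by (metis of_nat_numeral)

lemma Top_emb: "Top n j i = emb (Tpoly n j (i::'m::{finite,linorder}))"
proof (cases "j = 1")
 case True
 thus ?thesis unfolding Top_def Pop_def Tpoly_def Let_def
  by (simp only: simp_thms if_True emb_add emb_diff emb_single ratfun_var_def Fract_of_nat)
next
 case False
 thus ?thesis unfolding Top_def Qop_def Tpoly_def Let_def
  by (simp only: if_False emb_add emb_diff emb_single ratfun_var_def Fract_of_nat Fract_2
    Fract_add_1 Fract_diff_1 One_fract_def)
qed

lemma pact_Top:
 fixes i :: "'m::{finite,linorder}"
 assumes "open U" "z $ Some i : U" "(%t. F (upd z (Some i) t)) holomorphic_on U"
 shows "cid.pact (Tpoly n j i) F z =
  Tode (n - CARD('m)) (z $ None) j (%t. F (upd z (Some i) t)) (z $ Some i)" proof -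
 let ?D = "%k. (deriv ^^ k) (%t. F (upd z (Some i) t)) (z $ Some i)"
 have s: "{..3::nat} = {0, 1, 2, 3}" "{..2::nat} = {0, 1, 2}" by auto
 note ev = cid.pact_add cid.pact_diff cid.pact_single multi_iter_single funpow_cpartial
  cid.mpol_eval_add cid.mpol_eval_diff cid.mpol_eval_var cid.mpol_eval_of_nat cid.mpol_eval_numeral cid.mpol_eval_1
 show ?thesis
 proof (cases "j = 1")
  case True
  have "cid.pact (Tpoly n j i) F z = z $ Some i * ?D 2 + of_nat (n - CARD('m) + 1) * ?D 1 - z $ None * ?D 0"
   unfolding Tpoly_def Let_def using True by (simp only: simp_thms if_True ev)
  thus ?thesis unfolding Tode_expand[OF assms(1,3,2)] using True by (simp add: dord_def tcoef_def s)
 next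
  case False
  have "cid.pact (Tpoly n j i) F z = z $ Some i * ?D 3 + (of_nat (n - CARD('m)) - z $ Some i + 2) * ?D 2
    - (z $ None + of_nat (n - CARD('m) + j) + 1) * ?D 1 + z $ None * ?D 0"
   unfolding Tpoly_def Let_def using False by (simp only: if_False ev)
  thus ?thesis unfolding Tode_expand[OF assms(1,3,2)] using False by (simp add: dord_def tcoef_def s algebra_simps)
 qed
qed

lemma Top_in: "Top n j i : diffops {None, Some i} {Some i}"
 unfolding Top_def Pop_def Qop_def Let_def
 by (auto intro!: diffops_add diffops_diff diffops_single ratfuns_add ratfuns_diff ratfun_var_in
   simp: ratfuns_of_nat[of 2, simplified])

lemma lookup_Top:
 fixes i :: "'m::{finite,linorder}"
 shows "lookup (Top n j i) (single (Some i) (dord j)) = ratfun_var (Some i)"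
  "k > dord j ==> lookup (Top n j i) (single (Some i) k) = 0"
proof -
 have s: "single (Some i) a = single (Some i) b \<longleftrightarrow> a = b" for a b :: nat
  by (metis lookup_single_eq)
 have s0: "(0 = single (Some i) b) = (b = 0)" "(single (Some i) b = 0) = (b = 0)" for b :: nat
  using s[of 0 b] s[of b 0] by auto
 show "lookup (Top n j i) (single (Some i) (dord j)) = ratfun_var (Some i)"
  "k > dord j ==> lookup (Top n j i) (single (Some i) k) = 0"
  by (auto simp: Top_def Pop_def Qop_def Let_def dord_def lookup_add lookup_minus lookup_single when_def s s0)
qed

lemma ratfun_var_nz: "ratfun_var v ~= (0 :: ('v::linorder, 'a::idom) ratfun)"
 unfolding ratfun_var_def Fract_1_eq_0 by (metis lookup_single_eq lookup_zero zero_neq_one)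

lemma Top_order:
 fixes i :: "'m::{finite,linorder}"
 shows "op_order (Top n j i) = dord j" "Top n j i ~= 0"
proof -
 show nz: "Top n j i ~= 0" using lookup_Top(1)[of n j i] ratfun_var_nz[of "Some i"] by auto
 have "op_order (Top n j i) <= dord j" unfolding op_order_le_iff[OF Top_in] by (auto simp: lookup_Top)
 moreover have "\<not> op_order (Top n j i) <= dord j - 1"
 proof
  assume "op_order (Top n j i) <= dord j - 1"
  moreover have "dord j > dord j - 1" by (simp add: dord_def)
  ultimately have "lookup (Top n j i) (single (Some i) (dord j)) = 0" unfolding op_order_le_iff[OF Top_in] by blast
  thus False by (metis lookup_Top(1) ratfun_var_nz)
 qed
 ultimately show "op_order (Top n j i) = dord j" by simp
qed

section \<open>Functions on slices\<close>

definition slice :: "complex => complex set => (complex^('m::finite option)) set" where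
 "slice x0 U = {p. p $ None = x0 & (ALL i. p $ Some i : U)}"

text \<open>An open neighbourhood of every slice over an open U: smoothness refers to open sets in
  all m + 1 variables, although x is fixed on the slice.\<close>

definition tube :: "complex set => (complex^('m::finite option)) set" where
 "tube U = {p. ALL i. p $ Some i : U}"

lemma open_tube: "open U ==> open (tube U :: (complex^('m::finite option)) set)"
proof -
 assume U: "open U"
 have "tube U = (\<Inter>i. (%p::complex^('m option). p $ Some i) -` U)" by (auto simp: tube_def)
 moreover have "open ((%p::complex^('m option). p $ Some i) -` U)" for i by (rule open_vimage_vec_nth[OF U])
 ultimately show ?thesis by auto
qed

lemma open_cpower: "open U ==> open (cpower U :: (complex^('m::finite)) set)"
proof -
 assume U: "open U"
 have "cpower U = (\<Inter>i. (%p::complex^'m. p $ i) -` U)" by auto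
 moreover have "open ((%p::complex^'m. p $ i) -` U)" for i by (rule open_vimage_vec_nth[OF U])
 ultimately show ?thesis by auto
qed

lemma slice_tube: "slice x0 U \<subseteq> tube U"
 by (auto simp: slice_def tube_def)

text \<open>Constant in x: the factors solve the equations for one value x0, so relations are tested
  on \<open>slice x0 U\<close>.\<close>

definition pfun :: "('m::finite => complex => complex) => complex^('m option) => complex" where
 "pfun u p = (PROD i:UNIV. u i (p $ Some i))"

lemma smooth_pfun:
 assumes "open U" "!!i. u i holomorphic_on U"
 shows "smooth (tube U) (pfun u)"
proof -
 have "smooth (tube U) (%p. PROD i:UNIV. u i (p $ Some i))"
  by (intro smooth_prod open_tube[OF assms(1)] smooth_of_component[OF _ assms(1) _ assms(2)]) (auto simp: tube_def)
 thus ?thesis by (simp add: pfun_def[abs_def])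
qed

lemma pfun_upd: "pfun u (upd z (Some i) t) = u i t * (PROD k:UNIV-{i}. u k (z $ Some k))"
 unfolding pfun_def by (subst prod.remove[of _ i]) (auto intro!: prod.cong)

lemma multi_iter_pfun:
 assumes U: "open U" and u: "!!i. u i holomorphic_on U" and z: "z : tube U" and "lookup be None = 0"
 shows "multi_iter cpartial be (pfun u) z = pfun (%i. (deriv ^^ lookup be (Some i)) (u i)) z"
proof -
 note T = open_tube[OF U] smooth_pfun[OF U u]
 have "lookup be None = 0 --> (ALL z:tube U. multi_iter cpartial be (pfun u) z = pfun (%i. (deriv ^^ lookup be (Some i)) (u i)) z)"
 proof (induction be rule: multiindex_induct)
  case (step be v)
  show ?case
  proof (intro impI ballI)
   fix z :: "complex^('a option)" assume 0: "lookup (be + single v 1) None = 0" and z: "z : tube U"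
   have "v ~= None"
   proof
    assume "v = None"
    thus False using 0 by (simp add: lookup_add)
   qed
   then obtain i where v: "v = Some i" by auto
   have b0: "lookup be None = 0" using 0 by (simp add: lookup_add)
   let ?u = "%i. (deriv ^^ lookup be (Some i)) (u i)"
   have hu: "?u i holomorphic_on U" for i by (rule holomorphic_higher_deriv[OF u U])
   have zi: "z $ Some i : U" using z by (simp add: tube_def)
   have "multi_iter cpartial (be + single v 1) (pfun u) z = cpartial v (pfun ?u) z"
    unfolding smooth_multi_iter(2)[OF T z] by (rule cpartial_cong[OF T(1) z]) (use step b0 in auto)
   also have "... = deriv (?u i) (z $ Some i) * (PROD k:UNIV-{i}. ?u k (z $ Some k))"
    unfolding cpartial_upd v pfun_upd by (intro DERIV_imp_deriv DERIV_cmult_right holomorphic_derivI[OF hu U zi])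
   also have "... = pfun (%i. (deriv ^^ lookup (be + single v 1) (Some i)) (u i)) z"
   proof -
    have "(PROD k:UNIV-{i}. ?u k (z $ Some k)) = (PROD k:UNIV-{i}. (deriv ^^ lookup (be + single v 1) (Some k)) (u k) (z $ Some k))"
     by (intro prod.cong refl) (auto simp: v lookup_add lookup_single when_def)
    thus ?thesis unfolding pfun_def by (subst prod.remove[of UNIV i]) (auto simp: v lookup_add)
   qed
   finally show "multi_iter cpartial (be + single v 1) (pfun u) z =
    pfun (%i. (deriv ^^ lookup (be + single v 1) (Some i)) (u i)) z" . qed qed simp
 thus ?thesis using assms by blast
qed

lemma eventually_slice:
 fixes z :: "complex^('m::finite option)"
 assumes "open U" "z : slice x0 U"
 shows "\<forall>\<^sub>F t in nhds (z $ Some i). upd z (Some i) t : slice x0 U"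
proof -
 have "z : tube U" using assms(2) slice_tube by blast
 from eventually_upd[OF open_tube[OF assms(1)] this, of "Some i"]
 show ?thesis by eventually_elim (use assms(2) in \<open>auto simp: slice_def tube_def\<close>)
qed

lemma slice_dense:
 fixes d :: "('m::{finite,linorder} option, complex) mpol"
 assumes U: "open U" and z: "z : slice x0 U" and e: "e > 0"
  and y: "y $ None = x0" "mpol_eval id d y ~= 0"
 shows "EX w:slice x0 U. dist w z < e & mpol_eval id d w ~= 0"
proof -
 have "z : tube U" using z slice_tube by blast
 then obtain r where r: "r > 0" "ball z r \<subseteq> tube U" using open_tube[OF U] open_contains_ball by metis
 obtain w where w: "ALL v. v ~: range Some --> w $ v = z $ v" "dist w z < min e r" "mpol_eval id d w ~= 0"
  using cid.mpol_eval_dense[OF y(2), of "range Some" z "min e r"] y(1) z e r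
  by (auto simp: slice_def) (metis not_None_eq rangeI)
 have "w : tube U" using w(2) r(2) by (auto simp: dist_commute)
 moreover have "w $ None = x0" using w(1) z by (auto simp: slice_def)
 ultimately show ?thesis using w by (intro bexI[of _ w]) (auto simp: slice_def tube_def)
qed

text \<open>E depends on P and the family alone: the bad x0 are those at which the polynomial d
  obtained from \<open>Kill\<close> vanishes identically.\<close>

lemma annihilates_slice:
 fixes \<F> :: "((complex^('m::{finite,linorder} option) => complex) \<times> (complex^('m option)) set) set"
 assumes P: "P : cid.Kill \<F>"
 shows "EX E. finite E & (ALL x0 U F. x0 ~: E --> open U --> smooth (tube U) F --> (F, slice x0 U) : \<F> -->
  annihilates id P F (slice x0 U))" proof -
 obtain d Q where d: "clears d P Q" and Q: "!!F W z. (F, W) : \<F> ==> z : W ==> cid.pact Q F z = 0"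
  by (rule cid.KillE[OF P]) (rule that)
 let ?E = "{t. ALL z :: complex^('m option). z $ None = t --> mpol_eval id d z = 0}"
 have "d ~= 0" using d by (simp add: clears_def)
 hence "finite ?E" by (rule cid.finite_bad_parameters)
 moreover have "annihilates id P F (slice x0 U)"
  if x0: "x0 ~: ?E" and U: "open U" and F: "smooth (tube U) F" "(F, slice x0 U) : \<F>" for x0 U F
 proof -
  obtain y :: "complex^('m option)" where y: "y $ None = x0" "mpol_eval id d y ~= 0" using x0 by blast
  show ?thesis by (rule cid.annihilates_of_clears[OF d Q[OF F(2)] open_tube[OF U] F(1) slice_tube])
    (auto intro: slice_dense[OF U _ _ y])
 qed
 ultimately show ?thesis by blast
qed

text \<open>All parameter values and domains are treated at once, so that one clearing of denominators
  serves all of them.\<close>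

definition Fam :: "nat => ('m => nat) =>
  ((complex^('m::{finite,linorder} option) => complex) \<times> (complex^('m option)) set) set" where
 "Fam n J = {(pfun u, slice x0 U) | u x0 U. open U & x0 ~= 0 & (ALL i. u i : Vsol (n - CARD('m)) x0 U (J i))}"

lemma Fam_admissible: "cid.admissible (range Some) (Fam n J)"
 unfolding cid.admissible_def
proof (clarify, goal_cases)
 case (1 F W)
 then obtain u x0 U where F: "F = pfun u" "W = slice x0 U" and U: "open U" and u: "!!i. u i holomorphic_on U"
  by (auto simp: Fam_def Vsol_def)
 show ?case by (rule exI[of _ "tube U"])
   (use U u in \<open>auto simp: F slice_tube[THEN subsetD] intro!: open_tube smooth_pfun eventually_slice\<close>)
qed

lemma Top_Kill:
 fixes i :: "'m::{finite,linorder}"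
 shows "Top n (J i) i : cid.Kill (Fam n J)" unfolding Top_emb
proof (rule cid.KillI[OF clears_emb])
 fix F W z assume "(F, W) : Fam n J" and zW: "z : W"
 then obtain u x0 U where F: "F = pfun u" "W = slice x0 U" and U: "open U"
  and u: "!!i. u i : Vsol (n - CARD('m)) x0 U (J i)" by (auto simp: Fam_def)
 have z: "z $ Some i : U" "z $ None = x0" using zW F by (auto simp: slice_def)
 have hol: "u i holomorphic_on U" and T: "Tode (n - CARD('m)) x0 (J i) (u i) (z $ Some i) = 0"
  using u[of i] z by (auto simp: Vsol_def)
 let ?r = "PROD k:UNIV-{i}. u k (z $ Some k)"
 have sl: "(%t. F (upd z (Some i) t)) = (%t. SUM k:{i}. ?r * u k t)"
  by (simp add: F pfun_upd mult.commute fun_eq_iff)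
 have "(%t. F (upd z (Some i) t)) holomorphic_on U"
  unfolding sl using hol by (auto intro!: holomorphic_intros)
 from pact_Top[OF U z(1) this]
 show "cid.pact (Tpoly n (J i) i) F z = 0"
  unfolding sl using Tode_lincomb[OF U _ z(1), of "{i}" u "n - CARD('m)" x0 "J i" "%_. ?r"] hol T z(2) by simp
qed

section \<open>The least common left multiple\<close>

abbreviation Dvar :: "'m => ('m::{finite,linorder} option, complex) diffop set" where
 "Dvar i \<equiv> diffops {None, Some i} {Some i}"

text \<open>Membership in the left ideal generated by T; applied to differences it is congruence
  modulo T.\<close>

definition rmult :: "'m => ('m::{finite,linorder} option, complex) diffop => ('m option, complex) diffop => bool" where
 "rmult i T P \<longleftrightarrow> (EX A:Dvar i. P = op_mult A T)"

definition common_mult :: "nat => 'm => ('m::{finite,linorder} option, complex) diffop => bool" where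
 "common_mult n i P \<longleftrightarrow> P : Dvar i & (ALL j:{1..CARD('m)}. rmult i (Top n j i) P)"

lemma rmult_0 [simp]: "rmult i T 0"
 unfolding rmult_def by (rule bexI[of _ 0]) auto

lemma rmult_add: "rmult i T P ==> rmult i T Q ==> rmult i T (P + Q)"
 unfolding rmult_def
proof (elim bexE)
 fix A B assume "A : Dvar i" "P = op_mult A T" "B : Dvar i" "Q = op_mult B T"
 thus "EX A:Dvar i. P + Q = op_mult A T"
  by (intro bexI[of _ "A + B"]) (auto simp: op_mult_add_left intro: diffops_add)
qed

lemma rmult_diff: "rmult i T P ==> rmult i T Q ==> rmult i T (P - Q)"
 unfolding rmult_def
proof (elim bexE)
 fix A B assume "A : Dvar i" "P = op_mult A T" "B : Dvar i" "Q = op_mult B T"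
 thus "EX A:Dvar i. P - Q = op_mult A T"
  by (intro bexI[of _ "A - B"]) (auto simp: op_mult_diff_left intro: diffops_diff)
qed

lemma rmult_sum: "(!!k. k : A ==> rmult i T (f k)) ==> rmult i T (sum f A)"
 by (induction A rule: infinite_finite_induct) (auto intro: rmult_add)

lemma rmult_mult: "A : Dvar i ==> rmult i T P ==> rmult i T (op_mult A P)"
 unfolding rmult_def
proof (elim bexE)
 fix B assume "A : Dvar i" "B : Dvar i" "P = op_mult B T"
 thus "EX C:Dvar i. op_mult A P = op_mult C T"
  by (intro bexI[of _ "op_mult A B"]) (auto simp: op_mult_assoc intro: diffops_mult)
qed

lemma rmult_scale: "c : ratfuns {None, Some i} ==> rmult i T P ==> rmult i T (op_scale c P)"
 unfolding op_scale_eq_mult by (rule rmult_mult) (auto intro: diffops_single)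

lemma rmult_self: "rmult i T T"
 unfolding rmult_def by (rule bexI[of _ op_one]) auto

lemma Dvar_lambda: "Dvar i \<subseteq> lambda_diffops"
 by (auto intro: diffops_mono)

text \<open>The disc lies in the right half plane; it is the domain on which algebraic statements
  are tested.\<close>

lemma log_branch_Ln: "log_branch (ball 2 1) Ln"
proof -
 have "y ~: \<real>\<^sub>\<le>\<^sub>0 & y ~= 0" if "y : ball 2 1" for y :: complex
 proof -
  have "\<bar>Re (2 - y)\<bar> < 1" using abs_Re_le_cmod[of "2 - y"] that by (simp add: dist_norm)
  hence "Re y > 0" by auto
  thus ?thesis by (auto simp: complex_nonpos_Reals_iff)
 qed
 thus ?thesis unfolding log_branch_def by (auto intro!: holomorphic_intros)
qed

lemma pact_one_variable:
 fixes Q :: "('v::{finite,linorder}, complex) polyop"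
 assumes "!!al. al : keys Q ==> keys al \<subseteq> {v}" "!!k. k > r ==> lookup Q (single v k) = 0"
 shows "cid.pact Q F z = (SUM k<=r. mpol_eval id (lookup Q (single v k)) z * (cpartial v ^^ k) F z)"
proof -
 have inj: "inj_on (%k::nat. single v k) {..r}" by (rule inj_onI) (metis lookup_single_eq)
 have "keys Q \<subseteq> (%k. single v k) ` {..r}"
 proof
  fix al assume a: "al : keys Q"
  obtain k where k: "al = single v k" using keys_subset_single[OF assms(1)[OF a]] by blast
  hence "k <= r" using assms(2)[of k] a by (metis in_keys_iff not_le)
  thus "al : (%k. single v k) ` {..r}" using k by blast
 qed
 thus ?thesis
  by (subst cid.pact_superset[of "(%k. single v k) ` {..r}"]) (auto simp: sum.reindex[OF inj] multi_iter_single)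
qed

lemma clears_keys:
 assumes "clears d P Q" "al : keys Q"
 shows "al : keys P" using assms by (auto simp: clears_iff in_keys_iff) (metis Fract_1_eq_0 mult_zero_right)

lemma clears_lookup_0: "clears d P Q ==> lookup Q al = 0 \<longleftrightarrow> lookup P al = 0"
 unfolding clears_iff by (metis Fract_1_eq_0 mult_eq_0_iff)

text \<open>Freezing the other variables at w turns the relation into an ordinary equation for
  \<open>u i\<close>, multiplied by the nonzero product of the other factors.\<close>

lemma slice_ode:
 fixes Q :: "('m::{finite,linorder} option, complex) polyop"
 assumes w: "w : slice x0 U" and U: "open U" and u: "!!k. u k holomorphic_on U"
  and keys: "!!al. al : keys Q ==> keys al \<subseteq> {Some i}" "!!k. k > r ==> lookup Q (single (Some i) k) = 0"
  and nz: "!!k. k ~= i ==> u k (w $ Some k) ~= 0"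
  and kill: "!!z. z : slice x0 U ==> cid.pact Q (pfun u) z = 0"
 shows "u i : Osol r (%k y. mpol_eval id (lookup Q (single (Some i) k)) (upd w (Some i) y)) U"
proof -
 let ?c = "PROD k:UNIV-{i}. u k (w $ Some k)"
 have c: "?c ~= 0" using nz by (simp add: prod_zero_iff)
 have "(SUM k<=r. mpol_eval id (lookup Q (single (Some i) k)) (upd w (Some i) y) * (deriv ^^ k) (u i) y) = 0"
  if y: "y : U" for y
 proof -
  let ?z = "upd w (Some i) y"
  have z: "?z : slice x0 U" using w y by (auto simp: slice_def)
  have d: "(cpartial (Some i) ^^ k) (pfun u) ?z = ?c * (deriv ^^ k) (u i) y" for k
  proof -
   have "(%t. pfun u (upd ?z (Some i) t)) = (%t. SUM k:{i}. ?c * u k t)"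
    by (simp add: pfun_upd mult.commute fun_eq_iff)
   thus ?thesis unfolding funpow_cpartial using higher_deriv_lincomb[OF U _ y, of "{i}" u] u by simp
  qed
  have "0 = cid.pact Q (pfun u) ?z" using kill[OF z] by simp
  also have "... = (SUM k<=r. mpol_eval id (lookup Q (single (Some i) k)) ?z * (?c * (deriv ^^ k) (u i) y))"
   by (simp add: pact_one_variable[OF keys] d)
  also have "... = ?c * (SUM k<=r. mpol_eval id (lookup Q (single (Some i) k)) ?z * (deriv ^^ k) (u i) y)"
   unfolding sum_distrib_left by (intro sum.cong refl) simp
  finally show ?thesis using c by simp
 qed
 thus ?thesis using u by (simp add: Osol_def)
qed

lemma mpol_eval_slice_holomorphic:
 "(%y. mpol_eval id p (upd w v y)) holomorphic_on U"
proof -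
 obtain q where "ALL t. mpol_eval id p (upd w v t) = poly q t" using cid.mpol_eval_slice_poly by blast
 hence "(%y. mpol_eval id p (upd w v y)) = poly q" by auto
 moreover have "poly q holomorphic_on U"
  by (meson holomorphic_onI field_differentiable_at_within field_differentiable_def poly_DERIV)
 ultimately show ?thesis by simp
qed

text \<open>For generic x0 a common multiple annihilates all spaces \<open>Vsol\<close> with index
  up to m, whose sum has dimension 3 m - 1, while an equation of order r with nonzero leading
  coefficient has at most r independent solutions.\<close>

lemma common_mult_order:
 fixes i :: "'m::{finite,linorder}"
 assumes P: "common_mult n i P" "P ~= 0"
 shows "3 * CARD('m) - 1 <= op_order P"
proof (rule ccontr)
 assume neg: "\<not> ?thesis"
 let ?m = "CARD('m)" and ?M = "n - CARD('m)" and ?U = "ball 2 1 :: complex set"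
 have m1: "?m >= 1" by (simp add: Suc_leI)
 have PD: "P : Dvar i" using P by (simp add: common_mult_def)
 have U: "open ?U" "connected ?U" "?U ~= {}" "log_branch ?U Ln" using log_branch_Ln by auto
 have kill: "P : cid.Kill (Fam n (%_. j))" if j: "j : {1..?m}" for j
 proof -
  obtain A where A: "A : Dvar i" "P = op_mult A (Top n j i)"
   using P(1) j unfolding common_mult_def rmult_def by blast
  have "A : diffops UNIV (range Some)" using A(1) Dvar_lambda by blast
  thus ?thesis unfolding A(2) by (rule cid.Kill_mult[OF Fam_admissible]) (rule Top_Kill[of n "%_. j"])
 qed
 have "ALL j:{1..?m}. EX E. finite E & (ALL x0 U F. x0 ~: E --> open U --> smooth (tube U) F -->
   (F, slice x0 U) : Fam n (%_. j) --> annihilates id P F (slice x0 U))"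
  using annihilates_slice[OF kill] by blast
 then obtain E where E: "!!j. j : {1..?m} ==> finite (E j)"
  "!!j x0 U F. j : {1..?m} ==> x0 ~: E j ==> open U ==> smooth (tube U) F ==>
   (F, slice x0 U) : Fam n (%_. j) ==> annihilates id P F (slice x0 U)" by metis
 obtain d Q where dQ: "clears d P Q" by (rule clears_exists[OF PD]) (rule that)
 let ?r = "op_order P"
 let ?q = "lookup Q (single (Some i) ?r)"
 have q: "?q ~= 0" using op_order_lead[OF PD P(2)] clears_lookup_0[OF dQ] by blast
 \<comment> \<open>Parameters at which the leading coefficient would disappear.\<close>
 let ?E0 = "{t. ALL z :: complex^('m option). z $ None = t --> mpol_eval id ?q z = 0}"
 have "finite ((UN j:{1..?m}. E j) \<union> ?E0 \<union> {0})" using E(1) cid.finite_bad_parameters[OF q] by auto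
 from ex_new_if_finite[OF infinite_UNIV_char_0 this]
 obtain x0 where x0: "x0 ~: (UN j:{1..?m}. E j) \<union> ?E0 \<union> {0}" by (rule exE)
 then obtain y where y: "y $ None = x0" "mpol_eval id ?q y ~= 0" by blast
 have "(\<chi> v. case v of None => x0 | Some _ => 2) : slice x0 ?U" by (simp add: slice_def)
 then obtain w where w: "w : slice x0 ?U" "mpol_eval id ?q w ~= 0"
  using slice_dense[OF U(1) _ zero_less_one y] by blast
 have wU: "w $ Some k : ?U" for k using w by (auto simp: slice_def)
 have x00: "x0 ~= 0" using x0 by simp
 define p where "p k y = mpol_eval id (lookup Q (single (Some i) k)) (upd w (Some i) y)" for k y
 have keysQ: "keys al \<subseteq> {Some i}" if "al : keys Q" for al
  using clears_keys[OF dQ that] PD by (auto simp: diffops_def)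
 have hiQ: "lookup Q (single (Some i) k) = 0" if "k > ?r" for k
  using op_order_le_iff[OF PD, of ?r] that clears_lookup_0[OF dQ] by blast
 have V: "u : Osol ?r p ?U" if j: "j : {1..?m}" and u: "u : Vsol ?M x0 ?U j" for j u
 proof -
  \<comment> \<open>Auxiliary factors for the other variables; the value 1 at w keeps their product
    nonzero.\<close>
  have "ALL k::'m. EX u:Vsol ?M x0 ?U j. ALL a<dord j. (deriv ^^ a) u (w $ Some k) = 1"
   using Vsol_jets[OF x00 U(1,2) wU U(4), where e = "%_. 1"] by blast
  then obtain g where g: "!!k::'m. g k : Vsol ?M x0 ?U j" "!!k a. a < dord j ==> (deriv ^^ a) (g k) (w $ Some k) = 1"
   by metis
  define h where "h k = (if k = i then u else g k)" for k
  have hV: "h k : Vsol ?M x0 ?U j" for k using u g by (simp add: h_def)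
  hence hol: "h k holomorphic_on ?U" for k by (simp add: Vsol_def)
  have "annihilates id P (pfun h) (slice x0 ?U)"
   by (rule E(2)[OF j _ U(1)]) (use x0 j hol hV x00 smooth_pfun[OF U(1)] open_ball in \<open>auto simp: Fam_def\<close>)
  hence kill: "cid.pact Q (pfun h) z = 0" if "z : slice x0 ?U" for z
   using dQ that unfolding cid.annihilates_iff by blast
  have "h k (w $ Some k) ~= 0" if "k ~= i" for k using g(2)[of 0 k] that by (simp add: h_def dord_def)
  from slice_ode[OF w(1) U(1) hol keysQ hiQ this kill]
  show ?thesis by (simp add: h_def p_def[abs_def])
 qed
 have "ALL j. EX a b. vbasis ?M x0 j a b" using vbasis_exists[OF x00] by blast
 then obtain a b where vb: "!!j. vbasis ?M x0 j (a j) (b j)" by metis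
 have "EX c. (EX k:Bidx ?m. c k ~= 0) & (ALL y:?U. (SUM k:Bidx ?m. c k * ubas ?M Ln a b k y) = 0)"
 proof (rule Osol_dependent[where N = ?r and p = p and ?y0.0 = "w $ Some i"])
  show "p k holomorphic_on ?U" for k unfolding p_def[abs_def] by (rule mpol_eval_slice_holomorphic)
  show "p ?r (w $ Some i) ~= 0" using w(2) by (simp add: p_def)
  show "?r < card (Bidx ?m)" using neg card_Bidx[OF m1] by simp
  show "ubas ?M Ln a b k : Osol ?r p ?U" if "k : Bidx ?m" for k
  proof (rule V)
   show "fst k : {1..?m}" using that by (auto simp: Bidx_def)
   show "ubas ?M Ln a b k : Vsol ?M x0 ?U (fst k)" by (rule ubas_Vsol) (use vb that U in auto)
  qed
 qed (use U wU in auto)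
 thus False using ubas_indep[OF x00 vb U] by blast
qed

text \<open>\<open>rh j k\<close> holds the coefficients of the remainder of the k-th derivative
  modulo the j-th operator, which turns divisibility into linear algebra.\<close>

lemma residues_exist:
 fixes i :: "'m::{finite,linorder}"
 obtains rh where "!!j k a. rh j k a : ratfuns {None, Some i}"
  "!!j k. rmult i (Top n j i) (single (single (Some i) k) 1 - low_op (Some i) (dord j) (rh j k))"
proof -
 have "EX c. (ALL a. c a : ratfuns {None, Some i}) &
   rmult i (Top n j i) (single (single (Some i) k) 1 - low_op (Some i) (dord j) c)" for j k proof -
  have "single (single (Some i) k) 1 : Dvar i" by (rule diffops_single) auto
  from op_division[OF Top_in Top_order(2) this, of n j] show ?thesis
   unfolding Top_order(1) rmult_def by (metis add_diff_cancel_right')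
 qed
 then obtain rh where "ALL j k. (ALL a. rh j k a : ratfuns {None, Some i}) &
   rmult i (Top n j i) (single (single (Some i) k) 1 - low_op (Some i) (dord j) (rh j k))" by metis
 thus ?thesis using that by blast
qed

lemma op_scale_low_op: "op_scale c (low_op v r f) = low_op v r (%a. c * f a)"
 by (simp add: low_op_def op_scale_sum)

lemma low_op_sum: "(SUM k:A. low_op v r (f k)) = low_op v r (%a. SUM k:A. f k a)"
proof -
 have "single al (SUM k:A. g k) = (SUM k:A. single al (g k))" for al :: "'a \<Rightarrow>\<^sub>0 nat" and g :: "'c => ('a, 'b) ratfun"
  by (induction A rule: infinite_finite_induct) (auto simp: single_add)
 thus ?thesis unfolding low_op_def by (subst sum.swap) simp
qed

lemma residue_combination:
 fixes i :: "'m::{finite,linorder}"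
 assumes rh: "!!j k. rmult i (Top n j i) (single (single (Some i) k) 1 - low_op (Some i) (dord j) (rh j k))"
  and c: "!!k. k < N ==> c k : ratfuns {None, Some i}"
 shows "rmult i (Top n j i) (low_op (Some i) N c - low_op (Some i) (dord j) (%a. SUM k<N. c k * rh j k a))"
proof -
 have "rmult i (Top n j i) (SUM k<N. op_scale (c k) (single (single (Some i) k) 1 - low_op (Some i) (dord j) (rh j k)))"
  by (intro rmult_sum rmult_scale rh c) auto
 also have "(SUM k<N. op_scale (c k) (single (single (Some i) k) 1 - low_op (Some i) (dord j) (rh j k))) =
   low_op (Some i) N c - low_op (Some i) (dord j) (%a. SUM k<N. c k * rh j k a)"
  by (simp add: op_scale_diff sum_subtractf op_scale_low_op low_op_sum) (simp add: low_op_def)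
 finally show ?thesis .
qed

text \<open>An operator of order at most 3 m - 1 has 3 m coefficients, and its remainders impose one
  condition for each of the 3 m - 1 elements of \<open>Bidx\<close>.\<close>

lemma common_mult_exists:
 fixes i :: "'m::{finite,linorder}"
 shows "EX P. common_mult n i P & P ~= 0 & op_order P <= 3 * CARD('m) - 1"
proof -
 let ?m = "CARD('m)" and ?K = "ratfuns {None, Some i} :: ('m option, complex) ratfun set"
 have m1: "?m >= 1" by (simp add: Suc_leI)
 obtain rh where rh: "!!j k a. rh j k a : ?K"
  "!!j k. rmult i (Top n j i) (single (single (Some i) k) 1 - low_op (Some i) (dord j) (rh j k))"
  by (rule residues_exist[of i n]) (rule that)
 have "EX c. (ALL k:{..<3 * ?m}. c k : ?K) & (EX k:{..<3 * ?m}. c k ~= 0) &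
  (ALL e:Bidx ?m. (SUM k:{..<3 * ?m}. c k * rh (fst e) k (snd e)) = 0)"
  by (rule more_unknowns_than_equations[OF is_subfield_ratfuns]) (use rh card_Bidx[OF m1] m1 in auto)
 then obtain c where c: "!!k. k < 3 * ?m ==> c k : ?K" "EX k<3 * ?m. c k ~= 0"
  "!!e. e : Bidx ?m ==> (SUM k<3 * ?m. c k * rh (fst e) k (snd e)) = 0" by auto
 let ?P = "low_op (Some i) (3 * ?m) c"
 have "rmult i (Top n j i) ?P" if j: "j : {1..?m}" for j
 proof -
  have "low_op (Some i) (dord j) (%a. SUM k<3 * ?m. c k * rh j k a) = 0"
   unfolding low_op_def using c(3) j by (intro sum.neutral) (force simp: Bidx_def)
  thus ?thesis using residue_combination[where rh = rh and N = "3 * ?m" and c = c and j = j, OF rh(2) c(1)] by simp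
 qed
 moreover have "?P : Dvar i" by (rule low_op_in) (rule c)
 moreover have "?P ~= 0" using c(2) low_op_eq_0 by blast
 moreover have "op_order ?P < 3 * ?m" using m1 c(1) by (intro low_op_order[where X = "{None, Some i}"]) auto
 ultimately show ?thesis by (intro exI[of _ ?P]) (auto simp: common_mult_def)
qed

lemma is_Tlclm_iff:
 fixes i :: "'m::{finite,linorder}"
 shows "is_Tlclm n i L \<longleftrightarrow> common_mult n i L & L ~= 0 & (ALL P. common_mult n i P --> P ~= 0 --> op_order L <= op_order P)"
 by (auto simp: is_Tlclm_def is_lclm_def common_mult_def rmult_def Let_def)

lemma Tlclm_exists: "EX L. is_Tlclm n i L"
proof -
 let ?C = "%P. common_mult n i P & P ~= 0"
 obtain P where "?C P" using common_mult_exists by blast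
 hence "?C (arg_min op_order ?C) & (ALL y. ?C y --> op_order (arg_min op_order ?C) <= op_order y)"
  by (rule arg_min_nat_lemma)
 thus ?thesis unfolding is_Tlclm_iff by blast
qed

lemma Tlclm_order:
 fixes i :: "'m::{finite,linorder}"
 assumes "is_Tlclm n i L"
 shows "op_order L = 3 * CARD('m) - 1"
 using assms common_mult_order[of n i L] common_mult_exists[of n i] unfolding is_Tlclm_iff
 by (meson le_antisym le_trans)

lemma common_mult_diff: "common_mult n i P ==> common_mult n i Q ==> common_mult n i (P - Q)"
 unfolding common_mult_def by (auto intro: rmult_diff diffops_diff)

lemma common_mult_mult: "A : Dvar i ==> common_mult n i P ==> common_mult n i (op_mult A P)"
 unfolding common_mult_def by (auto intro: rmult_mult diffops_mult)

text \<open>The remainder of P modulo L is a common multiple of order below the minimal one.\<close>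

lemma common_mult_lclm:
 fixes i :: "'m::{finite,linorder}"
 assumes L: "is_Tlclm n i L" and P: "common_mult n i P"
 shows "rmult i L P"
proof -
 have L': "common_mult n i L" "L ~= 0" "L : Dvar i" using L by (auto simp: is_Tlclm_iff common_mult_def)
 have PD: "P : Dvar i" using P by (simp add: common_mult_def)
 obtain A c where A: "A : Dvar i" "!!a. c a : ratfuns {None, Some i}" "P = op_mult A L + low_op (Some i) (op_order L) c"
  using op_division[OF L'(3,2) PD] by blast
 let ?R = "low_op (Some i) (op_order L) c"
 have "common_mult n i ?R" using common_mult_diff[OF P common_mult_mult[OF A(1) L'(1)]] A(3) by simp
 moreover have "op_order ?R < op_order L"
 proof (rule low_op_order[where X = "{None, Some i}"])
  have "CARD('m) >= 1" by (simp add: Suc_leI)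
  thus "op_order L > 0" using Tlclm_order[OF L] by linarith
 qed (rule A)
 ultimately have "?R = 0" using L unfolding is_Tlclm_iff by (meson not_le)
 thus ?thesis using A by (auto simp: rmult_def)
qed

text \<open>A Chinese remainder theorem: 3 m - 1 coefficients face as many prescribed remainders,
  and the system is injective because no nonzero common multiple has order below 3 m - 1.\<close>

lemma crt_exists:
 fixes i :: "'m::{finite,linorder}"
 assumes j0: "j0 : {1..CARD('m)}"
 shows "EX E:Dvar i. rmult i (Top n j0 i) (E - op_one) & (ALL j:{1..CARD('m)}. j ~= j0 --> rmult i (Top n j i) E)"
proof -
 let ?m = "CARD('m)" and ?K = "ratfuns {None, Some i} :: ('m option, complex) ratfun set"
 let ?N = "3 * ?m - 1"
 have m1: "?m >= 1" by (simp add: Suc_leI)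
 hence N0: "?N > 0" by linarith
 obtain rh where rh: "!!j k a. rh j k a : ?K"
  "!!j k. rmult i (Top n j i) (single (single (Some i) k) 1 - low_op (Some i) (dord j) (rh j k))"
  by (rule residues_exist[of i n]) (rule that)
 have low0: "low_op (Some i) (dord j) (%a. SUM k<?N. c k * rh j k a) = low_op (Some i) (dord j) (b j)"
  if "j : {1..?m}" "!!e. e : Bidx ?m ==> (SUM k<?N. c k * rh (fst e) k (snd e)) = b (fst e) (snd e)" for j c b
  unfolding low_op_def using that by (intro sum.cong refl) (force simp: Bidx_def)
 \<comment> \<open>\<open>rh j0 0\<close> is the remainder of the operator 1, the value wanted
   modulo the operator with index \<open>j0\<close>.\<close>
 have "EX c. (ALL k:{..<?N}. c k : ?K) &
  (ALL e:Bidx ?m. (SUM k:{..<?N}. c k * rh (fst e) k (snd e)) = (if fst e = j0 then rh j0 0 (snd e) else 0))"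
 proof (rule square_system_solvable[OF is_subfield_ratfuns])
  fix c assume c: "!!k. k : {..<?N} ==> c k : ?K"
   "!!e. e : Bidx ?m ==> (SUM k:{..<?N}. c k * rh (fst e) k (snd e)) = 0"
  let ?P = "low_op (Some i) ?N c"
  have "rmult i (Top n j i) ?P" if j: "j : {1..?m}" for j
   using residue_combination[where rh = rh and N = ?N and c = c and j = j, OF rh(2)] c(1)
    low0[OF j, where c = c and b = "%_ _. 0"] c(2) by (simp add: low_op_def)
  moreover have "?P : Dvar i" by (rule low_op_in) (use c in auto)
  ultimately have "common_mult n i ?P" by (simp add: common_mult_def)
  moreover have "op_order ?P < ?N" using N0 c(1) by (intro low_op_order[where X = "{None, Some i}"]) auto
  ultimately have "?P = 0" using common_mult_order[of n i ?P] by auto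
  thus "ALL k:{..<?N}. c k = 0" using low_op_eq_0[of "Some i" ?N c] by blast
 qed (use rh card_Bidx[OF m1] in auto)
 then obtain c where c: "!!k. k < ?N ==> c k : ?K"
  "!!e. e : Bidx ?m ==> (SUM k<?N. c k * rh (fst e) k (snd e)) = (if fst e = j0 then rh j0 0 (snd e) else 0)"
  by auto
 let ?E = "low_op (Some i) ?N c"
 have r: "rmult i (Top n j i) (?E - low_op (Some i) (dord j) (%a. if j = j0 then rh j0 0 a else 0))"
  if j: "j : {1..?m}" for j
  using residue_combination[where rh = rh and N = ?N and c = c and j = j, OF rh(2)] c(1)
   low0[OF j, where c = c and b = "%j a. if j = j0 then rh j0 0 a else 0"] c(2) by simp
 show ?thesis
 proof (intro bexI conjI ballI impI)
  show "?E : Dvar i" by (rule low_op_in) (rule c)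
  have "rmult i (Top n j0 i) ((?E - low_op (Some i) (dord j0) (rh j0 0)) - (single (single (Some i) 0) 1 - low_op (Some i) (dord j0) (rh j0 0)))"
   by (rule rmult_diff) (use r[OF j0] rh(2)[of j0 0] in simp_all)
  thus "rmult i (Top n j0 i) (?E - op_one)" by (simp add: op_one_def)
  show "rmult i (Top n j i) ?E" if "j : {1..?m}" "j ~= j0" for j
   using r[OF that(1)] that(2) by (simp add: low_op_def)
 qed
qed

section \<open>Products of operators in different variables\<close>

definition prodop :: "('m => ('m::{finite,linorder} option, complex) diffop) => 'm list =>
  ('m option, complex) diffop" where "prodop f L = foldr op_mult (map f L) op_one"

lemma prodop_simps [simp]: "prodop f [] = op_one" "prodop f (i # L) = op_mult (f i) (prodop f L)"
 by (simp_all add: prodop_def)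

lemma Tprod_prodop: "Tprod n j = prodop (Top n j) (sorted_list_of_set UNIV)"
 by (simp add: Tprod_def prodop_def)

lemma prodop_cong: "(!!i. i : set L ==> f i = g i) ==> prodop f L = prodop g L"
 by (induction L) auto

lemma prodop_in:
 assumes "!!i. i : set L ==> f i : Dvar i"
 shows "prodop f L : diffops (insert None (Some ` set L)) (Some ` set L)" using assms
proof (induction L)
 case (Cons i L)
 have "f i : Dvar i" using Cons.prems by simp
 hence "f i : diffops (insert None (Some ` set (i # L))) (Some ` set (i # L))" by (rule diffops_mono) auto
 moreover have "prodop f L : diffops (insert None (Some ` set (i # L))) (Some ` set (i # L))"
  by (rule diffops_mono[OF Cons.IH]) (use Cons.prems in auto)
 ultimately show ?case by (simp add: diffops_mult)
qed simp

lemma prodop_commute: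
 assumes "!!k. k : set L ==> f k : Dvar k" "g : Dvar i" "i ~: set L"
 shows "op_mult g (prodop f L) = op_mult (prodop f L) g"
 by (rule op_mult_commute[OF assms(2) prodop_in[OF assms(1)]]) (use assms(3) in auto)

lemma prodop_split:
 assumes "distinct L" "i : set L" "!!k. k : set L ==> f k : Dvar k"
 shows "prodop f L = op_mult (prodop f (remove1 i L)) (f i)" using assms
proof (induction L)
 case (Cons k L)
 show ?case
 proof (cases "k = i")
  case True
  thus ?thesis using Cons.prems prodop_commute[of L f "f i" i] by auto
 next
  case False
  hence "prodop f L = op_mult (prodop f (remove1 i L)) (f i)" using Cons by auto
  thus ?thesis using False by (simp add: op_mult_assoc)
 qed
qed simp

text \<open>Operators in different variables commute, so the factors can be regrouped.\<close>

lemma prodop_mult: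
 assumes "distinct L" "!!k. k : set L ==> f k : Dvar k" "!!k. k : set L ==> g k : Dvar k"
 shows "prodop (%k. op_mult (f k) (g k)) L = op_mult (prodop f L) (prodop g L)" using assms
proof (induction L)
 case (Cons k L)
 have c: "op_mult (g k) (prodop f L) = op_mult (prodop f L) (g k)"
  using Cons.prems by (intro prodop_commute[of _ _ _ k]) auto
 have "prodop (%k. op_mult (f k) (g k)) (k # L) = op_mult (f k) (op_mult (op_mult (g k) (prodop f L)) (prodop g L))"
  using Cons by (simp add: op_mult_assoc)
 also have "... = op_mult (op_mult (f k) (prodop f L)) (op_mult (g k) (prodop g L))"
  unfolding c by (simp add: op_mult_assoc)
 finally show ?case by simp
qed simp

lemma prodop_sum:
 assumes "distinct L" "!!i. finite (A i)"
 shows "prodop (%i. SUM a:A i. f i a) L = (SUM al:PiE (set L) A. prodop (%i. f i (al i)) L)"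
 using assms(1)
proof (induction L)
 case (Cons i L)
 have i: "i ~: set L" using Cons.prems by simp
 have "(SUM al:PiE (set (i # L)) A. prodop (%i. f i (al i)) (i # L)) =
   (SUM (a, al):A i \<times> PiE (set L) A. prodop (%k. f k ((al(i := a)) k)) (i # L))"
  unfolding list.set PiE_insert_eq using inj_combinator[OF i, of A]
  by (subst sum.reindex) (auto simp: case_prod_unfold intro!: sum.cong)
 also have "... = (SUM (a, al):A i \<times> PiE (set L) A. op_mult (f i a) (prodop (%k. f k (al k)) L))"
 proof (intro sum.cong refl, clarify)
  fix a al
  have "prodop (%k. f k ((al(i := a)) k)) L = prodop (%k. f k (al k)) L"
   by (rule prodop_cong) (use i in auto)
  thus "prodop (%k. f k ((al(i := a)) k)) (i # L) = op_mult (f i a) (prodop (%k. f k (al k)) L)" by simp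
 qed
 also have "... = op_mult (SUM a:A i. f i a) (SUM al:PiE (set L) A. prodop (%k. f k (al k)) L)"
  by (simp only: op_mult_sum_left) (simp only: op_mult_sum_right sum.cartesian_product)
 finally show ?case using Cons by simp
qed simp

lemma ratfuns_mono: "p : ratfuns X ==> X \<subseteq> Y ==> p : ratfuns Y"
 by (elim ratfunsE) (auto intro: ratfunsI)

text \<open>The coefficient \<open>c k\<close> involves only x and its own \<lambda>, so it passes
  to the left through operators in the other variables.\<close>

lemma prodop_scale:
 assumes "distinct L" "!!k. k : set L ==> c k : ratfuns {None, Some k}" "!!k. k : set L ==> g k : Dvar k"
 shows "prodop (%k. op_scale (c k) (g k)) L = op_scale (PROD k:set L. c k) (prodop g L)" using assms
proof (induction L)
 case (Cons i L)
 let ?C = "PROD k:set L. c k"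
 have C: "?C : ratfuns (insert None (Some ` set L))" using Cons.prems(2)
 proof (induction L)
  case (Cons k L)
  have "c k : ratfuns (insert None (Some ` set (k # L)))" by (rule ratfuns_mono[OF Cons.prems]) auto
  moreover have "(PROD k:set L. c k) : ratfuns (insert None (Some ` set (k # L)))"
   by (rule ratfuns_mono[OF Cons.IH]) (use Cons.prems in auto)
  ultimately show ?case by (cases "k : set L") (auto simp: insert_absorb intro: ratfuns_mult)
 qed simp
 have "op_mult (g i) (single 0 ?C) = op_mult (single 0 ?C) (g i)"
  by (rule op_mult_commute[of _ "{None, Some i}" "{Some i}" _ "insert None (Some ` set L)" "{}"])
   (use Cons.prems C in \<open>auto intro: diffops_single\<close>)
 hence "op_mult (g i) (op_scale ?C (prodop g L)) = op_scale ?C (op_mult (g i) (prodop g L))"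
  unfolding op_scale_eq_mult[of ?C] by (simp only: op_mult_assoc[symmetric])
 thus ?case using Cons by (simp add: op_mult_scale)
qed simp

definition mi :: "('m::finite => nat) => ('m option \<Rightarrow>\<^sub>0 nat)" where
 "mi al = (SUM i:UNIV. single (Some i) (al i))"

lemma lookup_mi [simp]: "lookup (mi al) (Some i) = al i" "lookup (mi al) None = 0"
proof -
 have "lookup (mi al) (Some i) = (SUM k:UNIV. if k = i then al i else 0)"
  unfolding mi_def lookup_sum by (intro sum.cong) (auto simp: lookup_single when_def)
 thus "lookup (mi al) (Some i) = al i" by simp
 show "lookup (mi al) None = 0" by (simp add: mi_def lookup_sum lookup_single when_def)
qed

lemma mi_eqI: "lookup ga None = 0 ==> ga = mi (%i. lookup ga (Some i))"
proof (rule poly_mapping_eqI)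
 fix v assume "lookup ga None = 0"
 thus "lookup ga v = lookup (mi (%i. lookup ga (Some i))) v" by (cases v) auto
qed

lemma inj_mi: "mi al = mi be \<longleftrightarrow> al = be"
 by (metis ext lookup_mi(1))

lemma keys_mi: "keys (mi al) \<subseteq> range Some"
proof
 fix v assume "v : keys (mi al)"
 thus "v : range Some" by (cases v) (auto simp: in_keys_iff)
qed

lemma prodop_single:
 "prodop (%i. single (single (Some i) (al i)) 1) (sorted_list_of_set UNIV) = single (mi al) 1"
proof -
 have "prodop (%i. single (single (Some i) (al i)) 1) L = single (\<Sum>i\<leftarrow>L. single (Some i) (al i)) 1" for L
 proof (induction L)
  case (Cons i L)
  thus ?case by (simp add: op_mult_single opi_single_const del: single_one)
 qed (simp add: op_one_def)
 thus ?thesis by (simp add: mi_def sum_list_distinct_conv_sum_set)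
qed

section \<open>The rank\<close>

abbreviation vlist :: "'m::{finite,linorder} list" where
 "vlist \<equiv> sorted_list_of_set UNIV"

lemma position_bij: "bij_betw (position :: 'm::{finite,linorder} => nat) UNIV {1..CARD('m)}"
proof -
 have mono: "position i < position k" if "i < k" for i k :: 'm
  unfolding position_def by (rule psubset_card_mono) (use that in \<open>auto intro: less_imp_le dest: leD\<close>)
 have inj: "inj (position :: 'm => nat)" by (rule injI) (metis mono less_irrefl linorder_neqE)
 have "position i : {1..CARD('m)}" for i :: 'm
 proof -
  have "i : {j. j <= i}" by simp
  hence "card {j. j <= i} > 0" by (metis card_gt_0_iff empty_iff finite)
  moreover have "card {j. j <= i} <= CARD('m)" by (intro card_mono) auto
  ultimately show ?thesis by (simp add: position_def)
 qed
 hence "range (position :: 'm => nat) \<subseteq> {1..CARD('m)}" by auto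
 moreover have "card (range (position :: 'm => nat)) = CARD('m)" by (rule card_image[OF inj])
 ultimately have "range (position :: 'm => nat) = {1..CARD('m)}" by (intro card_subset_eq) auto
 thus ?thesis using inj by (simp add: bij_betw_def)
qed

lemma position_in: "position (i::'m::{finite,linorder}) : {1..CARD('m)}"
 using position_bij bij_betwE by blast

lemma left_ideal_diff:
 assumes "left_ideal (diffops UNIV S) I" "P : I" "Q : I"
 shows "P - Q : I"
proof -
 have "op_mult (single 0 (- 1)) Q : I"
  using assms unfolding left_ideal_def by (auto intro!: diffops_single ratfuns_uminus)
 hence "- Q : I" by (simp add: op_mult_single op_scale_minus)
 thus ?thesis using assms unfolding left_ideal_def by (metis diff_conv_add_uminus)
qed

lemma left_ideal_sum:
 assumes "left_ideal D I" "!!i. i : A ==> f i : I"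
 shows "sum f A : I" using assms(2)
 by (induction A rule: infinite_finite_induct) (use assms(1) in \<open>auto simp: left_ideal_def\<close>)

lemma has_rank_of_basis:
 fixes I :: "('v::{finite,linorder}, 'a::idom) diffop set"
 assumes I: "left_ideal (diffops UNIV S) I" and La: "finite La" "card La = r"
  and b: "!!k. k : La ==> b k : (diffops UNIV S)"
  and span: "!!P. P : (diffops UNIV S) ==> EX c. P - (SUM k:La. op_scale (c k) (b k)) : I"
  and indep: "!!c. (SUM k:La. op_scale (c k) (b k)) : I ==> ALL k:La. c k = 0"
 shows "has_rank (diffops UNIV S) I r"
proof -
 obtain h where h: "bij_betw h {..<r} La"
  using ex_bij_betw_nat_finite[OF La(1)] La(2) by (auto simp: atLeast0LessThan)
 have re: "(SUM i<r. op_scale (c i) (b (h i))) = (SUM k:La. op_scale (c (the_inv_into {..<r} h k)) (b k))" for c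
 proof -
  have "(SUM i<r. op_scale (c i) (b (h i))) = (SUM i<r. op_scale (c (the_inv_into {..<r} h (h i))) (b (h i)))"
   by (intro sum.cong refl) (use h in \<open>simp add: bij_betw_def the_inv_into_f_f\<close>)
  thus ?thesis
   by (simp add: sum.reindex_bij_betw[OF h, of "%k. op_scale (c (the_inv_into {..<r} h k)) (b k)"])
 qed
 show ?thesis unfolding has_rank_def
 proof (intro exI[of _ "%i. b (h i)"] conjI allI impI ballI)
  show "b (h i) : (diffops UNIV S)" if "i < r" for i using b h that by (auto simp: bij_betw_def)
  fix P :: "('v, 'a) diffop" assume "P : (diffops UNIV S)"
  then obtain c where c: "P - (SUM k:La. op_scale (c k) (b k)) : I" using span by blast
  let ?c = "%i. if i < r then c (h i) else 0"
  have "(SUM i<r. op_scale (?c i) (b (h i))) = (SUM i:{..<r}. op_scale (c (h i)) (b (h i)))"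
   by (rule sum.cong) auto
  also have "... = (SUM k:La. op_scale (c k) (b k))" by (rule sum.reindex_bij_betw[OF h])
  finally have ex: "P - (SUM i<r. op_scale (?c i) (b (h i))) : I" using c by simp
  show "EX! c. (ALL i>=r. c i = 0) & P - (SUM i<r. op_scale (c i) (b (h i))) : I"
  proof (rule ex1I[of _ ?c])
   show "(ALL i>=r. ?c i = 0) & P - (SUM i<r. op_scale (?c i) (b (h i))) : I" using ex by simp
   fix c' assume c': "(ALL i>=r. c' i = 0) & P - (SUM i<r. op_scale (c' i) (b (h i))) : I"
   let ?d = "%i. c' i - ?c i"
   have "(P - (SUM i<r. op_scale (?c i) (b (h i)))) - (P - (SUM i<r. op_scale (c' i) (b (h i)))) : I"
    by (rule left_ideal_diff[OF I ex]) (use c' in simp)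
   hence "(SUM i<r. op_scale (?d i) (b (h i))) : I" by (simp add: op_scale_diff_left sum_subtractf)
   hence "ALL k:La. ?d (the_inv_into {..<r} h k) = 0" unfolding re by (rule indep)
   hence "?d i = 0" if "i < r" for i
    using that h by (metis (no_types, lifting) bij_betw_def image_eqI lessThan_iff the_inv_into_f_f)
   thus "c' = ?c" using c' by (auto simp: fun_eq_iff)
  qed
 qed
qed

lemma left_ideal_Int:
 assumes "!!I. I : \<I> ==> left_ideal D I" "\<I> ~= {}"
 shows "left_ideal D (\<Inter>\<I>)"
proof -
 obtain I0 where "I0 : \<I>" using assms(2) by blast
 hence "\<Inter>\<I> \<subseteq> D" using assms(1)[of I0] unfolding left_ideal_def by blast
 thus ?thesis using assms(1) unfolding left_ideal_def by blast
qed

lemma left_ideal_hull: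
 assumes "G \<subseteq> lambda_diffops"
 shows "left_ideal lambda_diffops (left_ideal lambda_diffops hull G)" "G \<subseteq> left_ideal lambda_diffops hull G"
proof -
 have "left_ideal lambda_diffops lambda_diffops" by (auto simp: left_ideal_def intro: diffops_add diffops_mult)
 hence "lambda_diffops : {I. left_ideal lambda_diffops I & G \<subseteq> I}" using assms by simp
 hence "left_ideal lambda_diffops (\<Inter>{I. left_ideal lambda_diffops I & G \<subseteq> I})"
  by (intro left_ideal_Int) blast+
 thus "left_ideal lambda_diffops (left_ideal lambda_diffops hull G)" by (simp add: hull_def)
 show "G \<subseteq> left_ideal lambda_diffops hull G" by (rule hull_subset)
qed

lemma prodop_lambda:
 assumes "!!i. f i : Dvar i"
 shows "prodop f L : lambda_diffops" by (rule diffops_mono[OF prodop_in]) (use assms in auto)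

lemma generators_lambda:
 assumes "!!i. is_Tlclm n i (L i)"
 shows "generators n L \<subseteq> lambda_diffops"
proof -
 have "L i : Dvar i" for i using assms[of i] by (simp add: is_Tlclm_iff common_mult_def)
 hence "L i : lambda_diffops" for i using Dvar_lambda by blast
 moreover have "Tprod n j : lambda_diffops" for j unfolding Tprod_prodop by (rule prodop_lambda[OF Top_in])
 ultimately show ?thesis by (auto simp: generators_def)
qed

lemma Fam_Kill_mult:
 assumes "A : lambda_diffops" "P : cid.Kill (Fam n J)"
 shows "op_mult A P : cid.Kill (Fam n J)" by (rule cid.Kill_mult[OF Fam_admissible assms])

text \<open>As J is onto, some variable i carries the j-th equation, and its factor can be moved to
  the right end of \<open>Tprod n j\<close>. The LCLM in the variable i is a left multiple of the
  operator with index \<open>J i\<close>.\<close>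

lemma generators_Kill:
 fixes J :: "'m::{finite,linorder} => nat"
 assumes J: "bij_betw J UNIV {1..CARD('m)}" and L: "!!i. is_Tlclm n i (L i)"
  and P: "P : generators n L"
 shows "P : cid.Kill (Fam n J)"
proof -
 consider j where "j : {1..CARD('m)}" "P = Tprod n j" | i where "P = L i" using P by (auto simp: generators_def)
 thus ?thesis
 proof cases
  case 1
  then obtain i where i: "J i = j" using J by (metis bij_betw_def imageE)
  have "P = op_mult (prodop (Top n j) (remove1 i vlist)) (Top n (J i) i)"
   unfolding 1 Tprod_prodop i by (rule prodop_split) (auto simp: Top_in)
  moreover have "prodop (Top n j) (remove1 i vlist) : lambda_diffops" by (rule prodop_lambda[OF Top_in])
  ultimately show ?thesis using Fam_Kill_mult[OF _ Top_Kill[of n J i]] by simp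
 next
  case 2
  have "J i : {1..CARD('m)}" using J bij_betwE by blast
  then obtain A where A: "A : Dvar i" "L i = op_mult A (Top n (J i) i)"
   using L[of i] unfolding is_Tlclm_iff common_mult_def rmult_def by blast
  hence "A : lambda_diffops" using Dvar_lambda by blast
  thus ?thesis unfolding 2 A(2) by (rule Fam_Kill_mult[OF _ Top_Kill])
 qed
qed

lemma hull_Kill:
 fixes J :: "'m::{finite,linorder} => nat"
 assumes J: "bij_betw J UNIV {1..CARD('m)}" and L: "!!i. is_Tlclm n i (L i)"
 shows "left_ideal lambda_diffops hull generators n L \<subseteq> cid.Kill (Fam n J)"
proof -
 have "left_ideal lambda_diffops (lambda_diffops \<inter> cid.Kill (Fam n J))"
  by (auto simp: left_ideal_def intro: diffops_add diffops_mult cid.Kill_add Fam_Kill_mult)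
 moreover have "generators n L \<subseteq> lambda_diffops \<inter> cid.Kill (Fam n J)"
  using generators_lambda[OF L] generators_Kill[OF J L] by blast
 ultimately have "left_ideal lambda_diffops hull generators n L \<subseteq> lambda_diffops \<inter> cid.Kill (Fam n J)"
  by (rule hull_minimal[rotated])
 thus ?thesis by blast
qed

text \<open>An operator of low order in each variable that kills all products of solutions vanishes,
  because the jets of the factors can be prescribed.\<close>

lemma Kill_low_order:
 fixes J :: "'m::{finite,linorder} => nat" and c :: "('m => nat) => ('m option, complex) ratfun"
 assumes K: "(SUM al:PiE UNIV (%i. {..<dord (J i)}). op_scale (c al) (single (mi al) 1)) : cid.Kill (Fam n J)"
  (is "?P : _") and al: "al : PiE UNIV (%i. {..<dord (J i)})"
 shows "c al = 0"
proof -
 let ?A = "PiE UNIV (%i. {..<dord (J i)})" and ?U = "ball 2 1 :: complex set" and ?M = "n - CARD('m)"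
 have U: "open ?U" "connected ?U" "log_branch ?U Ln" using log_branch_Ln by auto
 have fin: "finite ?A" by (auto intro: finite_PiE)
 have lP: "lookup ?P be = (SUM al:?A. if be = mi al then c al else 0)" for be
  unfolding lookup_sum by (intro sum.cong refl) (auto simp: lookup_single when_def)
 have lm: "lookup ?P (mi be) = (if be : ?A then c be else 0)" for be
  unfolding lP inj_mi using fin by simp
 have keysP: "EX be:?A. ga = mi be" if "ga : keys ?P" for ga
 proof (rule ccontr)
  assume "\<not> ?thesis"
  hence "lookup ?P ga = 0" unfolding lP by (intro sum.neutral) auto
  thus False using that by (simp add: in_keys_iff)
 qed
 obtain d Q where dQ: "clears d ?P Q" and Q: "!!F W z. (F, W) : Fam n J ==> z : W ==> cid.pact Q F z = 0"
  by (rule cid.KillE[OF K]) (rule that)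
 have keysQ: "keys Q \<subseteq> mi ` ?A" using keysP clears_keys[OF dQ] by blast
 have "lookup Q (mi al) = 0"
 \<comment> \<open>It suffices to evaluate at points with x ~= 0 and all \<lambda> in the disc,
   where solutions with prescribed jets exist.\<close>
 proof (rule cid.mpol_eval_zero_slice[of "%v. case v of None => - {0} | Some _ => ?U"])
  show "infinite (case v of None => - {0} | Some _ => ?U)" for v :: "'m option"
  proof (cases v)
   case None
   thus ?thesis using infinite_UNIV_char_0[where 'a = complex] by (simp add: Compl_eq_Diff_UNIV)
  next
   case (Some a)
   thus ?thesis using uncountable_ball[of 1 "2::complex"] countable_finite by auto
  qed
  fix z :: "complex^('m option)" assume z: "!!v. z $ v : (case v of None => - {0} | Some _ => ?U)"
  have z0: "z $ None ~= 0" using z[of None] by simp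
  have zU: "z $ Some i : ?U" for i using z[of "Some i"] by simp
  have "ALL i. EX u:Vsol ?M (z $ None) ?U (J i). ALL k<dord (J i). (deriv ^^ k) u (z $ Some i) = (if k = al i then 1 else 0)"
   by (intro allI Vsol_jets[OF z0 U(1,2) zU U(3)])
  then obtain u where u: "!!i. u i : Vsol ?M (z $ None) ?U (J i)"
   "!!i k. k < dord (J i) ==> (deriv ^^ k) (u i) (z $ Some i) = (if k = al i then 1 else 0)" by metis
  have hol: "u i holomorphic_on ?U" for i using u(1)[of i] by (simp add: Vsol_def)
  have zT: "z : tube ?U" "z : slice (z $ None) ?U" using zU by (auto simp: tube_def slice_def)
  have "0 = cid.pact Q (pfun u) z" using Q[of "pfun u" "slice (z $ None) ?U" z] u(1) z0 zT by (auto simp: Fam_def)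
  also have "... = (SUM ga:mi ` ?A. mpol_eval id (lookup Q ga) z * multi_iter cpartial ga (pfun u) z)"
   using fin keysQ by (intro cid.pact_superset) auto
  also have "... = (SUM be:?A. mpol_eval id (lookup Q (mi be)) z * multi_iter cpartial (mi be) (pfun u) z)"
   by (subst sum.reindex) (auto simp: inj_on_def inj_mi)
  also have "... = (SUM be:?A. mpol_eval id (lookup Q (mi be)) z * (if be = al then 1 else 0))"
  proof (intro sum.cong refl)
   fix be assume be: "be : ?A"
   have "multi_iter cpartial (mi be) (pfun u) z = (PROD i:UNIV. if be i = al i then 1 else 0)"
    unfolding multi_iter_pfun[OF U(1) hol zT(1) lookup_mi(2)] pfun_def
    using be by (intro prod.cong refl) (auto simp: u(2) PiE_def Pi_def)
   also have "... = (if be = al then 1 else 0)"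
    by (cases "be = al") (auto intro!: prod_zero simp: fun_eq_iff)
   finally show "mpol_eval id (lookup Q (mi be)) z * multi_iter cpartial (mi be) (pfun u) z =
    mpol_eval id (lookup Q (mi be)) z * (if be = al then 1 else 0)" by simp qed
  also have "... = mpol_eval id (lookup Q (mi al)) z"
   using fin al by (simp add: if_distrib[of "%x. _ * x"] cong: if_cong)
  finally show "mpol_eval id (lookup Q (mi al)) z = 0" by simp
 qed
 hence "lookup ?P (mi al) = 0" using clears_lookup_0[OF dQ] by blast
 thus ?thesis using lm al by simp
qed

definition Lidx :: "(('m::{finite,linorder} => 'm) \<times> ('m => nat)) set" where
 "Lidx = Sigma {sg. sg permutes (UNIV :: 'm set)}
  (%sg. PiE UNIV (%i. {..<dord (position (sg i))}))"

lemma prod_dord: "(PROD j:{1..m}. dord j) = 2 * 3 ^ (m - 1)" if "m >= 1"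
 using that
proof (induction m rule: dec_induct)
 case (step m)
 hence "(PROD j:{1..Suc m}. dord j) = 2 * 3 ^ (m - 1) * dord (Suc m)" by simp
 thus ?case using step by (cases m) (auto simp: dord_def)
qed (simp add: dord_def)

lemma bij_position_perm:
 "sg permutes (UNIV :: 'm::{finite,linorder} set) ==> bij_betw (%i. position (sg i)) UNIV {1..CARD('m)}"
 using bij_betw_trans[OF permutes_imp_bij position_bij] by (simp add: comp_def)

lemma finite_Lidx: "finite (Lidx :: (('m::{finite,linorder} => 'm) \<times> ('m => nat)) set)"
 unfolding Lidx_def by (auto intro!: finite_SigmaI finite_PiE finite_permutations)

lemma card_Lidx:
 "card (Lidx :: (('m::{finite,linorder} => 'm) \<times> ('m => nat)) set) = 2 * fact CARD('m) * 3 ^ (CARD('m) - 1)"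
proof -
 have "card (PiE UNIV (%i. {..<dord (position (sg i))})) = 2 * 3 ^ (CARD('m) - 1)"
  if "sg permutes (UNIV :: 'm set)" for sg
 proof -
  have "card (PiE UNIV (%i. {..<dord (position (sg i))})) = (PROD i:UNIV. dord (position (sg i)))"
   by (simp add: card_PiE)
  also have "... = (PROD j:{1..CARD('m)}. dord j)"
   by (rule prod.reindex_bij_betw[OF bij_position_perm[OF that]])
  finally show ?thesis using prod_dord[of "CARD('m)"] by (simp add: Suc_leI)
 qed
 hence "card (Lidx :: (('m => 'm) \<times> ('m => nat)) set) =
   (SUM sg:{sg. sg permutes (UNIV :: 'm set)}. 2 * 3 ^ (CARD('m) - 1))"
  unfolding Lidx_def by (subst card_SigmaI) (auto intro!: finite_PiE finite_permutations sum.cong)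
 thus ?thesis by (simp add: card_permutations mult_ac)
qed

text \<open>A basis is formed by the operators \<partial>^al E_sg for (sg, al) in
  \<open>Lidx\<close>, where E_sg multiplies, over all variables i, the Chinese remainder operators
  that select the index \<open>position (sg i)\<close>. Reduction modulo the \<open>L i\<close>
  shows that they span; products of solutions detect independence.\<close>

theorem rank_of_system:
 fixes L :: "'m::{finite,linorder} => ('m option, complex) diffop"
 assumes L: "!!i. is_Tlclm n i (L i)"
 shows "holonomic_of_rank lambda_diffops (left_ideal lambda_diffops hull generators n L)
     (2 * fact CARD('m) * 3 ^ (CARD('m) - 1))" proof - let ?m = "CARD('m)"
 define II where "II = left_ideal lambda_diffops hull generators n L"
 have I: "left_ideal lambda_diffops II" and GI: "generators n L \<subseteq> II"
  using left_ideal_hull[OF generators_lambda[OF L]] unfolding II_def by auto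
 have I_add: "P + Q : II" if "P : II" "Q : II" for P Q using I that by (auto simp: left_ideal_def)
 have I_mult: "op_mult A P : II" if "A : lambda_diffops" "P : II" for A P using I that by (auto simp: left_ideal_def)
 have LI: "L i : II" for i using GI by (auto simp: generators_def)
 have "ALL i::'m. ALL j. EX E. j : {1..?m} --> E : Dvar i & rmult i (Top n j i) (E - op_one) &
   (ALL k:{1..?m}. k ~= j --> rmult i (Top n k i) E)" proof (intro allI) fix i :: 'm and j
  show "EX E. j : {1..?m} --> E : Dvar i & rmult i (Top n j i) (E - op_one) &
    (ALL k:{1..?m}. k ~= j --> rmult i (Top n k i) E)" proof (cases "j : {1..?m}")
   case True
   from crt_exists[OF True, of i n] show ?thesis by blast
  qed auto
 qed
 hence "EX E. ALL (i::'m) j. j : {1..?m} --> E i j : Dvar i & rmult i (Top n j i) (E i j - op_one) &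
   (ALL k:{1..?m}. k ~= j --> rmult i (Top n k i) (E i j))" by (simp only: choice_iff)
 then obtain E :: "'m => nat => ('m option, complex) diffop" where
  E0: "ALL i j. j : {1..?m} --> E i j : Dvar i & rmult i (Top n j i) (E i j - op_one) &
   (ALL k:{1..?m}. k ~= j --> rmult i (Top n k i) (E i j))" by blast
 have E: "!!i j. j : {1..?m} ==> E i j : Dvar i"
  "!!i j. j : {1..?m} ==> rmult i (Top n j i) (E i j - op_one)"
  "!!i j k. j : {1..?m} ==> k : {1..?m} ==> k ~= j ==> rmult i (Top n k i) (E i j)"
  using E0 by blast+
 have posin: "position i : {1..?m}" for i :: 'm by (rule position_in)
 have posinj: "inj (position :: 'm => nat)" by (rule bij_betw_imp_inj_on[OF position_bij])
 have Epos: "E i (position k) : Dvar i" "rmult i (Top n (position k) i) (E i (position k) - op_one)" for i k :: 'm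
  using E posin by blast+
  text \<open>Operators in the other variables commute with \<open>L i\<close>.\<close>
 have I_right: "op_mult P (prodop f K) : II" if rm: "rmult i (L i) P" and "!!k. k : set K ==> f k : Dvar k" "i ~: set K" for i P f K
 proof -
  obtain A where A: "A : Dvar i" "P = op_mult A (L i)" using rm unfolding rmult_def by blast
  have "L i : Dvar i" using L[of i] by (simp add: is_Tlclm_iff common_mult_def)
  hence "op_mult P (prodop f K) = op_mult (op_mult A (prodop f K)) (L i)"
   unfolding A op_mult_assoc by (simp add: prodop_commute[OF that(2) _ that(3)])
  moreover have "prodop f K : lambda_diffops" by (rule diffops_mono[OF prodop_in[OF that(2)]]) auto
  ultimately show ?thesis using A(1) Dvar_lambda by (auto intro!: I_mult LI diffops_mult)
 qed
 \<comment> \<open>Replacing one factor modulo \<open>L i\<close> changes the product by a term that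
   \<open>I_right\<close> puts into the ideal.\<close>
 have cong: "prodop f K - prodop g K : II"
  if "distinct K" "!!i. i : set K ==> rmult i (L i) (f i - g i)"
   "!!i. i : set K ==> f i : Dvar i" "!!i. i : set K ==> g i : Dvar i" for f g K
  using that
 proof (induction K)
  case Nil
  show ?case using I by (auto simp: left_ideal_def)
 next
  case (Cons i K)
  have "op_mult (f i - g i) (prodop f K) : II" using Cons.prems by (intro I_right[of i]) auto
  moreover have "op_mult (g i) (prodop f K - prodop g K) : II"
  proof (rule I_mult)
   show "g i : lambda_diffops" using Cons.prems(4)[of i] Dvar_lambda by auto
   show "prodop f K - prodop g K : II" using Cons by auto
  qed
  moreover have "prodop f (i # K) - prodop g (i # K) =
    op_mult (f i - g i) (prodop f K) + op_mult (g i) (prodop f K - prodop g K)"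
   by (simp add: op_mult_diff_left op_mult_diff_right)
  ultimately show ?case using I_add by simp
 qed
 define EJ where "EJ J = prodop (%i. E i (J i)) vlist" for J :: "'m => nat"
 have EJ_in: "EJ J : lambda_diffops" if "!!i. J i : {1..?m}" for J
  unfolding EJ_def by (rule prodop_lambda) (use that E in auto)
 \<comment> \<open>If J misses k, every factor is a left multiple of the k-th operator, so the
   product is a left multiple of \<open>Tprod n k\<close>.\<close>
 have EJ_bad: "EJ J : II" if J: "!!i. J i : {1..?m}" and k: "k : {1..?m}" "k ~: range J" for J k
 proof -
  have "ALL i. EX B:Dvar i. E i (J i) = op_mult B (Top n k i)"
   using E(3)[OF J k(1)] k(2) unfolding rmult_def by (metis rangeI)
  then obtain B where B: "!!i. B i : Dvar i" "!!i. E i (J i) = op_mult (B i) (Top n k i)" by metis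
  have "EJ J = op_mult (prodop B vlist) (Tprod n k)"
   unfolding EJ_def B(2) Tprod_prodop by (rule prodop_mult) (auto simp: B Top_in)
  moreover have "Tprod n k : II" using GI k(1) by (auto simp: generators_def)
  ultimately show ?thesis using I_mult[OF prodop_lambda[OF B(1)]] by simp
 qed
 \<comment> \<open>In each variable the operators \<open>E i j\<close> add up to 1 modulo
   \<open>L i\<close>. Expanding the product of these sums, every J that misses some k drops out,
   and the remaining ones are the permutations.\<close>
 have one: "op_one - (SUM sg:{sg. sg permutes UNIV}. EJ (%i. position (sg i))) : II"
 proof -
  have "rmult i (L i) (op_one - (SUM j:{1..?m}. E i j))" for i
  proof (rule common_mult_lclm[OF L])
   have "rmult i (Top n k i) (op_one - (SUM j:{1..?m}. E i j))" if k: "k : {1..?m}" for k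
   proof -
    have "rmult i (Top n k i) (0 - ((E i k - op_one) + (SUM j:{1..?m}-{k}. E i j)))"
    proof (intro rmult_diff rmult_0)
     have "rmult i (Top n k i) (SUM j:{1..?m}-{k}. E i j)" by (intro rmult_sum E(3) k) auto
     thus "rmult i (Top n k i) ((E i k - op_one) + (SUM j:{1..?m}-{k}. E i j))"
      by (rule rmult_add[OF E(2)[OF k]])
    qed
    thus ?thesis using k by (simp add: sum.remove[of _ k] algebra_simps)
   qed
   moreover have "op_one - (SUM j:{1..?m}. E i j) : Dvar i" using E by (intro diffops_diff diffops_sum) auto
   ultimately show "common_mult n i (op_one - (SUM j:{1..?m}. E i j))" by (simp add: common_mult_def)
  qed
  hence "prodop (%_. op_one) vlist - prodop (%i. SUM j:{1..?m}. E i j) vlist : II"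
   using E by (intro cong) (auto intro: diffops_sum)
  moreover have "prodop (%_. op_one) K = op_one" for K :: "'m list" by (induction K) auto
  moreover have "prodop (%i. SUM j:{1..?m}. E i j) vlist = (SUM J:PiE UNIV (%_. {1..?m}). EJ J)"
   unfolding EJ_def by (subst prodop_sum) auto
  ultimately have 1: "op_one - (SUM J:PiE UNIV (%_. {1..?m}). EJ J) : II" by (simp only:)
  let ?S = "(%sg i. position (sg i)) ` {sg. sg permutes (UNIV :: 'm set)}" and ?A = "PiE UNIV (%_::'m. {1..?m})"
  have sub: "?S \<subseteq> ?A" using posin by auto
  have fin: "finite ?A" by (auto intro: finite_PiE)
  have "EJ J : II" if J: "J : ?A - ?S" for J
  proof -
   have J1: "J i : {1..?m}" for i using J by auto
   have "EX k:{1..?m}. k ~: range J"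
   proof (rule ccontr)
    assume "\<not> ?thesis"
    hence r: "range J = {1..?m}" using J1 by auto
    hence "inj J" by (intro eq_card_imp_inj_on) auto
    hence bJ: "bij_betw J UNIV {1..?m}" using r by (simp add: bij_betw_def)
    let ?sg = "%i. the_inv_into UNIV (position :: 'm => nat) (J i)"
    have "bij ?sg" using bij_betw_trans[OF bJ bij_betw_the_inv_into[OF position_bij]] by (simp add: comp_def)
    hence "?sg permutes UNIV" by (rule bij_imp_permutes) simp
    moreover have "position (?sg i) = J i" for i :: 'm
     using position_bij J1[of i] by (intro f_the_inv_into_f) (auto simp: bij_betw_def)
    hence "J = (%i. position (?sg i))" by (simp add: fun_eq_iff)
    ultimately have "J : ?S" by (intro image_eqI[of _ _ ?sg]) simp_all
    thus False using J by simp
   qed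
   then obtain k where "k : {1..?m}" "k ~: range J" by blast
   thus ?thesis by (rule EJ_bad[of J, OF J1])
  qed
  hence "(SUM J:?A - ?S. EJ J) : II" by (intro left_ideal_sum[OF I]) auto
  hence "op_one - (SUM J:?S. EJ J) : II"
  proof -
   have "op_one - (SUM J:?A. EJ J) + (SUM J:?A - ?S. EJ J) = op_one - (SUM J:?S. EJ J)"
    unfolding sum.subset_diff[OF sub fin, of EJ] by simp
   thus ?thesis using I_add[OF 1 \<open>(SUM J:?A - ?S. EJ J) : II\<close>] by (simp only:)
  qed
  moreover have "(SUM J:?S. EJ J) = (SUM sg:{sg. sg permutes UNIV}. EJ (%i. position (sg i)))"
  proof (subst sum.reindex)
   show "inj_on (%sg i. position (sg i)) {sg. sg permutes (UNIV :: 'm set)}"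
    by (intro inj_onI) (auto simp: fun_eq_iff inj_eq[OF posinj])
  qed simp
  ultimately show ?thesis by simp
 qed
 let ?E = "%sg::'m => 'm. EJ (%i. position (sg i))" and ?A = "%sg::'m => 'm. PiE UNIV (%i. {..<dord (position (sg i))})"
 have reduce: "EX c. op_mult (single (mi ga) 1) (?E sg) -
   (SUM al:?A sg. op_scale (c al) (op_mult (single (mi al) 1) (?E sg))) : II" for ga sg
 proof -
  let ?j = "%i. position (sg i)" and ?d = "%i k. single (single (Some i) k) 1 :: ('m option, complex) diffop"
  have dD: "?d i k : Dvar i" for i k by (rule diffops_single) auto
  have ex: "EX c. (ALL a. c a : ratfuns {None, Some i}) &
    rmult i (L i) (op_mult (?d i (ga i)) (E i (?j i)) - (SUM a<dord (?j i). op_scale (c a) (op_mult (?d i a) (E i (?j i)))))" for i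
  proof -
   let ?T = "Top n (?j i) i"
   obtain A c where A: "A : Dvar i" "ALL a. c a : ratfuns {None, Some i}"
    "?d i (ga i) = op_mult A ?T + low_op (Some i) (dord (?j i)) c"
    using op_division[OF Top_in Top_order(2) dD] unfolding Top_order(1) by blast
   \<comment> \<open>The selected operator times its Chinese remainder operator is divisible by all
     operators, hence by \<open>L i\<close>. So only derivatives of order below \<open>dord\<close>
     remain in front of the latter.\<close>
   have TE: "common_mult n i (op_mult ?T (E i (?j i)))" unfolding common_mult_def
   proof (intro conjI ballI)
    show "op_mult ?T (E i (?j i)) : Dvar i" by (intro diffops_mult Top_in E posin)
    fix k assume k: "k : {1..?m}"
    show "rmult i (Top n k i) (op_mult ?T (E i (?j i)))"
    proof (cases "k = ?j i")
     case True
     have "rmult i ?T (op_mult ?T (E i (?j i) - op_one) + ?T)"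
      by (intro rmult_add rmult_mult Top_in E posin rmult_self)
     thus ?thesis using True by (simp add: op_mult_diff_right)
    qed (intro rmult_mult Top_in E(3) posin k)
   qed
   have "op_mult (?d i (ga i)) (E i (?j i)) - (SUM a<dord (?j i). op_scale (c a) (op_mult (?d i a) (E i (?j i)))) =
     op_mult A (op_mult ?T (E i (?j i)))"
    unfolding A(3) by (simp add: op_mult_add_left op_mult_assoc low_op_def op_mult_sum_left flip: op_mult_scale)
   moreover have "rmult i (L i) (op_mult A (op_mult ?T (E i (?j i))))"
    by (intro rmult_mult A common_mult_lclm[OF L TE])
   ultimately show ?thesis using A(2) by (intro exI[of _ c]) simp
  qed
  have "EX c. ALL i. (ALL a. c i a : ratfuns {None, Some i}) &
    rmult i (L i) (op_mult (?d i (ga i)) (E i (?j i)) - (SUM a<dord (?j i). op_scale (c i a) (op_mult (?d i a) (E i (?j i)))))"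
   by (rule choice, rule allI, rule ex)
  then obtain c where c: "!!i a. c i a : ratfuns {None, Some i}"
   "!!i. rmult i (L i) (op_mult (?d i (ga i)) (E i (?j i)) - (SUM a<dord (?j i). op_scale (c i a) (op_mult (?d i a) (E i (?j i)))))"
   by blast
  have "prodop (%i. op_mult (?d i (ga i)) (E i (?j i))) vlist -
    prodop (%i. SUM a<dord (?j i). op_scale (c i a) (op_mult (?d i a) (E i (?j i)))) vlist : II"
   using c Epos dD by (intro cong) (auto intro!: diffops_sum diffops_scale diffops_mult)
  moreover have "prodop (%i. op_mult (?d i (al i)) (E i (?j i))) vlist = op_mult (single (mi al) 1) (?E sg)" for al
   unfolding EJ_def prodop_single[symmetric] by (rule prodop_mult) (use dD Epos in auto)
  moreover have "prodop (%i. SUM a<dord (?j i). op_scale (c i a) (op_mult (?d i a) (E i (?j i)))) vlist =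
    (SUM al:?A sg. op_scale (PROD i:UNIV. c i (al i)) (prodop (%i. op_mult (?d i (al i)) (E i (?j i))) vlist))"
   by (subst prodop_sum) (auto intro!: sum.cong prodop_scale[THEN trans] c diffops_mult dD Epos)
  ultimately show ?thesis by (intro exI[of _ "%al. PROD i:UNIV. c i (al i)"]) simp
 qed
 let ?b = "%(sg, al). op_mult (single (mi al) 1) (?E sg)"
 have "has_rank lambda_diffops II (2 * fact ?m * 3 ^ (?m - 1))"
 proof (rule has_rank_of_basis[OF I finite_Lidx card_Lidx])
  have bD: "op_mult (single (mi al) 1) (?E sg) : lambda_diffops" for sg al
   by (intro diffops_mult diffops_single keys_mi EJ_in posin) simp
  show "?b k : lambda_diffops" if "k : Lidx" for k by (cases k) (simp only: case_prod_conv bD)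
 next
  fix P :: "('m option, complex) diffop" assume P: "P : lambda_diffops"
  have "EX c. ALL k. op_mult (single (mi (fst k)) 1) (?E (snd k)) -
    (SUM al:?A (snd k). op_scale (c k al) (op_mult (single (mi al) 1) (?E (snd k)))) : II"
   by (rule choice, rule allI, rule reduce)
  then obtain c' where c': "!!k. op_mult (single (mi (fst k)) 1) (?E (snd k)) -
    (SUM al:?A (snd k). op_scale (c' k al) (op_mult (single (mi al) 1) (?E (snd k)))) : II" by blast
  define c where "c ga sg = c' (ga, sg)" for ga sg
  have c: "op_mult (single (mi ga) 1) (?E sg) -
    (SUM al:?A sg. op_scale (c ga sg al) (op_mult (single (mi al) 1) (?E sg))) : II" for ga sg
   using c'[of "(ga, sg)"] by (simp only: c_def fst_conv snd_conv)
  let ?g = "%ga::'m option \<Rightarrow>\<^sub>0 nat. (%i. lookup ga (Some i))"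
  have g: "mi (?g ga) = ga" if "ga : keys P" for ga
  proof -
   have "keys ga \<subseteq> range Some" using P that by (simp add: diffops_def)
   hence "None ~: keys ga" by auto
   thus ?thesis using mi_eqI[of ga] by (simp add: in_keys_iff)
  qed
  let ?S = "{sg. sg permutes (UNIV :: 'm set)}"
  let ?X = "%sg ga. op_mult (single ga 1) (?E sg) -
    (SUM al:?A sg. op_scale (c (?g ga) sg al) (op_mult (single (mi al) 1) (?E sg)))"
  \<comment> \<open>P is congruent to the sum of the products P E_sg, and in each of them every
    monomial of P is reduced by means of \<open>reduce\<close>.\<close>
  have "op_mult P (op_one - (SUM sg:?S. ?E sg)) : II" by (rule I_mult[OF P one])
  moreover have "(SUM sg:?S. SUM ga:keys P. op_scale (lookup P ga) (?X sg ga)) : II"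
  proof (intro left_ideal_sum[OF I])
   fix sg ga assume "ga : keys P"
   hence "?X sg ga : II" using c[of "?g ga" sg] g by simp
   thus "op_scale (lookup P ga) (?X sg ga) : II"
    unfolding op_scale_eq_mult[of "lookup P ga"] by (intro I_mult diffops_single) auto
  qed
  ultimately have "op_mult P (op_one - (SUM sg:?S. ?E sg)) + (SUM sg:?S. SUM ga:keys P. op_scale (lookup P ga) (?X sg ga)) : II"
   by (rule I_add)
  also have "op_mult P (op_one - (SUM sg:?S. ?E sg)) + (SUM sg:?S. SUM ga:keys P. op_scale (lookup P ga) (?X sg ga)) =
    P - (SUM sg:?S. SUM al:?A sg. op_scale (SUM ga:keys P. lookup P ga * c (?g ga) sg al) (op_mult (single (mi al) 1) (?E sg)))"
  proof -
   have 1: "op_mult P Y = (SUM ga:keys P. op_scale (lookup P ga) (op_mult (single ga 1) Y))" for Y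
    by (subst (1) op_decompose[of P]) (simp add: op_mult_sum_left op_mult_scale del: op_scale_simps(5))
   have 2: "(SUM ga:keys P. op_scale (lookup P ga) (?X sg ga)) = op_mult P (?E sg) -
     (SUM al:?A sg. op_scale (SUM ga:keys P. lookup P ga * c (?g ga) sg al) (op_mult (single (mi al) 1) (?E sg)))" for sg
    unfolding 1[of "?E sg"] op_scale_diff sum_subtractf op_scale_sum op_scale_sum_left op_scale_simps(4)
    by (subst (2) sum.swap) simp
   show ?thesis unfolding 2 by (simp add: op_mult_diff_right op_mult_sum_right sum_subtractf)
  qed
  finally have "P - (SUM sg:?S. SUM al:?A sg. op_scale (SUM ga:keys P. lookup P ga * c (?g ga) sg al) (op_mult (single (mi al) 1) (?E sg))) : II" .
  moreover have "(SUM sg:?S. SUM al:?A sg. op_scale (SUM ga:keys P. lookup P ga * c (?g ga) sg al) (op_mult (single (mi al) 1) (?E sg))) =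
   (SUM k:Lidx. op_scale (SUM ga:keys P. lookup P ga * c (?g ga) (fst k) (snd k)) (?b k))"
   unfolding Lidx_def by (subst sum.Sigma) (auto simp: case_prod_unfold intro!: finite_permutations finite_PiE)
  ultimately show "EX c. P - (SUM k:Lidx. op_scale (c k) (?b k)) : II"
   by (intro exI[of _ "%k. SUM ga:keys P. lookup P ga * c (?g ga) (fst k) (snd k)"]) simp
 next
  fix c :: "('m => 'm) \<times> ('m => nat) => ('m option, complex) ratfun"
  assume c: "(SUM k:Lidx. op_scale (c k) (?b k)) : II"
  show "ALL k:Lidx. c k = 0"
  proof
   fix k :: "('m => 'm) \<times> ('m => nat)" assume k: "k : Lidx"
   define sg where "sg = fst k"
   have sg: "sg permutes UNIV" and ak: "snd k : ?A sg" using k by (auto simp: Lidx_def sg_def)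
   let ?J = "%i. position (sg i)"
   \<comment> \<open>Modulo operators that kill the products of solutions distributed according to
     sg, E_sg acts as 1 (\<open>same\<close>) and every other E_ta as 0 (\<open>other\<close>). This
     isolates the coefficients belonging to sg.\<close>
   let ?K = "cid.Kill (Fam n ?J)"
   have TK: "op_mult A (Top n (?J i) i) : ?K" if "A : lambda_diffops" for A i
    using Fam_Kill_mult[OF that Top_Kill[of n ?J i]] .
   have right: "op_mult P (prodop f K) : ?K"
    if rm: "rmult i (Top n (?J i) i) P" and "!!k. k : set K ==> f k : Dvar k" "i ~: set K" for i P f K
   proof -
    obtain A where A: "A : Dvar i" "P = op_mult A (Top n (?J i) i)" using rm unfolding rmult_def by blast
    have "op_mult P (prodop f K) = op_mult (op_mult A (prodop f K)) (Top n (?J i) i)"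
     unfolding A op_mult_assoc by (simp add: prodop_commute[OF that(2) Top_in that(3)])
    moreover have "prodop f K : lambda_diffops" by (rule diffops_mono[OF prodop_in[OF that(2)]]) auto
    ultimately show ?thesis using A(1) Dvar_lambda by (auto intro!: TK diffops_mult)
   qed
   have other: "?E ta : ?K" if ta: "ta ~= sg" for ta
   proof -
    obtain i where i: "ta i ~= sg i" using ta by blast
    have "position (sg i) ~= position (ta i)" using i by (auto simp: inj_eq[OF posinj])
    hence rm: "rmult i (Top n (?J i) i) (E i (position (ta i)))" by (intro E posin)
    obtain A where A: "A : Dvar i" "E i (position (ta i)) = op_mult A (Top n (?J i) i)"
     using rm by (auto simp: rmult_def)
    have "?E ta = op_mult (prodop (%i. E i (position (ta i))) (remove1 i vlist)) (E i (position (ta i)))"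
     unfolding EJ_def by (rule prodop_split) (use Epos in auto)
    also have "... = op_mult (op_mult (prodop (%i. E i (position (ta i))) (remove1 i vlist)) A) (Top n (?J i) i)"
     by (simp add: A(2) op_mult_assoc)
    also have "... : ?K" using A(1) Dvar_lambda Epos by (intro TK diffops_mult prodop_lambda) auto
    finally show ?thesis .
   qed
   have same: "?E sg - op_one : ?K"
   proof -
    have "prodop (%i. E i (?J i)) K - op_one : ?K" if "distinct K" for K using that
    proof (induction K)
     case (Cons i K)
     have "op_mult (E i (?J i) - op_one) (prodop (%i. E i (?J i)) K) : ?K"
      using Cons.prems Epos by (intro right[of i]) auto
     moreover have "prodop (%i. E i (?J i)) K - op_one : ?K" by (rule Cons.IH) (use Cons.prems in simp)
     moreover have "prodop (%i. E i (?J i)) (i # K) - op_one =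
       op_mult (E i (?J i) - op_one) (prodop (%i. E i (?J i)) K) + (prodop (%i. E i (?J i)) K - op_one)"
      by (simp add: op_mult_diff_left)
     ultimately show ?case by (simp only: cid.Kill_add)
    qed simp
    thus ?thesis unfolding EJ_def by simp
   qed
   let ?S = "{sg. sg permutes (UNIV :: 'm set)}"
   let ?Y = "%ta. SUM al:?A ta. op_scale (c (ta, al)) (op_mult (single (mi al) 1) (?E ta))"
   have mono: "op_mult (single (mi al) 1) P : ?K" if "P : ?K" for al P
    by (rule Fam_Kill_mult[OF _ that], rule diffops_single[OF _ keys_mi]) simp
   have "(SUM k:Lidx. op_scale (c k) (?b k)) = (SUM ta:?S. ?Y ta)"
    unfolding Lidx_def by (subst sum.Sigma) (auto simp: case_prod_unfold intro!: finite_permutations finite_PiE)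
   also have "... = ?Y sg + (SUM ta:?S - {sg}. ?Y ta)"
    using sg by (intro sum.remove) (auto intro: finite_permutations)
   finally have "?Y sg + (SUM ta:?S - {sg}. ?Y ta) : ?K"
    using c hull_Kill[OF bij_position_perm[OF sg] L] unfolding II_def by auto
   moreover have "(SUM ta:?S - {sg}. ?Y ta) : ?K"
    by (intro cid.Kill_sum cid.Kill_scale mono other) auto
   ultimately have "?Y sg + (SUM ta:?S - {sg}. ?Y ta) - (SUM ta:?S - {sg}. ?Y ta) : ?K"
    by (rule cid.Kill_diff)
   hence "?Y sg : ?K" by (simp only: add_diff_cancel_right')
   moreover have "(SUM al:?A sg. op_scale (c (sg, al)) (op_mult (single (mi al) 1) (?E sg - op_one))) : ?K"
    by (intro cid.Kill_sum cid.Kill_scale mono same)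
   ultimately have "(SUM al:?A sg. op_scale (c (sg, al)) (op_mult (single (mi al) 1) (?E sg))) -
     (SUM al:?A sg. op_scale (c (sg, al)) (op_mult (single (mi al) 1) (?E sg - op_one))) : ?K"
    by (rule cid.Kill_diff)
   hence "(SUM al:?A sg. op_scale (c (sg, al)) (single (mi al) 1)) : ?K"
    by (simp add: op_mult_diff_right op_scale_diff sum_subtractf del: op_scale_simps(5))
   from Kill_low_order[OF this ak] show "c k = 0" by (simp add: sg_def)
  qed
 qed
 thus ?thesis using I unfolding II_def by (simp add: holonomic_of_rank_def)
qed

section \<open>Solution spaces\<close>

lemma complex_dim_span:
 fixes b :: "'k => 'b => complex"
 assumes fin: "finite La"
  and indep: "!!c. (!!z. (SUM k:La. c k * b k z) = 0) ==> ALL k:La. c k = 0"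
 shows "complex_dim {f. EX c. f = (%z. SUM k:La. c k * b k z)} = card La"
proof -
 interpret V: vector_space "%(c::complex) (f::'b => complex) z. c * f z"
  by unfold_locales (auto simp: fun_eq_iff algebra_simps)
 have sum: "(SUM k:A. (%z. c k * f k z)) = (%z. SUM k:A. c k * f k z)"
  for A :: "'k set" and c :: "'k => complex" and f :: "'k => 'b => complex"
  by (induction A rule: infinite_finite_induct) (auto simp: fun_eq_iff)
 have inj: "inj_on b La"
 proof (rule inj_onI, rule ccontr)
  fix k k' assume k: "k : La" "k' : La" "b k = b k'" "k ~= k'"
  let ?c = "%i. (if i = k then 1 else 0) - (if i = k' then 1 else 0 :: complex)"
  have "(SUM i:La. ?c i * b i z) = 0" for z
  proof -
   have "(SUM i:La. ?c i * b i z) = (SUM i:La. (if i = k then b i z else 0)) - (SUM i:La. (if i = k' then b i z else 0))"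
    unfolding sum_subtractf[symmetric] by (intro sum.cong) auto
   also have "... = 0" using k fin by simp
   finally show ?thesis .
  qed
  from bspec[OF indep[OF this] k(1)] show False using k(4) by simp
 qed
 show ?thesis
 proof (rule V.dim_unique[where B = "b ` La"])
  show "b ` La \<subseteq> {f. EX c. f = (%z. SUM k:La. c k * b k z)}"
  proof clarify
   fix k assume k: "k : La"
   have "b k = (%z. SUM i:La. (if i = k then 1 else 0) * b i z)"
   proof
    fix z
    have "(SUM i:La. (if i = k then 1 else 0) * b i z) = (SUM i:La. if i = k then b i z else 0)"
     by (intro sum.cong) auto
    thus "b k z = (SUM i:La. (if i = k then 1 else 0) * b i z)" using k fin by simp
   qed
   thus "EX c. b k = (%z. SUM i:La. c i * b i z)" by (rule exI[of _ "%i. if i = k then 1 else 0"])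
  qed
  show "{f. EX c. f = (%z. SUM k:La. c k * b k z)} \<subseteq> V.span (b ` La)"
  proof clarify
   fix c
   have "(SUM k:La. (%z. c k * b k z)) : V.span (b ` La)"
    by (intro V.span_sum V.span_scale V.span_base imageI)
   thus "(%z. SUM k:La. c k * b k z) : V.span (b ` La)" by (simp only: sum)
  qed
  show "V.independent (b ` La)"
  proof (rule V.independent_if_scalars_zero)
   fix c x assume z: "(SUM x:b ` La. (%z. c x * x z)) = 0" and x: "x : b ` La"
   have "(%z. SUM k:La. c (b k) * b k z) = 0"
    using z unfolding sum.reindex[OF inj] comp_def sum[of "%k. c (b k)" b] .
   hence "ALL k:La. c (b k) = 0" by (intro indep) (auto simp: fun_eq_iff)
   thus "c x = 0" using x by auto
  qed (use fin in simp)
 qed (simp add: card_image[OF inj])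
qed

section \<open>Holomorphic functions of several variables\<close>

definition hs_at :: "(complex^'v::finite => complex) => complex^'v => bool" where
 "hs_at f z \<longleftrightarrow> (EX D. (f has_derivative D) (at z) & (ALL c w. D (c *s w) = c * D w))"

lemma holomorphic_several_iff: "holomorphic_several S f \<longleftrightarrow> (ALL z:S. hs_at f z)"
 by (simp add: holomorphic_several_def hs_at_def)

lemma hs_at_const: "hs_at (%z. c) z"
 unfolding hs_at_def by (rule exI[of _ "%_. 0"]) auto

lemma hs_at_add: "hs_at f z ==> hs_at g z ==> hs_at (%z. f z + g z) z"
 unfolding hs_at_def
proof (elim exE conjE)
 fix D D' assume "(f has_derivative D) (at z)" "(g has_derivative D') (at z)"
  "ALL c w. D (c *s w) = c * D w" "ALL c w. D' (c *s w) = c * D' w"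
 thus "EX D. ((%z. f z + g z) has_derivative D) (at z) & (ALL c w. D (c *s w) = c * D w)"
  by (intro exI[of _ "%h. D h + D' h"]) (auto intro: has_derivative_add simp: distrib_left)
qed

lemma hs_at_mult: "hs_at f z ==> hs_at g z ==> hs_at (%z. f z * g z) z"
 unfolding hs_at_def
proof (elim exE conjE)
 fix D D' assume "(f has_derivative D) (at z)" "(g has_derivative D') (at z)"
  "ALL c w. D (c *s w) = c * D w" "ALL c w. D' (c *s w) = c * D' w"
 thus "EX D. ((%z. f z * g z) has_derivative D) (at z) & (ALL c w. D (c *s w) = c * D w)"
  by (intro exI[of _ "%h. f z * D' h + D h * g z"]) (auto intro: has_derivative_mult simp: distrib_left mult.assoc mult.left_commute)
qed

lemma hs_at_sum: "(!!i. i : A ==> hs_at (f i) z) ==> hs_at (%z. SUM i:A. f i z) z"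
 by (induction A rule: infinite_finite_induct) (auto intro: hs_at_const hs_at_add)

lemma hs_at_prod: "(!!i. i : A ==> hs_at (f i) z) ==> hs_at (%z. PROD i:A. f i z) z"
 by (induction A rule: infinite_finite_induct) (auto intro: hs_at_const hs_at_mult)

lemma hs_at_component:
 assumes "g holomorphic_on U" "open U" "z $ i : U"
 shows "hs_at (%z. g (z $ i)) z" unfolding hs_at_def
proof (intro exI conjI)
 have "(g has_derivative (*) (deriv g (z $ i))) (at (z $ i))"
  using holomorphic_derivI[OF assms] by (simp add: has_field_derivative_def)
 from has_derivative_compose[OF bounded_linear.has_derivative[OF bounded_linear_vec_nth has_derivative_ident] this]
 show "((%z. g (z $ i)) has_derivative (%h. deriv g (z $ i) * h $ i)) (at z)" .
qed simp

lemma hs_at_cong: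
 assumes "open S" "z : S" "!!w. w : S ==> f w = g w" "hs_at f z"
 shows "hs_at g z" using assms(4) has_derivative_transform_within_open[OF _ assms(1,2,3)] unfolding hs_at_def by fast

text \<open>The derivative along an axis is multiplication by a complex number because D is
  homogeneous over the complex numbers.\<close>

lemma hs_at_upd:
 fixes z :: "complex^'v::finite"
 assumes "hs_at f (upd z i t)"
 shows "(%t. f (upd z i t)) field_differentiable at t"
proof -
 obtain D where D: "(f has_derivative D) (at (upd z i t))" "!!c w. D (c *s w) = c * D w"
  using assms by (auto simp: hs_at_def)
 have ax: "axis i h = h *s (axis i 1 :: complex^'v)" for h :: complex by (simp add: vec_eq_iff axis_def)
 have "linear (%h. axis i h :: complex^'v)" by (rule linearI) (auto simp: vec_eq_iff axis_def)
 hence "bounded_linear (%h. axis i h :: complex^'v)" by (simp add: linear_conv_bounded_linear)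
 hence "((%t. upd z i 0 + axis i t) has_derivative (%h. 0 + axis i h)) (at t)"
  by (intro has_derivative_add has_derivative_const bounded_linear_imp_has_derivative)
 moreover have "(%t. upd z i 0 + axis i t) = upd z i" by (auto simp: fun_eq_iff vec_eq_iff axis_def)
 ultimately have "(upd z i has_derivative (%h. axis i h)) (at t)" by simp
 from has_derivative_compose[OF this D(1)]
 have "((%t. f (upd z i t)) has_derivative (%h. D (axis i h))) (at t)" .
 moreover have "(%h. D (axis i h)) = (*) (D (axis i 1))" by (subst ax) (auto simp: D(2) fun_eq_iff)
 ultimately show ?thesis unfolding field_differentiable_def has_field_derivative_def by auto
qed

lemma holomorphic_several_slice:
 assumes "holomorphic_several (cpower U) f" "z : cpower U"
 shows "(%t. f (upd z i t)) holomorphic_on U"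
proof (rule holomorphic_onI)
 fix t assume "t : U"
 hence "upd z i t : cpower U" using assms(2) by auto
 hence "hs_at f (upd z i t)" using assms(1) unfolding holomorphic_several_iff by blast
 from hs_at_upd[OF this] show "(%t. f (upd z i t)) field_differentiable at t within U"
  by (rule field_differentiable_at_within)
qed

text \<open>The factors act one at a time; a variable outside \<open>set K\<close> still carries its
  original function \<open>v i\<close>.\<close>

lemma Tprod_acts:
 fixes v :: "'m::{finite,linorder} => complex => complex"
 assumes U: "open U" and v: "!!i. v i holomorphic_on U" and "distinct K"
 shows "cid.acts (tube U) (prodop (Top n j) K) (pfun v)
  (%p. PROD i:UNIV. if i : set K then Tode (n - CARD('m)) (p $ None) j (v i) (p $ Some i) else v i (p $ Some i))"
 using assms(3)
proof (induction K)
 case Nil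
 have "op_one = emb (single 0 1 :: ('m option, complex) polyop)" by (simp only: op_one_def emb_single One_fract_def)
 moreover have "cid.pact (single 0 1) (pfun v) z = pfun v z" for z by (simp add: cid.pact_single del: single_one)
 ultimately show ?case unfolding cid.acts_def by (intro exI[of _ "single 0 1"]) (auto simp: pfun_def)
next
 case (Cons i K)
 let ?T = "%x. Tode (n - CARD('m)) x j"
 let ?G = "%K p. PROD i:UNIV. if i : set K then ?T (p $ None) (v i) (p $ Some i) else v i (p $ Some i)"
 have i: "i ~: set K" using Cons.prems by simp
 have "cid.acts (tube U) (Top n j i) (?G K) (?G (i # K))" unfolding cid.acts_def
 proof (rule exI[of _ "Tpoly n j i"], intro conjI ballI Top_emb)
  fix z :: "complex^('m option)" assume z: "z : tube U"
  have zi: "z $ Some i : U" using z by (simp add: tube_def)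
  define c where "c = (PROD k:UNIV-{i}. if k : set K then ?T (z $ None) (v k) (z $ Some k) else v k (z $ Some k))"
  have sl: "(%t. ?G K (upd z (Some i) t)) = (%t. SUM k:{i}. c * v k t)"
  proof
   fix t
   have "(PROD k:UNIV-{i}. if k : set K then ?T (upd z (Some i) t $ None) (v k) (upd z (Some i) t $ Some k)
     else v k (upd z (Some i) t $ Some k)) = c" unfolding c_def by (intro prod.cong refl) auto
   hence "?G K (upd z (Some i) t) = v i t * c" by (subst prod.remove[of _ i]) (use i in auto)
   thus "?G K (upd z (Some i) t) = (SUM k:{i}. c * v k t)" by simp
  qed
  have hol: "(%t. ?G K (upd z (Some i) t)) holomorphic_on U"
   unfolding sl using v by (auto intro!: holomorphic_intros)
  have "cid.pact (Tpoly n j i) (?G K) z = ?T (z $ None) (%t. SUM k:{i}. c * v k t) (z $ Some i)"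
   using pact_Top[OF U zi hol, of n j] unfolding sl .
  also have "... = c * ?T (z $ None) (v i) (z $ Some i)"
   using Tode_lincomb[OF U _ zi, of "{i}" v "n - CARD('m)" "z $ None" j "%_. c"] v by simp
  also have "... = ?G (i # K) z"
  proof -
   have "(PROD k:UNIV-{i}. if k : set (i # K) then ?T (z $ None) (v k) (z $ Some k) else v k (z $ Some k)) = c"
    unfolding c_def by (intro prod.cong refl) auto
   thus ?thesis by (subst prod.remove[of _ i]) (simp_all add: mult.commute)
  qed
  finally show "cid.pact (Tpoly n j i) (?G K) z = ?G (i # K) z" .
 qed
 moreover have "cid.acts (tube U) (prodop (Top n j) K) (pfun v) (?G K)" by (rule Cons.IH) (use Cons.prems in simp)
 ultimately show ?case unfolding prodop_simps by (intro cid.acts_mult[OF open_tube[OF U] smooth_pfun[OF U v]])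
qed

text \<open>The facts that hold for x0 outside a finite set. The branch l is a parameter because
  \<open>non_logarithmic\<close> brings a branch of its own, for which the locale is interpreted
  again. \<open>lead\<close> says that the leading coefficient of \<open>L i\<close> survives at
  x0.\<close>

locale solution_space =
 fixes n :: nat and L :: "'m::{finite,linorder} => ('m option, complex) diffop"
  and x0 :: complex and U :: "complex set" and l :: "complex => complex"
  and a b :: "nat => nat => nat => complex" and M :: nat and B :: "(nat \<times> nat) set"
 assumes M_eq: "M = n - CARD('m)" and B_eq: "B = Bidx CARD('m)"
  and x0: "x0 ~= 0" and U: "open U" "connected U" "U ~= {}" and br: "log_branch U l"
  and vb: "!!j. vbasis M x0 j (a j) (b j)"
  and annih: "!!J u P. bij_betw J (UNIV :: 'm set) {1..CARD('m)} ==>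
   (!!i. u i : Vsol M x0 U (J i)) ==> P : generators n L ==>
   annihilates id P (pfun u) (slice x0 U)" and lclm: "!!i. is_Tlclm n i (L i)"
  and lead: "!!i. EX d Q y. clears d (L i) Q & (ALL al. mpol_vars (lookup Q al) \<subseteq> {None, Some i}) &
   y $ None = x0 & mpol_eval id (lookup Q (single (Some i) (3 * CARD('m) - 1))) y ~= 0" begin

abbreviation "u \<equiv> ubas M l a b"
abbreviation "Sol \<equiv> solutions (generators n L) x0 U"

definition tens :: "('m::{finite,linorder} => nat \<times> nat) => (complex, 'm) vec => complex" where
 "tens io z = (if z : cpower U then PROD i:UNIV. u (io i) (z $ i) else 0)"

text \<open>Tuples that use each of the m spaces exactly once; they index the basis of all
  solutions.\<close>

definition K :: "('m => nat \<times> nat) set" where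
 "K = {io : ms B. bij_betw (%i. fst (io i)) UNIV {1..CARD('m)}}"

lemma finite_B [simp]: "finite B"
 by (simp add: B_eq)

lemma B_def: "B = Sigma {1..CARD('m)} (%j. {..<dord j})"
 by (simp add: B_eq Bidx_def)

lemma finite_ms: "finite (ms B :: ('m => nat \<times> nat) set)"
 by (simp add: finite_PiE)

lemma finite_K: "finite K"
 using finite_ms by (simp add: K_def)

lemma m1: "CARD('m) >= 1"
 by (simp add: Suc_leI)

lemma card_B: "card B = 3 * CARD('m) - 1"
 unfolding B_eq by (rule card_Bidx[OF m1])

lemma u_Vsol: "be : B ==> u be : Vsol M x0 U (fst be)"
 unfolding B_eq by (rule ubas_Vsol[OF _ _ U(1) br]) (rule vb, assumption)

lemma u_holomorphic: "be : B ==> u be holomorphic_on U"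
 using u_Vsol by (simp add: Vsol_def)

lemma fst_B: "be : B ==> fst be : {1..CARD('m)}"
 unfolding B_def by (elim SigmaE) simp

lemma u_indep:
 assumes "open W" "connected W" "W ~= {}" "W \<subseteq> U"
  and "!!y. y : W ==> (SUM be:B. c be * u be y) = 0"
 shows "ALL be:B. c be = 0" unfolding B_eq
proof (rule ubas_indep[OF x0 vb assms(1-3) _ assms(5)[unfolded B_eq]])
 show "log_branch W l" using br assms(4) by (auto simp: log_branch_def intro: holomorphic_on_subset)
qed

lemma ms_B: "io : ms B ==> io i : B"
 by auto

lemma combination_tube:
 assumes "p : tube U"
 shows "(SUM io:A. C io * tens io (\<chi> i. p $ Some i)) = (SUM io:A. C io * pfun (%i. u (io i)) p)"
 using assms by (intro sum.cong refl) (auto simp: tens_def pfun_def tube_def)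

lemma tens_outside: "z ~: cpower U ==> tens io z = 0"
 unfolding tens_def by (rule if_not_P)

lemma combination_solution: "(%z. SUM io:K. C io * tens io z) : Sol"
 unfolding solutions_def
proof (intro CollectI conjI ballI)
 have K: "io i : B" if "io : K" for io i using that by (auto simp: K_def)
 show "holomorphic_several (cpower U) (%z. SUM io:K. C io * tens io z)"
  unfolding holomorphic_several_iff
 proof
  fix z :: "(complex, 'm) vec" assume z: "z : cpower U"
  have "hs_at (%z. SUM io:K. C io * (PROD i:UNIV. u (io i) (z $ i))) z"
   by (intro hs_at_sum hs_at_mult hs_at_const hs_at_prod hs_at_component[OF u_holomorphic[OF K] U(1)])
    (use z in auto)
  thus "hs_at (%z. SUM io:K. C io * tens io z) z"
   by (rule hs_at_cong[OF open_cpower[OF U(1)] z, rotated]) (simp add: tens_def)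
 qed
 show "ALL z. z ~: cpower U --> (SUM io:K. C io * tens io z) = 0"
  by (intro allI impI sum.neutral ballI) (simp only: tens_outside not_False_eq_True mult_zero_right)
 fix P assume P: "P : generators n L"
 let ?F = "%p. SUM io:K. C io * pfun (%i. u (io i)) p"
 have sm: "smooth (tube U) (pfun (%i. u (io i)))" if "io : K" for io
  by (rule smooth_pfun[OF U(1) u_holomorphic[OF K[OF that]]])
 have smF: "smooth (tube U) ?F" by (intro smooth_sum smooth_mult smooth_const open_tube U(1) sm)
 have "annihilates id P (%p. SUM io:K. C io * tens io (\<chi> i. p $ Some i)) (slice x0 U)"
  unfolding cid.annihilates_iff
 proof (intro allI impI ballI)
  fix d Q and z :: "(complex, 'm option) vec" assume d: "clears d P Q" and z: "z : slice x0 U"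
  have zt: "z : tube U" using z slice_tube by blast
  have "cid.pact Q (%p. SUM io:K. C io * tens io (\<chi> i. p $ Some i)) z = cid.pact Q ?F z"
   by (rule cid.pact_cong[OF open_tube[OF U(1)] smF _ zt, symmetric]) (simp only: combination_tube)
  also have "... = (SUM io:K. C io * cid.pact Q (pfun (%i. u (io i))) z)"
   by (rule cid.pact_sum[OF open_tube[OF U(1)] sm zt])
  also have "... = 0"
  proof (intro sum.neutral ballI)
   fix io assume io: "io : K"
   have "annihilates id P (pfun (%i. u (io i))) (slice x0 U)"
    by (rule annih[of "%i. fst (io i)"]) (use io K P u_Vsol in \<open>auto simp: K_def\<close>)
   thus "C io * cid.pact Q (pfun (%i. u (io i))) z = 0"
    using d z unfolding cid.annihilates_iff by auto
  qed
  finally show "cid.pact Q (%p. SUM io:K. C io * tens io (\<chi> i. p $ Some i)) z = 0" .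
 qed
 thus "annihilates id P (%p. SUM io:K. C io * tens io (\<chi> i. p $ Some i))
   {p. p $ None = x0 & (ALL i. p $ Some i : U)}" by (simp only: slice_def) qed

text \<open>\<open>L i\<close> imposes an ordinary equation of order 3 m - 1 on each slice, and the
  functions \<open>u be\<close> are 3 m - 1 independent solutions of it.\<close>

lemma solution_slice:
 assumes f: "f : Sol" and z: "z : cpower U"
 shows "EX c. ALL t:U. f (upd z i t) = (SUM be:B. c be * u be t)"
proof -
 let ?N = "3 * CARD('m) - 1"
 obtain d Q y where d: "clears d (L i) Q" and vars: "!!al. mpol_vars (lookup Q al) \<subseteq> {None, Some i}"
  and y: "y $ None = x0" "mpol_eval id (lookup Q (single (Some i) ?N)) y ~= 0"
  using lead[of i] by (elim exE conjE) (rule that, auto)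
 define w :: "(complex, 'm option) vec" where "w = (\<chi> v. case v of None => x0 | Some k => z $ k)"
 define p where "p k t = mpol_eval id (lookup Q (single (Some i) k)) (upd w (Some i) t)" for k t
 have w: "w : slice x0 U" using z by (simp add: slice_def w_def)
 have LD: "L i : Dvar i" using lclm[of i] by (simp add: is_Tlclm_iff common_mult_def)
 have LG: "L i : generators n L" by (simp add: generators_def)
 have keysQ: "keys al \<subseteq> {Some i}" if "al : keys Q" for al
  using clears_keys[OF d that] LD by (auto simp: diffops_def)
 have hiQ: "lookup Q (single (Some i) k) = 0" if "k > ?N" for k
 proof -
  have "op_order (L i) <= ?N" using Tlclm_order[OF lclm[of i]] by (rule eq_refl)
  hence "lookup (L i) (single (Some i) k) = 0" using op_order_le_iff[OF LD] that by blast
  thus ?thesis by (rule iffD2[OF clears_lookup_0[OF d]])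
 qed
 \<comment> \<open>The leading coefficient involves only x and one \<lambda>, so its nonzero value
   at y can be found again on the line through w.\<close>
 have "EX y0:U. p ?N y0 ~= 0"
 proof (rule ccontr)
  assume neg: "\<not> ?thesis"
  obtain q where q: "!!t. p ?N t = poly q t"
   using cid.mpol_eval_slice_poly[of "lookup Q (single (Some i) ?N)" w "Some i"] unfolding p_def by blast
  have "p ?N (y $ Some i) = mpol_eval id (lookup Q (single (Some i) ?N)) y" unfolding p_def
  proof (rule cid.mpol_eval_cong_vars)
   fix v assume "v : mpol_vars (lookup Q (single (Some i) ?N))"
   hence "v = None \<or> v = Some i" using vars by blast
   thus "upd w (Some i) (y $ Some i) $ v = y $ v" using y by (auto simp: w_def)
  qed
  hence "q ~= 0" using y(2) q by auto
  hence "finite {t. poly q t = 0}" by (rule poly_roots_finite)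
  hence "finite U" using neg q by (elim finite_subset[rotated]) auto
  thus False using U finite_imp_not_open by blast
 qed
 then obtain y0 where y0: "y0 : U" "p ?N y0 ~= 0" by blast
 have phol: "p k holomorphic_on U" for k unfolding p_def[abs_def] by (rule mpol_eval_slice_holomorphic)
 have V: "v : Osol ?N p U" if j: "j : {1..CARD('m)}" and v: "v : Vsol M x0 U j" for j v
 proof -
  \<comment> \<open>\<open>annih\<close> asks for a bijection that assigns the j-th equation to the
    variable i; a transposition provides it.\<close>
  obtain i0 :: 'm where i0: "position i0 = j" using position_bij j unfolding bij_betw_def by (metis imageE)
  define sg where "sg = Transposition.transpose i i0"
  define J where "J k = position (sg k)" for k
  have "sg permutes UNIV" unfolding sg_def by (rule permutes_swap_id) auto
  hence J: "bij_betw J UNIV {1..CARD('m)}" unfolding J_def by (rule bij_position_perm)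
  have Ji: "J i = j" by (simp add: J_def sg_def i0)
  have "ALL k::'m. EX g. g : Vsol M x0 U (J k) & (ALL r<dord (J k). (deriv ^^ r) g (w $ Some k) = 1)"
  proof
   fix k
   have "w $ Some k : U" using w by (simp add: slice_def)
   from Vsol_jets[OF x0 U(1,2) this br, of M "J k" "%_. 1"]
   show "EX g. g : Vsol M x0 U (J k) & (ALL r<dord (J k). (deriv ^^ r) g (w $ Some k) = 1)" by blast
  qed
  from choice[OF this] obtain g where g: "!!k. g k : Vsol M x0 U (J k)"
   "!!k r. r < dord (J k) ==> (deriv ^^ r) (g k) (w $ Some k) = 1" by blast
  define h where "h k = (if k = i then v else g k)" for k
  have hV: "h k : Vsol M x0 U (J k)" for k using v g Ji by (simp add: h_def)
  hence hol: "h k holomorphic_on U" for k by (simp add: Vsol_def)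
  have kill: "cid.pact Q (pfun h) z = 0" if "z : slice x0 U" for z
   using annih[OF J hV LG] d that unfolding cid.annihilates_iff by blast
  have nz: "h k (w $ Some k) ~= 0" if "k ~= i" for k using g(2)[of 0 k] that by (simp add: h_def dord_def)
  from slice_ode[OF w U(1) hol keysQ hiQ nz kill]
  show ?thesis by (simp add: h_def p_def[abs_def])
 qed
 have "(%t. f (upd z i t)) : Osol ?N p U" unfolding Osol_def
 proof (intro CollectI conjI ballI)
  show hol: "(%t. f (upd z i t)) holomorphic_on U"
   using f by (intro holomorphic_several_slice[OF _ z]) (simp add: solutions_def)
  fix t assume t: "t : U"
  let ?F = "%p. f (\<chi> i. p $ Some i)" and ?w = "upd w (Some i) t"
  have wt: "?w : slice x0 U" using w t by (auto simp: slice_def)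
  have "annihilates id (L i) ?F (slice x0 U)" using f LG by (auto simp: solutions_def slice_def)
  hence "0 = cid.pact Q ?F ?w" using d wt unfolding cid.annihilates_iff by auto
  also have "... = (SUM k<=?N. mpol_eval id (lookup Q (single (Some i) k)) ?w * (cpartial (Some i) ^^ k) ?F ?w)"
   by (rule pact_one_variable[OF keysQ hiQ]) assumption
  also have "... = (SUM k<=?N. p k t * (deriv ^^ k) (%s. ?F (upd ?w (Some i) s)) t)"
   by (simp only: funpow_cpartial p_def upd_nth if_True simp_thms)
  also have "(%s. ?F (upd ?w (Some i) s)) = (%s. f (upd z i s))"
  proof
   fix s
   have "(\<chi> k. upd ?w (Some i) s $ Some k) = upd z i s" by (simp add: vec_eq_iff w_def)
   thus "?F (upd ?w (Some i) s) = f (upd z i s)" by simp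
  qed
  finally show "(SUM k<=?N. p k t * (deriv ^^ k) (%s. f (upd z i s)) t) = 0" by simp
 qed
 moreover have "u be : Osol ?N p U" if "be : B" for be
  by (rule V[OF fst_B[OF that] u_Vsol[OF that]])
 ultimately show ?thesis
 proof (intro Osol_span[where u = u and B = B and p = p and N = ?N and U = U and ?y0.0 = y0])
  show "open U" "connected U" "y0 : U" "p ?N y0 ~= 0" "finite B" "card B = ?N"
   by (rule U y0 finite_B card_B)+
  show "p k holomorphic_on U" for k by (rule phol)
  show "ALL be:B. c be = 0" if "!!y. y : U ==> (SUM be:B. c be * u be y) = 0" for c
   by (rule u_indep[OF U order_refl that])
 qed
qed

lemma solution_expansion:
 assumes "f : Sol"
 shows "EX C. ALL z:cpower U. f z = (SUM io:ms B. C io * (PROD i:UNIV. u (io i) (z $ i)))"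
 by (rule tensor_span[OF finite_B u_indep[OF U order_refl] solution_slice[OF assms]])

text \<open>Application of \<open>Tprod n j\<close> leaves the terms without a factor from the kernel of the \<open>j\<close>-th
  operator, and it is injective on their span.\<close>

lemma expansion_zero:
 assumes f: "f : Sol" and C: "!!z. z : cpower U ==> f z = (SUM io:ms B. C io * (PROD i:UNIV. u (io i) (z $ i)))"
  and j: "j : {1..CARD('m)}" and io0: "io0 : ms B" "!!i. fst (io0 i) ~= j"
 shows "C io0 = 0"
proof -
 let ?B' = "{be : B. fst be ~= j}"
 define w where "w be = Tode M x0 j (u be)" for be
 let ?F = "%p. SUM io:ms B. C io * pfun (%i. u (io i)) p"
 have zero: "(SUM io:ms ?B'. C io * (PROD i:UNIV. w (io i) (z $ i))) = 0" if z: "z : cpower U" for z :: "(complex, 'm) vec"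
 proof -
  define p :: "(complex, 'm option) vec" where "p = (\<chi> v. case v of None => x0 | Some k => z $ k)"
  have p: "p : slice x0 U" "p : tube U" using z by (auto simp: slice_def tube_def p_def)
  have sm: "smooth (tube U) (pfun (%i. u (io i)))" if "io : ms B" for io
   by (rule smooth_pfun[OF U(1) u_holomorphic]) (use that in auto)
  have smF: "smooth (tube U) ?F" by (intro smooth_sum smooth_mult smooth_const open_tube U(1) sm)
  have acts: "cid.acts (tube U) (Tprod n j) (pfun (%i. u (io i))) (%p. PROD i:UNIV. Tode M (p $ None) j (u (io i)) (p $ Some i))"
   if "io : ms B" for io :: "'m => nat \<times> nat"
   using Tprod_acts[where v = "%i. u (io i)" and K = vlist and n = n and j = j, OF U(1) u_holomorphic[OF ms_B[OF that]]] unfolding Tprod_prodop M_eq[symmetric] by simp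
  \<comment> \<open>Any tuple serves to extract the polynomial operator Q, which is the same for all
    of them by \<open>emb_inj\<close>.\<close>
  have "(%_. (1, 0)) : ms B" using m1 by (auto simp: B_def dord_def)
  from acts[OF this] obtain Q where Q: "Tprod n j = emb (Q :: ('m option, complex) polyop)" by (auto simp: cid.acts_def)
  have Qp: "cid.pact Q (pfun (%i. u (io i))) p = (PROD i:UNIV. w (io i) (z $ i))" if "io : ms B" for io
  proof -
   from acts[OF that] obtain Q' where Q': "Tprod n j = emb Q'"
    "!!z. z : tube U ==> cid.pact Q' (pfun (%i. u (io i))) z = (PROD i:UNIV. Tode M (z $ None) j (u (io i)) (z $ Some i))"
    unfolding cid.acts_def by blast
   have "Q' = Q" by (rule emb_inj) (use Q Q'(1) in simp)
   thus ?thesis using Q'(2)[OF p(2)] by (simp add: p_def w_def)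
  qed
  have "annihilates id (Tprod n j) (%p. f (\<chi> i. p $ Some i)) (slice x0 U)"
   using f j by (auto simp: solutions_def slice_def generators_def)
  hence "0 = cid.pact Q (%p. f (\<chi> i. p $ Some i)) p"
   unfolding cid.annihilates_iff Q using clears_emb p(1) by metis
  also have "... = cid.pact Q ?F p" by (rule cid.pact_cong[OF open_tube[OF U(1)] smF _ p(2), symmetric])
    (subst C, auto simp: tube_def pfun_def)
  also have "... = (SUM io:ms B. C io * cid.pact Q (pfun (%i. u (io i))) p)"
   by (rule cid.pact_sum[OF open_tube[OF U(1)] sm p(2)])
  also have "... = (SUM io:ms B. C io * (PROD i:UNIV. w (io i) (z $ i)))"
   by (intro sum.cong refl) (simp add: Qp)
  also have "... = (SUM io:ms ?B'. C io * (PROD i:UNIV. w (io i) (z $ i)))"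
  proof (rule sum.mono_neutral_right[OF finite_ms])
   show "ALL io:ms B - ms ?B'. C io * (PROD i:UNIV. w (io i) (z $ i)) = 0"
   proof
    fix io :: "'m => nat \<times> nat" assume io: "io : ms B - ms ?B'"
    then obtain i where i: "io i : B" "fst (io i) = j" by (auto simp: PiE_iff)
    have "z $ i : U" using z by simp
    hence "w (io i) (z $ i) = 0" using u_Vsol[OF i(1)] i(2) by (simp add: w_def Vsol_def)
    hence "(PROD i:UNIV. w (io i) (z $ i)) = 0" by (auto intro!: prod_zero)
    thus "C io * (PROD i:UNIV. w (io i) (z $ i)) = 0" by simp
   qed
  qed auto
  finally show ?thesis by simp
 qed
 \<comment> \<open>A relation between the images under the j-th operator puts a combination of
   elements of the other spaces into the j-th one, which directness of the sum forbids.\<close>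
 have ind: "ALL be:?B'. c be = 0" if c: "!!y. y : U ==> (SUM be:?B'. c be * w be y) = 0" for c
 proof -
  let ?h = "%y. SUM be:?B'. c be * u be y"
  have hV: "?h : Vsol M x0 U j" unfolding Vsol_def
  proof (intro CollectI conjI ballI)
   show "?h holomorphic_on U" by (intro holomorphic_intros u_holomorphic) auto
   fix y assume y: "y : U"
   show "Tode M x0 j ?h y = 0"
    using Tode_lincomb[OF U(1) u_holomorphic y, of ?B' "%x. x" M x0 j c] c[OF y] by (simp add: w_def)
  qed
  \<comment> \<open>The j-th summand is minus the sum of the others; the sum over a single index
    gives it the form of \<open>Vsol_lincomb\<close>.\<close>
  define g where "g k = (if k = j then (%y. SUM be:{0::nat}. (- 1) * ?h y) else (%y. SUM r<dord k. c (k, r) * u (k, r) y))" for k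
  have g: "g k : Vsol M x0 U k" if k: "k : {1..CARD('m)}" for k
  proof (cases "k = j")
   case True
   have "(%y. SUM be:{0::nat}. (- 1) * ?h y) : Vsol M x0 U j" by (rule Vsol_lincomb[OF U(1) hV])
   thus ?thesis unfolding g_def using True by (simp only: if_True simp_thms)
  next
   case False
   have "u (k, r) : Vsol M x0 U k" if "r : {..<dord k}" for r
    using u_Vsol[of "(k, r)"] that k by (simp add: B_def)
   thus ?thesis unfolding g_def using False Vsol_lincomb[OF U(1), of "{..<dord k}" "%r. u (k, r)"] by simp
  qed
  have s: "(SUM k:{1..CARD('m)}. g k y) = 0" for y
  proof -
   have B': "?B' = Sigma ({1..CARD('m)} - {j}) (%j. {..<dord j})" by (auto simp: B_def)
   have "?h y = (SUM (k, r):?B'. c (k, r) * u (k, r) y)" by (intro sum.cong) auto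
   also have "... = (SUM k:{1..CARD('m)} - {j}. SUM r<dord k. c (k, r) * u (k, r) y)"
    unfolding B' by (rule sum.Sigma[symmetric]) auto
   also have "... = (SUM k:{1..CARD('m)} - {j}. g k y)" by (intro sum.cong refl) (simp add: g_def)
   finally have "?h y = (SUM k:{1..CARD('m)} - {j}. g k y)" .
   moreover have "(SUM k:{1..CARD('m)}. g k y) = g j y + (SUM k:{1..CARD('m)} - {j}. g k y)"
    by (rule sum.remove) (use j in auto)
   ultimately show ?thesis by (simp add: g_def)
  qed
  show ?thesis
  proof
   fix be assume be: "be : ?B'"
   obtain k r where kr: "be = (k, r)" by (cases be)
   have k: "k : {1..CARD('m)}" "k ~= j" "r < dord k" using be kr by (auto simp: B_def)
   have "(SUM r<dord k. c (k, r) * logser M l (a k r) (b k r) y) = 0" if y: "y : U" for y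
    using Vsol_direct[OF x0 U g s k(1) y] k(2) by (simp add: g_def ubas_def)
   from vbasis_indep[OF vb U(1,3) br this k(3)] show "c be = 0" unfolding kr .
  qed
 qed
 have "finite ?B'" by simp
 show ?thesis
 proof (rule tensor_indep[OF \<open>finite ?B'\<close> ind zero])
  show "io0 : ms ?B'" using io0 by auto
 qed
qed

text \<open>By counting, a tuple outside K omits one of the spaces, and
  \<open>expansion_zero\<close> applies to it.\<close>

lemma solution_expansion_K:
 assumes f: "f : Sol" and C: "!!z. z : cpower U ==> f z = (SUM io:ms B. C io * (PROD i:UNIV. u (io i) (z $ i)))"
  and io: "io : ms B" "io ~: K"
 shows "C io = 0"
proof -
 have sub: "(%i. fst (io i)) ` UNIV \<subseteq> {1..CARD('m)}"
  by (intro image_subsetI fst_B ms_B[OF io(1)])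
 have "(%i. fst (io i)) ` UNIV ~= {1..CARD('m)}"
 proof
  assume eq: "(%i. fst (io i)) ` UNIV = {1..CARD('m)}"
  hence "card ((%i. fst (io i)) ` UNIV) = CARD('m)" by simp
  hence "inj (%i. fst (io i))" by (intro eq_card_imp_inj_on) auto
  thus False using eq io by (simp add: K_def bij_betw_def)
 qed
 then obtain j where "j : {1..CARD('m)}" "!!i. fst (io i) ~= j" using sub by blast
 thus ?thesis by (intro expansion_zero[OF f C _ io(1)])
qed

lemma solutions_eq: "Sol = {f. EX C. f = (%z. SUM io:K. C io * tens io z)}"
proof (intro equalityI subsetI CollectI)
 fix f assume f: "f : Sol"
 from solution_expansion[OF f] obtain C where
  C: "!!z. z : cpower U ==> f z = (SUM io:ms B. C io * (PROD i:UNIV. u (io i) (z $ i)))" by blast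
 have "f = (%z. SUM io:K. C io * tens io z)"
 proof
  fix z
  show "f z = (SUM io:K. C io * tens io z)"
  proof (cases "z : cpower U")
   case True
   have "f z = (SUM io:K. C io * (PROD i:UNIV. u (io i) (z $ i)))" unfolding C[OF True]
   proof (rule sum.mono_neutral_right[OF finite_ms])
    show "K \<subseteq> ms B" by (auto simp: K_def)
    show "ALL io:ms B - K. C io * (PROD i:UNIV. u (io i) (z $ i)) = 0"
    proof
     fix io :: "'m => nat \<times> nat" assume "io : ms B - K"
     hence "C io = 0" by (intro solution_expansion_K[OF f C]) auto
     thus "C io * (PROD i:UNIV. u (io i) (z $ i)) = 0" by simp
    qed
   qed
   thus ?thesis using True by (simp add: tens_def)
  next
   case False
   hence "f z = 0" using f unfolding solutions_def by blast
   thus ?thesis by (simp only: tens_outside[OF False] mult_zero_right sum.neutral_const)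
  qed
 qed
 thus "EX C. f = (%z. SUM io:K. C io * tens io z)" by (rule exI[of _ C])
next
 fix f assume "f : {f. EX C. f = (%z. SUM io:K. C io * tens io z)}"
 thus "f : Sol" using combination_solution by auto
qed

lemma tens_indep:
 assumes "!!z. z : cpower U ==> (SUM io:K. C io * tens io z) = 0"
 shows "ALL io:K. C io = 0"
proof
 fix io assume io: "io : K"
 let ?C = "%io. if io : K then C io else 0"
 have "?C io = 0"
 proof (rule tensor_indep[OF finite_B u_indep[OF U order_refl]])
  fix z :: "(complex, 'm) vec" assume z: "z : cpower U"
  have "(SUM io:ms B. ?C io * (PROD i:UNIV. u (io i) (z $ i))) = (SUM io:K. C io * tens io z)"
   by (rule sum.mono_neutral_cong_right[OF finite_ms]) (use z in \<open>auto simp: K_def tens_def\<close>)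
  thus "(SUM io:ms B. ?C io * (PROD i:UNIV. u (io i) (z $ i))) = 0" using assms[OF z] by simp
 next
  show "io : ms B" using io by (simp add: K_def)
 qed
 thus "C io = 0" using io by simp
qed

end

section \<open>Shifted series, exponential sums and analytic continuation\<close>

lemma entire_coeffs_shift:
 assumes "entire_coeffs c"
 shows "entire_coeffs (%k. c (k + M))"
proof -
 obtain A C where 1: "0 <= A" "1 <= C" "!!n. norm (c n) <= A * C ^ n / fact n"
  using assms by (auto simp: entire_coeffs_def)
 have "norm (c (k + M)) <= (A * C ^ M) * C ^ k / fact k" for k
 proof -
  have "A * C ^ (k + M) / fact (k + M) <= A * C ^ (k + M) / fact k"
   using 1 by (intro divide_left_mono fact_mono mult_nonneg_nonneg mult_pos_pos) auto
  thus ?thesis using 1(3)[of "k + M"] by (simp add: power_add mult_ac)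
 qed
 thus ?thesis using 1 unfolding entire_coeffs_def by (intro exI[of _ "A * C ^ M"] exI[of _ C]) auto
qed

lemma pser_shift:
 assumes c: "entire_coeffs c" and low: "!!i. i < M ==> c i = 0"
 shows "pser c y = pser (%k. c (k + M)) y * y ^ M"
proof -
 have "pser c y = (suminf (%k. c (k + M) * y ^ (k + M))) + (SUM i<M. c i * y ^ i)"
  unfolding pser_def by (rule suminf_split_initial_segment[OF entire_summable[OF c]])
 also have "(SUM i<M. c i * y ^ i) = 0" using low by simp
 also have "suminf (%k. c (k + M) * y ^ (k + M)) = pser (%k. c (k + M)) y * y ^ M" unfolding pser_def
  using suminf_mult2[OF entire_summable[OF entire_coeffs_shift[OF c], where z = y], of M "y ^ M"]
  by (simp add: power_add mult.assoc)
 finally show ?thesis by simp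
qed

lemma poly_pderiv_1:
 fixes p :: "complex poly"
 shows "poly (pderiv p) 1 = (SUM i<=degree p. of_nat i * coeff p i)"
proof (induction p)
 case (pCons a p)
 show ?case
 proof (cases "p = 0")
  case False
  have "(SUM i<=degree (pCons a p). of_nat i * coeff (pCons a p) i) = (SUM i<=degree p. of_nat (Suc i) * coeff p i)"
   unfolding degree_pCons_eq[OF False] by (subst sum.atMost_Suc_shift) simp
  also have "... = (SUM i<=degree p. of_nat i * coeff p i) + (SUM i<=degree p. coeff p i)"
   by (simp add: algebra_simps sum.distrib)
  also have "(SUM i<=degree p. coeff p i) = poly p 1" by (simp add: poly_altdef)
  finally show ?thesis using pCons.IH by (simp add: pderiv_pCons)
 qed simp
qed simp

text \<open>A combination of geometric sequences that grows linearly is constant: apply a polynomial in the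
  shift which vanishes at all ratios and has a simple root at 1.\<close>

lemma exponential_sum_linear:
 fixes \<mu> c :: "'k => complex"
 assumes fin: "finite E" and eq: "!!N. al + of_nat N * be = (SUM rh:E. \<mu> rh ^ N * c rh)"
 shows "be = 0"
proof -
 \<comment> \<open>As a set, S contains 1 and each ratio once, so that 1 is a simple root of
   p.\<close>
 define S where "S = insert 1 (\<mu> ` E)"
 have S: "finite S" "1 : S" using fin by (auto simp: S_def)
 define q where "q = (PROD \<nu>:S - {1}. [:- \<nu>, 1:])"
 define p where "p = [:- 1, 1:] * q"
 have p: "p = (PROD \<nu>:S. [:- \<nu>, 1:])" unfolding p_def q_def using S by (subst prod.remove[of S 1]) auto
 have "poly p (\<mu> rh) = 0" if "rh : E" for rh
  unfolding p poly_prod using S(1) that by (intro prod_zero) (auto simp: S_def)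
 hence "0 = (SUM rh:E. poly p (\<mu> rh) * c rh)" by simp
 also have "... = (SUM i<=degree p. coeff p i * (SUM rh:E. \<mu> rh ^ i * c rh))"
  unfolding poly_altdef sum_distrib_left sum_distrib_right by (subst sum.swap) (simp add: mult.assoc)
 also have "... = (SUM i<=degree p. coeff p i * (al + of_nat i * be))" by (simp only: eq)
 also have "... = al * poly p 1 + be * poly (pderiv p) 1"
  unfolding poly_pderiv_1 by (simp add: poly_altdef algebra_simps sum.distrib sum_distrib_left)
 also have "poly p 1 = 0" by (simp add: p_def)
 also have "poly (pderiv p) 1 = poly q 1" by (simp only: p_def pderiv_mult) (simp add: pderiv_pCons)
 finally have "be * poly q 1 = 0" by simp
 moreover have "poly q 1 ~= 0" unfolding q_def poly_prod using S(1) by auto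
 ultimately show ?thesis by simp
qed

text \<open>The identity theorem in one variable, applied to the coordinates in turn: those in A
  already range over H, the others still over V.\<close>

lemma several_identity:
 fixes \<Phi> :: "complex^'v::finite => complex"
 assumes H: "open H" "connected H" and V: "open V" "V ~= {}" "V \<subseteq> H"
  and hol: "!!z i. z : cpower H ==> (%t. \<Phi> (upd z i t)) holomorphic_on H"
  and zero: "!!z. z : cpower V ==> \<Phi> z = 0" and z: "z : cpower H"
 shows "\<Phi> z = 0"
proof -
 have "ALL z:cpower H. (ALL i. i ~: A --> z $ i : V) --> \<Phi> z = 0" if "finite A" for A
  using that
 proof induction
  case empty
  thus ?case using zero by simp
 next
  case (insert i A)
  show ?case
  proof (intro ballI impI)
   fix z :: "complex^'v" assume z: "z : cpower H" and zV: "ALL k. k ~: insert i A --> z $ k : V"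
   have "\<Phi> (upd z i (z $ i)) = 0"
   proof (rule analytic_continuation_open[of V H "%t. \<Phi> (upd z i t)" "%_. 0"])
    show "\<Phi> (upd z i t) = 0" if t: "t : V" for t
    proof -
     have "upd z i t : cpower H" using z t V(3) by auto
     moreover have "ALL k. k ~: A --> upd z i t $ k : V" using zV t by auto
     ultimately show ?thesis using insert.IH by blast
    qed
    show "(%t. \<Phi> (upd z i t)) holomorphic_on H" by (rule hol[OF z])
   qed (use H V z in auto)
   moreover have "upd z i (z $ i) = z" by (simp add: vec_eq_iff)
   ultimately show "\<Phi> z = 0" by simp
  qed
 qed
 from this[of UNIV] show ?thesis using z by simp
qed

section \<open>Anti-symmetric and non-logarithmic solutions\<close>

context solution_space
begin

definition A0 :: "('m => nat) set" where
 "A0 = PiE UNIV (%i. {..<dord (position i)})"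

text \<open>The bound \<open>dord (position i) - 1\<close> leaves out the logarithmic basis element
  of each space.\<close>

definition A1 :: "('m => nat) set" where
 "A1 = PiE UNIV (%i. {..<dord (position i) - 1})"

definition eta :: "('m => nat) => 'm => nat \<times> nat" where
 "eta al i = (position i, al i)"

definition skew :: "('m => nat) => (complex, 'm) vec => complex" where
 "skew al z = (SUM sg | sg permutes UNIV. of_int (sign sg) * tens (eta al \<circ> sg) z)"

lemma finite_A0: "finite A0" "finite A1"
 by (simp_all add: A0_def A1_def finite_PiE)

lemma A1_A0: "A1 \<subseteq> A0"
 unfolding A0_def A1_def by (rule PiE_mono) auto

lemma card_A0: "card A0 = 2 * 3 ^ (CARD('m) - 1)"
proof -
 have "card A0 = (PROD i:(UNIV::'m set). dord (position i))" by (simp add: A0_def card_PiE)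
 also have "... = (PROD j:{1..CARD('m)}. dord j)" by (rule prod.reindex_bij_betw[OF position_bij])
 finally show ?thesis using prod_dord[OF m1] by simp
qed

lemma card_A1: "card A1 = 2 ^ (CARD('m) - 1)"
proof -
 have p: "(PROD j:{1..k}. dord j - 1) = 2 ^ (k - 1)" if "k >= 1" for k using that
 proof (induction k rule: dec_induct)
  case (step k)
  hence "(PROD j:{1..Suc k}. dord j - 1) = 2 ^ (k - 1) * (dord (Suc k) - 1)" by simp
  thus ?case using step by (cases k) (auto simp: dord_def)
 qed (simp add: dord_def)
 have "card A1 = (PROD i:(UNIV::'m set). dord (position i) - 1)" by (simp add: A1_def card_PiE)
 also have "... = (PROD j:{1..CARD('m)}. dord j - 1)" by (rule prod.reindex_bij_betw[OF position_bij])
 finally show ?thesis using p[OF m1] by simp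
qed

lemma tens_permute:
 assumes "sg permutes UNIV"
 shows "tens io (\<chi> i. z $ sg i) = tens (io \<circ> inv sg) z"
proof -
 have "(\<chi> i. z $ sg i) : cpower U \<longleftrightarrow> z : cpower U"
  using permutes_surj[OF assms] by (auto simp: surj_def) metis
 moreover have "(PROD i:UNIV. u ((io \<circ> inv sg) i) (z $ i)) = (PROD i:UNIV. u (io i) (z $ sg i))"
  by (subst prod.permute[OF assms]) (simp add: permutes_inverses[OF assms])
 ultimately show ?thesis by (simp add: tens_def)
qed

text \<open>The first components of a tuple in K determine the permutation; undoing it leaves one
  index for each space.\<close>

lemma K_bij: "bij_betw (%(sg, al). eta al \<circ> sg) ({sg. sg permutes UNIV} \<times> A0) K"
proof (rule bij_betwI')
 have inj: "inj (position :: 'm => nat)" and img: "range (position :: 'm => nat) = {1..CARD('m)}"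
  using position_bij by (auto simp: bij_betw_def)
 fix x y :: "('m => 'm) \<times> ('m => nat)"
 assume x: "x : {sg. sg permutes UNIV} \<times> A0" and y: "y : {sg. sg permutes UNIV} \<times> A0"
 obtain sg al ta be where xy: "x = (sg, al)" "y = (ta, be)" by (cases x, cases y)
 show "(case x of (sg, al) => eta al \<circ> sg) = (case y of (sg, al) => eta al \<circ> sg) \<longleftrightarrow> x = y"
 proof
  assume "(case x of (sg, al) => eta al \<circ> sg) = (case y of (sg, al) => eta al \<circ> sg)"
  hence *: "eta al (sg i) = eta be (ta i)" for i by (simp add: xy fun_eq_iff)
  hence st: "sg = ta" using inj by (auto simp: eta_def inj_def)
  have "al k = be k" for k
  proof -
   obtain i where "k = sg i" using permutes_surj[of sg UNIV] x xy by (auto simp: surj_def)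
   thus ?thesis using *[of i] st by (simp add: eta_def)
  qed
  thus "x = y" using st xy by (simp add: fun_eq_iff)
 qed simp
next
 fix x assume x: "x : {sg. sg permutes (UNIV :: 'm set)} \<times> A0"
 obtain sg al where x': "x = (sg, al)" by (cases x)
 have sg: "sg permutes UNIV" and al: "al i < dord (position i)" for i using x x' by (auto simp: A0_def)
 have "eta al (sg i) : B" for i
  unfolding eta_def B_def using position_in[of "sg i"] al[of "sg i"] by simp
 thus "(case x of (sg, al) => eta al \<circ> sg) : K"
  using bij_position_perm[OF sg] by (auto simp: K_def x' eta_def)
next
 fix io assume io: "io : K"
 let ?q = "inv_into UNIV (position :: 'm => nat)"
 define sg where "sg i = ?q (fst (io i))" for i
 have bij: "bij_betw (%i. fst (io i)) UNIV {1..CARD('m)}" using io by (simp add: K_def)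
 have "bij_betw (?q \<circ> (%i. fst (io i))) UNIV UNIV"
  by (rule bij_betw_trans[OF bij bij_betw_inv_into[OF position_bij]])
 hence sg: "sg permutes UNIV" by (intro bij_imp_permutes) (auto simp: sg_def[abs_def] comp_def)
 have psg: "position (sg i) = fst (io i)" for i
 proof -
  have "fst (io i) : range (position :: 'm => nat)"
   using bij position_bij[where 'm = 'm] by (auto simp: bij_betw_def)
  thus ?thesis unfolding sg_def by (rule f_inv_into_f)
 qed
 define al where "al k = snd (io (inv sg k))" for k
 have "eta al \<circ> sg = io"
  by (auto simp: fun_eq_iff eta_def psg al_def permutes_inverses[OF sg])
 moreover have "al : A0"
 proof -
  have "al k < dord (position k)" for k
  proof -
   have "io (inv sg k) : B" using io by (auto simp: K_def)
   hence "snd (io (inv sg k)) < dord (fst (io (inv sg k)))" unfolding B_def by (elim SigmaE) simp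
   thus ?thesis by (simp add: al_def psg[symmetric] permutes_inverses[OF sg])
  qed
  thus ?thesis by (simp add: A0_def PiE_iff)
 qed
 ultimately show "EX x:{sg. sg permutes UNIV} \<times> A0. io = (case x of (sg, al) => eta al \<circ> sg)"
  using sg by (intro bexI[of _ "(sg, al)"]) auto
qed

lemma card_K: "card K = 2 * fact CARD('m) * 3 ^ (CARD('m) - 1)"
 using bij_betw_same_card[OF K_bij] by (simp add: card_cartesian_product card_permutations[OF refl] card_A0)

lemma sum_K: "(SUM io:K. g io) = (SUM al:A0. SUM sg | sg permutes UNIV. g (eta al \<circ> sg))"
proof -
 have "(SUM io:K. g io) = (SUM x:{sg. sg permutes UNIV} \<times> A0. g (case x of (sg, al) => eta al \<circ> sg))"
  by (rule sum.reindex_bij_betw[OF K_bij, symmetric])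
 also have "... = (SUM (sg, al):{sg. sg permutes UNIV} \<times> A0. g (eta al \<circ> sg))"
  by (intro sum.cong) auto
 also have "... = (SUM sg | sg permutes UNIV. SUM al:A0. g (eta al \<circ> sg))"
  by (rule sum.cartesian_product[symmetric])
 finally show ?thesis by (subst sum.swap)
qed

text \<open>Rewriting in tensors over K transfers independence and the solution property to the
  functions \<open>skew al\<close>.\<close>

lemma skew_combination:
 assumes A: "A \<subseteq> A0"
 shows "EX C. (ALL al:A. C (eta al) = c al) & (ALL z. (SUM al:A. c al * skew al z) = (SUM io:K. C io * tens io z))"
proof -
 let ?h = "%(sg, al). eta al \<circ> sg" and ?D = "{sg. sg permutes (UNIV :: 'm set)} \<times> A0"
 define C where "C io = (case inv_into ?D ?h io of (sg, al) => of_int (sign sg) * (if al : A then c al else 0))" for io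
 have C: "C (eta al \<circ> sg) = of_int (sign sg) * (if al : A then c al else 0)" if "sg permutes UNIV" "al : A0" for sg al
 proof -
  have "inv_into ?D ?h (?h (sg, al)) = (sg, al)"
   by (rule inv_into_f_f) (use K_bij that in \<open>auto simp: bij_betw_def\<close>)
  thus ?thesis by (simp add: C_def)
 qed
 have 1: "C (eta al) = c al" if "al : A" for al
  using C[OF permutes_id, of al] that A by (auto simp: sign_id)
 have 2: "(SUM al:A. c al * skew al z) = (SUM io:K. C io * tens io z)" for z
 proof -
  have "(SUM io:K. C io * tens io z) = (SUM al:A0. (if al : A then c al else 0) * skew al z)"
   unfolding sum_K skew_def sum_distrib_left by (intro sum.cong refl) (simp add: C)
  also have "... = (SUM al:A. c al * skew al z)"
   by (rule sum.mono_neutral_cong_right[OF finite_A0(1) A]) auto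
  finally show ?thesis by simp
 qed
 show ?thesis using 1 2 by (intro exI[of _ C]) blast
qed

lemma eta_K: "al : A0 ==> eta al : K"
 using bspec[OF bij_betwE[OF K_bij], of "(id, al)"] by (simp add: permutes_id)

lemma skew_indep:
 assumes A: "A \<subseteq> A0" and zero: "!!z. (SUM al:A. c al * skew al z) = 0"
 shows "ALL al:A. c al = 0"
proof -
 obtain C where C: "!!al. al : A ==> C (eta al) = c al"
  "!!z. (SUM al:A. c al * skew al z) = (SUM io:K. C io * tens io z)"
  using skew_combination[OF A, of c] by blast
 have "ALL io:K. C io = 0" by (rule tens_indep) (simp add: C(2)[symmetric] zero)
 thus ?thesis using C(1) eta_K A by fastforce
qed

lemma skew_antisymmetric: "antisymmetric (%z. SUM al:A. c al * skew al z)"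
 unfolding antisymmetric_def
proof (intro allI impI)
 fix \<pi> :: "'m => 'm" and z :: "(complex, 'm) vec" assume \<pi>: "\<pi> permutes UNIV"
 have perm: "permutation sg" if "sg permutes (UNIV :: 'm set)" for sg
  using that by (rule permutes_imp_permutation[rotated]) simp
 have s: "of_int (sign \<pi>) * of_int (sign \<pi>) = (1::complex)" by (metis of_int_1 of_int_mult sign_idempotent)
 have "skew al (\<chi> i. z $ \<pi> i) = of_int (sign \<pi>) * skew al z" for al
 proof -
  have "skew al (\<chi> i. z $ \<pi> i) = (SUM sg | sg permutes UNIV. of_int (sign sg) * tens (eta al \<circ> sg \<circ> inv \<pi>) z)"
   unfolding skew_def by (simp add: tens_permute[OF \<pi>])
  also have "... = (SUM sg | sg permutes UNIV. of_int (sign (sg \<circ> \<pi>)) * tens (eta al \<circ> (sg \<circ> \<pi>) \<circ> inv \<pi>) z)"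
   by (rule sum_permutations_compose_right[OF \<pi>])
  also have "... = of_int (sign \<pi>) * skew al z" unfolding skew_def sum_distrib_left
  proof (rule sum.cong[OF refl])
   fix sg :: "'m => 'm" assume "sg : {sg. sg permutes UNIV}"
   hence "sign (sg \<circ> \<pi>) = sign sg * sign \<pi>" using perm \<pi> by (simp add: sign_compose)
   moreover have "eta al \<circ> (sg \<circ> \<pi>) \<circ> inv \<pi> = eta al \<circ> sg"
    by (simp add: fun_eq_iff permutes_inverses[OF \<pi>])
   ultimately show "of_int (sign (sg \<circ> \<pi>)) * tens (eta al \<circ> (sg \<circ> \<pi>) \<circ> inv \<pi>) z =
     of_int (sign \<pi>) * (of_int (sign sg) * tens (eta al \<circ> sg) z)" by simp qed
  finally show ?thesis .
 qed
 thus "(SUM al:A. c al * skew al (\<chi> i. z $ \<pi> i)) = of_int (sign \<pi>) * (SUM al:A. c al * skew al z)"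
  by (simp add: sum_distrib_left mult_ac)
qed

text \<open>Comparing coefficients of independent tensors turns anti-symmetry into
  \<open>C (io \<circ> \<pi>) = of_int (sign \<pi>) * C io\<close>, so the coefficients for the
  identity permutation determine all others.\<close>

lemma antisymmetric_expansion:
 assumes f: "f : Sol" "antisymmetric f"
 shows "EX C. (ALL z. f z = (SUM io:K. C io * tens io z)) & (ALL z. f z = (SUM al:A0. C (eta al) * skew al z))"
proof -
 obtain C where C: "!!z. f z = (SUM io:K. C io * tens io z)" using f(1) unfolding solutions_eq by auto
 have Cp: "C (io \<circ> \<pi>) = of_int (sign \<pi>) * C io" if io: "io : K" and \<pi>: "\<pi> permutes UNIV" for io \<pi>
 proof -
  have KK: "io \<circ> ta : K" if "io : K" "ta permutes UNIV" for io ta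
   using that bij_betw_trans[OF permutes_imp_bij[OF that(2)], of "%i. fst (io i)" "{1..CARD('m)}"]
   by (auto simp: K_def comp_def)
  have "ALL io:K. C (io \<circ> \<pi>) - of_int (sign \<pi>) * C io = 0"
  proof (rule tens_indep)
   fix z :: "(complex, 'm) vec"
   have "f (\<chi> i. z $ \<pi> i) = (SUM io:K. C io * tens (io \<circ> inv \<pi>) z)"
    unfolding C by (simp add: tens_permute[OF \<pi>])
   also have "... = (SUM io:K. C (io \<circ> \<pi>) * tens io z)"
    by (rule sum.reindex_bij_witness[where i = "%io. io \<circ> \<pi>" and j = "%io. io \<circ> inv \<pi>"])
     (auto simp: KK \<pi> permutes_inv comp_assoc permutes_inv_o[OF \<pi>])
   finally have "(SUM io:K. C (io \<circ> \<pi>) * tens io z) = of_int (sign \<pi>) * f z"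
    using f(2) \<pi> by (simp add: antisymmetric_def)
   thus "(SUM io:K. (C (io \<circ> \<pi>) - of_int (sign \<pi>) * C io) * tens io z) = 0"
    by (simp add: C left_diff_distrib sum_subtractf sum_distrib_left mult.assoc)
  qed
  thus ?thesis using io by auto
 qed
 have "f z = (SUM al:A0. C (eta al) * skew al z)" for z
  unfolding C sum_K skew_def sum_distrib_left by (intro sum.cong refl) (simp add: Cp eta_K)
 thus ?thesis using C by blast
qed

lemma skew_solution:
 assumes "A \<subseteq> A0"
 shows "(%z. SUM al:A. c al * skew al z) : Sol"
proof -
 obtain C where "!!z. (SUM al:A. c al * skew al z) = (SUM io:K. C io * tens io z)"
  using skew_combination[OF assms, of c] by blast
 thus ?thesis using combination_solution[of C] by simp
qed

theorem dim_solutions: "complex_dim Sol = 2 * fact CARD('m) * 3 ^ (CARD('m) - 1)"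
 unfolding solutions_eq card_K[symmetric] by (rule complex_dim_span[OF finite_K tens_indep])

theorem dim_antisymmetric: "complex_dim {f : Sol. antisymmetric f} = 2 * 3 ^ (CARD('m) - 1)"
proof -
 have "{f : Sol. antisymmetric f} = {f. EX c. f = (%z. SUM al:A0. c al * skew al z)}"
 proof (intro equalityI subsetI)
  fix f assume "f : {f : Sol. antisymmetric f}"
  then obtain C where "!!z. f z = (SUM al:A0. C (eta al) * skew al z)"
   using antisymmetric_expansion[of f] by blast
  thus "f : {f. EX c. f = (%z. SUM al:A0. c al * skew al z)}"
   by (intro CollectI exI[of _ "%al. C (eta al)"]) auto
 next
  fix f assume "f : {f. EX c. f = (%z. SUM al:A0. c al * skew al z)}"
  thus "f : {f : Sol. antisymmetric f}" using skew_solution[OF order_refl] skew_antisymmetric by auto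
 qed
 thus ?thesis using complex_dim_span[of A0 skew, OF finite_A0(1) skew_indep[OF order_refl]] card_A0 by simp
qed

lemma vb_entire:
 assumes "be : B"
 shows "entire_coeffs (a (fst be) (snd be))" "entire_coeffs (b (fst be) (snd be))"
proof -
 have "snd be < dord (fst be)" using assms unfolding B_def by (elim SigmaE) simp
 thus "entire_coeffs (a (fst be) (snd be))" "entire_coeffs (b (fst be) (snd be))"
  using vb[of "fst be"] by (auto simp: vbasis_def)
qed

text \<open>If the solution has a non-logarithmic expansion, the difference of both expansions extends in
  the variables \<open>log \<lambda>\<^sub>k\<close> to half planes. Adding \<open>2 \<pi> i N\<close> to \<open>log \<lambda>\<^sub>i\<close> produces a term linear in \<open>N\<close>
  that has to vanish.\<close>

lemma non_logarithmic_coefficient: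
 fixes i :: 'm and E :: "(complex, 'm) vec set"
 assumes C: "!!z. z : cpower U ==> f z = (SUM io:ms B. C io * (PROD i:UNIV. u (io i) (z $ i)))"
  and cl: "0 : closure U" and r: "r > 0" and E: "finite E"
  and g: "!!rh. rh : E ==> holomorphic_several (cpower (ball 0 r)) (g rh)"
  and eq: "!!z. z : cpower (U \<inter> ball 0 r) ==> f z = (SUM rh:E. exp (SUM i:UNIV. rh $ i * l (z $ i)) * g rh z)"
  and io0: "io0 : ms B" "snd (io0 i) = dord (fst (io0 i)) - 1"
 shows "C io0 = 0"
proof -
 obtain y0 where "y0 : U" "dist y0 0 < r" using cl r closure_approachable[of 0 U] by blast
 hence "y0 : U \<inter> ball 0 r" by (simp add: dist_commute)
 moreover have "open (U \<inter> ball 0 r)" using U by auto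
 ultimately obtain e where e: "e > 0" "ball y0 e \<subseteq> U \<inter> ball 0 r" using open_contains_ball by metis
 define W where "W = ball y0 e"
 have W: "open W" "connected W" "W ~= {}" "W \<subseteq> U" "W \<subseteq> ball 0 r" using e by (auto simp: W_def)
 have brW: "log_branch W l" using br W(4) by (auto simp: log_branch_def intro: holomorphic_on_subset)
 have lexp: "exp (l y) = y" if "y : W" for y using brW that by (simp add: log_branch_def)
 \<comment> \<open>The half plane of logarithms of numbers with modulus below r; in these
   coordinates both expansions are holomorphic.\<close>
 define H where "H = {s. Re s < ln r}"
 have H: "open H" "connected H"
  by (auto simp: H_def open_halfspace_Re_lt convex_halfspace_Re_lt intro: convex_connected)
 have Hexp: "exp s : ball 0 r \<longleftrightarrow> s : H" for s
 proof -
  have "exp (Re s) < r \<longleftrightarrow> Re s < ln r" using r by (metis exp_less_cancel_iff exp_ln)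
  thus ?thesis by (simp add: H_def dist_norm)
 qed
 define V where "V = l ` W"
 have V: "open V" "V ~= {}" "V \<subseteq> H"
 proof -
  show "open V" unfolding V_def by (rule log_branch_open_image[OF W(1) brW])
  show "V \<subseteq> H"
  proof
   fix s assume "s : V"
   then obtain y where y: "y : W" "s = l y" by (auto simp: V_def)
   hence "exp s : ball 0 r" using W(5) lexp by auto
   thus "s : H" by (simp only: Hexp)
  qed
 qed (use W in \<open>auto simp: V_def\<close>)
 define sb where "sb be = sser M (a (fst be) (snd be)) (b (fst be) (snd be))" for be
 define sl where "sl be = sser M (b (fst be) (snd be)) (%_. 0)" for be
 have sb_hol: "sb be holomorphic_on X" if "be : B" for be X
  unfolding sb_def by (rule sser_holomorphic[OF vb_entire[OF that]])
 have sbl: "sb be (l y) = u be y" if "y : W" for be y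
  unfolding sb_def ubas_def using logser_sser[OF brW that] by simp
 \<comment> \<open>The difference of the two expansions in logarithmic coordinates. It vanishes on
   \<open>cpower V\<close>, hence on \<open>cpower H\<close>, which is stable under the shifts by 2
   pi i N.\<close>
 define \<Phi> where "\<Phi> s = (SUM io:ms B. C io * (PROD k:UNIV. sb (io k) (s $ k))) -
  (SUM rh:E. exp (SUM k:UNIV. rh $ k * s $ k) * g rh (\<chi> k. exp (s $ k)))" for s :: "(complex, 'm) vec"
 have \<Phi>0: "\<Phi> s = 0" if s: "s : cpower H" for s
 proof (rule several_identity[OF H V _ _ s, of \<Phi>])
  fix z :: "(complex, 'm) vec" and i assume z: "z : cpower H"
  have comp: "(%t. h (upd z i t $ k)) holomorphic_on H" if "h holomorphic_on UNIV" for h k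
   using holomorphic_on_subset[OF that, of H] by (cases "k = i") auto
  have gh: "(%t. g rh (\<chi> k. exp (upd z i t $ k))) holomorphic_on H" if "rh : E" for rh
  proof -
   let ?z = "(\<chi> k. exp (z $ k)) :: (complex, 'm) vec"
   have "?z : cpower (ball 0 r)" using z Hexp by simp
   from holomorphic_several_slice[OF g[OF that] this, of i]
   have "((%t. g rh (upd ?z i t)) \<circ> exp) holomorphic_on H"
    by (intro holomorphic_on_compose_gen[where t = "ball 0 r"]) (use Hexp in \<open>auto intro: holomorphic_intros\<close>)
   moreover have "((%t. g rh (upd ?z i t)) \<circ> exp) = (%t. g rh (\<chi> k. exp (upd z i t $ k)))"
   proof
    fix t
    have "upd ?z i (exp t) = (\<chi> k. exp (upd z i t $ k))" by (simp add: vec_eq_iff)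
    thus "((%t. g rh (upd ?z i t)) \<circ> exp) t = g rh (\<chi> k. exp (upd z i t $ k))" by (simp only: comp_apply)
   qed
   ultimately show ?thesis by simp
  qed
  show "(%t. \<Phi> (upd z i t)) holomorphic_on H" unfolding \<Phi>_def
   by (intro holomorphic_intros gh comp sb_hol comp[of "%x. x"]) auto
 next
  fix z :: "(complex, 'm) vec" assume z: "z : cpower V"
  hence "ALL k. EX y. y : W & z $ k = l y" by (auto simp: V_def)
  from choice[OF this] obtain y where y: "!!k. y k : W" "!!k. z $ k = l (y k)" by blast
  define w where "w = (\<chi> k. y k)"
  have w: "w : cpower U" "w : cpower (U \<inter> ball 0 r)" using subsetD[OF W(4) y(1)] subsetD[OF W(5) y(1)] by (auto simp: w_def)
  have "(\<chi> k. exp (z $ k)) = w" using y lexp by (simp add: vec_eq_iff w_def)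
  moreover have "(SUM k:UNIV. rh $ k * z $ k) = (SUM k:UNIV. rh $ k * l (w $ k))" for rh :: "(complex, 'm) vec"
   by (simp add: w_def y(2))
  moreover have "(PROD k:UNIV. sb (io k) (z $ k)) = (PROD k:UNIV. u (io k) (w $ k))" for io
   by (simp add: w_def y sbl)
  ultimately show "\<Phi> z = 0" unfolding \<Phi>_def using C[OF w(1)] eq[OF w(2)] by simp
 qed
 have shift: "(SUM io:ms B. C io * (sl (io i) (s $ i) * (PROD k:UNIV-{i}. sb (io k) (s $ k)))) = 0"
  if s: "s : cpower H" for s
 proof -
  let ?c = "2 * of_real pi * \<i>"
  let ?P = "%io. PROD k:UNIV-{i}. sb (io k) (s $ k)"
  define al where "al = (SUM io:ms B. C io * (sb (io i) (s $ i) * ?P io))"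
  define be where "be = ?c * (SUM io:ms B. C io * (sl (io i) (s $ i) * ?P io))"
  \<comment> \<open>The solution side is affine in N by \<open>sser_shift\<close>; the other side is
    a sum of geometric sequences, since a shift of s affects only the exponential factors.\<close>
  have "al + of_nat N * be = (SUM rh:E. exp (?c * rh $ i) ^ N * (exp (SUM k:UNIV. rh $ k * s $ k) * g rh (\<chi> k. exp (s $ k))))" for N
  proof -
   define s' where "s' = upd s i (s $ i + ?c * of_nat N)"
   have "s' : cpower H" using s by (auto simp: s'_def H_def)
   hence "\<Phi> s' = 0" by (rule \<Phi>0)
   moreover have "(PROD k:UNIV. sb (io k) (s' $ k)) =
     sb (io i) (s $ i) * ?P io + of_nat N * (?c * (sl (io i) (s $ i) * ?P io))" for io
   proof -
    have "(PROD k:UNIV-{i}. sb (io k) (s' $ k)) = ?P io" by (intro prod.cong) (auto simp: s'_def)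
    moreover have "sb (io i) (s' $ i) = sb (io i) (s $ i) + of_nat N * ?c * sl (io i) (s $ i)"
     using sser_shift by (simp add: s'_def sb_def sl_def)
    ultimately show ?thesis by (subst prod.remove[of _ i]) (simp_all add: algebra_simps)
   qed
   moreover have "(\<chi> k. exp (s' $ k)) = (\<chi> k. exp (s $ k))"
   proof -
    have "exp (?c * of_nat N) = 1" using exp_integer_2pi[of "of_nat N"] by (simp add: mult_ac)
    thus ?thesis by (simp add: vec_eq_iff s'_def exp_add)
   qed
   moreover have "exp (SUM k:UNIV. rh $ k * s' $ k) = exp (?c * rh $ i) ^ N * exp (SUM k:UNIV. rh $ k * s $ k)" for rh :: "(complex, 'm) vec"
   proof -
    have "(SUM k:UNIV. rh $ k * s' $ k) = (SUM k:UNIV. rh $ k * s $ k) + of_nat N * (?c * rh $ i)"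
    proof -
     have "(SUM k:UNIV. rh $ k * s' $ k) = (SUM k:UNIV. rh $ k * s $ k + (if k = i then of_nat N * (?c * rh $ i) else 0))"
      by (intro sum.cong) (auto simp: s'_def algebra_simps)
     thus ?thesis by (simp add: sum.distrib)
    qed
    thus ?thesis by (simp add: exp_add exp_of_nat_mult mult.commute)
   qed
   ultimately show ?thesis unfolding \<Phi>_def al_def be_def
    by (simp add: distrib_left sum.distrib sum_distrib_left mult.assoc mult.left_commute)
  qed
  from exponential_sum_linear[OF E this] show ?thesis unfolding be_def by simp
 qed
 let ?top = "%be::nat \<times> nat. (fst be, dord (fst be) - 1)"
 \<comment> \<open>The logarithmic element at i has turned into the element with index 0 there,
   because \<open>b j (dord j - 1) = a j 0\<close>; \<open>C'\<close> is the coefficient after this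
   change of index.\<close>
 define C' where "C' ka = (if snd (ka i) = 0 then C (ka(i := ?top (ka i))) else 0)" for ka
 have Bmem: "(fst be, 0) : B" "?top be : B" "snd be < dord (fst be)" if "be : B" for be
  using that unfolding B_def by (auto simp: dord_def split: if_splits)
 have ms_upd: "ka(i := be) : ms B" if "ka : ms B" "be : B" for ka :: "'m => nat \<times> nat" and be
  using that by (auto simp: PiE_iff)
 have zero: "(SUM ka:ms B. C' ka * (PROD k:UNIV. u (ka k) (z $ k))) = 0" if z: "z : cpower W" for z :: "(complex, 'm) vec"
 proof -
  define s where "s = (\<chi> k. l (z $ k))"
  have s: "s : cpower H" using z V(3) by (auto simp: s_def V_def)
  have zW: "z $ k : W" for k using z by simp
  let ?P = "%io. PROD k:UNIV-{i}. u (io k) (z $ k)"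
  let ?X = "{ka : ms B. snd (ka i) = 0}" and ?Y = "{io : ms B. io i = ?top (io i)}"
  have "0 = (SUM io:ms B. C io * (sl (io i) (s $ i) * (PROD k:UNIV-{i}. sb (io k) (s $ k))))"
   using shift[OF s] by simp
  also have "... = (SUM io:ms B. C io * (sl (io i) (s $ i) * ?P io))"
   by (simp add: s_def sbl[OF zW])
  also have "... = (SUM io:?Y. C io * (u (fst (io i), 0) (z $ i) * ?P io))"
  proof (rule sum.mono_neutral_cong_right[OF finite_ms])
   show "ALL io:ms B - ?Y. C io * (sl (io i) (s $ i) * ?P io) = 0"
   proof
    fix io assume io: "io : ms B - ?Y"
    hence "snd (io i) < dord (fst (io i))" "snd (io i) ~= dord (fst (io i)) - 1"
     using Bmem(3)[of "io i"] by (auto simp: prod_eq_iff)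
    hence "snd (io i) < dord (fst (io i)) - 1" by simp
    hence "b (fst (io i)) (snd (io i)) = (%_. 0)" using vb[of "fst (io i)"] by (simp add: vbasis_def)
    hence "sl (io i) (s $ i) = 0" by (simp add: sl_def sser_def pser_def)
    thus "C io * (sl (io i) (s $ i) * ?P io) = 0" by simp
   qed
   fix io assume io: "io : ?Y"
   define j where "j = fst (io i)"
   have "dord j - 1 > 0" by (simp add: dord_def)
   hence "b j 0 = (%_. 0)" "b j (dord j - 1) = a j 0" using vb[of j] by (auto simp: vbasis_def)
   moreover have "io i = (j, dord j - 1)" using io by (simp add: j_def)
   ultimately have "sl (io i) (s $ i) = sb (j, 0) (l (z $ i))" by (simp add: sl_def sb_def s_def)
   thus "C io * (sl (io i) (s $ i) * ?P io) = C io * (u (fst (io i), 0) (z $ i) * ?P io)"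
    by (simp add: sbl[OF zW] j_def)
  qed auto
  also have "... = (SUM ka:?X. C (ka(i := ?top (ka i))) * (u (ka i) (z $ i) * ?P ka))"
  proof (rule sum.reindex_bij_witness[where i = "%ka. ka(i := ?top (ka i))" and j = "%io. io(i := (fst (io i), 0))"])
   fix io assume io: "io : ?Y"
   hence e: "io(i := (fst (io i), dord (fst (io i)) - 1)) = io" by (simp add: fun_upd_idem_iff)
   thus "(io(i := (fst (io i), 0)))(i := ?top ((io(i := (fst (io i), 0))) i)) = io" by simp
   show "io(i := (fst (io i), 0)) : ?X" using io ms_upd[of io] Bmem(1)[of "io i"] by auto
   have "?P (io(i := (fst (io i), 0))) = ?P io" by (intro prod.cong) auto
   thus "C ((io(i := (fst (io i), 0)))(i := ?top ((io(i := (fst (io i), 0))) i))) *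
     (u ((io(i := (fst (io i), 0))) i) (z $ i) * ?P (io(i := (fst (io i), 0)))) =
     C io * (u (fst (io i), 0) (z $ i) * ?P io)" using e by simp next
   fix ka assume ka: "ka : ?X"
   hence "ka i = (fst (ka i), 0)" by (auto simp: prod_eq_iff)
   thus "(ka(i := ?top (ka i)))(i := (fst ((ka(i := ?top (ka i))) i), 0)) = ka"
    by (simp add: fun_upd_idem_iff)
   show "ka(i := ?top (ka i)) : ?Y" using ka ms_upd[of ka] Bmem(2)[of "ka i"] by auto
  qed
  also have "... = (SUM ka:ms B. C' ka * (PROD k:UNIV. u (ka k) (z $ k)))"
   by (rule sum.mono_neutral_cong_left[OF finite_ms]) (auto simp: C'_def prod.remove[of UNIV i])
  finally show ?thesis by simp
 qed
 have "C' (io0(i := (fst (io0 i), 0))) = 0" by (rule tensor_indep[OF finite_B u_indep[OF W(1-4)] zero])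
   (assumption | rule ms_upd Bmem(1) ms_B io0(1))+
 moreover have "io0(i := (fst (io0 i), dord (fst (io0 i)) - 1)) = io0"
  using io0(2) by (simp add: fun_upd_idem_iff prod_eq_iff)
 ultimately show ?thesis by (simp add: C'_def)
qed

lemma change_branch:
 assumes "log_branch U l'"
 shows "solution_space n L x0 U l' a b M B"
proof (rule solution_space.intro)
 show "annihilates id P (pfun u) (slice x0 U)"
  if "bij_betw J (UNIV :: 'm set) {1..CARD('m)}" "!!i. u i : Vsol M x0 U (J i)" "P : generators n L" for J u P
  by (rule annih[OF that])
qed (rule M_eq B_eq x0 U assms vb lclm lead)+

text \<open>Indices in A1 involve no logarithm, so the functions do not depend on the
  branch.\<close>

lemma skew_branch:
 assumes br': "log_branch U l'" and al: "al : A1"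
 shows "skew al = solution_space.skew U l' a b M al"
proof -
 interpret S': solution_space n L x0 U l' a b M B by (rule change_branch[OF br'])
 have "b (position i) (al i) = (%_. 0)" for i
 proof -
  have "al i < dord (position i) - 1" using al by (auto simp: A1_def)
  thus ?thesis using vb[of "position i"] by (simp add: vbasis_def)
 qed
 hence "u (eta al i) = S'.u (eta al i)" for i
  by (simp add: ubas_def logser_def eta_def pser_def fun_eq_iff)
 hence "tens (eta al \<circ> sg) z = S'.tens (eta al \<circ> sg) z" for sg z
  by (simp add: tens_def S'.tens_def)
 moreover have "eta al = S'.eta al" by (simp add: fun_eq_iff eta_def S'.eta_def)
 ultimately show ?thesis by (simp add: skew_def[abs_def] S'.skew_def[abs_def])
qed

lemma skew_non_logarithmic: "non_logarithmic U (%z. SUM al:A1. c al * skew al z)"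
 unfolding non_logarithmic_def
proof (intro exI conjI ballI)
 \<comment> \<open>For these elements the coefficients below M vanish, so division by y^M is a shift
   of the series and the single exponent 0 suffices.\<close>
 define G where "G be y = pser (%k. a (fst be) (snd be) (k + M)) y" for be y
 define g where "g z = (SUM al:A1. c al * (SUM sg | sg permutes UNIV. of_int (sign sg) * (PROD i:UNIV. G (eta al (sg i)) (z $ i))))" for z :: "(complex, 'm) vec"
 have ab: "b (position k) (al k) = (%_. 0)" "!!i. i < M ==> a (position k) (al k) i = 0" "eta al k : B" if "al : A1" for al k
 proof -
  have "al k < dord (position k) - 1" using that by (auto simp: A1_def)
  thus "b (position k) (al k) = (%_. 0)" "!!i. i < M ==> a (position k) (al k) i = 0"
   using vb[of "position k"] by (simp_all add: vbasis_def)
  show "eta al k : B" using eta_K[of al] that A1_A0 by (auto simp: K_def)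
 qed
 have uG: "u (eta al k) y = G (eta al k) y" if "al : A1" "y : U" for al k y
 proof -
  have y: "y ~= 0" using br that by (auto simp: log_branch_def)
  have ent: "entire_coeffs (a (position k) (al k))" using vb_entire[OF ab(3)[OF that(1)]] by (simp add: eta_def)
  have "pser (a (position k) (al k)) y = G (eta al k) y * y ^ M"
   unfolding G_def eta_def fst_conv snd_conv by (rule pser_shift[OF ent ab(2)[OF that(1)]])
  thus ?thesis using y ab(1)[OF that(1), of k] by (simp add: ubas_def logser_def eta_def pser_def)
 qed
 have Ghol: "G (eta al k) holomorphic_on UNIV" if "al : A1" for al k
  unfolding G_def[abs_def] by (intro pser_holomorphic entire_coeffs_shift vb_entire ab(3) that)
 show "l holomorphic_on U" "!!y. y : U ==> exp (l y) = y" using br by (auto simp: log_branch_def)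
 show "(0::real) < 1" "finite {0 :: (complex, 'm) vec}" by auto
 show "holomorphic_several (cpower (ball 0 1)) g" if "rh : {0 :: (complex, 'm) vec}" for rh
  unfolding holomorphic_several_iff g_def
  by (intro ballI hs_at_sum hs_at_mult hs_at_const hs_at_prod hs_at_component[OF Ghol]) auto
 fix z :: "(complex, 'm) vec" assume z: "z : cpower (U \<inter> ball 0 1)"
 hence zU: "z : cpower U" by simp
 have "tens (eta al \<circ> sg) z = (PROD i:UNIV. G (eta al (sg i)) (z $ i))" if "al : A1" for al sg
  using zU uG[OF that] by (simp add: tens_def)
 thus "(SUM al:A1. c al * skew al z) =
   (SUM rh:{0}. exp (SUM i:UNIV. rh $ i * l (z $ i)) * g z)" by (simp add: g_def skew_def) qed

text \<open>An index in A0 outside A1 carries the logarithmic element in some variable, where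
  \<open>non_logarithmic_coefficient\<close> forces its coefficient to be 0. The branch of the given
  expansion is that of the locale.\<close>

lemma non_logarithmic_branch_expansion:
 assumes f: "f : Sol" "antisymmetric f" and cl: "0 : closure U" and r: "r > 0" and E: "finite E"
  and g: "!!rh. rh : E ==> holomorphic_several (cpower (ball 0 r)) (g rh)"
  and eq: "!!z. z : cpower (U \<inter> ball 0 r) ==> f z = (SUM rh:E. exp (SUM i:UNIV. rh $ i * l (z $ i)) * g rh z)"
 shows "EX c. f = (%z. SUM al:A1. c al * skew al z)"
proof -
 obtain C where C: "!!z. f z = (SUM io:K. C io * tens io z)" "!!z. f z = (SUM al:A0. C (eta al) * skew al z)"
  using antisymmetric_expansion[OF f] by blast
 let ?C = "%io. if io : K then C io else 0"
 have ex: "f z = (SUM io:ms B. ?C io * (PROD i:UNIV. u (io i) (z $ i)))" if z: "z : cpower U" for z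
  unfolding C(1)
  by (rule sum.mono_neutral_cong_left[OF finite_ms]) (use z in \<open>auto simp: K_def tens_def\<close>)
 have "C (eta al) = 0" if al: "al : A0 - A1" for al
 proof -
  have "EX i. al i = dord (position i) - 1"
  proof (rule ccontr)
   assume neg: "\<not> ?thesis"
   have "al i < dord (position i) - 1" for i
   proof -
    have "al i < dord (position i)" "al i ~= dord (position i) - 1" using al neg by (auto simp: A0_def)
    thus ?thesis by simp
   qed
   thus False using al by (auto simp: A1_def PiE_iff)
  qed
  then obtain i where i: "al i = dord (position i) - 1" by blast
  have etaK: "eta al : K" using al eta_K by blast
  hence "eta al : ms B" by (simp add: K_def)
  moreover have "snd (eta al i) = dord (fst (eta al i)) - 1" by (simp add: eta_def i)
  ultimately have "?C (eta al) = 0"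
   by (intro non_logarithmic_coefficient[where C = ?C and f = f and g = g and E = E and r = r and i = i])
    (assumption | rule ex cl r E g eq)+
  thus ?thesis using etaK by simp
 qed
 hence "f z = (SUM al:A1. C (eta al) * skew al z)" for z
  unfolding C(2) by (intro sum.mono_neutral_right[OF finite_A0(1) A1_A0]) auto
 thus ?thesis by (intro exI[of _ "%al. C (eta al)"]) auto
qed

theorem dim_non_logarithmic:
 assumes cl: "0 : closure U"
 shows "complex_dim {f : Sol. antisymmetric f & non_logarithmic U f} = 2 ^ (CARD('m) - 1)"
proof -
 have "{f : Sol. antisymmetric f & non_logarithmic U f} = {f. EX c. f = (%z. SUM al:A1. c al * skew al z)}"
 proof (intro equalityI subsetI)
  fix f assume f: "f : {f : Sol. antisymmetric f & non_logarithmic U f}"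
  obtain l' r and E :: "(complex, 'm) vec set" and g where
   w: "l' holomorphic_on U" "ALL y:U. exp (l' y) = y" "r > 0" "finite E"
   "!!rh. rh : E ==> holomorphic_several (cpower (ball 0 r)) (g rh)"
   "!!z. z : cpower (U \<inter> ball 0 r) ==> f z = (SUM rh:E. exp (SUM i:UNIV. rh $ i * l' (z $ i)) * g rh z)"
   using f unfolding non_logarithmic_def by blast
  have br': "log_branch U l'" using w(1,2) by (simp add: log_branch_def)
  interpret S': solution_space n L x0 U l' a b M B by (rule change_branch[OF br'])
  obtain c where "f = (%z. SUM al:S'.A1. c al * S'.skew al z)"
   using S'.non_logarithmic_branch_expansion[OF _ _ cl w(3-6)] f by blast
  moreover have "S'.A1 = A1" by (simp add: S'.A1_def A1_def)
  ultimately have "f = (%z. SUM al:A1. c al * skew al z)"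
   using skew_branch[OF br'] by (simp add: fun_eq_iff)
  thus "f : {f. EX c. f = (%z. SUM al:A1. c al * skew al z)}" by (intro CollectI exI[of _ c])
 next
  fix f assume "f : {f. EX c. f = (%z. SUM al:A1. c al * skew al z)}"
  thus "f : {f : Sol. antisymmetric f & non_logarithmic U f}"
   using skew_solution[OF A1_A0] skew_antisymmetric skew_non_logarithmic by auto
 qed
 thus ?thesis using complex_dim_span[of A1 skew, OF finite_A0(2) skew_indep[OF A1_A0]] card_A1 by simp
qed

end

text \<open>E collects 0, the finitely many x0 at which annihilation of the products may fail for
  one of the finitely many bijections and generators, and those at which a leading coefficient
  disappears. A logarithm exists because U is simply connected and avoids 0.\<close>

theorem solution_space_dimensions:
 fixes L :: "'m::{finite,linorder} => ('m option, complex) diffop"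
 assumes L: "!!i. is_Tlclm n i (L i)"
 shows "EX E. finite E & (ALL x0 U. x0 ~: E & open U & U ~= {} & simply_connected U & 0 ~: U -->
  complex_dim (solutions (generators n L) x0 U) = 2 * fact CARD('m) * 3 ^ (CARD('m) - 1) &
  complex_dim {f : solutions (generators n L) x0 U. antisymmetric f} = 2 * 3 ^ (CARD('m) - 1) &
  (0 : closure U -->
    complex_dim {f : solutions (generators n L) x0 U. antisymmetric f & non_logarithmic U f}
     = 2 ^ (CARD('m) - 1)))" proof - let ?G = "generators n L" and ?N = "3 * CARD('m) - 1"
 let ?J = "{J. bij_betw J (UNIV :: 'm set) {1..CARD('m)}}"
 have "?J \<subseteq> PiE UNIV (%_. {1..CARD('m)})"
 proof
  fix J assume "J : ?J"
  hence "J i : {1..CARD('m)}" for i using bij_betwE[of J UNIV] by blast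
  thus "J : PiE UNIV (%_. {1..CARD('m)})" by (simp add: PiE_iff)
 qed
 hence finJ: "finite ?J" by (rule finite_subset) (simp add: finite_PiE)
 have finG: "finite ?G" by (simp add: generators_def)
 have "ALL x:?J \<times> ?G. EX E. finite E & (ALL x0 U F. x0 ~: E --> open U --> smooth (tube U) F -->
   (F, slice x0 U) : Fam n (fst x) --> annihilates id (snd x) F (slice x0 U))" proof
  fix x assume "x : ?J \<times> ?G"
  hence "snd x : cid.Kill (Fam n (fst x))" by (intro generators_Kill[OF _ L]) auto
  thus "EX E. finite E & (ALL x0 U F. x0 ~: E --> open U --> smooth (tube U) F -->
   (F, slice x0 U) : Fam n (fst x) --> annihilates id (snd x) F (slice x0 U))"
   by (rule annihilates_slice)
 qed
 from bchoice[OF this] obtain E1 where E1: "ALL x:?J \<times> ?G. finite (E1 x) & (ALL x0 U F. x0 ~: E1 x -->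
   open U --> smooth (tube U) F --> (F, slice x0 U) : Fam n (fst x) --> annihilates id (snd x) F (slice x0 U))"
  by (rule exE)
 have "ALL i. EX dQ. clears (fst dQ) (L i) (snd dQ) & (ALL al. mpol_vars (lookup (snd dQ) al) \<subseteq> {None, Some i})"
 proof
  fix i
  have "L i : Dvar i" using L[of i] by (simp add: is_Tlclm_iff common_mult_def)
  then obtain d Q where "clears d (L i) Q" "!!al. mpol_vars (lookup Q al) \<subseteq> {None, Some i}"
   by (rule clears_exists) (rule that)
  thus "EX dQ. clears (fst dQ) (L i) (snd dQ) & (ALL al. mpol_vars (lookup (snd dQ) al) \<subseteq> {None, Some i})"
   by (intro exI[of _ "(d, Q)"]) simp
 qed
 from choice[OF this] obtain dQ where dQ: "!!i. clears (fst (dQ i)) (L i) (snd (dQ i))"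
  "!!i al. mpol_vars (lookup (snd (dQ i)) al) \<subseteq> {None, Some i}" by blast
 define q where "q i = lookup (snd (dQ i)) (single (Some i) ?N)" for i
 let ?E2 = "%i. {t. ALL z :: complex^('m option). z $ None = t --> mpol_eval id (q i) z = 0}"
 have finE2: "finite (?E2 i)" for i
 proof (rule cid.finite_bad_parameters)
  have "L i : Dvar i" "L i ~= 0" using L[of i] by (auto simp: is_Tlclm_iff common_mult_def)
  from op_order_lead[OF this] have "lookup (L i) (single (Some i) ?N) ~= 0" unfolding Tlclm_order[OF L] .
  thus "q i ~= 0" unfolding q_def using clears_lookup_0[OF dQ(1)] by blast
 qed
 define E where "E = {0} \<union> (UN x:?J \<times> ?G. E1 x) \<union> (UN i. ?E2 i)"
 have "finite E" unfolding E_def using conjunct1[OF bspec[OF E1]] finJ finG finE2 by (intro finite_UnI finite_UN_I finite_SigmaI finite.intros) simp_all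
 moreover have "complex_dim (solutions ?G x0 U) = 2 * fact CARD('m) * 3 ^ (CARD('m) - 1) &
  complex_dim {f : solutions ?G x0 U. antisymmetric f} = 2 * 3 ^ (CARD('m) - 1) &
  (0 : closure U -->
    complex_dim {f : solutions ?G x0 U. antisymmetric f & non_logarithmic U f} = 2 ^ (CARD('m) - 1))"
  if x0: "x0 ~: E" and U: "open U" "U ~= {}" "simply_connected U" "0 ~: U" for x0 U
 proof -
  have x00: "x0 ~= 0" using x0 by (simp add: E_def)
  have "EX l. l holomorphic_on U & (ALL z:U. z = exp (l z))"
   using U simply_connected_eq_holomorphic_log[OF U(1)] by (auto intro: holomorphic_on_ident)
  then obtain l where l: "log_branch U l" unfolding log_branch_def by metis
  have "ALL j. EX ab. vbasis (n - CARD('m)) x0 j (fst ab) (snd ab)" using vbasis_exists[OF x00] by simp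
  from choice[OF this] obtain ab where ab: "!!j. vbasis (n - CARD('m)) x0 j (fst (ab j)) (snd (ab j))" by blast
  have ann: "annihilates id P (pfun u) (slice x0 U)"
   if J: "bij_betw J UNIV {1..CARD('m)}" and u: "!!i. u i : Vsol (n - CARD('m)) x0 U (J i)" and P: "P : ?G"
   for J and u :: "'m => complex => complex" and P
  proof -
   have JP: "(J, P) : ?J \<times> ?G" using J P by simp
   have "x0 ~: E1 (J, P)" using x0 JP unfolding E_def by blast
   moreover have "smooth (tube U) (pfun u)" by (rule smooth_pfun[OF U(1)]) (use u in \<open>simp add: Vsol_def\<close>)
   moreover have "(pfun u, slice x0 U) : Fam n (fst (J, P))" using u U(1) x00 by (auto simp: Fam_def)
   ultimately show ?thesis using conjunct2[OF bspec[OF E1 JP], rule_format, of x0 U "pfun u"] U(1) by simp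
  qed
  have lead: "EX d Q y. clears d (L i) Q & (ALL al. mpol_vars (lookup Q al) \<subseteq> {None, Some i}) &
   y $ None = x0 & mpol_eval id (lookup Q (single (Some i) ?N)) y ~= 0" for i proof -
   have "x0 ~: ?E2 i" using x0 unfolding E_def by blast
   then obtain y where "y $ None = x0" "mpol_eval id (q i) y ~= 0" by blast
   thus ?thesis using dQ[of i] unfolding q_def by blast
  qed
  interpret solution_space n L x0 U l "%j. fst (ab j)" "%j. snd (ab j)" "n - CARD('m)" "Bidx CARD('m)"
  proof (rule solution_space.intro)
   show "connected U" by (rule simply_connected_imp_connected[OF U(3)])
   show "annihilates id P (pfun u) (slice x0 U)"
    if "bij_betw J (UNIV :: 'm set) {1..CARD('m)}" "!!i. u i : Vsol (n - CARD('m)) x0 U (J i)" "P : ?G" for J u P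
    by (rule ann[OF that])
  qed (rule refl x00 U(1,2) l ab L lead)+
  show ?thesis using dim_solutions dim_antisymmetric dim_non_logarithmic by blast
 qed
 ultimately show ?thesis by (intro exI[of _ E]) blast
qed

section \<open>The determinant of integrals\<close>

definition Wint :: "(complex => complex) => (complex => complex) => complex => complex => complex" where
 "Wint p g x y = contour_integral (linepath 0 x) (%t. p t * g (t * y))"

lemma entire_arg: "g holomorphic_on UNIV ==> (%t. g (t * y)) holomorphic_on UNIV"
proof -
 assume g: "g holomorphic_on UNIV"
 have "(%t. t * y) holomorphic_on UNIV" by (intro holomorphic_intros)
 from holomorphic_on_compose_gen[OF this g] show ?thesis by (simp add: comp_def)
qed

lemma entire_has_deriv: "g holomorphic_on UNIV ==> (g has_field_derivative deriv g z) (at z)"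
 by (rule holomorphic_derivI[OF _ open_UNIV UNIV_I])

lemma entire_continuous:
 "g holomorphic_on UNIV ==> continuous_on S h ==> continuous_on S (%z. g (h z))"
 by (rule continuous_on_compose2[OF holomorphic_on_imp_continuous_on]) auto

lemma line_integral_primitive:
 assumes "!!t. (F has_field_derivative f t) (at t)"
 shows "(f has_contour_integral (F x - F 0)) (linepath 0 x)"
 using contour_integral_primitive[of UNIV F f "linepath 0 x"] assms by simp

lemma line_integral_deriv:
 assumes "f holomorphic_on UNIV"
 shows "((%x. contour_integral (linepath 0 x) f) has_field_derivative f x) (at x)"
proof -
 obtain F where F: "!!x. x : UNIV ==> (F has_field_derivative f x) (at x within UNIV)"
  using holomorphic_convex_primitive'[OF convex_UNIV open_UNIV assms] by blast
 have "contour_integral (linepath 0 x) f = F x - F 0" for x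
  by (rule contour_integral_unique[OF line_integral_primitive]) (use F in simp)
 thus ?thesis using F[of x] by (auto intro!: derivative_eq_intros)
qed

lemma has_line_integral:
 assumes "f holomorphic_on UNIV"
 shows "(f has_contour_integral contour_integral (linepath 0 x) f) (linepath 0 x)"
proof (rule has_contour_integral_integral[OF contour_integrable_continuous_linepath])
 show "continuous_on (closed_segment 0 x) f"
  using holomorphic_on_imp_continuous_on[OF assms] continuous_on_subset by blast
qed

lemma Wint_has:
 assumes "p holomorphic_on UNIV" "g holomorphic_on UNIV"
 shows "((%t. p t * g (t * y)) has_contour_integral Wint p g x y) (linepath 0 x)"
 unfolding Wint_def by (rule has_line_integral) (intro holomorphic_on_mult entire_arg assms)

lemma Wint_eqI:
 assumes "(f has_contour_integral I) (linepath 0 x)" "f = (%t. p t * g (t * y))"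
 shows "I = Wint p g x y" using contour_integral_unique[OF assms(1)] unfolding assms(2) Wint_def by simp

lemma Wint_x:
 assumes "p holomorphic_on UNIV" "g holomorphic_on UNIV"
 shows "((%x. Wint p g x y) has_field_derivative p x * g (x * y)) (at x)"
 unfolding Wint_def by (rule line_integral_deriv) (intro holomorphic_on_mult entire_arg assms)

text \<open>Over a fixed interval x and y enter the integrand only, which gives differentiation in y
  under the integral and joint continuity.\<close>

lemma Wint_integral:
 "Wint p g x y = integral (cbox 0 1) (%s. p (of_real s * x) * g (of_real s * x * y) * x)"
 unfolding Wint_def contour_integral_integral vector_derivative_linepath_at
 by (simp add: linepath_def scaleR_conv_of_real)

lemma Wint_y:
 assumes p: "p holomorphic_on UNIV" and g: "g holomorphic_on UNIV"
 shows "((%y. Wint p g x y) has_field_derivative Wint (%t. t * p t) (deriv g) x y) (at y)"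
proof -
 have g': "deriv g holomorphic_on UNIV" by (rule holomorphic_deriv[OF g open_UNIV])
 have "((%y. integral (cbox 0 1) (%s. p (of_real s * x) * g (of_real s * x * y) * x)) has_field_derivative
   integral (cbox 0 1) (%s. (of_real s * x * p (of_real s * x)) * deriv g (of_real s * x * y) * x)) (at y within UNIV)"
 proof (rule leibniz_rule_field_derivative)
  fix y s
  show "((%y. p (of_real s * x) * g (of_real s * x * y) * x) has_field_derivative
    of_real s * x * p (of_real s * x) * deriv g (of_real s * x * y) * x) (at y within UNIV)"
   by (rule derivative_eq_intros DERIV_chain2[OF entire_has_deriv[OF g]] refl | simp)+
 next
  fix y
  have "continuous_on (cbox 0 1) (%s. p (of_real s * x) * g (of_real s * x * y) * x)"
   by (intro continuous_intros entire_continuous[OF p] entire_continuous[OF g])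
  thus "(%s. p (of_real s * x) * g (of_real s * x * y) * x) integrable_on cbox 0 1"
   by (rule integrable_continuous)
 next
  show "continuous_on (UNIV \<times> cbox 0 1)
   (%(y, s). of_real s * x * p (of_real s * x) * deriv g (of_real s * x * y) * x)" unfolding split_beta
   by (intro continuous_intros entire_continuous[OF p] entire_continuous[OF g'])
 qed auto
 moreover have "Wint p g x = (%y. integral (cbox 0 1) (%s. p (of_real s * x) * g (of_real s * x * y) * x))" for p g
  by (rule ext) (rule Wint_integral)
 ultimately show ?thesis by simp
qed

lemma Wint_continuous:
 fixes v w :: "'v::finite"
 assumes p: "p holomorphic_on UNIV" and g: "g holomorphic_on UNIV"
 shows "continuous_on UNIV (%z :: complex^'v. Wint p g (z $ v) (z $ w))" unfolding Wint_integral
proof (rule integral_continuous_on_param)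
 show "continuous_on (UNIV \<times> cbox 0 1)
  (%(z :: complex^'v, s). p (of_real s * z $ v) * g (of_real s * z $ v * z $ w) * z $ v)"
  unfolding split_beta by (intro continuous_intros entire_continuous[OF p] entire_continuous[OF g])
qed

lemma deriv_Wint: "p holomorphic_on UNIV ==> g holomorphic_on UNIV ==> deriv (Wint p g x) = Wint (%t. t * p t) (deriv g) x"
 using Wint_y by (auto intro!: DERIV_imp_deriv)

lemma Wint_entire: "p holomorphic_on UNIV ==> g holomorphic_on UNIV ==> Wint p g x holomorphic_on UNIV"
proof (rule holomorphic_onI)
 fix y assume "p holomorphic_on UNIV" "g holomorphic_on UNIV"
 from Wint_y[OF this, of x y] show "Wint p g x field_differentiable at y within UNIV"
  unfolding field_differentiable_def by (intro exI[of _ "Wint (%t. t * p t) (deriv g) x y"]) simp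
qed

section \<open>Smoothness of compositions and of integrals\<close>

lemma smooth_component: "open Om ==> smooth Om (%z. z $ v)"
 by (rule smooth_of_component[of Om UNIV _ "%x. x"]) auto

lemma smooth_entire:
 fixes Om :: "(complex^'v::finite) set"
 assumes Om: "open Om" and F: "smooth Om F" and g: "g holomorphic_on UNIV"
 shows "smooth Om (%z. g (F z))"
proof -
 let ?G = "{%z. g (F z) | g. g holomorphic_on UNIV} \<union> {H. smooth Om H}"
 have pd: "pdiff v (%z. g (F z)) z" "cpartial v (%z. g (F z)) z = deriv g (F z) * cpartial v F z"
  if "z : Om" "g holomorphic_on UNIV" for g v z
 proof -
  have "((%t. g (F (upd z v t))) has_field_derivative deriv g (F (upd z v (z $ v))) * cpartial v F z) (at (z $ v))"
   by (rule DERIV_chain2[OF entire_has_deriv[OF that(2)] pdiff_has_deriv[OF smooth_pdiff[OF F that(1)]]])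
  hence "((%t. g (F (upd z v t))) has_field_derivative deriv g (F z) * cpartial v F z) (at (z $ v))"
   by (simp only: upd_same)
  thus "pdiff v (%z. g (F z)) z" "cpartial v (%z. g (F z)) z = deriv g (F z) * cpartial v F z"
   by (rule pdiffI)+
 qed
 show ?thesis
 proof (rule smooth_alg_gen[OF Om, of ?G])
  fix H assume "H : ?G"
  then consider g where "H = (%z. g (F z))" "g holomorphic_on UNIV" | "smooth Om H" by blast
  thus "diff_into Om (alg_gen ?G) H"
  proof cases
   case 1
   have g': "deriv g holomorphic_on UNIV" by (rule holomorphic_deriv[OF 1(2) open_UNIV])
   have "(%z. deriv g (F z) * cpartial v F z) : alg_gen ?G" for v
    by (rule alg_gen.mult; rule alg_gen.gen) (use g' smooth_cpartial[OF Om F] in auto)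
   hence "EX G:alg_gen ?G. ALL z:Om. cpartial v H z = G z" for v
    using pd(2)[OF _ 1(2)] unfolding 1(1) by (intro bexI[of _ "%z. deriv g (F z) * cpartial v F z"]) auto
   moreover have "cpartial v (cpartial w H) z =
     deriv (deriv g) (F z) * cpartial v F z * cpartial w F z + deriv g (F z) * cpartial v (cpartial w F) z"
    if z: "z : Om" for v w z
   proof -
    have "cpartial v (cpartial w H) z = cpartial v (%z. deriv g (F z) * cpartial w F z) z"
     unfolding 1(1) by (rule cpartial_cong[OF Om z pd(2)[OF _ 1(2)]])
    thus ?thesis
     unfolding pdiff_mult(2)[OF pd(1)[OF z g'] smooth_pdiff[OF smooth_cpartial[OF Om F] z]] pd(2)[OF z g'] by simp
   qed
   moreover have "continuous_on Om H"
    unfolding 1(1) by (rule entire_continuous[OF 1(2) smooth_continuous[OF F]])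
   ultimately show ?thesis
    unfolding diff_into_def using pd(1)[OF _ 1(2)] smooth_commute[OF F] unfolding 1(1) by simp
  next
   case 2
   show ?thesis by (rule diff_into_mono[OF smooth_diff_into[OF 2]]) (auto intro: alg_gen.gen)
  qed
 next
  show "(%z. g (F z)) : alg_gen ?G" by (rule alg_gen.gen) (use g in blast)
 qed
qed

text \<open>The family of all \<open>Wint p g\<close> is closed under differentiation up to smooth
  functions: the x-derivative is the integrand at the upper limit, and the y-derivative replaces p
  by t p and g by its derivative.\<close>

lemma smooth_Wint:
 fixes v w :: "'v::finite"
 assumes vw: "v ~= w" and p: "p holomorphic_on UNIV" and g: "g holomorphic_on UNIV"
 shows "smooth UNIV (%z. Wint p g (z $ v) (z $ w))"
proof -
 let ?G = "{%z. Wint p g (z $ v) (z $ w) | p g. p holomorphic_on UNIV & g holomorphic_on UNIV} \<union> {H. smooth UNIV H}"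
 have pd: "pdiff k (%z. Wint p g (z $ v) (z $ w)) z"
  "cpartial k (%z. Wint p g (z $ v) (z $ w)) z = (if k = v then p (z $ v) * g (z $ v * z $ w)
   else if k = w then Wint (%t. t * p t) (deriv g) (z $ v) (z $ w) else 0)"
  if "p holomorphic_on UNIV" "g holomorphic_on UNIV" for p g k and z :: "complex^'v"
 proof -
  have "((%t. Wint p g (upd z k t $ v) (upd z k t $ w)) has_field_derivative (if k = v then p (z $ v) * g (z $ v * z $ w)
   else if k = w then Wint (%t. t * p t) (deriv g) (z $ v) (z $ w) else 0)) (at (z $ k))"
   using Wint_x[OF that] Wint_y[OF that] vw by auto
  thus "pdiff k (%z. Wint p g (z $ v) (z $ w)) z"
   "cpartial k (%z. Wint p g (z $ v) (z $ w)) z = (if k = v then p (z $ v) * g (z $ v * z $ w)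
   else if k = w then Wint (%t. t * p t) (deriv g) (z $ v) (z $ w) else 0)" by (rule pdiffI)+ qed
 have pX: "cpartial k (%z. p (z $ v) * g (z $ v * z $ w)) z = (if k = w then z $ v * p (z $ v) * deriv g (z $ v * z $ w) else 0)"
  if "g holomorphic_on UNIV" "k ~= v" for p g k and z :: "complex^'v"
 proof (rule pdiffI(2))
  have "((%t. g (c * t)) has_field_derivative deriv g (c * t) * c) (at t)" for c t
   by (rule DERIV_chain2[OF entire_has_deriv[OF that(1)] DERIV_cmult_Id])
  thus "((%t. p (upd z k t $ v) * g (upd z k t $ v * upd z k t $ w)) has_field_derivative
   (if k = w then z $ v * p (z $ v) * deriv g (z $ v * z $ w) else 0)) (at (z $ k))" proof (cases "k = w")
   case True
   have "((%t. p (z $ v) * g (z $ v * t)) has_field_derivative p (z $ v) * (deriv g (z $ v * z $ w) * z $ v)) (at (z $ w))"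
    by (rule DERIV_cmult) fact
   thus ?thesis using True that(2) by (simp add: mult_ac)
  next
   case False
   thus ?thesis using that(2) by simp
  qed
 qed
 show ?thesis
 proof (rule smooth_alg_gen[OF open_UNIV, of ?G])
  fix H assume "H : ?G"
  then consider p g where "H = (%z. Wint p g (z $ v) (z $ w))" "p holomorphic_on UNIV" "g holomorphic_on UNIV"
   | "smooth UNIV H" by blast
  thus "diff_into UNIV (alg_gen ?G) H"
  proof cases
   case 1
   have g': "deriv g holomorphic_on UNIV" "(%t. t * p t) holomorphic_on UNIV"
    using 1 by (auto intro!: holomorphic_deriv holomorphic_intros)
   let ?D = "%k z. if k = v then p (z $ v) * g (z $ v * z $ w)
     else if k = w then Wint (%t. t * p t) (deriv g) (z $ v) (z $ w) else 0"
   have cp: "cpartial k H = ?D k" for k unfolding 1(1) using pd(2)[OF 1(2,3)] by blast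
   have sm: "smooth UNIV (%z. p (z $ v) * g (z $ v * z $ w))"
    by (intro smooth_mult[OF open_UNIV] smooth_entire[where g = p] smooth_entire[where g = g] open_UNIV smooth_component 1(2,3))
   have "?D k : alg_gen ?G" for k
   proof (rule alg_gen.gen, cases "k = v"; cases "k = w")
   qed (use sm g' in auto)
   hence "cpartial k H : alg_gen ?G" for k by (simp only: cp)
   hence "EX G:alg_gen ?G. ALL z:UNIV. cpartial k H z = G z" for k
    by (intro bexI[of _ "cpartial k H"]) auto
   moreover have "cpartial k (cpartial k' H) z = cpartial k' (cpartial k H) z" for k k' z
   proof -
    have vw': "cpartial v (?D w) z = cpartial w (?D v) z" for z
     using pd(2)[OF g'(2,1), of v z] pX[OF 1(3), of w p z] vw by simp
    have o: "cpartial k (?D k') z = 0" "cpartial k' (?D k) z = 0" if "k ~= v" "k ~= w" for k k' z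
     using that pd(2)[OF g'(2,1), of k z] pX[OF 1(3), of k p z] by (cases "k' = v"; cases "k' = w"; simp)+
    show ?thesis
    proof (cases "k = k'")
     case False
     have "cpartial k (?D k') z = cpartial k' (?D k) z"
     proof (cases "k : {v, w} & k' : {v, w}")
      case True
      then consider "k = v" "k' = w" | "k = w" "k' = v" using False by auto
      thus ?thesis
      proof cases
       case 1
       show ?thesis unfolding 1 by (rule vw')
      next
       case 2
       show ?thesis unfolding 2 by (rule vw'[symmetric])
      qed
     next
      case False
      then consider "k ~= v" "k ~= w" | "k' ~= v" "k' ~= w" by blast
      thus ?thesis
      proof cases
       case 1
       thus ?thesis using o[of k] by simp
      next
       case 2
       thus ?thesis using o[of k'] by simp
      qed
     qed
     thus ?thesis unfolding cp .
    qed simp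
   qed
   moreover have "continuous_on UNIV H" unfolding 1(1) by (rule Wint_continuous[OF 1(2,3)])
   ultimately show ?thesis unfolding diff_into_def using pd(1)[OF 1(2,3)] unfolding 1(1) by simp
  next
   case 2
   show ?thesis by (rule diff_into_mono[OF smooth_diff_into[OF 2]]) (auto intro: alg_gen.gen)
  qed
 next
  show "(%z. Wint p g (z $ v) (z $ w)) : alg_gen ?G" by (rule alg_gen.gen) (use p g in blast)
 qed
qed

section \<open>The hypergeometric function and the modified columns\<close>

definition Phi :: "nat => complex => complex" where
 "Phi M = hyp0F1 (M + 1)"

definition hcoef :: "nat => nat => complex" where
 "hcoef M k = 1 / (pochhammer (of_nat (M + 1)) k * fact k)"

lemma hcoef_rec: "of_nat (Suc k) * (of_nat k + of_nat (M + 1)) * hcoef M (Suc k) = hcoef M k"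
proof -
 have "of_nat k + of_nat (M + 1) = (of_nat (k + M + 1) :: complex)" by simp
 also have "... ~= 0" unfolding of_nat_eq_0_iff by simp
 finally have nz: "of_nat k + of_nat (M + 1) ~= (0 :: complex)" "of_nat (Suc k) ~= (0 :: complex)"
  unfolding of_nat_eq_0_iff by auto
 define a b :: complex where "a = of_nat (Suc k)" and "b = of_nat k + of_nat (M + 1)"
 have "hcoef M (Suc k) = 1 / (pochhammer (of_nat (M + 1)) k * b * (a * fact k))"
  unfolding hcoef_def pochhammer_Suc fact_Suc a_def b_def by (simp only: add.commute)
 hence "a * b * hcoef M (Suc k) = a * b * (1 / (pochhammer (of_nat (M + 1)) k * b * (a * fact k)))" by (simp only:)
 moreover have "a ~= 0" "b ~= 0" using nz by (simp_all only: a_def b_def not_False_eq_True)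
 hence "a * b * (1 / (pochhammer (of_nat (M + 1)) k * b * (a * fact k))) = 1 / (pochhammer (of_nat (M + 1)) k * fact k)"
  by simp
 ultimately have "a * b * hcoef M (Suc k) = hcoef M k" by (simp only: hcoef_def)
 thus ?thesis by (simp only: a_def b_def)
qed

lemma hcoef_entire: "entire_coeffs (hcoef M)"
 unfolding entire_coeffs_def
proof (intro exI[of _ 1] conjI allI)
 fix k
 have "norm (hcoef M k) = 1 / (norm (pochhammer (of_nat (M + 1)) k :: complex) * fact k)"
  by (simp add: hcoef_def norm_divide norm_mult)
 moreover have "norm (pochhammer (of_nat (M + 1)) k :: complex) >= 1"
 proof -
  have "(pochhammer (of_nat (M + 1)) k :: complex) = of_nat (pochhammer (M + 1) k)" by (rule pochhammer_of_nat)
  moreover have "pochhammer (M + 1) k ~= 0" using pochhammer_pos[of "M + 1" k] by simp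
  ultimately show ?thesis by (simp add: Suc_leI)
 qed
 ultimately show "norm (hcoef M k) <= 1 * 1 ^ k / fact k" by (simp add: frac_le mult_le_cancel_right1)
qed auto

lemma deriv_pser:
 assumes "entire_coeffs c"
 shows "entire_coeffs (diffs c)" "deriv (pser c) = pser (diffs c)"
proof -
 show "entire_coeffs (diffs c)"
  using entire_coeffs_shift[OF entire_coeffs_index[OF assms], of 1] by (simp add: diffs_def)
 show "deriv (pser c) = pser (diffs c)"
  using pser_has_deriv[OF assms] by (auto simp: pser_def intro!: DERIV_imp_deriv)
qed

lemma Phi_pser: "Phi M = pser (hcoef M)"
 by (simp add: Phi_def hyp0F1_def pser_def hcoef_def fun_eq_iff)

lemma Phi_entire: "Phi M holomorphic_on UNIV" "deriv (Phi M) holomorphic_on UNIV" "deriv (deriv (Phi M)) holomorphic_on UNIV"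
 unfolding Phi_pser by (auto intro!: holomorphic_deriv pser_holomorphic hcoef_entire)

lemma Phi_ode: "z * deriv (deriv (Phi M)) z + (of_nat M + 1) * deriv (Phi M) z = Phi M z"
proof -
 let ?c1 = "diffs (hcoef M)" and ?c2 = "diffs (diffs (hcoef M))"
 note 1 = deriv_pser[OF hcoef_entire, of M]
 note 2 = deriv_pser[OF 1(1)]
 have coef: "shift_up ?c2 k + (of_nat M + 1) * ?c1 k = hcoef M k" for k
  using hcoef_rec[of k M] by (cases k) (simp_all add: diffs_def algebra_simps)
 have "shift_up ?c2 = (%k. of_nat k * ?c1 k)"
 proof
  fix k
  show "shift_up ?c2 k = of_nat k * ?c1 k" by (cases k) (simp_all add: diffs_def)
 qed
 hence sh: "entire_coeffs (shift_up ?c2)" using entire_coeffs_index[OF 1(1)] by simp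
 have "pser (shift_up ?c2) z + (of_nat M + 1) * pser ?c1 z = pser (%k. shift_up ?c2 k + (of_nat M + 1) * ?c1 k) z"
  using pser_add[OF sh entire_coeffs_cmult[OF 1(1)]] pser_cmult[OF 1(1)] by simp
 thus ?thesis unfolding coef Phi_pser 1(2) 2(2) pser_shift_up[OF 2(1)] .
qed

definition Gk :: "nat => nat => complex => complex => complex" where
 "Gk M k x = Wint (%t. (t - x) ^ k * (t ^ M * exp (- t))) (Phi M) x"

lemma weight_entire:
 "(%t. (t - x) ^ k * (t ^ M * exp (- t))) holomorphic_on UNIV"
 "(%t. t * ((t - x) ^ k * (t ^ M * exp (- t)))) holomorphic_on UNIV"
 "(%t. t * (t * ((t - x) ^ k * (t ^ M * exp (- t))))) holomorphic_on UNIV"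
 "(%t. t ^ M * exp (- t)) holomorphic_on UNIV" by (intro holomorphic_intros)+

text \<open>By \<open>Phi_ode\<close> at z = t y the first two terms under the integral combine to t
  times the integrand, so P multiplies the weight by t - x.\<close>

lemma Pode_Gk: "Pode M x (Gk M k x) y = Gk M (Suc k) x y"
proof -
 let ?p = "%t. (t - x) ^ k * (t ^ M * exp (- t))"
 let ?I = "%t. y * (t * (t * ?p t) * deriv (deriv (Phi M)) (t * y)) + (of_nat M + 1) * (t * ?p t * deriv (Phi M) (t * y)) - x * (?p t * Phi M (t * y))"
 have "(?I has_contour_integral Pode M x (Gk M k x) y) (linepath 0 x)"
  unfolding Pode_def Gk_def deriv_Wint[OF weight_entire(1) Phi_entire(1)] deriv_Wint[OF weight_entire(2) Phi_entire(2)]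
  by (intro has_contour_integral_diff has_contour_integral_add has_contour_integral_lmul Wint_has weight_entire Phi_entire)
 moreover have "?I = (%t. (t - x) ^ Suc k * (t ^ M * exp (- t)) * Phi M (t * y))"
 proof
  fix t
  have "?I t = t * ?p t * (t * y * deriv (deriv (Phi M)) (t * y) + (of_nat M + 1) * deriv (Phi M) (t * y)) - x * (?p t * Phi M (t * y))"
   by (simp add: algebra_simps)
  also have "... = (t - x) * ?p t * Phi M (t * y)" unfolding Phi_ode by (simp add: algebra_simps)
  finally show "?I t = (t - x) ^ Suc k * (t ^ M * exp (- t)) * Phi M (t * y)" by (simp add: mult_ac)
 qed
 ultimately show ?thesis unfolding Gk_def by (rule Wint_eqI)
qed

lemma Wint_by_parts:
 assumes q: "!!t. (q has_field_derivative q' t) (at t)" "q 0 = 0" and g: "g holomorphic_on UNIV"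
  and J: "((%t. q' t * g (t * y) + y * q t * deriv g (t * y)) has_contour_integral J) (linepath 0 x)"
 shows "J = q x * g (x * y)"
proof -
 have "((%t. q' t * g (t * y) + y * q t * deriv g (t * y)) has_contour_integral (q x * g (x * y) - q 0 * g (0 * y))) (linepath 0 x)"
 proof (rule line_integral_primitive)
  fix t
  have "((%t. g (t * y)) has_field_derivative deriv g (t * y) * y) (at t)"
   by (rule DERIV_chain2[OF entire_has_deriv[OF g]]) (auto intro!: derivative_eq_intros)
  from DERIV_mult[OF q(1) this]
  show "((%t. q t * g (t * y)) has_field_derivative q' t * g (t * y) + y * q t * deriv g (t * y)) (at t)"
   by (simp add: mult_ac)
 qed
 from contour_integral_unique[OF this] contour_integral_unique[OF J] show ?thesis by (simp add: q(2))
qed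

lemma weight_deriv:
 "((%t. (t - x1) ^ k * t ^ Suc M * exp (- t)) has_field_derivative
  (of_nat k * (t - x1) ^ (k - 1) * t ^ Suc M + of_nat (Suc M) * t ^ M * (t - x1) ^ k - (t - x1) ^ k * t ^ Suc M) * exp (- t))
 (at (t :: complex))" by (rule derivative_eq_intros refl | simp)+ (simp add: algebra_simps)

text \<open>Integration by parts of (t - x1)^k t^(M + 1) e^(-t) against the derivative of
  \<open>Phi\<close>, with the second derivative removed by \<open>Phi_ode\<close>. For k = 0 the
  truncated exponent \<open>k - 1\<close> comes with the coefficient 0.\<close>

lemma Wint_ode:
 fixes x1 :: complex and M :: nat
 defines "p \<equiv> %k t. (t - x1) ^ k * (t ^ M * exp (- t))"
 shows "of_nat k * Wint (%t. t * p (k - 1) t) (deriv (Phi M)) x y + Wint (p k) (Phi M) x y - Wint (%t. t * p k t) (deriv (Phi M)) x y =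
  (x - x1) ^ k * x ^ Suc M * exp (- x) * deriv (Phi M) (x * y)"
proof (rule Wint_by_parts[OF weight_deriv _ Phi_entire(2)])
 let ?I = "%t. of_nat k * (t * p (k - 1) t * deriv (Phi M) (t * y)) + p k t * Phi M (t * y) - t * p k t * deriv (Phi M) (t * y)"
 have "(?I has_contour_integral of_nat k * Wint (%t. t * p (k - 1) t) (deriv (Phi M)) x y + Wint (p k) (Phi M) x y -
   Wint (%t. t * p k t) (deriv (Phi M)) x y) (linepath 0 x)" unfolding p_def
  by (intro has_contour_integral_diff has_contour_integral_add has_contour_integral_lmul Wint_has weight_entire Phi_entire)
 moreover have "?I t = (of_nat k * (t - x1) ^ (k - 1) * t ^ Suc M + of_nat (Suc M) * t ^ M * (t - x1) ^ k - (t - x1) ^ k * t ^ Suc M) *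
   exp (- t) * deriv (Phi M) (t * y) + y * ((t - x1) ^ k * t ^ Suc M * exp (- t)) * deriv (deriv (Phi M)) (t * y)" for t
  unfolding p_def Phi_ode[of "t * y" M, symmetric] by (simp add: algebra_simps)
 ultimately show "((%t. (of_nat k * (t - x1) ^ (k - 1) * t ^ Suc M + of_nat (Suc M) * t ^ M * (t - x1) ^ k - (t - x1) ^ k * t ^ Suc M) *
   exp (- t) * deriv (Phi M) (t * y) + y * ((t - x1) ^ k * t ^ Suc M * exp (- t)) * deriv (deriv (Phi M)) (t * y)) has_contour_integral
  of_nat k * Wint (%t. t * p (k - 1) t) (deriv (Phi M)) x y + Wint (p k) (Phi M) x y -
   Wint (%t. t * p k t) (deriv (Phi M)) x y) (linepath 0 x)" by (simp only:) qed simp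

text \<open>With x1 = x the boundary term vanishes. By \<open>Pode_Gk\<close> the result reads
  (\<partial> - 1) P G = (k + 1) \<partial> G for G = \<open>Gk M k x\<close>, which for k > 0 is
  the equation with index k + 1.\<close>

lemma Gk_deriv: "deriv (Gk M (Suc k) x) y = of_nat (Suc k) * deriv (Gk M k x) y + Gk M (Suc k) x y"
 using Wint_ode[of "Suc k" x M x y] unfolding Gk_def deriv_Wint[OF weight_entire(1) Phi_entire(1)] by simp

lemma Gk_Vsol: "k ~= 0 ==> Gk M k x : Vsol M x UNIV (Suc k)"
proof -
 assume k: "k ~= 0"
 have "Pode M x (Gk M k x) = Gk M (Suc k) x" using Pode_Gk by blast
 hence "Tode M x (Suc k) (Gk M k x) y = 0" for y using k Gk_deriv[of M k x y] by (simp add: Tode_def Qode_def)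
 thus ?thesis by (simp add: Vsol_def Gk_def Wint_entire weight_entire Phi_entire)
qed

lemma psi_Vsol: "(%y. x ^ M * exp (- x) * Phi M (x * y)) : Vsol M x UNIV 1"
proof -
 have d: "((%y. g (x * y)) has_field_derivative deriv g (x * y) * x) (at y)" if "g holomorphic_on UNIV" for g y
  by (rule DERIV_chain2[OF entire_has_deriv[OF that] DERIV_cmult_Id])
 let ?c = "x ^ M * exp (- x)"
 have 1: "deriv (%y. ?c * Phi M (x * y)) = (%y. ?c * (deriv (Phi M) (x * y) * x))"
  by (rule ext, rule DERIV_imp_deriv, rule DERIV_cmult[OF d[OF Phi_entire(1)]])
 have 2: "deriv (%y. ?c * (deriv (Phi M) (x * y) * x)) = (%y. ?c * (deriv (deriv (Phi M)) (x * y) * x * x))"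
  by (rule ext, rule DERIV_imp_deriv, rule DERIV_cmult, rule DERIV_cmult_right[OF d[OF Phi_entire(2)]])
 have "Pode M x (%y. ?c * Phi M (x * y)) y = 0" for y
 proof -
  have "Pode M x (%y. ?c * Phi M (x * y)) y =
    ?c * x * (x * y * deriv (deriv (Phi M)) (x * y) + (of_nat M + 1) * deriv (Phi M) (x * y) - Phi M (x * y))"
   unfolding Pode_def 1 2 by (simp add: algebra_simps)
  thus ?thesis unfolding Phi_ode by simp
 qed
 moreover have "(%y. ?c * Phi M (x * y)) holomorphic_on UNIV"
  using entire_arg[OF Phi_entire(1), of M x] by (auto intro!: holomorphic_intros simp: mult.commute)
 ultimately show ?thesis by (simp add: Vsol_def Tode_def)
qed

text \<open>For j = m the exponent of t - x is 0, and the column is replaced by its derivative at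
  the upper limit.\<close>

definition col :: "nat => nat => nat => complex => complex => complex" where
 "col M m j x = (if j = m then (%y. x ^ M * exp (- x) * Phi M (x * y)) else Gk M (m - j) x)"

lemma col_Vsol: "j : {1..m} ==> col M m j x : Vsol M x UNIV (Suc m - j)"
 using Gk_Vsol[of "m - j" M x] psi_Vsol[of x M] by (auto simp: col_def Suc_diff_le)

lemma Wint_expand:
 "Wint (%t. (t - x1) ^ k * (t ^ M * exp (- t))) (Phi M) x y =
  (SUM l<=k. of_nat (k choose l) * (- x1) ^ (k - l) * Wint (%t. t ^ (M + l) * exp (- t)) (Phi M) x y)"
proof -
 have "((%t. SUM l<=k. of_nat (k choose l) * (- x1) ^ (k - l) * (t ^ (M + l) * exp (- t) * Phi M (t * y))) has_contour_integral
  (SUM l<=k. of_nat (k choose l) * (- x1) ^ (k - l) * Wint (%t. t ^ (M + l) * exp (- t)) (Phi M) x y)) (linepath 0 x)"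
  by (intro has_contour_integral_sum has_contour_integral_lmul Wint_has weight_entire Phi_entire finite_atMost)
 moreover have "(%t. SUM l<=k. of_nat (k choose l) * (- x1) ^ (k - l) * (t ^ (M + l) * exp (- t) * Phi M (t * y))) =
   (%t. (t - x1) ^ k * (t ^ M * exp (- t)) * Phi M (t * y))" proof fix t
  have "(t - x1) ^ k = (SUM l<=k. of_nat (k choose l) * t ^ l * (- x1) ^ (k - l))"
   using binomial_ring[of t "- x1" k] by simp
  thus "(SUM l<=k. of_nat (k choose l) * (- x1) ^ (k - l) * (t ^ (M + l) * exp (- t) * Phi M (t * y))) =
   (t - x1) ^ k * (t ^ M * exp (- t)) * Phi M (t * y)"
   by (simp only: sum_distrib_right) (intro sum.cong refl, simp add: power_add mult_ac)
 qed
 ultimately show ?thesis by (rule Wint_eqI[symmetric])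
qed

text \<open>In \<open>Gk\<close> the variable x also enters the weight; the binomial expansion moves
  it into coefficients, to which \<open>smooth_Wint\<close> is indifferent.\<close>

lemma smooth_col: "smooth UNIV (%z :: complex^('m::finite option). col M m j (z $ None) (z $ Some i))"
proof (cases "j = m")
 case True
 have "smooth UNIV (%z :: complex^('m option). (%x. x ^ M * exp (- x)) (z $ None) * Phi M (z $ None * z $ Some i))"
  by (intro smooth_mult[OF open_UNIV] smooth_entire[where g = "Phi M"] smooth_entire[where g = "%x. x ^ M * exp (- x)"]
    open_UNIV smooth_component weight_entire(4) Phi_entire(1))
 thus ?thesis using True by (simp add: col_def)
next
 case False
 have "smooth UNIV (%z :: complex^('m option). SUM l<=m - j. of_nat (m - j choose l) * (%x. (- x) ^ (m - j - l)) (z $ None) *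
   Wint (%t. t ^ (M + l) * exp (- t)) (Phi M) (z $ None) (z $ Some i))"
 proof (intro smooth_sum smooth_mult smooth_const open_UNIV smooth_Wint weight_entire Phi_entire)
  show "smooth UNIV (%z :: complex^('m option). (%x. (- x) ^ (m - j - l)) (z $ None))" for l
   by (rule smooth_entire[OF open_UNIV smooth_component[OF open_UNIV]]) (intro holomorphic_intros)
 qed simp
 thus ?thesis using False by (simp add: col_def Gk_def Wint_expand)
qed

lemma Hint_Wint: "Hint k (M + 1) x y = Wint (%t. t ^ k * exp (- t)) (Phi M) x y"
 by (simp add: Hint_def Wint_def Phi_def)

text \<open>A permutation preserves the sum of the positions. It follows that only the diagonal
  contributes to the determinant of a triangular matrix.\<close>

lemma permutes_position_mono_id:
 assumes sg: "sg permutes (UNIV :: 'm::{finite,linorder} set)" and le: "!!i. position (sg i) <= position i"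
 shows "sg = id"
proof (rule ccontr)
 assume "sg ~= id"
 then obtain i where i: "sg i ~= i" by (auto simp: fun_eq_iff)
 have "inj (position :: 'm => nat)" using position_bij[where 'm = 'm] by (simp add: bij_betw_def)
 hence "position (sg i) < position i" using le[of i] i by (auto simp: le_less dest: injD)
 hence "(SUM i:UNIV. position (sg i)) < (SUM i:(UNIV::'m set). position i)"
  by (intro sum_strict_mono_ex1) (use le in auto)
 moreover have "(SUM i:UNIV. position (sg i)) = (SUM i:(UNIV::'m set). position i)"
  using sum.permute[OF sg, of position] by (simp add: comp_def)
 ultimately show False by simp
qed

text \<open>The columns are combined so that they contain powers of \<open>t - x1\<close> instead of \<open>t\<close>.
  When the determinant is differentiated at \<open>x = x1\<close>, only the derivative of the last column survives.\<close>

lemma Rfun_expand: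
 fixes z :: "complex^('m::{finite,linorder} option)"
 assumes n: "CARD('m) <= n"
 shows "Rfun n z = (SUM sg | sg permutes (UNIV :: 'm set). of_int (sign sg) *
  (PROD i:UNIV. col (n - CARD('m)) CARD('m) (position (sg i)) (z $ None) (z $ Some i)))" proof -
 let ?m = "CARD('m)" and ?M = "n - CARD('m)"
 define x1 where "x1 = z $ None"
 define k where "k j = ?m - position j" for j :: 'm
 define GG where "GG k = Wint (%t. (t - x1) ^ k * (t ^ ?M * exp (- t))) (Phi ?M)" for k
 define A where "A x = (\<chi> (i::'m) (j::'m). Hint (n - position j) (?M + 1) x (z $ Some i))" for x
 \<comment> \<open>C contains the fixed number x1, so multiplication by it does not disturb
   differentiation in x; it is triangular with 1 on the diagonal.\<close>
 define C :: "((complex, 'm) vec, 'm) vec" where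
  "C = (\<chi> j' j. if k j' <= k j then of_nat (k j choose k j') * (- x1) ^ (k j - k j') else 0)"
 have pos: "1 <= position j" "position j <= ?m" for j :: 'm using position_in[of j] by auto
 have nk: "n - position j = ?M + k j" for j using pos(2)[of j] n by (simp add: k_def)
 have kbij: "bij_betw k UNIV {..<?m}"
 proof -
  have "bij_betw (%p. ?m - p) {1..?m} {..<?m}"
   by (rule bij_betw_byWitness[where f' = "%l. ?m - l"]) auto
  from bij_betw_trans[OF position_bij this] show ?thesis by (simp add: comp_def k_def[abs_def])
 qed
 have AC: "A x ** C = (\<chi> i j. GG (k j) x (z $ Some i))" for x
 proof -
  have "(SUM j':UNIV. Hint (n - position j') (?M + 1) x y * (if k j' <= k j then of_nat (k j choose k j') * (- x1) ^ (k j - k j') else 0)) =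
    GG (k j) x y" for j y proof - let ?W = "%l. Wint (%t. t ^ (?M + l) * exp (- t)) (Phi ?M) x y"
   let ?f = "%l. if l <= k j then of_nat (k j choose l) * (- x1) ^ (k j - l) * ?W l else 0"
   have "(SUM j':UNIV. Hint (n - position j') (?M + 1) x y * (if k j' <= k j then of_nat (k j choose k j') * (- x1) ^ (k j - k j') else 0)) =
    (SUM j':UNIV. ?f (k j'))" by (intro sum.cong refl) (simp only: nk Hint_Wint, simp add: mult_ac)
   also have "... = (SUM l<?m. ?f l)" by (rule sum.reindex_bij_betw[OF kbij])
   also have "... = (SUM l<=k j. of_nat (k j choose l) * (- x1) ^ (k j - l) * ?W l)"
   proof (rule sum.mono_neutral_cong_right)
    have "k j < ?m" using bij_betwE[OF kbij] by auto
    thus "{..k j} \<subseteq> {..<?m}" by auto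
   qed auto
   finally show ?thesis unfolding GG_def Wint_expand .
  qed
  thus ?thesis by (simp add: A_def C_def matrix_matrix_mult_def vec_eq_iff)
 qed
 have detC: "det C = 1"
 proof -
  have "det C = (SUM sg | sg permutes (UNIV :: 'm set). if sg = id then 1 else 0)" unfolding det_def
  proof (rule sum.cong[OF refl])
   fix sg assume "sg : {sg. sg permutes (UNIV :: 'm set)}"
   hence sg: "sg permutes UNIV" by simp
   show "of_int (sign sg) * (PROD i:UNIV. C $ i $ sg i) = (if sg = id then 1 else 0)"
   proof (cases "sg = id")
    case True
    thus ?thesis by (simp add: C_def sign_id)
   next
    case False
    then obtain i where "\<not> position (sg i) <= position i" using permutes_position_mono_id[OF sg] by blast
    hence "\<not> k i <= k (sg i)" using pos[of i] pos[of "sg i"] unfolding k_def by linarith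
    hence "C $ i $ sg i = 0" by (simp add: C_def)
    hence "(PROD i:UNIV. C $ i $ sg i) = 0" by (intro prod_zero) auto
    thus ?thesis using False by simp
   qed
  qed
  also have "... = 1" by (subst sum.delta) (auto simp: permutes_id finite_permutations)
  finally show ?thesis .
 qed
 have det: "det (A x) = (SUM sg | sg permutes (UNIV :: 'm set). of_int (sign sg) * (PROD i:UNIV. GG (k (sg i)) x (z $ Some i)))" for x
 proof -
  have "det (A x) = det (A x ** C)" by (simp add: det_mul detC)
  thus ?thesis by (simp add: AC det_def)
 qed
 obtain jm :: 'm where jm: "position jm = ?m"
  using position_bij pos unfolding bij_betw_def by (metis (no_types, lifting) One_nat_def Suc_leI atLeastAtMost_iff imageE le_refl zero_less_card_finite)
 have k0: "k j = 0 \<longleftrightarrow> j = jm" for j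
 proof -
  have "k j = 0 \<longleftrightarrow> position j = position jm" using pos(2)[of j] jm by (auto simp: k_def)
  thus ?thesis using position_bij unfolding bij_betw_def inj_def by auto
 qed
 define \<psi> where "\<psi> y = x1 ^ ?M * exp (- x1) * Phi ?M (x1 * y)" for y
 \<comment> \<open>The derivative in the upper limit is the integrand at t = x1, which vanishes
   unless k = 0.\<close>
 have dG: "((%x. GG k x y) has_field_derivative (if k = 0 then \<psi> y else 0)) (at x1)" for k y
 proof -
  have "(%t. (t - x1) ^ k * (t ^ ?M * exp (- t))) x1 * Phi ?M (x1 * y) = (if k = 0 then \<psi> y else 0)"
   by (simp add: \<psi>_def)
  thus ?thesis unfolding GG_def using Wint_x[OF weight_entire(1) Phi_entire(1), of x1 k ?M ?M y x1] by simp
 qed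
 have colG: "col ?M ?m (position j) x1 = (if j = jm then \<psi> else GG (k j) x1)" for j
 proof (cases "j = jm")
  case False
  hence "position j ~= ?m" using k0[of j] by (auto simp: k_def)
  thus ?thesis using False by (simp add: col_def Gk_def GG_def k_def)
 qed (simp add: col_def jm \<psi>_def fun_eq_iff)
 have dP: "((%x. PROD i:UNIV. GG (k (sg i)) x (z $ Some i)) has_field_derivative
   (PROD i:UNIV. col ?M ?m (position (sg i)) x1 (z $ Some i))) (at x1)" if sg: "sg permutes UNIV" for sg
 proof -
  let ?D = "%i. if k (sg i) = 0 then \<psi> (z $ Some i) else 0"
  let ?P = "%i. PROD i':UNIV - {i}. GG (k (sg i')) x1 (z $ Some i')"
  define i0 where "i0 = inv sg jm"
  have i0: "sg i = jm \<longleftrightarrow> i = i0" for i unfolding i0_def using permutes_inverses[OF sg] by metis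
  have "(SUM i:UNIV. ?D i * ?P i) = (SUM i:UNIV. if i = i0 then \<psi> (z $ Some i0) * ?P i0 else 0)"
   by (intro sum.cong refl) (auto simp: k0 i0)
  also have "... = \<psi> (z $ Some i0) * ?P i0" by simp
  also have "?P i0 = (PROD i:UNIV - {i0}. col ?M ?m (position (sg i)) x1 (z $ Some i))"
   by (intro prod.cong refl) (auto simp: colG i0)
  also have "\<psi> (z $ Some i0) * ... = (PROD i:UNIV. col ?M ?m (position (sg i)) x1 (z $ Some i))"
   using i0[of i0] by (subst (2) prod.remove[of _ i0]) (auto simp: colG)
  finally have "(SUM i:UNIV. ?D i * ?P i) = (PROD i:UNIV. col ?M ?m (position (sg i)) x1 (z $ Some i))" .
  moreover have "((%x. PROD i:UNIV. GG (k (sg i)) x (z $ Some i)) has_field_derivative (SUM i:UNIV. ?D i * ?P i)) (at x1)"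
   by (rule has_field_derivative_prod) (rule dG)
  ultimately show ?thesis by simp
 qed
 have "((%x. det (A x)) has_field_derivative (SUM sg | sg permutes (UNIV :: 'm set). of_int (sign sg) *
  (PROD i:UNIV. col ?M ?m (position (sg i)) x1 (z $ Some i)))) (at x1)"
  unfolding det by (intro DERIV_sum DERIV_cmult dP) simp
 thus ?thesis unfolding Rfun_def x1_def A_def by (rule DERIV_imp_deriv)
qed

text \<open>Derivatives in the \<lambda> directions see only the values for x = x0. This permits
  comparing a function of x and \<lambda> with a \<open>pfun\<close>, which is constant in
  x.\<close>

lemma multi_iter_slice_cong:
 fixes F G :: "complex^('m::{finite,linorder} option) => complex"
 assumes eq: "!!z. z $ None = x0 ==> F z = G z" and be: "lookup be None = 0" and z: "z $ None = x0"
 shows "multi_iter cpartial be F z = multi_iter cpartial be G z"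
proof -
 have "ALL z. z $ None = x0 --> foldr (%v. cpartial v ^^ lookup be v) L F z = foldr (%v. cpartial v ^^ lookup be v) L G z" for L
 proof (induction L)
  case (Cons v L)
  let ?f = "foldr (%v. cpartial v ^^ lookup be v) L"
  show ?case
  proof (cases v)
   case None
   thus ?thesis using Cons be by simp
  next
   case (Some i)
   have "ALL z. z $ None = x0 --> (cpartial (Some i) ^^ k) (?f F) z = (cpartial (Some i) ^^ k) (?f G) z" for k
   proof (induction k)
    case 0
    thus ?case using Cons by simp
   next
    case (Suc k)
    show ?case
    proof (intro allI impI)
     fix z :: "complex^('m option)" assume z: "z $ None = x0"
     have "(%t. (cpartial (Some i) ^^ k) (?f F) (upd z (Some i) t)) = (%t. (cpartial (Some i) ^^ k) (?f G) (upd z (Some i) t))"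
     proof
      fix t
      have "upd z (Some i) t $ None = x0" using z by simp
      thus "(cpartial (Some i) ^^ k) (?f F) (upd z (Some i) t) = (cpartial (Some i) ^^ k) (?f G) (upd z (Some i) t)"
       using Suc by blast
     qed
     thus "(cpartial (Some i) ^^ Suc k) (?f F) z = (cpartial (Some i) ^^ Suc k) (?f G) z"
      by (simp only: funpow.simps comp_apply cpartial_upd)
    qed
   qed
   thus ?thesis using Some by simp
  qed
 qed (use eq in simp)
 thus ?thesis using z by (simp add: multi_iter_def)
qed

lemma Fract_self: "a ~= 0 ==> Fract a a = (1 :: 'a::idom fract)"
 unfolding One_fract_def by (simp add: eq_fract)

lemma clears_multiple: "clears d P Q ==> a ~= 0 ==> clears (d * a) P (psc a Q)"
 using clears_scale[of d P Q a a] by (simp add: Fract_self)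

theorem generators_annihilate_Rfun:
 fixes L :: "'m::{finite,linorder} => ('m option, complex) diffop"
 assumes n: "CARD('m) <= n" and L: "!!i. is_Tlclm n i (L i)" and P: "P : generators n L"
 shows "annihilates id P (Rfun n) UNIV"
proof -
 let ?m = "CARD('m)" and ?M = "n - CARD('m)"
 define F where "F sg z = (PROD i:UNIV. col ?M ?m (position (sg i)) (z $ None) (z $ Some i))"
  for sg :: "'m => 'm" and z :: "complex^('m option)"
 have sm: "smooth UNIV (F sg)" for sg
  unfolding F_def[abs_def] by (rule smooth_prod[OF open_UNIV smooth_col])
 have PL: "P : lambda_diffops" using generators_lambda[OF L] P by blast
 have ann: "annihilates id P (F sg) UNIV" if sg: "sg permutes UNIV" for sg
 proof -
  \<comment> \<open>The column with number j solves the equation with number m + 1 - j, see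
    \<open>col_Vsol\<close>.\<close>
  define J where "J i = Suc ?m - position (sg i)" for i
  have "bij_betw (%p. Suc ?m - p) {1..?m} {1..?m}"
   by (rule bij_betw_byWitness[where f' = "%p. Suc ?m - p"]) auto
  from bij_betw_trans[OF bij_position_perm[OF sg] this]
  have J: "bij_betw J UNIV {1..?m}" by (simp add: comp_def J_def[abs_def])
  obtain d Q where d: "clears d P Q"
   and Q: "!!F W z. (F, W) : Fam n J ==> z : W ==> cid.pact Q F z = 0"
   by (rule cid.KillE[OF generators_Kill[OF J L P]]) (rule that)
  \<comment> \<open>The extra factor x takes care of x = 0, a value excluded from
    \<open>Fam\<close>.\<close>
  let ?X = "single (single None 1) 1 :: ('m option, complex) mpol"
  have X0: "?X ~= 0" using ratfun_var_nz[of "None :: 'm option"] unfolding ratfun_var_def by (metis Fract_1_eq_0)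
  have "P : cid.Kill {(F sg, UNIV)}"
  proof (rule cid.KillI[OF clears_multiple[OF d X0]])
   fix F' W and z :: "complex^('m option)" assume "(F', W) : {(F sg, UNIV)}"
   hence F': "F' = F sg" by simp
   have "cid.pact (psc ?X Q) F' z = z $ None * cid.pact Q (F sg) z"
    unfolding F' cid.pact_psc cid.mpol_eval_var ..
   also have "... = 0"
   proof (cases "z $ None = 0")
    case False
    define u where "u i = col ?M ?m (position (sg i)) (z $ None)" for i
    have "(pfun u, slice (z $ None) UNIV) : Fam n J"
     unfolding Fam_def using False col_Vsol[OF position_in] unfolding u_def J_def by blast
    moreover have "z : slice (z $ None) UNIV" by (simp add: slice_def)
    ultimately have "cid.pact Q (pfun u) z = 0" by (rule Q)
    moreover have "cid.pact Q (F sg) z = cid.pact Q (pfun u) z" unfolding cid.pact_def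
    proof (rule sum.cong[OF refl])
     fix be assume "be : keys Q"
     hence "keys be \<subseteq> range Some" using clears_keys[OF d] PL unfolding diffops_def by blast
     hence "lookup be None = 0" by (auto simp: in_keys_iff)
     hence "multi_iter cpartial be (F sg) z = multi_iter cpartial be (pfun u) z"
      by (intro multi_iter_slice_cong[of "z $ None"]) (auto simp: F_def pfun_def u_def)
     thus "mpol_eval id (lookup Q be) z * multi_iter cpartial be (F sg) z =
       mpol_eval id (lookup Q be) z * multi_iter cpartial be (pfun u) z" by simp qed
    ultimately show ?thesis by simp
   qed simp
   finally show "cid.pact (psc ?X Q) F' z = 0" .
  qed
  thus ?thesis by (rule cid.annihilates_UNIV_of_Kill[OF _ singletonI sm])
 qed
 have R: "Rfun n = (%z. SUM sg | sg permutes (UNIV :: 'm set). of_int (sign sg) * F sg z)"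
  unfolding F_def by (rule ext) (rule Rfun_expand[OF n])
 show ?thesis unfolding cid.annihilates_iff
 proof (intro allI impI ballI)
  fix d Q and z :: "complex^('m option)" assume d: "clears d P Q"
  have "cid.pact Q (Rfun n) z = (SUM sg | sg permutes (UNIV :: 'm set). of_int (sign sg) * cid.pact Q (F sg) z)"
   unfolding R by (rule cid.pact_sum[OF open_UNIV sm UNIV_I])
  also have "... = 0" using ann d unfolding cid.annihilates_iff by (intro sum.neutral) auto
  finally show "cid.pact Q (Rfun n) z = 0" .
 qed
qed

section \<open>A holonomic system over the rational numbers\<close>

global_interpretation crat: coeff_embedding "of_rat :: rat => complex" by (rule coeff_embedding_of_rat)

lemma diffops_UNIV: "diffops UNIV UNIV = (UNIV :: ('v::linorder, 'a::idom) diffop set)"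
 by (auto simp: diffops_def)

text \<open>By linearity of \<open>Th\<close>, more than \<open>card C\<close> operators have a
  nontrivial combination in its kernel and hence in I. So a longest family independent modulo I
  exists, and it is a basis of the quotient.\<close>

lemma rank_bound:
 fixes I :: "('v::{finite,linorder}, 'a::idom) diffop set" and Th :: "('v, 'a) diffop => 'e => ('v, 'a) ratfun"
 assumes I: "left_ideal (diffops UNIV S) I" and C: "finite C"
  and lin: "!!e c b r. Th (SUM i<r::nat. op_scale (c i) (b i)) e = (SUM i<r. c i * Th (b i) e)"
  and ker: "!!P. P : diffops UNIV S ==> (!!e. e : C ==> Th P e = 0) ==> P : I"
 shows "EX r<=card C. has_rank (diffops UNIV S) I r"
proof -
 let ?D = "diffops UNIV S :: ('v, 'a) diffop set"
 have scale: "op_scale a P : ?D" if "P : ?D" for a P using that by (intro diffops_scale) auto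
 have scaleI: "op_scale a P : I" if "P : I" for a P
 proof -
  have "single 0 a : ?D" by (intro diffops_single) auto
  thus ?thesis using I that unfolding op_scale_eq_mult left_ideal_def by blast
 qed
 define ind where "ind r b \<longleftrightarrow> (ALL i<r. b i : ?D) &
  (ALL c. (SUM i<r. op_scale (c i) (b i)) : I --> (ALL i<r. c i = 0))" for r :: nat and b
 have bound: "r <= card C" if "ind r b" for r b
 proof (rule ccontr)
  assume "\<not> r <= card C"
  hence "card C < card {..<r}" by simp
  from more_unknowns_than_equations[OF is_subfield_UNIV C finite_lessThan this, of "%i. Th (b i)"]
  obtain c where c: "EX i:{..<r}. c i ~= 0" "!!e. e : C ==> (SUM i<r. c i * Th (b i) e) = 0" by auto
  have "(SUM i<r. op_scale (c i) (b i)) : I"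
  proof (rule ker)
   show "(SUM i<r. op_scale (c i) (b i)) : ?D" using that unfolding ind_def by (intro diffops_sum scale) auto
   show "Th (SUM i<r. op_scale (c i) (b i)) e = 0" if "e : C" for e
    using lin[where c = c and b = b and r = r and e = e] c(2)[OF that] by simp
  qed
  thus False using that c(1) unfolding ind_def by blast
 qed
 have "ind 0 (%_. 0)" by (simp add: ind_def)
 hence "EX b. ind 0 b" by blast
 moreover have "ALL r. (EX b. ind r b) --> r < Suc (card C)" using bound by (auto simp: less_Suc_eq_le)
 ultimately obtain r where r: "EX b. ind r b" "!!r'. (EX b. ind r' b) ==> r' <= r"
  using ex_has_greatest_nat[of "%r. EX b. ind r b" 0 "%r. r" "Suc (card C)"] by blast
 then obtain b where b: "ind r b" by blast
 have "has_rank ?D I r"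
 proof (rule has_rank_of_basis[OF I, of "{..<r}" r b])
  show "b k : ?D" if "k : {..<r}" for k using b that by (simp add: ind_def)
  show "ALL k:{..<r}. c k = 0" if "(SUM k<r. op_scale (c k) (b k)) : I" for c
   using b that unfolding ind_def by auto
  fix P assume P: "P : ?D"
  have "\<not> ind (Suc r) (b(r := P))" using r(2)[of "Suc r"] by fastforce
  moreover have "ALL i<Suc r. (b(r := P)) i : ?D" using b P by (auto simp: ind_def less_Suc_eq)
  ultimately obtain c where c: "(SUM i<Suc r. op_scale (c i) ((b(r := P)) i)) : I" "EX i<Suc r. c i ~= 0"
   unfolding ind_def by blast
  have s: "(SUM i<Suc r. op_scale (c i) ((b(r := P)) i)) = (SUM i<r. op_scale (c i) (b i)) + op_scale (c r) P" by simp
  have cr: "c r ~= 0"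
  proof
   assume "c r = 0"
   hence "(SUM i<r. op_scale (c i) (b i)) : I" using c(1) s by simp
   hence "ALL i<r. c i = 0" using b unfolding ind_def by blast
   thus False using c(2) \<open>c r = 0\<close> by (auto simp: less_Suc_eq)
  qed
  have "op_scale (1 / c r) ((SUM i<r. op_scale (c i) (b i)) + op_scale (c r) P) : I"
   using c(1) unfolding s by (rule scaleI)
  also have "op_scale (1 / c r) ((SUM i<r. op_scale (c i) (b i)) + op_scale (c r) P) =
    P - (SUM i<r. op_scale (- (c i / c r)) (b i))"
   using cr by (simp add: op_scale_add op_scale_sum op_scale_minus sum_negf)
  finally show "EX c. P - (SUM k<r. op_scale (c k) (b k)) : I" by (rule exI[of _ "%i. - (c i / c r)"])
 qed auto
 thus ?thesis using bound[OF b] by blast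
qed

definition ee :: "nat => nat => complex => complex => complex" where
 "ee M r x y = (if r = 0 then Wint (%t. t ^ M * exp (- t)) (Phi M) x y
  else if r = 1 then exp (- x) * Phi M (x * y) else exp (- x) * deriv (Phi M) (x * y))"

lemma Wint_dy:
 "Wint (%t. t * (t ^ M * exp (- t))) (deriv (Phi M)) x y = ee M 0 x y - x ^ Suc M * ee M 2 x y"
 using Wint_ode[of 0 0 M x y] by (simp add: ee_def algebra_simps)

text \<open>Integration by parts exchanges a power of t for y times the y-derivative, so every H
  arises from the first one by differentiation in \<lambda>, up to the boundary term.\<close>

lemma Wint_Suc:
 "Wint (%t. t ^ Suc k * exp (- t)) (Phi M) x y = of_nat (Suc k) * Wint (%t. t ^ k * exp (- t)) (Phi M) x y
  + y * Wint (%t. t * (t ^ k * exp (- t))) (deriv (Phi M)) x y - x ^ Suc k * ee M 1 x y" proof -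
 let ?p = "%k t. t ^ k * exp (- t)"
 let ?J = "of_nat (Suc k) * Wint (?p k) (Phi M) x y + y * Wint (%t. t * ?p k t) (deriv (Phi M)) x y - Wint (?p (Suc k)) (Phi M) x y"
 let ?I = "%t. of_nat (Suc k) * (?p k t * Phi M (t * y)) + y * (t * ?p k t * deriv (Phi M) (t * y)) - ?p (Suc k) t * Phi M (t * y)"
 have "(?I has_contour_integral ?J) (linepath 0 x)"
  by (intro has_contour_integral_diff has_contour_integral_add has_contour_integral_lmul Wint_has weight_entire(4) Phi_entire)
   (intro holomorphic_intros)
 hence "((%t. (of_nat (Suc k) * t ^ k - t ^ Suc k) * exp (- t) * Phi M (t * y) + y * ?p (Suc k) t * deriv (Phi M) (t * y))
   has_contour_integral ?J) (linepath 0 x)" by (simp add: algebra_simps)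
 moreover have "((%t. ?p (Suc k) t) has_field_derivative (of_nat (Suc k) * t ^ k - t ^ Suc k) * exp (- t)) (at t)" for t :: complex
  by (rule derivative_eq_intros refl | simp)+ (simp add: algebra_simps)
 ultimately have "?J = ?p (Suc k) x * Phi M (x * y)" by (intro Wint_by_parts[OF _ _ Phi_entire(1)]) auto
 hence "?J = x ^ Suc k * ee M 1 x y" by (simp add: ee_def)
 thus ?thesis by (simp only: diff_eq_eq eq_diff_eq add.commute)
qed

definition eef :: "nat => 'm => nat => complex^('m::finite option) => complex" where
 "eef M i r z = ee M r (z $ None) (z $ Some i)"

abbreviation reval :: "('v::finite, rat) mpol => complex^'v => complex" where
 "reval \<equiv> mpol_eval of_rat"

definition mvar :: "'v => ('v, rat) mpol" where
 "mvar v = single (single v 1) 1"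

lemma reval_mvar: "reval (mvar v) z = z $ v"
 unfolding mvar_def by (rule crat.mpol_eval_var)

lemmas reval_simps = reval_mvar crat.mpol_eval_add crat.mpol_eval_uminus crat.mpol_eval_diff crat.mpol_eval_mult
 crat.mpol_eval_of_nat crat.mpol_eval_power crat.mpol_eval_0 crat.mpol_eval_1

lemma sum3: "(SUM r<3::nat. f r) = f 0 + f 1 + (f 2 :: 'a::comm_monoid_add)"
 by (simp add: eval_nat_numeral lessThan_Suc add_ac)

lemma smooth_eef: "smooth UNIV (eef M i r :: complex^('m::finite option) => complex)"
proof -
 have xy: "smooth UNIV (%z :: complex^('m option). z $ None * z $ Some i)"
  by (intro smooth_mult open_UNIV smooth_component)
 have ex: "smooth UNIV (%z :: complex^('m option). exp (- (z $ None)))"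
  by (rule smooth_entire[where g = "%x. exp (- x)", OF open_UNIV smooth_component[OF open_UNIV]]) (intro holomorphic_intros)
 have 0: "smooth UNIV (%z :: complex^('m option). Wint (%t. t ^ M * exp (- t)) (Phi M) (z $ None) (z $ Some i))"
  by (rule smooth_Wint[OF _ weight_entire(4) Phi_entire(1)]) simp
 have 1: "smooth UNIV (%z :: complex^('m option). exp (- (z $ None)) * Phi M (z $ None * z $ Some i))"
  by (rule smooth_mult[OF open_UNIV ex smooth_entire[OF open_UNIV xy Phi_entire(1)]])
 have 2: "smooth UNIV (%z :: complex^('m option). exp (- (z $ None)) * deriv (Phi M) (z $ None * z $ Some i))"
  by (rule smooth_mult[OF open_UNIV ex smooth_entire[OF open_UNIV xy Phi_entire(2)]])
 show ?thesis unfolding eef_def[abs_def] ee_def using 0 1 2 by (cases "r = 0"; cases "r = 1") simp_all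
qed

lemma eef_lambda:
 fixes i :: "'m::finite" and z :: "complex^('m option)"
 shows "cpartial (Some i) (eef M i 0) z = eef M i 0 z - z $ None ^ Suc M * eef M i 2 z"
  "cpartial (Some i) (eef M i 1) z = z $ None * eef M i 2 z"
  "z $ Some i * cpartial (Some i) (eef M i 2) z = eef M i 1 z - (of_nat M + 1) * eef M i 2 z"
proof -
 let ?x = "z $ None" and ?y = "z $ Some i"
 have d: "((%t. exp (- ?x) * g (?x * t)) has_field_derivative exp (- ?x) * (deriv g (?x * ?y) * ?x)) (at ?y)"
  if "g holomorphic_on UNIV" for g
  by (rule DERIV_cmult, rule DERIV_chain2[OF entire_has_deriv[OF that] DERIV_cmult_Id])
 have "cpartial (Some i) (eef M i 0) z = Wint (%t. t * (t ^ M * exp (- t))) (deriv (Phi M)) ?x ?y"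
  by (rule pdiffI) (use Wint_y[OF weight_entire(4) Phi_entire(1)] in \<open>simp add: eef_def ee_def\<close>)
 thus "cpartial (Some i) (eef M i 0) z = eef M i 0 z - ?x ^ Suc M * eef M i 2 z" by (simp only: Wint_dy eef_def)
 have "cpartial (Some i) (eef M i 1) z = exp (- ?x) * (deriv (Phi M) (?x * ?y) * ?x)"
  by (rule pdiffI) (use d[OF Phi_entire(1)] in \<open>simp add: eef_def ee_def\<close>)
 thus "cpartial (Some i) (eef M i 1) z = ?x * eef M i 2 z" by (simp add: eef_def ee_def mult_ac)
 have "cpartial (Some i) (eef M i 2) z = exp (- ?x) * (deriv (deriv (Phi M)) (?x * ?y) * ?x)"
  by (rule pdiffI) (use d[OF Phi_entire(2)] in \<open>simp add: eef_def ee_def\<close>)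
 moreover have "?y * (exp (- ?x) * (deriv (deriv (Phi M)) (?x * ?y) * ?x)) =
   exp (- ?x) * (Phi M (?x * ?y) - (of_nat M + 1) * deriv (Phi M) (?x * ?y))"
  unfolding Phi_ode[of "?x * ?y" M, symmetric] by (simp add: algebra_simps)
 ultimately show "?y * cpartial (Some i) (eef M i 2) z = eef M i 1 z - (of_nat M + 1) * eef M i 2 z"
  by (simp add: eef_def ee_def right_diff_distrib mult_ac)
qed

lemma eef_x:
 fixes i :: "'m::finite" and z :: "complex^('m option)"
 shows "cpartial None (eef M i 0) z = z $ None ^ M * eef M i 1 z"
  "cpartial None (eef M i 1) z = - eef M i 1 z + z $ Some i * eef M i 2 z"
  "z $ None * cpartial None (eef M i 2) z = - z $ None * eef M i 2 z + eef M i 1 z - (of_nat M + 1) * eef M i 2 z"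
proof -
 let ?x = "z $ None" and ?y = "z $ Some i"
 have d: "((%t. exp (- t) * g (t * ?y)) has_field_derivative - exp (- ?x) * g (?x * ?y) + deriv g (?x * ?y) * ?y * exp (- ?x)) (at ?x)"
  if "g holomorphic_on UNIV" for g
 proof (rule DERIV_mult)
  show "((%t. exp (- t)) has_field_derivative - exp (- ?x)) (at ?x)" by (auto intro!: derivative_eq_intros)
  show "((%t. g (t * ?y)) has_field_derivative deriv g (?x * ?y) * ?y) (at ?x)"
   by (rule DERIV_chain2[OF entire_has_deriv[OF that]]) (auto intro!: derivative_eq_intros)
 qed
 have "cpartial None (eef M i 0) z = ?x ^ M * exp (- ?x) * Phi M (?x * ?y)"
  by (rule pdiffI) (use Wint_x[OF weight_entire(4) Phi_entire(1)] in \<open>simp add: eef_def ee_def\<close>)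
 thus "cpartial None (eef M i 0) z = ?x ^ M * eef M i 1 z" by (simp add: eef_def ee_def)
 have "cpartial None (eef M i 1) z = - exp (- ?x) * Phi M (?x * ?y) + deriv (Phi M) (?x * ?y) * ?y * exp (- ?x)"
  by (rule pdiffI) (use d[OF Phi_entire(1)] in \<open>simp add: eef_def ee_def\<close>)
 thus "cpartial None (eef M i 1) z = - eef M i 1 z + ?y * eef M i 2 z" by (simp add: eef_def ee_def mult_ac)
 have "cpartial None (eef M i 2) z = - exp (- ?x) * deriv (Phi M) (?x * ?y) + deriv (deriv (Phi M)) (?x * ?y) * ?y * exp (- ?x)"
  by (rule pdiffI) (use d[OF Phi_entire(2)] in \<open>simp add: eef_def ee_def\<close>)
 moreover have "?x * (- exp (- ?x) * deriv (Phi M) (?x * ?y) + deriv (deriv (Phi M)) (?x * ?y) * ?y * exp (- ?x)) =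
  - ?x * (exp (- ?x) * deriv (Phi M) (?x * ?y)) + exp (- ?x) * Phi M (?x * ?y) - (of_nat M + 1) * (exp (- ?x) * deriv (Phi M) (?x * ?y))"
  unfolding Phi_ode[of "?x * ?y" M, symmetric] by (simp add: algebra_simps)
 ultimately show "?x * cpartial None (eef M i 2) z = - ?x * eef M i 2 z + eef M i 1 z - (of_nat M + 1) * eef M i 2 z"
  by (simp add: eef_def ee_def)
qed

text \<open>The clause on \<open>A 0\<close> records that differentiating the two functions without
  integral never produces the integral; it keeps the product of integrals alone out of the
  span.\<close>

lemma eef_lambda_span:
 fixes i :: "'m::{finite,linorder}"
 assumes "r < 3"
 shows "EX A. (ALL z. z $ Some i * cpartial (Some i) (eef M i r) z = (SUM r'<3. reval (A r') z * eef M i r' z)) & (r ~= 0 --> A 0 = 0)"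
proof -
 let ?X = "mvar None :: ('m option, rat) mpol" and ?Y = "mvar (Some i) :: ('m option, rat) mpol"
 let ?A = "%a b c (r::nat). if r = 0 then a else if r = 1 then b else c :: ('m option, rat) mpol"
 consider "r = 0" | "r = 1" | "r = 2" using assms by linarith
 thus ?thesis
 proof cases
  case 1
  show ?thesis unfolding 1 sum3 by (rule exI[of _ "?A ?Y 0 (- (?Y * ?X ^ Suc M))"])
    (simp only: eef_lambda reval_simps if_True simp_thms, simp add: reval_simps algebra_simps)
 next
  case 2
  show ?thesis unfolding 2 sum3 by (rule exI[of _ "?A 0 0 (?Y * ?X)"])
    (simp only: eef_lambda reval_simps if_True simp_thms, simp add: reval_simps algebra_simps)
 next
  case 3
  show ?thesis unfolding 3 sum3 by (rule exI[of _ "?A 0 1 (- (of_nat M + 1))"])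
    (simp only: eef_lambda reval_simps if_True simp_thms, simp add: reval_simps algebra_simps)
 qed
qed

lemma eef_x_span:
 fixes i :: "'m::{finite,linorder}"
 assumes "r < 3"
 shows "EX A. (ALL z. z $ None * cpartial None (eef M i r) z = (SUM r'<3. reval (A r') z * eef M i r' z)) & (r ~= 0 --> A 0 = 0)"
proof -
 let ?X = "mvar None :: ('m option, rat) mpol" and ?Y = "mvar (Some i) :: ('m option, rat) mpol"
 let ?A = "%a b c (r::nat). if r = 0 then a else if r = 1 then b else c :: ('m option, rat) mpol"
 consider "r = 0" | "r = 1" | "r = 2" using assms by linarith
 thus ?thesis
 proof cases
  case 1
  show ?thesis unfolding 1 sum3 by (rule exI[of _ "?A 0 (?X * ?X ^ M) 0"])
    (simp only: eef_x reval_simps if_True simp_thms, simp add: reval_simps algebra_simps)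
 next
  case 2
  show ?thesis unfolding 2 sum3 by (rule exI[of _ "?A 0 (- ?X) (?X * ?Y)"])
    (simp only: eef_x reval_simps if_True simp_thms, simp add: reval_simps algebra_simps)
 next
  case 3
  show ?thesis unfolding 3 sum3 by (rule exI[of _ "?A 0 1 (- (?X + of_nat M + 1))"])
    (simp only: eef_x reval_simps if_True simp_thms, simp add: reval_simps algebra_simps)
 qed
qed

lemma eef_partial_span:
 fixes i :: "'m::{finite,linorder}"
 assumes r: "r < 3"
 shows "EX A. (ALL z. z $ None * z $ Some i * cpartial v (eef M i r) z = (SUM r'<3. reval (A r') z * eef M i r' z)) & (r ~= 0 --> A 0 = 0)"
proof -
 consider "v = None" | "v = Some i" | "v ~= None" "v ~= Some i" by blast
 thus ?thesis
 proof cases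
  case 1
  obtain A where A: "!!z. z $ None * cpartial None (eef M i r) z = (SUM r'<3. reval (A r') z * eef M i r' z)" "r ~= 0 --> A 0 = 0"
   using eef_x_span[OF r, of M i] by blast
  have "z $ None * z $ Some i * cpartial v (eef M i r) z = (SUM r'<3. reval (mvar (Some i) * A r') z * eef M i r' z)" for z
  proof -
   have "z $ None * z $ Some i * cpartial v (eef M i r) z = z $ Some i * (z $ None * cpartial None (eef M i r) z)"
    unfolding 1 by simp
   thus ?thesis unfolding A(1) sum_distrib_left by (simp add: reval_simps mult.assoc)
  qed
  thus ?thesis using A(2) by (intro exI[of _ "%r'. mvar (Some i) * A r'"]) simp
 next
  case 2
  obtain A where A: "!!z. z $ Some i * cpartial (Some i) (eef M i r) z = (SUM r'<3. reval (A r') z * eef M i r' z)" "r ~= 0 --> A 0 = 0"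
   using eef_lambda_span[OF r, of i M] by blast
  have "z $ None * z $ Some i * cpartial v (eef M i r) z = (SUM r'<3. reval (mvar None * A r') z * eef M i r' z)" for z
  proof -
   have "z $ None * z $ Some i * cpartial v (eef M i r) z = z $ None * (z $ Some i * cpartial (Some i) (eef M i r) z)"
    unfolding 2 by simp
   thus ?thesis unfolding A(1) sum_distrib_left by (simp add: reval_simps mult.assoc)
  qed
  thus ?thesis using A(2) by (intro exI[of _ "%r'. mvar None * A r'"]) simp
 next
  case 3
  have "cpartial v (eef M i r) z = 0" for z by (rule pdiffI) (cases v; use 3 in \<open>simp add: eef_def\<close>)
  thus ?thesis by (intro exI[of _ "%_. 0"]) simp
 qed
qed

lemma pdiff_sum:
 assumes "!!i. i : A ==> pdiff v (F i) z"
 shows "pdiff v (%z. SUM i:A. F i z) z & cpartial v (%z. SUM i:A. F i z) z = (SUM i:A. cpartial v (F i) z)"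
 using assms
proof (induction A rule: infinite_finite_induct)
 case (insert i A)
 thus ?case using pdiff_add[of v "F i" z "%z. SUM i:A. F i z"] by simp
qed simp_all

lemma Wint_span:
 fixes i :: "'m::{finite,linorder}"
 shows "EX q. ALL z. Wint (%t. t ^ (M + l) * exp (- t)) (Phi M) (z $ None) (z $ Some i) = (SUM r<3. reval (q r) z * eef M i r z)"
proof (induction l)
 case 0
 show ?case by (rule exI[of _ "%r. if r = 0 then 1 else 0"]) (simp add: sum3 eef_def ee_def)
next
 case (Suc l)
 let ?H = "%z :: complex^('m option). Wint (%t. t ^ (M + l) * exp (- t)) (Phi M) (z $ None) (z $ Some i)"
 obtain q where q: "!!z. ?H z = (SUM r<3. reval (q r) z * eef M i r z)" using Suc by blast
 have "ALL r. EX A. r < 3 --> (ALL z. z $ Some i * cpartial (Some i) (eef M i r) z = (SUM r'<3. reval (A r') z * eef M i r' z))"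
  using eef_lambda_span[of _ i M] by blast
 from choice[OF this] obtain A where
  A: "!!r z. r < 3 ==> z $ Some i * cpartial (Some i) (eef M i r) z = (SUM r'<3. reval (A r r') z * eef M i r' z)" by blast
 have dH: "z $ Some i * Wint (%t. t * (t ^ (M + l) * exp (- t))) (deriv (Phi M)) (z $ None) (z $ Some i) =
   (SUM r<3. z $ Some i * reval (mpol_deriv (Some i) (q r)) z * eef M i r z) + (SUM r<3. reval (q r) z * (SUM r'<3. reval (A r r') z * eef M i r' z))" for z
 proof -
  have "Wint (%t. t * (t ^ (M + l) * exp (- t))) (deriv (Phi M)) (z $ None) (z $ Some i) = cpartial (Some i) ?H z"
   by (rule pdiffI(2)[symmetric]) (use Wint_y[OF weight_entire(4) Phi_entire(1)] in simp)
  also have "... = cpartial (Some i) (%z. SUM r<3. reval (q r) z * eef M i r z) z" by (simp only: q)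
  also have "... = (SUM r<3. cpartial (Some i) (%z. reval (q r) z * eef M i r z) z)"
   by (rule conjunct2[OF pdiff_sum]) (rule pdiff_mult(1)[OF crat.pdiff_mpol_eval(1) smooth_pdiff[OF smooth_eef UNIV_I]])
  also have "... = (SUM r<3. reval (mpol_deriv (Some i) (q r)) z * eef M i r z + reval (q r) z * cpartial (Some i) (eef M i r) z)"
   by (simp add: pdiff_mult(2)[OF crat.pdiff_mpol_eval(1) smooth_pdiff[OF smooth_eef UNIV_I]] crat.pdiff_mpol_eval(2))
  finally have "z $ Some i * Wint (%t. t * (t ^ (M + l) * exp (- t))) (deriv (Phi M)) (z $ None) (z $ Some i) =
    (SUM r<3. z $ Some i * reval (mpol_deriv (Some i) (q r)) z * eef M i r z) + (SUM r<3. reval (q r) z * (z $ Some i * cpartial (Some i) (eef M i r) z))"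
   by (simp add: sum_distrib_left sum.distrib algebra_simps)
  thus ?thesis by (simp add: A)
 qed
 \<comment> \<open>Coefficients according to \<open>Wint_Suc\<close> and the product rule; the last
   term is the boundary term, which affects only r = 1.\<close>
 define q' where "q' r = of_nat (Suc (M + l)) * q r + mvar (Some i) * mpol_deriv (Some i) (q r) + (SUM s<3. q s * A s r)
  - (if r = 1 then mvar None ^ Suc (M + l) else 0)" for r
 have "Wint (%t. t ^ (M + Suc l) * exp (- t)) (Phi M) (z $ None) (z $ Some i) = (SUM r<3. reval (q' r) z * eef M i r z)" for z
 proof -
  have "Wint (%t. t ^ (M + Suc l) * exp (- t)) (Phi M) (z $ None) (z $ Some i) =
    of_nat (Suc (M + l)) * (SUM r<3. reval (q r) z * eef M i r z) + ((SUM r<3. z $ Some i * reval (mpol_deriv (Some i) (q r)) z * eef M i r z) +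
    (SUM r<3. reval (q r) z * (SUM r'<3. reval (A r r') z * eef M i r' z))) - z $ None ^ Suc (M + l) * eef M i 1 z"
   unfolding add_Suc_right Wint_Suc q dH eef_def ..
  also have "... = (SUM r<3. reval (q' r) z * eef M i r z)"
   unfolding q'_def sum3 by (simp add: reval_simps algebra_simps)
  finally show ?thesis .
 qed
 thus ?case by blast
qed

text \<open>The last column contains no integral; the clause on \<open>q 0\<close> later gives each
  product in the expansion of the determinant a factor of index r ~= 0.\<close>

lemma col_span:
 fixes i :: "'m::{finite,linorder}"
 shows "EX q. (ALL z. col M m j (z $ None) (z $ Some i) = (SUM r<3. reval (q r) z * eef M i r z)) & (j = m --> q 0 = 0)"
proof (cases "j = m")
 case True
 thus ?thesis by (intro exI[of _ "%r. if r = 1 then mvar None ^ M else 0"])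
   (simp add: sum3 col_def eef_def ee_def reval_simps)
next
 case False
 have "ALL l. EX q. ALL z. Wint (%t. t ^ (M + l) * exp (- t)) (Phi M) (z $ None) (z $ Some i) = (SUM r<3. reval (q r) z * eef M i r z)"
  using Wint_span by blast
 from choice[OF this] obtain q where
  q: "!!l z. Wint (%t. t ^ (M + l) * exp (- t)) (Phi M) (z $ None) (z $ Some i) = (SUM r<3. reval (q l r) z * eef M i r z)" by blast
 let ?k = "m - j"
 let ?c = "%l. of_nat (?k choose l) * (- mvar None) ^ (?k - l) :: ('m option, rat) mpol"
 have "col M m j (z $ None) (z $ Some i) = (SUM r<3. reval (SUM l<=?k. ?c l * q l r) z * eef M i r z)" for z
 proof -
  have "col M m j (z $ None) (z $ Some i) = (SUM l<=?k. reval (?c l) z * (SUM r<3. reval (q l r) z * eef M i r z))"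
   using False by (simp add: col_def Gk_def Wint_expand q reval_simps)
  also have "... = (SUM r<3. SUM l<=?k. reval (?c l) z * (reval (q l r) z * eef M i r z))"
   unfolding sum_distrib_left by (rule sum.swap)
  also have "... = (SUM r<3. reval (SUM l<=?k. ?c l * q l r) z * eef M i r z)"
   unfolding crat.mpol_eval_sum crat.mpol_eval_mult sum_distrib_right by (simp only: mult.assoc)
  finally show ?thesis .
 qed
 with False show ?thesis
  by (intro exI[of _ "%r. SUM l<=?k. ?c l * q l r"] conjI allI impI) (assumption, rule notE)
qed

section \<open>The space spanned by the products\<close>

definition Cs :: "('m::finite => nat) set" where
 "Cs = PiE UNIV (%_. {..<3}) - {%_. 0}"

lemma finite_Cs: "finite (Cs :: ('m::finite => nat) set)"
 by (simp add: Cs_def finite_PiE)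

lemma card_Cs: "card (Cs :: ('m::finite => nat) set) = 3 ^ CARD('m) - 1"
proof -
 have "(%_. 0) : PiE UNIV (%_::'m. {..<3::nat})" by (rule PiE_I) auto
 thus ?thesis unfolding Cs_def by (subst card_Diff_singleton) (auto simp: card_PiE)
qed

definition Ef :: "nat => ('m => nat) => complex^('m::finite option) => complex" where
 "Ef M c z = (PROD i:UNIV. eef M i (c i) z)"

text \<open>This space is closed under all partial derivatives, and its dimension over the field of rational
  functions is at most \<open>card Cs = 3^m - 1\<close>, which bounds the rank.\<close>

definition Emod :: "nat => (complex^('m::{finite,linorder} option) => complex) set" where
 "Emod M = {F. smooth UNIV F & (EX d p. d ~= 0 & (ALL z. reval d z * F z = (SUM c:Cs. reval (p c) z * Ef M c z)))}"

lemma EmodI: "smooth UNIV F ==> d ~= 0 ==> (!!z. reval d z * F z = (SUM c:Cs. reval (p c) z * Ef M c z)) ==> F : Emod M"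
 unfolding Emod_def by blast

lemma EmodE:
 assumes "F : Emod M"
 obtains d p where "smooth UNIV F" "d ~= 0" "!!z. reval d z * F z = (SUM c:Cs. reval (p c) z * Ef M c z)"
 using assms unfolding Emod_def by blast

lemma smooth_Ef: "smooth UNIV (Ef M c)"
 unfolding Ef_def[abs_def] by (rule smooth_prod[OF open_UNIV smooth_eef])

lemma smooth_reval: "smooth UNIV (reval (q :: ('v::{finite,linorder}, rat) mpol))"
 by (rule crat.smooth_mpol_eval[OF open_UNIV])

lemma Emod_Ef: "c : Cs ==> Ef M c : Emod M"
proof (rule EmodI[OF smooth_Ef one_neq_zero])
 fix z assume c: "c : (Cs :: ('a => nat) set)"
 have "(SUM c':Cs. reval (if c' = c then 1 else 0) z * Ef M c' z) = (SUM c':Cs. if c' = c then Ef M c' z else 0)"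
  by (intro sum.cong refl) simp
 thus "reval 1 z * Ef M c z = (SUM c':Cs. reval (if c' = c then 1 else 0) z * Ef M c' z)"
  using c by (simp add: finite_Cs)
qed

lemma Emod_0: "(%z. 0) : Emod M"
 by (rule EmodI[of _ 1 "%_. 0"]) simp_all

lemma Emod_add: "F : Emod M ==> G : Emod M ==> (%z. F z + G z) : Emod M"
proof -
 assume "F : Emod M" "G : Emod M"
 then obtain d p d' p' where F: "smooth UNIV F" "d ~= 0" "!!z. reval d z * F z = (SUM c:Cs. reval (p c) z * Ef M c z)"
  and G: "smooth UNIV G" "d' ~= 0" "!!z. reval d' z * G z = (SUM c:Cs. reval (p' c) z * Ef M c z)"
  by (elim EmodE) (rule that)
 show ?thesis
 proof (rule EmodI[of _ "d * d'" "%c. d' * p c + d * p' c"])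
  fix z
  have "reval (d * d') z * (F z + G z) = reval d' z * (reval d z * F z) + reval d z * (reval d' z * G z)"
   by (simp add: reval_simps algebra_simps)
  also have "... = (SUM c:Cs. reval (d' * p c + d * p' c) z * Ef M c z)"
   unfolding F(3) G(3) sum_distrib_left sum.distrib[symmetric] by (intro sum.cong refl) (simp add: reval_simps algebra_simps)
  finally show "reval (d * d') z * (F z + G z) = (SUM c:Cs. reval (d' * p c + d * p' c) z * Ef M c z)" .
 qed (use F G in \<open>auto intro: smooth_add\<close>)
qed

lemma Emod_sum: "(!!i. i : A ==> F i : Emod M) ==> (%z. SUM i:A. F i z) : Emod M"
 by (induction A rule: infinite_finite_induct) (auto intro: Emod_0 Emod_add)

lemma Emod_mult: "F : Emod M ==> (%z. reval q z * F z) : Emod M"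
proof -
 assume "F : Emod M"
 then obtain d p where F: "smooth UNIV F" "d ~= 0" "!!z. reval d z * F z = (SUM c:Cs. reval (p c) z * Ef M c z)"
  by (elim EmodE) (rule that)
 show ?thesis
 proof (rule EmodI[of _ d "%c. q * p c"])
  fix z
  have "reval d z * (reval q z * F z) = reval q z * (reval d z * F z)" by simp
  also have "... = (SUM c:Cs. reval (q * p c) z * Ef M c z)"
   unfolding F(3) sum_distrib_left by (intro sum.cong refl) (simp add: reval_simps)
  finally show "reval d z * (reval q z * F z) = (SUM c:Cs. reval (q * p c) z * Ef M c z)" .
 qed (use F in \<open>auto intro: smooth_mult smooth_reval\<close>)
qed

text \<open>The denominator d in \<open>Emod\<close> may be any nonzero polynomial, so the factors
  that clear the derivatives can be undone.\<close>

lemma Emod_div: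
 assumes "smooth UNIV F" "q ~= 0" "(%z. reval q z * F z) : Emod M"
 shows "F : Emod M"
proof -
 obtain d p where F: "d ~= 0" "!!z. reval d z * (reval q z * F z) = (SUM c:Cs. reval (p c) z * Ef M c z)"
  using assms(3) by (elim EmodE) (rule that)
 show ?thesis by (rule EmodI[of _ "d * q" p]) (use F assms in \<open>simp_all add: reval_simps mult.assoc\<close>)
qed

lemma mvar_nz: "mvar v ~= 0"
 unfolding mvar_def by (metis lookup_single_eq lookup_zero zero_neq_one)

text \<open>Changing one entry of c to r reaches the excluded index only if that entry was the sole
  nonzero one and r = 0, and then its coefficient is 0.\<close>

lemma Emod_Ef_partial:
 fixes c :: "'m::{finite,linorder} => nat"
 assumes c: "c : Cs"
 shows "cpartial v (Ef M c) : Emod M"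
proof -
 let ?t = "%i. mvar None * mvar (Some i) :: ('m option, rat) mpol"
 have c3: "c i < 3" for i using c by (auto simp: Cs_def)
 have "ALL i. EX A. (ALL z. z $ None * z $ Some i * cpartial v (eef M i (c i)) z = (SUM r<3. reval (A r) z * eef M i r z)) & (c i ~= 0 --> A 0 = 0)"
  using eef_partial_span[OF c3] by blast
 from choice[OF this] obtain A where
  A: "!!i z. z $ None * z $ Some i * cpartial v (eef M i (c i)) z = (SUM r<3. reval (A i r) z * eef M i r z)"
  "!!i. c i ~= 0 ==> A i 0 = 0" by blast
 have d: "cpartial v (Ef M c) z = (SUM i:UNIV. cpartial v (eef M i (c i)) z * (PROD k:UNIV - {i}. eef M k (c k) z))" for z
 proof (rule pdiffI(2))
  have "((%t. PROD i:UNIV. eef M i (c i) (upd z v t)) has_field_derivative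
    (SUM i:UNIV. cpartial v (eef M i (c i)) z * (PROD k:UNIV - {i}. eef M k (c k) (upd z v (z $ v))))) (at (z $ v))"
   by (rule has_field_derivative_prod) (rule pdiff_has_deriv[OF smooth_pdiff[OF smooth_eef UNIV_I]])
  thus "((%t. Ef M c (upd z v t)) has_field_derivative
    (SUM i:UNIV. cpartial v (eef M i (c i)) z * (PROD k:UNIV - {i}. eef M k (c k) z))) (at (z $ v))"
   by (simp only: Ef_def upd_same)
 qed
 let ?q = "%i r. (PROD k:UNIV - {i}. ?t k) * A i r"
 have E: "reval (PROD i:UNIV. ?t i) z * cpartial v (Ef M c) z = (SUM i:UNIV. SUM r<3. reval (?q i r) z * Ef M (c(i := r)) z)" for z
 proof -
  have "reval (PROD k:UNIV. ?t k) z * (cpartial v (eef M i (c i)) z * (PROD k:UNIV - {i}. eef M k (c k) z)) =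
    (SUM r<3. reval (?q i r) z * Ef M (c(i := r)) z)" for i proof -
   have p: "Ef M (c(i := r)) z = eef M i r z * (PROD k:UNIV - {i}. eef M k (c k) z)" for r
    unfolding Ef_def by (subst prod.remove[of _ i]) auto
   have "reval (PROD k:UNIV. ?t k) z = reval (PROD k:UNIV - {i}. ?t k) z * (z $ None * z $ Some i)"
    by (subst prod.remove[of _ i]) (simp_all add: reval_simps)
   hence "reval (PROD k:UNIV. ?t k) z * (cpartial v (eef M i (c i)) z * (PROD k:UNIV - {i}. eef M k (c k) z)) =
     reval (PROD k:UNIV - {i}. ?t k) z * (z $ None * z $ Some i * cpartial v (eef M i (c i)) z) * (PROD k:UNIV - {i}. eef M k (c k) z)"
    by simp
   also have "... = (SUM r<3. reval (?q i r) z * Ef M (c(i := r)) z)"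
    unfolding A(1) p crat.mpol_eval_mult sum_distrib_left sum_distrib_right by (intro sum.cong refl) simp
   finally show ?thesis .
  qed
  thus ?thesis unfolding d sum_distrib_left by simp
 qed
 show ?thesis
 proof (rule Emod_div[of _ "PROD i:UNIV. ?t i"])
  show "smooth UNIV (cpartial v (Ef M c))" by (rule smooth_cpartial[OF open_UNIV smooth_Ef])
  show "(PROD i:UNIV. ?t i) ~= 0" by (simp add: prod_zero_iff mvar_nz)
  have "(%z. reval (?q i r) z * Ef M (c(i := r)) z) : Emod M" if r: "r : {..<3}" for i r
  proof (cases "c(i := r) : Cs")
   case True
   thus ?thesis by (intro Emod_mult Emod_Ef)
  next
   case False
   have "c(i := r) : PiE UNIV (%_. {..<3})" using c3 r by auto
   hence z: "c(i := r) = (%_. 0)" using False by (simp add: Cs_def)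
   hence "r = 0" "!!k. k ~= i ==> c k = 0" by (auto simp: fun_eq_iff split: if_splits)
   moreover have "c ~= (%_. 0)" using c by (simp add: Cs_def)
   ultimately have "A i r = 0" using A(2)[of i] by (metis ext)
   thus ?thesis by (simp add: Emod_0)
  qed
  thus "(%z. reval (PROD i:UNIV. ?t i) z * cpartial v (Ef M c) z) : Emod M"
   unfolding E by (intro Emod_sum)
 qed
qed

lemma Emod_partial:
 assumes "F : Emod M"
 shows "cpartial v F : Emod M"
proof -
 obtain d p where F: "smooth UNIV F" "d ~= 0" "!!z. reval d z * F z = (SUM c:Cs. reval (p c) z * Ef M c z)"
  using assms by (elim EmodE) (rule that)
 note pF = smooth_pdiff[OF F(1) UNIV_I] and pE = smooth_pdiff[OF smooth_Ef UNIV_I]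
 note pr = crat.pdiff_mpol_eval
 have eq: "reval d z * cpartial v F z = (SUM c:Cs. reval (mpol_deriv v (p c)) z * Ef M c z + reval (p c) z * cpartial v (Ef M c) z)
   + reval (- mpol_deriv v d) z * F z" for z proof -
  have "reval (mpol_deriv v d) z * F z + reval d z * cpartial v F z = cpartial v (%z. reval d z * F z) z"
   by (simp only: pdiff_mult(2)[OF pr(1) pF] pr(2))
  also have "... = cpartial v (%z. SUM c:Cs. reval (p c) z * Ef M c z) z" by (simp only: F(3))
  also have "... = (SUM c:Cs. cpartial v (%z. reval (p c) z * Ef M c z) z)"
   by (rule conjunct2[OF pdiff_sum]) (rule pdiff_mult(1)[OF pr(1) pE])
  also have "... = (SUM c:Cs. reval (mpol_deriv v (p c)) z * Ef M c z + reval (p c) z * cpartial v (Ef M c) z)"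
   by (simp only: pdiff_mult(2)[OF pr(1) pE] pr(2))
  finally show ?thesis by (simp add: reval_simps algebra_simps)
 qed
 show ?thesis
 proof (rule Emod_div[OF smooth_cpartial[OF open_UNIV F(1)] F(2)])
  show "(%z. reval d z * cpartial v F z) : Emod M"
   unfolding eq by (intro Emod_add Emod_sum Emod_mult Emod_Ef Emod_Ef_partial assms)
 qed
qed

lemma Emod_smooth: "F : Emod M ==> smooth UNIV F"
 by (simp add: Emod_def)

lemma Emod_multi_iter:
 fixes F :: "complex^('m::{finite,linorder} option) => complex"
 assumes F: "F : Emod M"
 shows "multi_iter cpartial al F : Emod M"
proof (induction al rule: multiindex_induct)
 case (step al v)
 have "multi_iter cpartial (al + single v 1) F = cpartial v (multi_iter cpartial al F)"
  by (rule ext) (rule smooth_multi_iter(2)[OF open_UNIV Emod_smooth[OF F] UNIV_I])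
 thus ?case using Emod_partial[OF step] by simp
qed (use F in simp)

text \<open>Every permutation assigns the last column to some row, and there the coefficient of the
  integral is 0; so the excluded product does not occur.\<close>

lemma Rfun_Emod:
 assumes n: "CARD('m::{finite,linorder}) <= n"
 shows "(Rfun n :: complex^('m option) => complex) : Emod (n - CARD('m))"
proof -
 let ?m = "CARD('m)" and ?M = "n - CARD('m)"
 have "ALL x. EX q. (ALL z. col ?M ?m (position (snd x :: 'm)) (z $ None) (z $ Some (fst x)) = (SUM r<3. reval (q r) z * eef ?M (fst x :: 'm) r z)) &
   (position (snd x) = ?m --> q 0 = 0)" using col_span by blast from choice[OF this] obtain q where
  q: "!!x z. col ?M ?m (position (snd x :: 'm)) (z $ None) (z $ Some (fst x)) = (SUM r<3. reval (q x r) z * eef ?M (fst x :: 'm) r z)"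
  "!!x. position (snd x) = ?m ==> q x 0 = 0" by blast
 have ex: "EX j :: 'm. position j = ?m"
 proof -
  have "?m : {1..?m}" by (simp add: Suc_leI)
  thus ?thesis using position_bij[where 'm = 'm] unfolding bij_betw_def by (metis imageE)
 qed
 have "(%z. PROD i:UNIV. col ?M ?m (position (sg i)) (z $ None) (z $ Some i)) : Emod ?M"
  if sg: "sg permutes UNIV" for sg :: "'m => 'm"
 proof -
  let ?Q = "%c. PROD i:UNIV. q (i, sg i) (c i)"
  have "(PROD i:UNIV. col ?M ?m (position (sg i)) (z $ None) (z $ Some i)) =
    (SUM c:PiE UNIV (%_. {..<3}). reval (?Q c) z * Ef ?M c z)" for z proof -
   have "(PROD i:UNIV. col ?M ?m (position (sg i)) (z $ None) (z $ Some i)) =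
     (PROD i:UNIV. SUM r<3. reval (q (i, sg i) r) z * eef ?M i r z)"
    using q(1)[of "(i, sg i)" for i] by simp
   also have "... = (SUM c:PiE UNIV (%_. {..<3}). PROD i:UNIV. reval (q (i, sg i) (c i)) z * eef ?M i (c i) z)"
    by (rule prod_sum_PiE) auto
   finally show ?thesis by (simp only: prod.distrib crat.mpol_eval_prod Ef_def)
  qed
  moreover have "(%z. reval (?Q c) z * Ef ?M c z) : Emod ?M" if c: "c : PiE UNIV (%_. {..<3})" for c
  proof (cases "c : Cs")
   case True
   thus ?thesis by (intro Emod_mult Emod_Ef)
  next
   case False
   hence c0: "c = (%_. 0)" using c by (simp add: Cs_def)
   obtain j i where "position j = ?m" "sg i = j" using ex permutes_surj[OF sg] by (metis surj_def)
   hence "q (i, sg i) (c i) = 0" using q(2)[of "(i, sg i)"] c0 by simp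
   hence "?Q c = 0" by (intro prod_zero) auto
   thus ?thesis by (simp only: crat.mpol_eval_0 mult_zero_left Emod_0)
  qed
  ultimately show ?thesis by (simp only: Emod_sum)
 qed
 hence "(%z :: complex^('m option). SUM sg | sg permutes (UNIV :: 'm set). reval (of_int (sign sg)) z * (PROD i:UNIV. col ?M ?m (position (sg i)) (z $ None) (z $ Some i))) : Emod ?M"
  by (intro Emod_sum Emod_mult) simp
 moreover have "reval (of_int (sign sg)) z = of_int (sign sg)" for sg :: "'m => 'm" and z :: "complex^('m option)"
  by (simp add: sign_def reval_simps)
 moreover have "Rfun n = (%z. SUM sg | sg permutes UNIV. of_int (sign sg) * (PROD i:UNIV. col ?M ?m (position (sg i)) (z $ None) (z $ Some (i::'m))))"
  by (rule ext) (rule Rfun_expand[OF n])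
 ultimately show ?thesis by simp
qed

lemma Fract_sum_1: "Fract (SUM i:A. f i) (1 :: 'a::idom) = (SUM i:A. Fract (f i) 1)"
 by (induction A rule: infinite_finite_induct) (auto simp: Fract_add_1)

text \<open>The ideal consists of all operators that \<open>Kill\<close> assigns to R. Coordinates
  of the derivatives of R with respect to the products are merely chosen: any choice gives a linear
  map whose kernel lies in the ideal, hence an upper bound for the rank.\<close>

theorem rational_system:
 assumes n: "CARD('m::{finite,linorder}) <= n"
 shows "EX (I :: ('m option, rat) diffop set) r. r <= 3 ^ CARD('m) - 1 & holonomic_of_rank UNIV I r &
    (ALL P:I. annihilates of_rat P (Rfun n) UNIV)" proof -
 let ?M = "n - CARD('m)" and ?R = "Rfun n :: complex^('m option) => complex"
 let ?F = "{(?R, UNIV :: (complex^('m option)) set)}"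
 define I where "I = crat.Kill ?F"
 have smR: "smooth UNIV ?R" by (rule Emod_smooth[OF Rfun_Emod[OF n]])
 have adm: "crat.admissible UNIV ?F" unfolding crat.admissible_def using smR by (auto intro!: exI[of _ UNIV])
 have I: "left_ideal (diffops UNIV UNIV) I" unfolding left_ideal_def diffops_UNIV I_def
  by (auto intro: crat.Kill_add crat.Kill_mult[OF adm, of _ UNIV] simp: diffops_UNIV)
 have "ALL al. EX dp. fst dp ~= 0 & (ALL z. reval (fst dp) z * multi_iter cpartial al ?R z = (SUM c:Cs. reval (snd dp c) z * Ef ?M c z))"
 proof
  fix al
  obtain d p where "d ~= 0" "!!z. reval d z * multi_iter cpartial al ?R z = (SUM c:Cs. reval (p c) z * Ef ?M c z)"
   using Emod_multi_iter[OF Rfun_Emod[OF n], of al] by (elim EmodE) (rule that)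
  thus "EX dp. fst dp ~= 0 & (ALL z. reval (fst dp) z * multi_iter cpartial al ?R z = (SUM c:Cs. reval (snd dp c) z * Ef ?M c z))"
   by (intro exI[of _ "(d, p)"]) simp
 qed
 from choice[OF this] obtain dp where dp: "!!al. fst (dp al) ~= 0"
  "!!al z. reval (fst (dp al)) z * multi_iter cpartial al ?R z = (SUM c:Cs. reval (snd (dp al) c) z * Ef ?M c z)" by blast
 define d p where "d al = fst (dp al)" and "p al = snd (dp al)" for al
 note d = dp[folded d_def p_def]
 define w where "w al c = Fract (p al c) (d al)" for al c
 define Th where "Th P c = (SUM al:keys P. lookup P al * w al c)" for P c
 have Thsup: "Th P c = (SUM al:A. lookup P al * w al c)" if "finite A" "keys P \<subseteq> A" for P c A
  unfolding Th_def using that by (intro sum.mono_neutral_left) (auto simp: in_keys_iff)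
 have Thlin: "Th (SUM i<r. op_scale (c i) (b i)) e = (SUM i<r. c i * Th (b i) e)" for e c b and r :: nat
 proof -
  let ?A = "(UN i<r. keys (b i)) \<union> keys (SUM i<r. op_scale (c i) (b i))"
  have fin: "finite ?A" by simp
  have "Th (SUM i<r. op_scale (c i) (b i)) e = (SUM al:?A. lookup (SUM i<r. op_scale (c i) (b i)) al * w al e)"
   by (rule Thsup[OF fin]) blast
  also have "... = (SUM al:?A. SUM i<r. c i * (lookup (b i) al * w al e))"
   by (simp add: lookup_sum sum_distrib_right mult.assoc)
  also have "... = (SUM i<r. c i * (SUM al:?A. lookup (b i) al * w al e))"
   unfolding sum_distrib_left by (rule sum.swap)
  also have "... = (SUM i<r. c i * Th (b i) e)"
  proof (rule sum.cong[OF refl])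
   fix i assume i: "i : {..<r}"
   have "Th (b i) e = (SUM al:?A. lookup (b i) al * w al e)"
    by (rule Thsup[OF fin]) (use i in blast)
   thus "c i * (SUM al:?A. lookup (b i) al * w al e) = c i * Th (b i) e" by simp
  qed
  finally show ?thesis .
 qed
 have ker: "P : I" if Th0: "!!c. c : Cs ==> Th P c = 0" for P
 proof -
  have "P : diffops UNIV UNIV" by (simp add: diffops_UNIV)
  then obtain e Q where eQ: "clears e P Q" by (rule clears_exists) (rule that)
  let ?A = "keys Q"
  \<comment> \<open>A common denominator for the coordinates of the derivatives that occur in
    P.\<close>
  define D where "D = (PROD al:?A. d al)"
  define D' where "D' al = (PROD be:?A - {al}. d be)" for al
  have DD: "D = d al * D' al" if "al : ?A" for al unfolding D_def D'_def using that by (intro prod.remove) auto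
  have D0: "D ~= 0" unfolding D_def using d(1) by (simp add: prod_zero_iff)
  have poly0: "(SUM al:?A. lookup Q al * D' al * p al c) = 0" if c: "c : Cs" for c
  proof -
   have "Fract (SUM al:?A. lookup Q al * D' al * p al c) 1 = (SUM al:?A. Fract (lookup Q al) 1 * (Fract D 1 * w al c))"
    unfolding Fract_sum_1
   proof (rule sum.cong[OF refl])
    fix al assume al: "al : ?A"
    have "Fract D 1 * w al c = Fract (D' al * p al c) 1"
     unfolding w_def DD[OF al] mult_fract by (simp add: eq_fract d(1) mult_ac)
    thus "Fract (lookup Q al * D' al * p al c) 1 = Fract (lookup Q al) 1 * (Fract D 1 * w al c)"
     by (simp add: mult_fract mult.assoc)
   qed
   also have "... = Fract D 1 * (SUM al:?A. Fract (lookup Q al) 1 * w al c)"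
    by (simp add: sum_distrib_left mult_ac)
   also have "(SUM al:?A. Fract (lookup Q al) 1 * w al c) = (SUM al:?A. Fract e 1 * lookup P al * w al c)"
    using eQ by (simp add: clears_iff)
   also have "... = Fract e 1 * Th P c"
   proof -
    have sub: "keys P \<subseteq> ?A"
    proof
     fix al assume "al : keys P"
     thus "al : ?A" unfolding in_keys_iff clears_lookup_0[OF eQ] .
    qed
    show ?thesis unfolding Thsup[OF finite_keys sub] sum_distrib_left
     by (intro sum.cong refl) (simp only: mult.assoc)
   qed
   finally show ?thesis using Th0[OF c] by simp
  qed
  show "P : I" unfolding I_def
  proof (rule crat.KillI[OF clears_multiple[OF eQ D0]])
   fix F W and z :: "complex^('m option)" assume "(F, W) : ?F"
   hence F: "F = ?R" by simp
   have "crat.pact (psc D Q) F z = (SUM al:?A. reval D z * (reval (lookup Q al) z * multi_iter cpartial al ?R z))"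
    unfolding F crat.pact_psc unfolding crat.pact_def sum_distrib_left ..
   also have "... = (SUM al:?A. SUM c:Cs. reval (lookup Q al * D' al * p al c) z * Ef ?M c z)"
   proof (rule sum.cong[OF refl])
    fix al assume al: "al : ?A"
    have "reval D z * (reval (lookup Q al) z * multi_iter cpartial al ?R z) =
      reval (lookup Q al * D' al) z * (reval (d al) z * multi_iter cpartial al ?R z)"
     unfolding DD[OF al] by (simp add: reval_simps)
    thus "reval D z * (reval (lookup Q al) z * multi_iter cpartial al ?R z) =
      (SUM c:Cs. reval (lookup Q al * D' al * p al c) z * Ef ?M c z)"
     unfolding d(2) sum_distrib_left by (simp add: reval_simps mult.assoc)
   qed
   also have "... = (SUM c:Cs. reval (SUM al:?A. lookup Q al * D' al * p al c) z * Ef ?M c z)"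
    unfolding crat.mpol_eval_sum sum_distrib_right by (rule sum.swap)
   also have "... = 0" by (simp add: poly0)
   finally show "crat.pact (psc D Q) F z = 0" .
  qed
 qed
 obtain r where r: "r <= card (Cs :: ('m => nat) set)" "has_rank (diffops UNIV UNIV) I r"
 proof -
  have "EX r<=card (Cs :: ('m => nat) set). has_rank (diffops UNIV UNIV) I r"
  proof (rule rank_bound[of UNIV I Cs Th])
   show "Th (SUM i<r. op_scale (c i) (b i)) e = (SUM i<r. c i * Th (b i) e)" for e c b and r :: nat
    by (rule Thlin)
   show "P : I" if "!!e. e : Cs ==> Th P e = 0" for P by (rule ker[OF that])
  qed (rule I finite_Cs)+
  thus thesis using that by blast
 qed
 have "ALL P:I. annihilates of_rat P ?R UNIV"
  unfolding I_def using crat.annihilates_UNIV_of_Kill[OF _ singletonI smR] by blast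
 thus ?thesis using r I unfolding holonomic_of_rank_def diffops_UNIV card_Cs by blast
qed

theorem theorem2p3:
  fixes n m :: nat
  assumes m: "m = CARD('m::{finite,linorder})" and "1 \<le> m" and "m \<le> n"
  shows
    "(\<forall>i::'m. \<exists>L. is_Tlclm n i L) \<and>
     (\<forall>L :: 'm \<Rightarrow> ('m option, complex) diffop. (\<forall>i. is_Tlclm n i (L i)) \<longrightarrow>
        (\<forall>P\<in>generators n L. annihilates id P (Rfun n) UNIV) \<and>
        holonomic_of_rank lambda_diffops (left_ideal lambda_diffops hull generators n L)
          (2 * fact m * 3 ^ (m - 1)) \<and>
        (\<exists>E. finite E \<and> (\<forall>x0 U. x0 \<notin> E \<and> open U \<and> U \<noteq> {} \<and> simply_connected U \<and> 0 \<notin> U \<longrightarrow>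
           complex_dim (solutions (generators n L) x0 U) = 2 * fact m * 3 ^ (m - 1) \<and>
           complex_dim {f \<in> solutions (generators n L) x0 U. antisymmetric f} = 2 * 3 ^ (m - 1) \<and>
           (0 \<in> closure U \<longrightarrow>
             complex_dim {f \<in> solutions (generators n L) x0 U. antisymmetric f \<and> non_logarithmic U f}
               = 2 ^ (m - 1))))) \<and>
     (\<exists>(I :: ('m option, rat) diffop set) r. r \<le> 3 ^ m - 1 \<and> holonomic_of_rank UNIV I r \<and>
        (\<forall>P\<in>I. annihilates of_rat P (Rfun n) UNIV))"
proof -
 have n: "CARD('m) <= n" using assms by simp
 show ?thesis unfolding m by (intro conjI allI impI ballI Tlclm_exists)
   (rule generators_annihilate_Rfun[OF n] rank_of_system solution_space_dimensions rational_system[OF n]; blast?)+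
qed

end
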